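(* There are exactly 74 combinatorial types of 3-dimensional convex polytopes with 8 vertices and 9 faces (2-faces). Among them, exactly two types are decomposable, in the sense that every polyhedron of that combinatorial type is decomposable: (A) the type obtained from a triangular prism by stacking a tetrahedron onto one of its triangular faces (the "capped prism") and then stacking a further tetrahedron onto one of the triangular faces of the first stacked tetrahedron; (B) the type obtained from a triangular prism by stacking a tetrahedron onto each of its two triangular faces. Every polyhedron with 8 vertices and 9 faces that is not combinatorially equivalent to (A) or (B) is indecomposable.
   Context: Two polytopes are combinatorially equivalent (have the same combinatorial type) if their face lattices are isomorphic. Stacking a tetrahedron onto a triangular face $F$ of a polyhedron $P$ means forming $\mathrm{conv}(P\cup\{u\})$ with $u$ a point beyond $F$ and beneath all other faces of $P$. A convex polytope $P$ is decomposable if $P=Q+R$ (Minkowski sum) for convex bodies $Q,R$ neither of which is of the form $\lambda P+t$ with $\lambda>0$ and $t$ a vector; otherwise $P$ is indecomposable. *)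

theory Defs
  imports "HOL-Analysis.Analysis"
begin

type_synonym pt3 = "real^3"

definition polyhedron3 :: "pt3 set \<Rightarrow> bool" where
  "polyhedron3 P \<longleftrightarrow> polytope P \<and> aff_dim P = 3"

definition verts :: "pt3 set \<Rightarrow> pt3 set" where
  "verts P = {v. v extreme_point_of P}"

definition facets :: "pt3 set \<Rightarrow> pt3 set set" where
  "facets P = {F. F facet_of P}"

definition comb_equiv :: "pt3 set \<Rightarrow> pt3 set \<Rightarrow> bool" where
  "comb_equiv P Q \<longleftrightarrow>
     (\<exists>f. bij_betw f {F. F face_of P} {G. G face_of Q} \<and>
          (\<forall>F1 F2. F1 face_of P \<longrightarrow> F2 face_of P \<longrightarrow> (F1 \<subseteq> F2 \<longleftrightarrow> f F1 \<subseteq> f F2)))"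

definition convex_body :: "pt3 set \<Rightarrow> bool" where
  "convex_body K \<longleftrightarrow> K \<noteq> {} \<and> compact K \<and> convex K"

definition minkowski_sum :: "pt3 set \<Rightarrow> pt3 set \<Rightarrow> pt3 set" where
  "minkowski_sum Q R = {q + r | q r. q \<in> Q \<and> r \<in> R}"

definition homothetic_copy :: "pt3 set \<Rightarrow> pt3 set \<Rightarrow> bool" where
  "homothetic_copy Q P \<longleftrightarrow> (\<exists>c t. c > 0 \<and> Q = (\<lambda>x. c *\<^sub>R x + t) ` P)"

definition decomposable :: "pt3 set \<Rightarrow> bool" where
  "decomposable P \<longleftrightarrow>
     (\<exists>Q R. convex_body Q \<and> convex_body R \<and> P = minkowski_sum Q R \<and>
            \<not> homothetic_copy Q P \<and> \<not> homothetic_copy R P)"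

definition triangle_face :: "pt3 set \<Rightarrow> bool" where
  "triangle_face F \<longleftrightarrow> card (verts F) = 3"

definition beyond_only :: "pt3 set \<Rightarrow> pt3 set \<Rightarrow> pt3 \<Rightarrow> bool" where
  "beyond_only P F u \<longleftrightarrow> F facet_of P \<and>
     (\<forall>G a b. G facet_of P \<longrightarrow> a \<noteq> 0 \<longrightarrow> P \<subseteq> {x. a \<bullet> x \<le> b} \<longrightarrow>
              G = P \<inter> {x. a \<bullet> x = b} \<longrightarrow>
              (if G = F then a \<bullet> u > b else a \<bullet> u < b))"

definition stacking :: "pt3 set \<Rightarrow> pt3 set \<Rightarrow> pt3 \<Rightarrow> pt3 set \<Rightarrow> bool" where
  "stacking P F u Q \<longleftrightarrow> polyhedron3 P \<and> triangle_face F \<and> beyond_only P F u \<and>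
     Q = convex hull (insert u P)"

definition tri_prism :: "pt3 set \<Rightarrow> bool" where
  "tri_prism P \<longleftrightarrow> (\<exists>a b c v. P = convex hull {a, b, c, a + v, b + v, c + v} \<and> aff_dim P = 3)"

text \<open>Type (A): prism, stack onto a triangular facet (apex u), then stack onto a
  triangular facet of the first stacked tetrahedron (i.e. a facet containing u).\<close>
definition typeA :: "pt3 set \<Rightarrow> bool" where
  "typeA X \<longleftrightarrow> polyhedron3 X \<and> (\<exists>P F u P1 G w P2. tri_prism P \<and> stacking P F u P1 \<and>
       G facet_of P1 \<and> u \<in> G \<and> stacking P1 G w P2 \<and> comb_equiv X P2)"

definition typeB :: "pt3 set \<Rightarrow> bool" where
  "typeB X \<longleftrightarrow> polyhedron3 X \<and> (\<exists>P F1 u P1 F2 w P2. tri_prism P \<and> stacking P F1 u P1 \<and>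
       F2 facet_of P \<and> F2 \<noteq> F1 \<and> stacking P1 F2 w P2 \<and> comb_equiv X P2)"

definition polys_8_9 :: "pt3 set set" where
  "polys_8_9 = {P. polyhedron3 P \<and> card (verts P) = 8 \<and> card (facets P) = 9}"

definition comb_rel :: "pt3 set set \<Rightarrow> (pt3 set \<times> pt3 set) set" where
  "comb_rel S = {(P, Q). P \<in> S \<and> Q \<in> S \<and> comb_equiv P Q}"

end

theory Submission
  imports Defs
begin

text \<open>
  A polytope with 8 vertices and 9 facets has 15 edges. Euler's relation, the fact that two facets meet in
  at most an edge and that each vertex of a facet lies on exactly two of its neighbours make the vertex-facet
  incidences a finite combinatorial problem; an exhaustive search, whose leaves carry the relabelling to a
  representative, leaves 76 incidence systems. Two of them contain a hexagon three of whose sides form a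
  triangle and so are not polytopal, and the other 74 are realised by explicit integer coordinates and told
  apart by an isomorphism invariant of the incidences.

  If \<open>P = Q + R\<close>, each edge of \<open>Q\<close> is a multiple of the corresponding edge of \<open>P\<close>, and the edges of a triangle
  of the graph share the same factor. In 72 of the types a chain of such triangles reaches all vertices, which
  forces \<open>Q\<close> to be homothetic to \<open>P\<close>. In the types (A) and (B) the three quadrilaterals of the prism separate
  the vertices into two groups; if the planes of these quadrilaterals have a common point or a common direction,
  one group can be scaled towards that point, or translated, independently of the other, which yields a summand.
\<close>

section \<open>Faces of three-dimensional polytopes\<close>

text \<open>Euler's relation works in two directions. For an unknown polytope it gives 30
  vertex-facet incidences, so the largest of the 9 facets has 4, 5 or 6 vertices and all others have
  at most 4. For an explicit hull (a realisation, the prism, a stacking) it certifies that a list of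
  supporting planes omits no facet. The local conditions handed to the search are necessary for a
  polytope but not sufficient, whence the spurious systems. The search stays small because vertices
  on the same chosen facets are never told apart: a partial system is a list of classes with their
  sizes, and a new facet is a choice of how many vertices to take from each class. As long as some
  chosen facet lacks a neighbour at one of its vertices, the next facet is required to be such a
  neighbour. All comparisons of types use bijections of vertices that map facets to facets, since
  the facets determine the face lattice. The search bounds the number of types from above; the
  realisations and the invariant bound it from below.\<close>

lemma affine_eq_on_hull:
  fixes a a' :: "'a::euclidean_space"
  assumes "\<And>x. x \<in> S \<Longrightarrow> a \<bullet> x + b = a' \<bullet> x + b'" "x \<in> affine hull S"
  shows "a \<bullet> x + b = a' \<bullet> x + b'"
proof -
  have "affine {x. (a - a') \<bullet> x = b' - b}" by (rule affine_hyperplane)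
  moreover have "S \<subseteq> {x. (a - a') \<bullet> x = b' - b}" using assms(1) by (force simp: inner_diff_left)
  ultimately have "affine hull S \<subseteq> {x. (a - a') \<bullet> x = b' - b}" by (simp add: hull_minimal)
  with assms(2) show ?thesis by (force simp: inner_diff_left)
qed

lemma face_of_aff_dim_eq:
  fixes S :: "'a::euclidean_space set"
  assumes "convex S" "F face_of S" "G face_of S" "F \<subseteq> G" "aff_dim G \<le> aff_dim F"
  shows "F = G"
  using assms face_of_aff_dim_lt[of G F] face_of_imp_convex[of G S]
  by (metis face_of_face linorder_not_le)

text \<open>A dimension count: the intersection contains \<open>R\<close> and is a proper face of
  \<open>F\<close>, whose dimension exceeds that of \<open>R\<close> by one.\<close>

lemma facet_Int_ridge:
  fixes P :: "'a::euclidean_space set"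
  assumes P: "polyhedron P" and R: "R face_of P" "aff_dim R = aff_dim P - 2"
    and F: "F facet_of P" "G facet_of P" "F \<noteq> G" "R \<subseteq> F" "R \<subseteq> G"
  shows "F \<inter> G = R"
proof -
  have cP: "convex P" by (simp add: P polyhedron_imp_convex)
  have ff: "F face_of P" "G face_of P" using F facet_of_imp_face_of by auto
  have "F \<inter> G face_of P" using ff by (rule face_of_Int)
  moreover have "F \<inter> G \<noteq> F"
    using face_of_aff_dim_eq[OF cP ff(1) ff(2)] F by (auto simp: facet_of_def)
  ultimately have "aff_dim (F \<inter> G) < aff_dim F"
    using face_of_aff_dim_lt[of F "F \<inter> G"] ff face_of_imp_convex face_of_subset[of "F \<inter> G" P F]
    by (metis face_of_face inf.cobounded1)
  then have "aff_dim (F \<inter> G) \<le> aff_dim R" using F R by (simp add: facet_of_def)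
  then show ?thesis
    using face_of_aff_dim_eq[OF cP R(1) \<open>F \<inter> G face_of P\<close>] F by auto
qed

text \<open>Three facets through a ridge are impossible: on the affine hull the slack function of the third
  facet would be a positive combination of the other two, so it would vanish only on the ridge.\<close>

theorem ridge_two_facets:
  fixes P :: "'a::euclidean_space set"
  assumes P: "polyhedron P" and R: "R face_of P" "R \<noteq> {}" "aff_dim R = aff_dim P - 2"
  shows "card {F. F facet_of P \<and> R \<subseteq> F} = 2"
proof -
  have cP: "convex P" by (simp add: P polyhedron_imp_convex)
  let ?N = "{F. F facet_of P \<and> R \<subseteq> F}"
  have RP: "R \<noteq> P" using R(3) by auto
  have Req: "R = \<Inter>?N" using face_of_polyhedron[OF P R(1,2) RP] .
  obtain F1 where F1: "F1 facet_of P" "R \<subseteq> F1"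
    using face_of_polyhedron_subset_facet[OF P R(1,2) RP] by blast
  have "R \<noteq> F1" using F1 R(3) by (auto simp: facet_of_def)
  then obtain F2 where F2: "F2 facet_of P" "R \<subseteq> F2" "F2 \<noteq> F1"
    using Req F1 by blast
  have "F3 = F1 \<or> F3 = F2" if F3: "F3 facet_of P" "R \<subseteq> F3" for F3
  proof (rule ccontr)
    assume "\<not> ?thesis"
    then have ne: "F3 \<noteq> F1" "F3 \<noteq> F2" by auto
    note I12 = facet_Int_ridge[OF P R(1,3) F1(1) F2(1) F2(3)[symmetric] F1(2) F2(2)]
    note I13 = facet_Int_ridge[OF P R(1,3) F1(1) F3(1) ne(1)[symmetric] F1(2) F3(2)]
    note I23 = facet_Int_ridge[OF P R(1,3) F2(1) F3(1) ne(2)[symmetric] F2(2) F3(2)]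
    obtain a1 b1 where h1: "P \<subseteq> {x. a1 \<bullet> x \<le> b1}" "F1 = P \<inter> {x. a1 \<bullet> x = b1}"
      using facet_of_polyhedron[OF P F1(1)] by metis
    obtain a2 b2 where h2: "P \<subseteq> {x. a2 \<bullet> x \<le> b2}" "F2 = P \<inter> {x. a2 \<bullet> x = b2}"
      using facet_of_polyhedron[OF P F2(1)] by metis
    obtain a3 b3 where h3: "P \<subseteq> {x. a3 \<bullet> x \<le> b3}" "F3 = P \<inter> {x. a3 \<bullet> x = b3}"
      using facet_of_polyhedron[OF P F3(1)] by metis
    have "R \<noteq> F2" using F2 R(3) by (auto simp: facet_of_def)
    obtain y1 where y1: "y1 \<in> F1" "y1 \<notin> R" using \<open>R \<noteq> F1\<close> F1 by auto
    obtain y2 where y2: "y2 \<in> F2" "y2 \<notin> R" using \<open>R \<noteq> F2\<close> F2 by auto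
    have y1P: "y1 \<in> P" and y2P: "y2 \<in> P" using y1 y2 h1 h2 by auto
    have y1n: "y1 \<notin> F2" "y1 \<notin> F3" using I12 I13 y1 by auto
    have y2n: "y2 \<notin> F1" "y2 \<notin> F3" using I12 I23 y2 by auto
    \<comment> \<open>The ridge together with one point of \<open>F1\<close> and one of
      \<open>F2\<close>, both off \<open>R\<close>, spans the affine hull of \<open>P\<close>; an
      affine identity on \<open>P\<close> has to be checked only there.\<close>
    have "y1 \<notin> affine hull R" using face_of_imp_eq_affine_Int[OF cP R(1)] y1 y1P by auto
    then have d1: "aff_dim (insert y1 R) = aff_dim R + 1" by (simp add: aff_dim_insert)
    have "affine hull (insert y1 R) \<subseteq> affine hull F1" using y1 F1 by (intro hull_mono) auto
    moreover have "y2 \<notin> affine hull F1"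
      using face_of_imp_eq_affine_Int[OF cP facet_of_imp_face_of[OF F1(1)]] y2n y2P by auto
    ultimately have "y2 \<notin> affine hull (insert y1 R)" by auto
    then have d2: "aff_dim (insert y2 (insert y1 R)) = aff_dim P"
      using d1 R(3) by (simp add: aff_dim_insert)
    have sub: "insert y2 (insert y1 R) \<subseteq> P" using y1P y2P face_of_imp_subset[OF R(1)] by auto
    have hull: "affine hull (insert y2 (insert y1 R)) = affine hull P"
      using d2 sub affine_dim_equal[of "affine hull (insert y2 (insert y1 R))" "affine hull P"]
      by (simp add: hull_mono)
    \<comment> \<open>The two factors are read off at \<open>y2\<close> and \<open>y1\<close>, where
      the slack of \<open>F2\<close>, respectively of \<open>F1\<close>, vanishes.\<close>
    define l where "l = (b3 - a3 \<bullet> y2) / (b1 - a1 \<bullet> y2)"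
    define m where "m = (b3 - a3 \<bullet> y1) / (b2 - a2 \<bullet> y1)"
    have p: "b3 - a3 \<bullet> y2 > 0" "b1 - a1 \<bullet> y2 > 0" "b3 - a3 \<bullet> y1 > 0" "b2 - a2 \<bullet> y1 > 0"
      using h1 h2 h3 y1n y2n y1P y2P by (force simp: less_le)+
    have lm: "l > 0" "m > 0" using p by (auto simp: l_def m_def)
    have e: "a1 \<bullet> y1 = b1" "a2 \<bullet> y2 = b2" using y1 y2 h1 h2 by auto
    have lmeq: "l * (b1 - a1 \<bullet> y2) = b3 - a3 \<bullet> y2" "m * (b2 - a2 \<bullet> y1) = b3 - a3 \<bullet> y1"
      using p by (auto simp: l_def m_def)
    have eq: "a3 \<bullet> x + - b3 = (l *\<^sub>R a1 + m *\<^sub>R a2) \<bullet> x + - (l * b1 + m * b2)" if "x \<in> P" for x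
    proof (rule affine_eq_on_hull[where S = "insert y2 (insert y1 R)"])
      show "x \<in> affine hull insert y2 (insert y1 R)" using that hull hull_inc by force
      fix z assume "z \<in> insert y2 (insert y1 R)"
      then consider "z = y2" | "z = y1" | "z \<in> R" by auto
      then show "a3 \<bullet> z + - b3 = (l *\<^sub>R a1 + m *\<^sub>R a2) \<bullet> z + - (l * b1 + m * b2)"
      proof cases
        case 1 then show ?thesis using lmeq e by (simp add: inner_add_left algebra_simps)
      next
        case 2 then show ?thesis using lmeq e by (simp add: inner_add_left algebra_simps)
      next
        case 3
        then have "a1 \<bullet> z = b1" "a2 \<bullet> z = b2" "a3 \<bullet> z = b3"
          using F1(2) F2(2) F3(2) h1 h2 h3 by auto
        then show ?thesis by (simp add: inner_add_left)
      qed
    qed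
    have "F3 \<subseteq> F1"
    proof
      fix x assume x: "x \<in> F3"
      then have xP: "x \<in> P" and "a3 \<bullet> x = b3" using h3 by auto
      then have s: "l * (b1 - a1 \<bullet> x) + m * (b2 - a2 \<bullet> x) = 0"
        using eq[OF xP] by (simp add: inner_add_left algebra_simps)
      have "b1 - a1 \<bullet> x \<ge> 0" "b2 - a2 \<bullet> x \<ge> 0" using h1 h2 xP by auto
      with s lm have "l * (b1 - a1 \<bullet> x) = 0"
        by (smt (verit, best) mult_nonneg_nonneg)
      then show "x \<in> F1" using h1 lm xP by auto
    qed
    then have "F3 = R" using I13 by auto
    then show False using F3 R(3) by (auto simp: facet_of_def)
  qed
  then have "?N = {F1, F2}" using F1 F2 by auto
  then show ?thesis using F2(3) by simp
qed

section \<open>Faces through their vertex sets\<close>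

definition facet_verts :: "pt3 set \<Rightarrow> pt3 set set" where
  "facet_verts P = verts ` facets P"

lemma verts_face: "F face_of P \<Longrightarrow> verts F = verts P \<inter> F"
  by (auto simp: verts_def extreme_point_of_face)

lemma polytope_conv_verts: "polytope P \<Longrightarrow> P = convex hull (verts P)"
  unfolding verts_def using Krein_Milman_Minkowski polytope_imp_compact polytope_imp_convex by blast

lemma finite_verts: "polytope P \<Longrightarrow> finite (verts P)"
  unfolding verts_def using finite_polyhedron_extreme_points polytope_imp_polyhedron by blast

lemma finite_facets: "polytope P \<Longrightarrow> finite (facets P)"
  unfolding facets_def by (rule finite_polytope_facets)

lemma face_conv_verts: "polytope P \<Longrightarrow> F face_of P \<Longrightarrow> F = convex hull (verts F)"
  using polytope_conv_verts face_of_polytope_polytope by blast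

lemma inj_on_verts_faces: "polytope P \<Longrightarrow> inj_on verts {F. F face_of P}"
  by (rule inj_onI) (metis face_conv_verts mem_Collect_eq)

lemma facets_face: "F \<in> facets P \<Longrightarrow> F face_of P"
  by (simp add: facets_def facet_of_imp_face_of)

lemma inj_on_verts_facets: "polytope P \<Longrightarrow> inj_on verts (facets P)"
  by (rule inj_on_subset[OF inj_on_verts_faces]) (auto dest: facets_face)

lemma verts_subset: "verts P \<subseteq> P"
  by (auto simp: verts_def extreme_point_of_def)

lemma singleton_face: "v \<in> verts P \<longleftrightarrow> {v} face_of P"
  by (simp add: verts_def face_of_singleton)

lemma verts_face_subset: "F face_of P \<Longrightarrow> verts F \<subseteq> verts P"
  by (auto simp: verts_face)

lemma face_subset_iff_verts:
  assumes "polytope P" "F face_of P" "G face_of P"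
  shows "F \<subseteq> G \<longleftrightarrow> verts F \<subseteq> verts G"
proof
  assume "verts F \<subseteq> verts G"
  then have "convex hull (verts F) \<subseteq> convex hull (verts G)" by (rule hull_mono)
  then show "F \<subseteq> G" using assms face_conv_verts by metis
next
  assume "F \<subseteq> G"
  then show "verts F \<subseteq> verts G" using assms by (auto simp: verts_face)
qed

lemma card_verts_aff_dim:
  assumes "polytope P" shows "aff_dim P + 1 \<le> int (card (verts P))"
proof -
  have "aff_dim P = aff_dim (verts P)"
    using polytope_conv_verts[OF assms] aff_dim_convex_hull by metis
  then show ?thesis using aff_dim_le_card[OF finite_verts[OF assms]] by simp
qed

lemma card_verts_le_2:
  assumes "polytope P" "aff_dim P \<le> 1" shows "card (verts P) \<le> 2"
proof (cases "P = {}")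
  case True then show ?thesis by (simp add: verts_def)
next
  case False
  moreover have "collinear P" using assms(2) by (simp add: collinear_aff_dim)
  ultimately obtain a b where "P = closed_segment a b"
    using compact_convex_collinear_segment[of P] polytope_imp_compact polytope_imp_convex assms(1)
    by metis
  then have "verts P \<subseteq> {a, b}" by (auto simp: verts_def extreme_point_of_segment)
  then have "card (verts P) \<le> card {a, b}" by (intro card_mono) auto
  also have "\<dots> \<le> 2" by (simp add: card_insert_if)
  finally show ?thesis .
qed

lemma card_verts_edge:
  assumes "polytope P" "aff_dim P = 1" shows "card (verts P) = 2"
  using card_verts_le_2[of P] card_verts_aff_dim[of P] assms by linarith

lemma aff_dim_1_of_two_verts:
  assumes "polytope P" "aff_dim P \<le> 1" "card (verts P) = 2" shows "aff_dim P = 1"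
proof -
  obtain a b where ab: "verts P = {a, b}" "a \<noteq> b" using assms(3) by (meson card_2_iff)
  then have "{a, b} \<subseteq> P" using verts_subset by auto
  then have "aff_dim {a, b} \<le> aff_dim P" by (rule aff_dim_subset)
  with ab assms(2) show ?thesis by simp
qed

locale poly3 =
  fixes P :: "pt3 set"
  assumes P3: "polyhedron3 P"
begin

lemma pt: "polytope P" and dim3: "aff_dim P = 3"
  using P3 by (auto simp: polyhedron3_def)

lemma ph: "polyhedron P" using pt by (rule polytope_imp_polyhedron)

lemma cvx: "convex P" using pt by (rule polytope_imp_convex)

lemma face_pt: "F face_of P \<Longrightarrow> polytope F"
  using pt face_of_polytope_polytope by blast

lemma facet_dim: "F \<in> facets P \<Longrightarrow> aff_dim F = 2"
  by (simp add: facets_def facet_of_def dim3)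

lemma facetI: "F face_of P \<Longrightarrow> aff_dim F = 2 \<Longrightarrow> F \<in> facets P"
  by (auto simp: facets_def facet_of_def dim3)

lemma facet_card_ge3: "F \<in> facets P \<Longrightarrow> card (verts F) \<ge> 3"
  using card_verts_aff_dim[OF face_pt[OF facets_face]] facet_dim by fastforce

lemma finite_facet_verts: "F \<in> facets P \<Longrightarrow> finite (verts F)"
  using finite_verts face_pt facets_face by blast

lemma facet_Int_dim:
  assumes "F \<in> facets P" "G \<in> facets P" "F \<noteq> G" shows "aff_dim (F \<inter> G) \<le> 1"
proof -
  have ff: "F face_of P" "G face_of P" using assms facets_face by auto
  have "F \<inter> G \<noteq> F"
    using face_of_aff_dim_eq[OF cvx ff] assms facet_dim by auto
  moreover have "F \<inter> G face_of F"
    using face_of_face[OF ff(1)] face_of_Int[OF ff] by auto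
  ultimately have "aff_dim (F \<inter> G) < aff_dim F"
    using face_of_aff_dim_lt ff face_of_imp_convex by blast
  then show ?thesis using facet_dim[OF assms(1)] by simp
qed

lemma verts_Int: "F face_of P \<Longrightarrow> G face_of P \<Longrightarrow> verts (F \<inter> G) = verts F \<inter> verts G"
  using verts_face[OF face_of_Int, of F P G] verts_face[of F P] verts_face[of G P] by auto

lemma facet_Int_card:
  assumes "F \<in> facets P" "G \<in> facets P" "F \<noteq> G" shows "card (verts F \<inter> verts G) \<le> 2"
  using card_verts_le_2[OF face_pt, of "F \<inter> G"] facet_Int_dim[OF assms] verts_Int face_of_Int
    assms facets_face by metis

lemma facet_Int_edge:
  assumes "F \<in> facets P" "G \<in> facets P" "F \<noteq> G" "card (verts F \<inter> verts G) = 2"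
  shows "aff_dim (F \<inter> G) = 1"
  using aff_dim_1_of_two_verts[OF face_pt, of "F \<inter> G"] facet_Int_dim[OF assms(1-3)] verts_Int
    face_of_Int assms facets_face by metis

lemma edge_two_facets:
  assumes "E face_of P" "aff_dim E = 1"
  shows "card {F \<in> facets P. E \<subseteq> F} = 2"
  using ridge_two_facets[OF ph assms(1)] assms(2) dim3 by (force simp: facets_def)

text \<open>This is \<open>ridge_two_facets\<close> for the polygon \<open>F\<close>, whose ridges
  are its vertices.\<close>

lemma vertex_two_edges:
  assumes F: "F \<in> facets P" and v: "v \<in> verts F"
  shows "card {E. E face_of P \<and> aff_dim E = 1 \<and> E \<subseteq> F \<and> v \<in> E} = 2"
proof -
  have "card {E. E facet_of F \<and> {v} \<subseteq> E} = 2"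
    using ridge_two_facets[of F "{v}"] face_pt[OF facets_face[OF F]] v
    by (simp add: singleton_face facet_dim[OF F] polytope_imp_polyhedron)
  moreover have "{E. E facet_of F \<and> {v} \<subseteq> E} = {E. E face_of P \<and> aff_dim E = 1 \<and> E \<subseteq> F \<and> v \<in> E}"
    using face_of_face[OF facets_face[OF F]] facet_dim[OF F] by (auto simp: facet_of_def)
  ultimately show ?thesis by simp
qed

text \<open>Intersecting with \<open>F\<close> matches the neighbours at \<open>v\<close> with the
  two edges of \<open>F\<close> at \<open>v\<close>, because an edge lies on exactly one facet
  besides \<open>F\<close>. The statement expresses that \<open>F\<close> is a polygon without
  mentioning a cyclic order of its vertices, which is the form that the search needs.\<close>

lemma facet_two_neighbours:
  assumes F: "F \<in> facets P" and v: "v \<in> verts F"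
  shows "card {G \<in> facets P. G \<noteq> F \<and> v \<in> verts G \<and> card (verts F \<inter> verts G) = 2} = 2"
    (is "card ?A = 2")
proof -
  let ?B = "{E. E face_of P \<and> aff_dim E = 1 \<and> E \<subseteq> F \<and> v \<in> E}"
  have vP: "v \<in> verts P" "v \<in> F" using v F verts_face facets_face by blast+
  have "bij_betw (\<lambda>G. F \<inter> G) ?A ?B"
  proof (rule bij_betw_imageI)
    show "inj_on (\<lambda>G. F \<inter> G) ?A"
    proof (rule inj_onI)
      fix G H assume G: "G \<in> ?A" and H: "H \<in> ?A" and eq: "F \<inter> G = F \<inter> H"
      have E: "F \<inter> G face_of P" "aff_dim (F \<inter> G) = 1"
        using face_of_Int[OF facets_face facets_face] facet_Int_edge F G by blast+
      have fin: "finite {K \<in> facets P. F \<inter> G \<subseteq> K}" using finite_facets[OF pt] by auto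
      have "{F, G, H} \<subseteq> {K \<in> facets P. F \<inter> G \<subseteq> K}" using F G H eq by blast
      from card_mono[OF fin this] have "card {F, G, H} \<le> 2" by (simp add: edge_two_facets[OF E])
      moreover have "F \<noteq> G" "F \<noteq> H" using G H by blast+
      then have "card {F, G, H} = 3" if "G \<noteq> H" using that by simp
      ultimately show "G = H" by fastforce
    qed
    show "(\<lambda>G. F \<inter> G) ` ?A = ?B"
    proof (intro equalityI subsetI)
      fix E assume "E \<in> (\<lambda>G. F \<inter> G) ` ?A"
      then obtain G where G: "G \<in> ?A" "E = F \<inter> G" by blast
      then have "v \<in> G" using verts_subset by blast
      then show "E \<in> ?B"
        using F G vP face_of_Int[OF facets_face facets_face] facet_Int_edge by blast
    next
      fix E assume E: "E \<in> ?B"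
      then have c2: "card {K \<in> facets P. E \<subseteq> K} = 2" using edge_two_facets by auto
      have "F \<in> {K \<in> facets P. E \<subseteq> K}" using F E by auto
      with c2 obtain G where G: "G \<in> facets P" "E \<subseteq> G" "G \<noteq> F"
        by (metis (no_types, lifting) card_2_iff' mem_Collect_eq)
      have FG: "F \<inter> G face_of P" using F G by (simp add: facets_face face_of_Int)
      have "E = F \<inter> G"
        using face_of_aff_dim_eq[OF cvx _ FG, of E] facet_Int_dim[OF F G(1)] G(2,3) E by fastforce
      then have "card (verts F \<inter> verts G) = 2"
        using card_verts_edge[OF face_pt, of E] E verts_Int[OF facets_face facets_face, OF F G(1)]
        by simp
      moreover have "v \<in> verts G" using G E vP verts_face facets_face by blast
      ultimately show "E \<in> (\<lambda>G. F \<inter> G) ` ?A" using G \<open>E = F \<inter> G\<close> by blast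
    qed
  qed
  from bij_betw_same_card[OF this] show ?thesis by (simp only: vertex_two_edges[OF assms])
qed

lemma vertex_in_facet:
  assumes "v \<in> verts P" obtains F where "F \<in> facets P" "v \<in> verts F"
proof -
  have "{v} face_of P" "{v} \<noteq> P" using assms dim3 by (auto simp: singleton_face)
  then obtain F where "F facet_of P" "{v} \<subseteq> F"
    using face_of_polyhedron_subset_facet[OF ph] by blast
  then show thesis using that assms verts_face facet_of_imp_face_of by (force simp: facets_def)
qed

text \<open>Any facet through \<open>v\<close> brings along its two neighbours at
  \<open>v\<close>.\<close>

lemma vertex_degree_ge3:
  assumes "v \<in> verts P" shows "card {F \<in> facets P. v \<in> verts F} \<ge> 3"
proof -
  obtain F where F: "F \<in> facets P" "v \<in> verts F" using vertex_in_facet assms by blast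
  let ?A = "{G \<in> facets P. G \<noteq> F \<and> v \<in> verts G \<and> card (verts F \<inter> verts G) = 2}"
  have "insert F ?A \<subseteq> {F \<in> facets P. v \<in> verts F}" using F by auto
  then have "card (insert F ?A) \<le> card {F \<in> facets P. v \<in> verts F}"
    using finite_facets[OF pt] by (intro card_mono) auto
  moreover have "card (insert F ?A) = 3"
    using facet_two_neighbours[OF F] finite_facets[OF pt] by (subst card_insert_disjoint) auto
  ultimately show ?thesis by simp
qed

lemma facet_hyperplane:
  assumes "F \<in> facets P"
  obtains a b where "a \<noteq> 0" "P \<subseteq> {x. a \<bullet> x \<le> b}" "F = P \<inter> {x. a \<bullet> x = b}"
  using facet_of_polyhedron[OF ph] assms by (auto simp: facets_def)

end

section \<open>Euler's relation\<close>

text \<open>Finitely many hyperplanes through the origin do not cover the space. Applied to the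
  differences of vertices, this gives a height function that takes different values at different
  vertices.\<close>

lemma generic_functional:
  fixes S :: "'a::euclidean_space set"
  assumes "finite S" "0 \<notin> S" shows "\<exists>c. \<forall>x\<in>S. c \<bullet> x \<noteq> 0"
  using assms
proof (induction S rule: finite_induct)
  case (insert s S)
  then obtain c where c: "\<forall>x\<in>S. c \<bullet> x \<noteq> 0" by auto
  show ?case
  proof (cases "c \<bullet> s = 0")
    case False then show ?thesis using c by auto
  next
    case True
    \<comment> \<open>The forbidden multiples of \<open>s\<close> are 0 and those that would
      annihilate an earlier vector. If \<open>s \<bullet> x = 0\<close>, the quotient takes the
      default value 0, which is forbidden anyway.\<close>
    let ?B = "insert 0 ((\<lambda>x. - (c \<bullet> x) / (s \<bullet> x)) ` S)"
    have "finite ?B" using insert by auto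
    then obtain t where t: "t \<notin> ?B" using ex_new_if_finite infinite_UNIV_char_0 by blast
    have "(c + t *\<^sub>R s) \<bullet> x \<noteq> 0" if x: "x \<in> S" for x
    proof
      assume z: "(c + t *\<^sub>R s) \<bullet> x = 0"
      then have e: "c \<bullet> x + t * (s \<bullet> x) = 0" by (simp add: inner_add_left)
      with c x have "s \<bullet> x \<noteq> 0" by auto
      with e have "t = - (c \<bullet> x) / (s \<bullet> x)" by (simp add: field_simps)
      with t x show False by blast
    qed
    moreover have "(c + t *\<^sub>R s) \<bullet> s \<noteq> 0"
      using True t insert by (auto simp: inner_add_left)
    ultimately show ?thesis by blast
  qed
qed auto

context poly3
begin

lemma affine_hull_UNIV: "affine hull P = UNIV"
  using dim3 aff_dim_eq_full[of P] by simp

lemma interior_eq: "interior P = P - \<Union>(facets P)"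
  using rel_interior_of_polyhedron[OF ph] rel_interior_interior[OF affine_hull_UNIV]
  by (simp add: facets_def)

lemma facet_disjoint_interior: "F \<in> facets P \<Longrightarrow> z \<in> interior P \<Longrightarrow> z \<notin> F"
  using interior_eq by blast

lemma interior_nonempty: "interior P \<noteq> {}"
  using rel_interior_interior[OF affine_hull_UNIV] rel_interior_eq_empty[OF cvx] dim3 by auto

text \<open>General position: the two ends of an edge have different heights, so a level plane
  contains no edge.\<close>

lemma no_flat_edge:
  assumes inj: "inj_on ((\<bullet>) c) (verts P)" and K: "K face_of P" "aff_dim K = 1" "\<And>z. z \<in> K \<Longrightarrow> c \<bullet> z = d"
  shows False
proof -
  have "card (verts K) = 2" using card_verts_edge[OF face_pt] K by auto
  then obtain a b where ab: "verts K = {a, b}" "a \<noteq> b" by (meson card_2_iff)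
  then have "a \<in> verts P" "b \<in> verts P" "a \<in> K" "b \<in> K" using verts_face[OF K(1)] by auto
  then show False using ab K(3) inj_onD[OF inj, of a b] by auto
qed

text \<open>The segment from an interior point to whichever of \<open>x\<close> and \<open>y\<close>
  lies on the other side of the level crosses it, and all its points except possibly the far end are
  interior.\<close>

lemma level_meets_interior:
  assumes xy: "x \<in> P" "y \<in> P" "c \<bullet> x < d" "d < c \<bullet> y"
  obtains z where "z \<in> interior P" "c \<bullet> z = d"
proof -
  obtain z0 where z0: "z0 \<in> interior P" using interior_nonempty by auto
  have step: "\<exists>z. z \<in> interior P \<and> c \<bullet> z = d" if w: "w \<in> P" and
    s: "(c \<bullet> w - d) * (d - c \<bullet> z0) > 0" for w
  proof -
    define e where "e = (c \<bullet> w - d) / (c \<bullet> w - c \<bullet> z0)"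
    have sg: "(c \<bullet> w - d > 0 \<and> d - c \<bullet> z0 > 0) \<or> (c \<bullet> w - d < 0 \<and> d - c \<bullet> z0 < 0)"
      using s by (simp add: zero_less_mult_iff)
    have e: "0 < e" "e \<le> 1" "c \<bullet> w - c \<bullet> z0 \<noteq> 0"
      unfolding e_def using sg by (auto simp: divide_simps)
    have "w - e *\<^sub>R (w - z0) \<in> interior P" by (rule mem_interior_convex_shrink[OF cvx z0 w e(1,2)])
    moreover have "c \<bullet> (w - e *\<^sub>R (w - z0)) = d"
      using e(3) by (simp add: inner_diff_right e_def)
    ultimately show ?thesis by blast
  qed
  consider "c \<bullet> z0 = d" | "c \<bullet> z0 < d" | "c \<bullet> z0 > d" by linarith
  then show thesis
  proof cases
    case 1 then show ?thesis using that z0 by auto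
  next
    case 2 then show ?thesis using step[of y] xy that by (auto simp: zero_less_mult_iff)
  next
    case 3 then show ?thesis using step[of x] xy that by (auto simp: zero_less_mult_iff)
  qed
qed

text \<open>The facets in question correspond to the two sides, at \<open>v\<close>, of the polygon cut out of \<open>P\<close> by the
  level plane of \<open>c\<close> through \<open>v\<close>.\<close>

lemma two_intermediate_facets:
  assumes inj: "inj_on ((\<bullet>) c) (verts P)" and v: "v \<in> verts P"
    and xy: "x \<in> P" "y \<in> P" "c \<bullet> x < c \<bullet> v" "c \<bullet> v < c \<bullet> y"
  shows "card {F \<in> facets P. v \<in> verts F \<and> (\<exists>x\<in>verts F. c \<bullet> x < c \<bullet> v) \<and> (\<exists>y\<in>verts F. c \<bullet> v < c \<bullet> y)} = 2"
    (is "card ?A = 2")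
proof -
  define H where "H = {z. c \<bullet> z = c \<bullet> v}"
  define S where "S = P \<inter> H"
  let ?B = "{E. E facet_of S \<and> {v} \<subseteq> E}"
  have c0: "c \<noteq> 0" using xy by auto
  have cH: "convex H" "polyhedron H" "affine H"
    by (auto simp: H_def convex_hyperplane polyhedron_hyperplane affine_hyperplane)
  have pS: "polyhedron S" unfolding S_def using ph cH by blast
  have cS: "convex S" using pS polyhedron_imp_convex by blast
  obtain z where z: "z \<in> interior P" "c \<bullet> z = c \<bullet> v" using level_meets_interior[OF xy] by blast
  have zS: "z \<in> S" using z interior_subset by (auto simp: S_def H_def)
  \<comment> \<open>The level plane meets the interior of \<open>P\<close>, so the section
    \<open>S\<close> is two-dimensional.\<close>
  have "aff_dim (H \<inter> interior P) = aff_dim H"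
    using aff_dim_convex_Int_open[OF cH(1) open_interior, of P] z by (auto simp: H_def)
  moreover have "aff_dim H = 2" using c0 by (simp add: H_def)
  moreover have "aff_dim (H \<inter> interior P) \<le> aff_dim S"
    using interior_subset by (intro aff_dim_subset) (auto simp: S_def)
  moreover have "aff_dim S \<le> aff_dim H" by (intro aff_dim_subset) (auto simp: S_def)
  ultimately have dS: "aff_dim S = 2" by simp
  have vH: "v \<in> H" by (simp add: H_def)
  have "{v} face_of S"
    using face_of_slice[OF _ cH(1), of "{v}" P] v vH by (simp add: S_def singleton_face)
  then have B2: "card ?B = 2" using ridge_two_facets[OF pS, of "{v}"] dS by simp
  have slice: "F \<inter> H face_of S" "F \<inter> H \<noteq> S" "aff_dim (F \<inter> H) \<le> 1" if F: "F \<in> facets P" for F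
  proof -
    show 1: "F \<inter> H face_of S" unfolding S_def by (rule face_of_slice[OF facets_face[OF F] cH(1)])
    show 2: "F \<inter> H \<noteq> S" using zS facet_disjoint_interior[OF F z(1)] by blast
    show "aff_dim (F \<inter> H) \<le> 1" using face_of_aff_dim_lt[OF cS 1 2] dS by simp
  qed
  \<comment> \<open>A facet with vertices on both sides of \<open>H\<close> crosses \<open>H\<close>
    inside a segment, and such a point cannot be the extreme point \<open>v\<close>. Thus the facet
    cuts \<open>S\<close> in a side and not only in \<open>v\<close>.\<close>
  have other: "\<exists>u. u \<in> F \<inter> H \<and> u \<noteq> v" if F: "F \<in> ?A" for F
  proof -
    obtain x' y' where x'y': "x' \<in> verts F" "y' \<in> verts F" "c \<bullet> x' < c \<bullet> v" "c \<bullet> v < c \<bullet> y'"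
      using F by blast
    have FP: "F face_of P" "v \<in> verts F" using F facets_face by auto
    define t where "t = (c \<bullet> v - c \<bullet> x') / (c \<bullet> y' - c \<bullet> x')"
    have t: "0 < t" "t < 1" using x'y' by (auto simp: t_def divide_simps)
    define u where "u = (1 - t) *\<^sub>R x' + t *\<^sub>R y'"
    have "x' \<noteq> y'" using x'y' by auto
    then have uo: "u \<in> open_segment x' y'" using t by (auto simp: in_segment u_def)
    have "x' \<in> F" "y' \<in> F" using x'y' verts_subset by auto
    then have "u \<in> F"
      using t by (auto simp: u_def intro!: convexD[OF face_of_imp_convex[OF FP(1)]])
    moreover have "c \<bullet> u = c \<bullet> x' + t * (c \<bullet> y' - c \<bullet> x')"
      by (simp add: u_def inner_add_right algebra_simps)
    then have "u \<in> H" using x'y' by (simp add: t_def H_def)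
    moreover have "u \<noteq> v"
      using FP(2) uo \<open>x' \<in> F\<close> \<open>y' \<in> F\<close> by (auto simp: verts_def extreme_point_of_def)
    ultimately show ?thesis by blast
  qed
  have dimA: "aff_dim (F \<inter> H) = 1" if F: "F \<in> ?A" for F
  proof -
    obtain u where u: "u \<in> F \<inter> H" "u \<noteq> v" using other[OF F] by blast
    have "v \<in> F" using F verts_subset by blast
    then have "aff_dim {u, v} \<le> aff_dim (F \<inter> H)" using u vH by (intro aff_dim_subset) auto
    then show ?thesis using slice(3)[of F] F u by simp
  qed
  have "bij_betw (\<lambda>F. F \<inter> H) ?A ?B"
  proof (rule bij_betw_imageI)
    show "inj_on (\<lambda>F. F \<inter> H) ?A"
    proof (rule inj_onI, rule ccontr)
      fix F G assume F: "F \<in> ?A" and G: "G \<in> ?A" and eq: "F \<inter> H = G \<inter> H" and ne: "F \<noteq> G"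
      have FG: "F \<in> facets P" "G \<in> facets P" using F G by blast+
      let ?K = "F \<inter> G"
      have K: "?K face_of P" using facets_face[OF FG(1)] facets_face[OF FG(2)] by (rule face_of_Int)
      \<comment> \<open>If two facets had the same trace on \<open>H\<close>, their intersection
        would be an edge of \<open>P\<close> inside the level plane.\<close>
      have sub: "F \<inter> H \<subseteq> ?K" using eq by blast
      have d: "aff_dim ?K = 1"
        using aff_dim_subset[OF sub] dimA[OF F] facet_Int_dim[OF FG ne] by simp
      have "affine hull (F \<inter> H) = affine hull ?K"
        using affine_dim_equal[of "affine hull (F \<inter> H)" "affine hull ?K"] hull_mono[OF sub, of affine]
          d dimA[OF F] other[OF F] by auto
      moreover have "affine hull (F \<inter> H) \<subseteq> H" using cH(3) by (simp add: hull_minimal)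
      ultimately have "?K \<subseteq> H" using hull_subset[of ?K affine] by simp
      then show False using no_flat_edge[OF inj K d, of "c \<bullet> v"] by (auto simp: H_def)
    qed
    show "(\<lambda>F. F \<inter> H) ` ?A = ?B"
    proof (intro equalityI subsetI)
      fix E assume "E \<in> (\<lambda>F. F \<inter> H) ` ?A"
      then obtain F where F: "F \<in> ?A" "E = F \<inter> H" by blast
      have "v \<in> F" using F verts_subset by blast
      then show "E \<in> ?B" using F slice[of F] dimA[OF F(1)] dS vH by (simp add: facet_of_def) blast
    next
      fix E assume E: "E \<in> ?B"
      have Ef: "E face_of S" "aff_dim E = 1" "v \<in> E" using E dS by (auto simp: facet_of_def)
      \<comment> \<open>A relative interior point of the side \<open>E\<close> lies on the boundary
        of \<open>P\<close>, hence on a facet, and that facet then contains all of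
        \<open>E\<close>.\<close>
      have "rel_interior E \<noteq> {}" using Ef face_of_imp_convex rel_interior_eq_empty by blast
      then obtain p where p: "p \<in> rel_interior E" by blast
      have pE: "p \<in> E" using p rel_interior_subset by blast
      have pS: "p \<in> S" using pE Ef(1) face_of_imp_subset by blast
      have "E \<noteq> S" using Ef dS by auto
      then have "p \<notin> rel_interior S" using face_of_disjoint_rel_interior[OF Ef(1)] pE by blast
      moreover have "p \<in> rel_interior S" if "p \<in> interior P"
      proof -
        have "affine hull S \<subseteq> H" unfolding S_def using cH(3) by (simp add: hull_minimal)
        then have "interior P \<inter> affine hull S \<subseteq> S" using interior_subset by (auto simp: S_def)
        then show ?thesis using that pS open_interior unfolding mem_rel_interior by blast
      qed
      ultimately have "p \<notin> interior P" by blast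
      then obtain F where F: "F \<in> facets P" "p \<in> F" using interior_eq pS by (auto simp: S_def)
      have "E \<subseteq> F \<inter> H"
        using subset_of_face_of[OF slice(1)[OF F(1)] face_of_imp_subset[OF Ef(1)]] p F(2) pS
        by (auto simp: S_def)
      then have EF: "E = F \<inter> H"
        using face_of_aff_dim_eq[OF cS Ef(1) slice(1)[OF F(1)]] slice(3)[OF F(1)] Ef(2) by simp
      have vF: "v \<in> verts F" using v EF Ef(3) verts_face[OF facets_face[OF F(1)]] by blast
      have Fc: "F = convex hull verts F" by (rule face_conv_verts[OF pt facets_face[OF F(1)]])
      \<comment> \<open>With all vertices of \<open>F\<close> on one side of the level plane,
        \<open>E\<close> would be a face of \<open>F\<close>, so an edge of \<open>P\<close> of
        constant height.\<close>
      have False if lo: "\<forall>x\<in>verts F. c \<bullet> v \<le> c \<bullet> x"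
      proof -
        have "F \<subseteq> {x. c \<bullet> v \<le> c \<bullet> x}"
          by (subst Fc, rule hull_minimal) (use lo convex_halfspace_ge[of "c \<bullet> v" c] in \<open>auto simp: inner_commute\<close>)
        then have "F \<inter> {x. c \<bullet> x = c \<bullet> v} face_of F"
          using face_of_imp_convex[OF facets_face[OF F(1)]]
          by (intro face_of_Int_supporting_hyperplane_ge) auto
        then have "E face_of F" by (simp add: EF H_def)
        then have "E face_of P" by (rule face_of_trans[OF _ facets_face[OF F(1)]])
        moreover have "\<And>z. z \<in> E \<Longrightarrow> c \<bullet> z = c \<bullet> v" by (simp add: EF H_def)
        ultimately show False using no_flat_edge[OF inj _ Ef(2)] by blast
      qed
      moreover have False if hi: "\<forall>x\<in>verts F. c \<bullet> x \<le> c \<bullet> v"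
      proof -
        have "F \<subseteq> {x. c \<bullet> x \<le> c \<bullet> v}"
          by (subst Fc, rule hull_minimal) (use hi convex_halfspace_le[of c "c \<bullet> v"] in auto)
        then have "F \<inter> {x. c \<bullet> x = c \<bullet> v} face_of F"
          using face_of_imp_convex[OF facets_face[OF F(1)]]
          by (intro face_of_Int_supporting_hyperplane_le) auto
        then have "E face_of F" by (simp add: EF H_def)
        then have "E face_of P" by (rule face_of_trans[OF _ facets_face[OF F(1)]])
        moreover have "\<And>z. z \<in> E \<Longrightarrow> c \<bullet> z = c \<bullet> v" by (simp add: EF H_def)
        ultimately show False using no_flat_edge[OF inj _ Ef(2)] by blast
      qed
      ultimately have "F \<in> ?A" using F(1) vF by force
      then show "E \<in> (\<lambda>F. F \<inter> H) ` ?A" using EF by blast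
    qed
  qed
  from bij_betw_same_card[OF this] show ?thesis by (simp only: B2)
qed

text \<open>Injectivity makes the minimum and the maximum unique, and they differ because
  \<open>S\<close> has two elements.\<close>

lemma card_intermediate:
  fixes f :: "pt3 \<Rightarrow> real"
  assumes inj: "inj_on f S" and fin: "finite S" and two: "card S \<ge> 2"
  shows "card {v \<in> S. (\<exists>x\<in>S. f x < f v) \<and> (\<exists>y\<in>S. f v < f y)} + 2 = card (S :: pt3 set)"
proof -
  have ne: "S \<noteq> {}" using two by auto
  obtain m where m: "m \<in> S" "\<And>x. x \<in> S \<Longrightarrow> f m \<le> f x"
  proof -
    have "Min (f ` S) \<in> f ` S" using fin ne by simp
    then obtain m where "m \<in> S" "f m = Min (f ` S)" by auto
    then show thesis using fin by (intro that[of m]) auto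
  qed
  obtain M where M: "M \<in> S" "\<And>x. x \<in> S \<Longrightarrow> f x \<le> f M"
  proof -
    have "Max (f ` S) \<in> f ` S" using fin ne by simp
    then obtain m where "m \<in> S" "f m = Max (f ` S)" by auto
    then show thesis using fin by (intro that[of m]) auto
  qed
  have "m \<noteq> M"
  proof
    assume "m = M"
    then have "\<And>x. x \<in> S \<Longrightarrow> x = m" using m M inj_onD[OF inj] by (metis order_antisym)
    then have "S \<subseteq> {m}" by blast
    then have "card S \<le> card {m}" by (intro card_mono) auto
    then show False using two by simp
  qed
  moreover have "{v \<in> S. (\<exists>x\<in>S. f x < f v) \<and> (\<exists>y\<in>S. f v < f y)} = S - {m, M}" (is "?L = ?R")
  proof (intro equalityI subsetI)
    fix v assume "v \<in> ?L" then show "v \<in> ?R" using m M by force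
  next
    fix v assume v: "v \<in> ?R"
    then have "f m \<noteq> f v" "f v \<noteq> f M" using inj_onD[OF inj] m M by blast+
    then have "f m < f v" "f v < f M" using v m M by (auto simp: less_le)
    then show "v \<in> ?L" using v m M by blast
  qed
  ultimately show ?thesis using m M fin two by (simp add: card_Diff_subset)
qed

text \<open>Double counting for a generic height: the pairs of a facet and a vertex that is neither
  lowest nor highest in it. A facet with n vertices contributes n - 2, and each vertex contributes 2
  unless it is lowest or highest in \<open>P\<close>. Edges need not be mentioned, since the sum on
  the left is twice their number.\<close>

theorem euler: "(\<Sum>F\<in>facets P. card (verts F)) + 4 = 2 * card (facets P) + 2 * card (verts P)"
proof -
  let ?V = "verts P"
  have fin: "finite ?V" "finite (facets P)" using finite_verts[OF pt] finite_facets[OF pt] by auto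
  have V4: "card ?V \<ge> 4" using card_verts_aff_dim[OF pt] dim3 by simp
  have "finite ((\<lambda>(v, w). v - w) ` {(v, w). v \<in> ?V \<and> w \<in> ?V \<and> v \<noteq> w})"
    by (rule finite_imageI, rule finite_subset[of _ "?V \<times> ?V"]) (use fin in auto)
  moreover have "0 \<notin> (\<lambda>(v, w). v - w) ` {(v, w). v \<in> ?V \<and> w \<in> ?V \<and> v \<noteq> w}" by auto
  ultimately obtain c where c: "\<forall>x\<in>(\<lambda>(v, w). v - w) ` {(v, w). v \<in> ?V \<and> w \<in> ?V \<and> v \<noteq> w}. c \<bullet> x \<noteq> 0"
    using generic_functional by blast
  have inj: "inj_on ((\<bullet>) c) ?V"
  proof (rule inj_onI, rule ccontr)
    fix v w assume vw: "v \<in> ?V" "w \<in> ?V" "c \<bullet> v = c \<bullet> w" "v \<noteq> w"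
    then have "c \<bullet> (v - w) \<noteq> 0" using c by force
    then show False using vw by (simp add: inner_diff_right)
  qed
  define mid where "mid S v \<longleftrightarrow> (\<exists>x\<in>S. c \<bullet> x < c \<bullet> v) \<and> (\<exists>y\<in>S. c \<bullet> v < c \<bullet> y)" for S v
  have F: "card {v \<in> ?V. v \<in> verts F \<and> mid (verts F) v} + 2 = card (verts F)" if "F \<in> facets P" for F
  proof -
    have s: "verts F \<subseteq> ?V" using verts_face_subset facets_face that by blast
    then have "{v \<in> ?V. v \<in> verts F \<and> mid (verts F) v} = {v \<in> verts F. mid (verts F) v}" by blast
    then show ?thesis
      using card_intermediate[OF inj_on_subset[OF inj s]] finite_facet_verts[OF that]
        facet_card_ge3[OF that] unfolding mid_def by simp
  qed
  have V: "card {F \<in> facets P. v \<in> verts F \<and> mid (verts F) v} = (if mid ?V v then 2 else 0)"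
    if v: "v \<in> ?V" for v
  proof (cases "mid ?V v")
    case True
    then obtain x y where "x \<in> P" "y \<in> P" "c \<bullet> x < c \<bullet> v" "c \<bullet> v < c \<bullet> y"
      using verts_subset unfolding mid_def by blast
    from two_intermediate_facets[OF inj v this] True show ?thesis unfolding mid_def by simp
  next
    \<comment> \<open>A vertex that is lowest or highest in \<open>P\<close> is so in each facet
      through it.\<close>
    case False
    then have "{F \<in> facets P. v \<in> verts F \<and> mid (verts F) v} = {}"
      using verts_face_subset[OF facets_face] unfolding mid_def by blast
    then show ?thesis using False by (metis card.empty)
  qed
  have "(\<Sum>F\<in>facets P. card {v \<in> ?V. v \<in> verts F \<and> mid (verts F) v})
      = (\<Sum>v\<in>?V. card {F \<in> facets P. v \<in> verts F \<and> mid (verts F) v})"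
    by (rule sum_multicount_gen) (use fin in auto)
  also have "\<dots> = (\<Sum>v\<in>?V. if mid ?V v then 2 else 0)" by (rule sum.cong) (use V in auto)
  also have "\<dots> = 2 * card {v \<in> ?V. mid ?V v}"
    using fin by (simp add: sum.If_cases Int_def)
  finally have 1: "(\<Sum>F\<in>facets P. card {v \<in> ?V. v \<in> verts F \<and> mid (verts F) v}) = 2 * card {v \<in> ?V. mid ?V v}" .
  have 2: "card {v \<in> ?V. mid ?V v} + 2 = card ?V"
    using card_intermediate[OF inj fin(1)] V4 unfolding mid_def by simp
  have "(\<Sum>F\<in>facets P. card (verts F)) = (\<Sum>F\<in>facets P. card {v \<in> ?V. v \<in> verts F \<and> mid (verts F) v} + 2)"
    by (rule sum.cong) (use F in auto)
  also have "\<dots> = 2 * card {v \<in> ?V. mid ?V v} + 2 * card (facets P)"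
    by (simp only: sum.distrib 1 sum_constant) simp
  finally show ?thesis using 2 by simp
qed

end

section \<open>Triangular facets and the face lattice\<close>

context poly3
begin

text \<open>A point of the plane of \<open>F\<close> on the strict inner side of the three side
  lines has positive barycentric coordinates, so a fourth vertex would lie in the triangle
  \<open>a\<close>, \<open>b\<close>, \<open>c\<close> and not be extreme. This is the convexity
  argument that the incidence conditions of the search do not contain.\<close>

lemma facet_triangle:
  assumes F: "F \<in> facets P" and abc: "a \<noteq> b" "b \<noteq> c" "a \<noteq> c"
    and G: "G1 \<in> facets P" "G2 \<in> facets P" "G3 \<in> facets P"
    and I: "verts F \<inter> verts G1 = {a, b}" "verts F \<inter> verts G2 = {b, c}" "verts F \<inter> verts G3 = {a, c}"
  shows "verts F = {a, b, c}"
proof (rule ccontr)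
  assume "verts F \<noteq> {a, b, c}"
  moreover have abcF: "{a, b, c} \<subseteq> verts F" using I by blast
  ultimately obtain d where d: "d \<in> verts F" "d \<noteq> a" "d \<noteq> b" "d \<noteq> c" by blast
  have sep: "\<exists>n \<beta>. \<forall>x\<in>verts F. n \<bullet> x \<le> \<beta> \<and> (n \<bullet> x = \<beta> \<longleftrightarrow> x \<in> verts G)" if hG: "G \<in> facets P" for G
  proof -
    obtain n \<beta> where n: "P \<subseteq> {x. n \<bullet> x \<le> \<beta>}" "G = P \<inter> {x. n \<bullet> x = \<beta>}"
      using facet_hyperplane[OF hG] by metis
    have "x \<in> P \<and> (x \<in> G \<longleftrightarrow> x \<in> verts G)" if "x \<in> verts F" for x
    proof -
      have "x \<in> verts P" using that verts_face_subset[OF facets_face[OF F]] by blast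
      then show ?thesis
        using verts_subset verts_face[OF facets_face[OF \<open>G \<in> facets P\<close>]] by blast
    qed
    then show ?thesis using n by blast
  qed
  obtain n1 \<beta>1 where n1: "\<forall>x\<in>verts F. n1 \<bullet> x \<le> \<beta>1 \<and> (n1 \<bullet> x = \<beta>1 \<longleftrightarrow> x \<in> verts G1)"
    using sep[OF G(1)] by blast
  obtain n2 \<beta>2 where n2: "\<forall>x\<in>verts F. n2 \<bullet> x \<le> \<beta>2 \<and> (n2 \<bullet> x = \<beta>2 \<longleftrightarrow> x \<in> verts G2)"
    using sep[OF G(2)] by blast
  obtain n3 \<beta>3 where n3: "\<forall>x\<in>verts F. n3 \<bullet> x \<le> \<beta>3 \<and> (n3 \<bullet> x = \<beta>3 \<longleftrightarrow> x \<in> verts G3)"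
    using sep[OF G(3)] by blast
  have k: "\<And>x. x \<in> verts F \<Longrightarrow> x \<in> verts G1 \<longleftrightarrow> x = a \<or> x = b"
      "\<And>x. x \<in> verts F \<Longrightarrow> x \<in> verts G2 \<longleftrightarrow> x = b \<or> x = c"
      "\<And>x. x \<in> verts F \<Longrightarrow> x \<in> verts G3 \<longleftrightarrow> x = a \<or> x = c"
    using I(1) apply blast using I(2) apply blast using I(3) by blast
  have m: "a \<in> verts G1" "b \<in> verts G1" "c \<notin> verts G1" "d \<notin> verts G1"
      "b \<in> verts G2" "c \<in> verts G2" "a \<notin> verts G2" "d \<notin> verts G2"
      "a \<in> verts G3" "c \<in> verts G3" "b \<notin> verts G3" "d \<notin> verts G3"
    using abc d abcF by (simp_all add: k)
  have v1: "n1 \<bullet> a = \<beta>1" "n1 \<bullet> b = \<beta>1" "n1 \<bullet> c < \<beta>1" "n1 \<bullet> d < \<beta>1"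
    using n1 m abcF d(1) by (auto simp: less_le)
  have v2: "n2 \<bullet> b = \<beta>2" "n2 \<bullet> c = \<beta>2" "n2 \<bullet> a < \<beta>2" "n2 \<bullet> d < \<beta>2"
    using n2 m abcF d(1) by (auto simp: less_le)
  have v3: "n3 \<bullet> a = \<beta>3" "n3 \<bullet> c = \<beta>3" "n3 \<bullet> b < \<beta>3" "n3 \<bullet> d < \<beta>3"
    using n3 m abcF d(1) by (auto simp: less_le)
  have "affine hull {a, b} \<subseteq> {x. n1 \<bullet> x = \<beta>1}"
    by (rule hull_minimal) (use v1 in \<open>auto simp: affine_hyperplane\<close>)
  then have "c \<notin> affine hull {a, b}" using v1(3) by auto
  then have "aff_dim (insert c {a, b}) = 2" using abc(1) by (subst aff_dim_insert) simp
  moreover have "insert c {a, b} = {a, b, c}" by blast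
  ultimately have d2: "aff_dim {a, b, c} = 2" by simp
  have abcF': "{a, b, c} \<subseteq> F" using abcF verts_subset by blast
  have "affine hull {a, b, c} = affine hull F"
    using affine_dim_equal[of "affine hull {a,b,c}" "affine hull F"] hull_mono[OF abcF', of affine]
      facet_dim[OF F] d2 by simp
  moreover have "d \<in> F" using d(1) verts_subset by blast
  ultimately have "d \<in> affine hull {a, b, c}" using hull_inc[of d F affine] by simp
  then obtain u v w where uvw: "d = u *\<^sub>R a + v *\<^sub>R b + w *\<^sub>R c" "u + v + w = 1"
    by (auto simp: affine_hull_3)
  have w: "w = 1 - u - v" using uvw(2) by simp
  \<comment> \<open>The slack of a side depends only on the barycentric coordinate of the opposite
    vertex, which therefore has the sign of that slack.\<close>
  have "n1 \<bullet> d = \<beta>1 + w * (n1 \<bullet> c - \<beta>1)"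
    using v1 by (simp add: uvw(1) w inner_add_right algebra_simps)
  then have "w * (n1 \<bullet> c - \<beta>1) < 0" using v1 by simp
  then have w0: "w > 0" using v1(3) by (simp add: mult_less_0_iff)
  have "n2 \<bullet> d = \<beta>2 + u * (n2 \<bullet> a - \<beta>2)"
    using v2 by (simp add: uvw(1) w inner_add_right algebra_simps)
  then have "u * (n2 \<bullet> a - \<beta>2) < 0" using v2 by simp
  then have u0: "u > 0" using v2(3) by (simp add: mult_less_0_iff)
  have "n3 \<bullet> d = \<beta>3 + v * (n3 \<bullet> b - \<beta>3)"
    using v3 by (simp add: uvw(1) w inner_add_right algebra_simps)
  then have "v * (n3 \<bullet> b - \<beta>3) < 0" using v3 by simp
  then have v0: "v > 0" using v3(3) by (simp add: mult_less_0_iff)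
  have "d \<in> convex hull {a, b, c}"
    unfolding convex_hull_3 using uvw u0 v0 w0 less_imp_le by blast
  moreover have "convex (F - {d})" using d(1) by (simp add: verts_def extreme_point_of_stillconvex face_of_imp_convex[OF facets_face[OF F]])
  then have "convex hull {a, b, c} \<subseteq> F - {d}"
    using abcF' d by (intro hull_minimal) auto
  ultimately show False by blast
qed

text \<open>An order-theoretic description of facets, which makes them recognisable under an
  isomorphism of face lattices.\<close>

lemma facet_maximal: "F \<in> facets P \<longleftrightarrow> F face_of P \<and> F \<noteq> P \<and> (\<forall>G. G face_of P \<longrightarrow> F \<subseteq> G \<longrightarrow> G = F \<or> G = P)"
  (is "?L \<longleftrightarrow> ?R")
proof
  assume F: ?L
  have "G = F" if "G face_of P" "F \<subseteq> G" "G \<noteq> P" for G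
    using face_of_aff_dim_eq[OF cvx facets_face[OF F] that(1,2)] face_of_aff_dim_lt[OF cvx that(1,3)]
      facet_dim[OF F] dim3 by auto
  then show ?R using F facets_face facet_dim[OF F] dim3 by auto
next
  assume F: ?R
  show ?L
  proof (cases "F = {}")
    \<comment> \<open>The empty face is not maximal, as a vertex lies strictly between it and
      \<open>P\<close>.\<close>
    case True
    obtain v where "v \<in> verts P" using card_verts_aff_dim[OF pt] dim3 by fastforce
    then have "{v} face_of P" by (simp add: singleton_face)
    moreover have "{v} \<noteq> P" using dim3 by auto
    ultimately show ?thesis using F True by blast
  next
    case False
    then obtain G where "G facet_of P" "F \<subseteq> G"
      using face_of_polyhedron_subset_facet[OF ph] F by blast
    moreover from this have "G \<noteq> P" by auto
    ultimately show ?thesis using F facet_of_imp_face_of by (fastforce simp: facets_def)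
  qed
qed

lemma finite_facet_verts_set: "finite (facet_verts P)"
  by (simp add: facet_verts_def finite_facets[OF pt])

lemma card_facet_verts: "card (facet_verts P) = card (facets P)"
  unfolding facet_verts_def by (rule card_image[OF inj_on_verts_facets[OF pt]])

lemma facet_verts_subset: "S \<in> facet_verts P \<Longrightarrow> S \<subseteq> verts P"
  unfolding facet_verts_def using verts_face_subset facets_face by blast

lemma euler_verts: "(\<Sum>S\<in>facet_verts P. card S) + 4 = 2 * card (facet_verts P) + 2 * card (verts P)"
  using euler card_facet_verts unfolding facet_verts_def
  by (simp add: sum.reindex[OF inj_on_verts_facets[OF pt]])

text \<open>A proper nonempty face is the intersection of the facets that contain it. Hence the
  vertex sets of the facets determine the whole face lattice.\<close>

lemma face_verts_eq:
  "verts ` {F. F face_of P} = {verts P, {}} \<union> {\<Inter>\<G> | \<G>. \<G> \<noteq> {} \<and> \<G> \<subseteq> facet_verts P}" (is "?L = ?R")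
proof (intro equalityI subsetI)
  fix S assume "S \<in> ?L"
  then obtain F where F: "F face_of P" "S = verts F" by blast
  show "S \<in> ?R"
  proof (cases "F = {} \<or> F = P")
    case True then show ?thesis using F by (auto simp: verts_def)
  next
    case False
    let ?N = "{G. G facet_of P \<and> F \<subseteq> G}"
    have eq: "F = \<Inter>?N" using face_of_polyhedron[OF ph F(1)] False by blast
    obtain G where "G \<in> ?N" using face_of_polyhedron_subset_facet[OF ph F(1)] False by blast
    have "verts F = verts P \<inter> \<Inter>?N" using verts_face[OF F(1)] eq by blast
    also have "\<dots> = \<Inter>(verts ` ?N)"
      using \<open>G \<in> ?N\<close> verts_face[OF facet_of_imp_face_of] by blast
    finally have "S = \<Inter>(verts ` ?N)" using F by blast
    moreover have "verts ` ?N \<subseteq> facet_verts P" "verts ` ?N \<noteq> {}"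
      using \<open>G \<in> ?N\<close> by (auto simp: facet_verts_def facets_def)
    ultimately show ?thesis by blast
  qed
next
  fix S assume "S \<in> ?R"
  then consider "S = verts P" | "S = {}" | \<G> where "\<G> \<noteq> {}" "\<G> \<subseteq> facet_verts P" "S = \<Inter>\<G>" by blast
  then show "S \<in> ?L"
  proof cases
    case 1 then show ?thesis using face_of_refl[OF cvx] by blast
  next
    case 2
    then have "S = verts {}" by (simp add: verts_def)
    then show ?thesis by blast
  next
    case 3
    then obtain N where N: "N \<subseteq> facets P" "\<G> = verts ` N" unfolding facet_verts_def by (meson subset_image_iff)
    then have ne: "N \<noteq> {}" using 3 by blast
    have f: "\<Inter>N face_of P" using ne N facets_face by (intro face_of_Inter) auto
    have "verts (\<Inter>N) = verts P \<inter> \<Inter>N" by (rule verts_face[OF f])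
    also have "\<dots> = \<Inter>(verts ` N)" using ne N(1) verts_face[OF facets_face] by blast
    finally have "S = verts (\<Inter>N)" using 3 N by simp
    then show ?thesis using f by blast
  qed
qed

end

section \<open>Combinatorial equivalence as a bijection of vertices\<close>

lemma comb_equiv_of_bij:
  assumes P: "polyhedron3 P" and Q: "polyhedron3 Q" and \<sigma>: "bij_betw \<sigma> (verts P) (verts Q)"
    and im: "(`) \<sigma> ` facet_verts P = facet_verts Q"
  shows "comb_equiv P Q"
proof -
  interpret P: poly3 P using P by unfold_locales
  interpret Q: poly3 Q using Q by unfold_locales
  let ?L = "verts ` {F. F face_of P}" and ?M = "verts ` {F. F face_of Q}"
  have inj: "inj_on \<sigma> (verts P)" and sV: "\<sigma> ` verts P = verts Q" using \<sigma> by (auto simp: bij_betw_def)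
  \<comment> \<open>Injectivity on the vertices lets images commute with intersections, so
    intersections of facets go to intersections of facets.\<close>
  have Int: "\<sigma> ` \<Inter>\<G> = \<Inter>((`) \<sigma> ` \<G>)" if "\<G> \<noteq> {}" "\<G> \<subseteq> facet_verts P" for \<G>
  proof (intro equalityI subsetI)
    fix y assume y: "y \<in> \<Inter>((`) \<sigma> ` \<G>)"
    obtain G0 where G0: "G0 \<in> \<G>" using \<open>\<G> \<noteq> {}\<close> by blast
    then obtain v where v: "v \<in> G0" "y = \<sigma> v" using y by blast
    have "v \<in> G" if G: "G \<in> \<G>" for G
    proof -
      obtain w where w: "w \<in> G" "y = \<sigma> w" using y G by blast
      have "w \<in> verts P" "v \<in> verts P"
        using w v G G0 P.facet_verts_subset \<open>\<G> \<subseteq> facet_verts P\<close> by blast+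
      then show ?thesis using inj_onD[OF inj, of v w] w v by simp
    qed
    then show "y \<in> \<sigma> ` \<Inter>\<G>" using v by blast
  qed blast
  have LM: "(`) \<sigma> ` ?L = ?M"
  proof -
    have "(`) \<sigma> ` {\<Inter>\<G> | \<G>. \<G> \<noteq> {} \<and> \<G> \<subseteq> facet_verts P} = {\<Inter>\<G> | \<G>. \<G> \<noteq> {} \<and> \<G> \<subseteq> facet_verts Q}"
      (is "?A = ?B")
    proof (intro equalityI subsetI)
      fix S assume "S \<in> ?A"
      then obtain \<G> where G: "\<G> \<noteq> {}" "\<G> \<subseteq> facet_verts P" "S = \<sigma> ` \<Inter>\<G>" by blast
      then have "S = \<Inter>((`) \<sigma> ` \<G>)" using Int by blast
      moreover have "(`) \<sigma> ` \<G> \<subseteq> facet_verts Q" using G im by blast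
      ultimately show "S \<in> ?B" using G by blast
    next
      fix S assume "S \<in> ?B"
      then obtain \<G> where G: "\<G> \<noteq> {}" "\<G> \<subseteq> facet_verts Q" "S = \<Inter>\<G>" by blast
      then obtain \<H> where H: "\<H> \<subseteq> facet_verts P" "\<G> = (`) \<sigma> ` \<H>" using im by (metis subset_image_iff)
      then have "S = \<sigma> ` \<Inter>\<H>" using Int[of \<H>] G by blast
      then show "S \<in> ?A" using H G by blast
    qed
    then show ?thesis unfolding P.face_verts_eq Q.face_verts_eq image_Un using sV by simp
  qed
  have Lsub: "S \<subseteq> verts P" if "S \<in> ?L" for S using that verts_face_subset by blast
  \<comment> \<open>The image of a face is rebuilt as the hull of its moved vertices;
    \<open>LM\<close> guarantees that this is a face again.\<close>
  define f where "f F = convex hull (\<sigma> ` verts F)" for F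
  have f: "f F face_of Q \<and> verts (f F) = \<sigma> ` verts F" if F: "F face_of P" for F
  proof -
    obtain G where G: "G face_of Q" "verts G = \<sigma> ` verts F" using LM F by (metis (no_types, lifting) image_iff mem_Collect_eq)
    then have "f F = G" using face_conv_verts[OF Q.pt G(1)] by (simp add: f_def)
    then show ?thesis using G by simp
  qed
  have sub: "F1 \<subseteq> F2 \<longleftrightarrow> f F1 \<subseteq> f F2" if F: "F1 face_of P" "F2 face_of P" for F1 F2
  proof -
    have "F1 \<subseteq> F2 \<longleftrightarrow> verts F1 \<subseteq> verts F2" by (rule face_subset_iff_verts[OF P.pt F])
    also have "\<dots> \<longleftrightarrow> \<sigma> ` verts F1 \<subseteq> \<sigma> ` verts F2"
      using inj_on_image_subset_iff[OF inj] verts_face_subset[OF F(1)] verts_face_subset[OF F(2)] by simp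
    also have "\<dots> \<longleftrightarrow> f F1 \<subseteq> f F2"
      using face_subset_iff_verts[OF Q.pt, of "f F1" "f F2"] f F by simp
    finally show ?thesis .
  qed
  have "bij_betw f {F. F face_of P} {G. G face_of Q}"
  proof (rule bij_betw_imageI)
    show "inj_on f {F. F face_of P}" by (rule inj_onI) (metis mem_Collect_eq order_antisym order_refl sub)
    show "f ` {F. F face_of P} = {G. G face_of Q}"
    proof (intro equalityI subsetI)
      fix G assume "G \<in> {G. G face_of Q}"
      then have G: "G face_of Q" by simp
      then have "verts G \<in> (`) \<sigma> ` ?L" using LM by blast
      then obtain F where F: "F face_of P" "verts G = \<sigma> ` verts F" by blast
      then have "G = f F" using face_conv_verts[OF Q.pt G] by (simp add: f_def)
      then show "G \<in> f ` {F. F face_of P}" using F by blast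
    qed (use f in blast)
  qed
  then show ?thesis unfolding comb_equiv_def using sub by blast
qed

text \<open>The counterpart of \<open>facet_maximal\<close> at the bottom of the lattice: vertices
  are recognisable as minimal nonempty faces.\<close>

lemma singleton_face_minimal:
  fixes P :: "pt3 set"
  assumes "polytope P" "F face_of P" "F \<noteq> {}"
  shows "(\<exists>v. F = {v}) \<longleftrightarrow> (\<forall>G. G face_of P \<longrightarrow> G \<subseteq> F \<longrightarrow> G = {} \<or> G = F)"
proof
  assume R: "\<forall>G. G face_of P \<longrightarrow> G \<subseteq> F \<longrightarrow> G = {} \<or> G = F"
  have "verts F \<noteq> {}" using face_conv_verts[OF assms(1,2)] assms(3) by (metis convex_hull_eq_empty)
  then obtain v where v: "v \<in> verts F" by blast
  then have "{v} face_of P" "{v} \<subseteq> F"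
    using assms(2) verts_face_subset verts_subset singleton_face by blast+
  then show "\<exists>v. F = {v}" using R by blast
qed blast

text \<open>An isomorphism of face lattices preserves bottom and top, hence also atoms and coatoms.
  Its action on the atoms is \<open>\<sigma>\<close>, and the vertices of a face are the atoms below
  it.\<close>

lemma bij_of_comb_equiv:
  assumes P: "polyhedron3 P" and Q: "polyhedron3 Q" and "comb_equiv P Q"
  obtains \<sigma> where "bij_betw \<sigma> (verts P) (verts Q)" "(`) \<sigma> ` facet_verts P = facet_verts Q"
proof -
  interpret P: poly3 P using P by unfold_locales
  interpret Q: poly3 Q using Q by unfold_locales
  obtain f where bij: "bij_betw f {F. F face_of P} {G. G face_of Q}" and
    mono: "\<And>F1 F2. F1 face_of P \<Longrightarrow> F2 face_of P \<Longrightarrow> F1 \<subseteq> F2 \<longleftrightarrow> f F1 \<subseteq> f F2"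
    using assms(3) unfolding comb_equiv_def by blast
  have ff: "f F face_of Q" if "F face_of P" for F using bij_betwE[OF bij] that by simp
  have surj: "\<exists>F. F face_of P \<and> f F = G" if "G face_of Q" for G
    using bij_betw_imp_surj_on[OF bij] that by (metis (no_types, lifting) image_iff mem_Collect_eq)
  have eqf: "f F1 = f F2 \<longleftrightarrow> F1 = F2" if "F1 face_of P" "F2 face_of P" for F1 F2
    using mono[OF that] mono[OF that(2,1)] by auto
  have f0: "f {} = {}"
  proof -
    obtain F where "F face_of P" "f F = {}" using surj[OF empty_face_of] by blast
    then show ?thesis using mono[of "{}" F] by simp
  qed
  have fP: "f P = Q"
  proof -
    obtain F where F: "F face_of P" "f F = Q" using surj[OF face_of_refl[OF Q.cvx]] by blast
    then have "Q \<subseteq> f P" using mono[of F P] face_of_refl[OF P.cvx] face_of_imp_subset by blast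
    then show ?thesis using ff[OF face_of_refl[OF P.cvx]] face_of_imp_subset by blast
  qed
  have sing: "(\<exists>v. F = {v}) \<longleftrightarrow> (\<exists>w. f F = {w})" if F: "F face_of P" for F
  proof (cases "F = {}")
    case True then show ?thesis using f0 by auto
  next
    case False
    then have ne: "f F \<noteq> {}" using eqf[OF F empty_face_of] f0 by auto
    have "(\<forall>G. G face_of P \<longrightarrow> G \<subseteq> F \<longrightarrow> G = {} \<or> G = F)
        \<longleftrightarrow> (\<forall>G. G face_of Q \<longrightarrow> G \<subseteq> f F \<longrightarrow> G = {} \<or> G = f F)" (is "?A \<longleftrightarrow> ?B")
    proof
      assume A: ?A
      show ?B
      proof (intro allI impI)
        fix G assume "G face_of Q" "G \<subseteq> f F"
        then obtain G' where "G' face_of P" "f G' = G" using surj by blast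
        then show "G = {} \<or> G = f F" using A mono[of G' F] F f0 \<open>G \<subseteq> f F\<close> by blast
      qed
    next
      assume B: ?B
      show ?A
      proof (intro allI impI)
        fix G assume G: "G face_of P" "G \<subseteq> F"
        then have "f G = {} \<or> f G = f F" using B ff mono[OF G(1) F] by blast
        then show "G = {} \<or> G = F" using eqf[OF G(1) empty_face_of] eqf[OF G(1) F] f0 by auto
      qed
    qed
    then show ?thesis
      using singleton_face_minimal[OF P.pt F False] singleton_face_minimal[OF Q.pt ff[OF F] ne] by simp
  qed
  have ex: "\<exists>w. f {v} = {w}" if "v \<in> verts P" for v
    using sing[of "{v}"] that singleton_face by blast
  define \<sigma> where "\<sigma> v = the_elem (f {v})" for v
  have s: "f {v} = {\<sigma> v}" if "v \<in> verts P" for v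
  proof -
    obtain w where "f {v} = {w}" using ex[OF \<open>v \<in> verts P\<close>] by blast
    then show ?thesis by (simp add: \<sigma>_def)
  qed
  have sv: "\<sigma> v \<in> verts Q" if "v \<in> verts P" for v
    using s[OF that] ff[of "{v}"] that by (simp add: singleton_face)
  have img: "\<sigma> ` verts F = verts (f F)" if F: "F face_of P" for F
  proof (intro equalityI subsetI)
    fix w assume "w \<in> \<sigma> ` verts F"
    then obtain v where v: "v \<in> verts F" "w = \<sigma> v" by blast
    then have vP: "v \<in> verts P" "v \<in> F" using verts_face[OF F] by auto
    then have "f {v} \<subseteq> f F" using mono[of "{v}" F] F by (simp add: singleton_face)
    then show "w \<in> verts (f F)" using s[OF vP(1)] sv[OF vP(1)] v verts_face[OF ff[OF F]] by auto
  next
    fix w assume w: "w \<in> verts (f F)"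
    then have wQ: "{w} face_of Q" "w \<in> f F"
      using verts_face[OF ff[OF F]] by (auto simp: singleton_face)
    then obtain G where G: "G face_of P" "f G = {w}" using surj by blast
    then obtain v where v: "G = {v}" using sing[OF G(1)] by blast
    then have vP: "v \<in> verts P" using G by (simp add: singleton_face)
    have "w = \<sigma> v" using s[OF vP] G v by simp
    moreover have "{v} \<subseteq> F" using mono[of "{v}" F] G v F wQ by simp
    then have "v \<in> verts F" using vP verts_face[OF F] by simp
    ultimately show "w \<in> \<sigma> ` verts F" by blast
  qed
  have "inj_on \<sigma> (verts P)"
  proof (rule inj_onI)
    fix v w assume vw: "v \<in> verts P" "w \<in> verts P" "\<sigma> v = \<sigma> w"
    then have "f {v} = f {w}" using s by simp
    then show "v = w" using eqf[of "{v}" "{w}"] vw by (simp add: singleton_face)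
  qed
  moreover have "\<sigma> ` verts P = verts Q" using img[OF face_of_refl[OF P.cvx]] fP by simp
  ultimately have b: "bij_betw \<sigma> (verts P) (verts Q)" by (simp add: bij_betw_def)
  have fac: "F \<in> facets P \<longleftrightarrow> f F \<in> facets Q" if F: "F face_of P" for F
  proof -
    have "(\<forall>G. G face_of P \<longrightarrow> F \<subseteq> G \<longrightarrow> G = F \<or> G = P)
        \<longleftrightarrow> (\<forall>G. G face_of Q \<longrightarrow> f F \<subseteq> G \<longrightarrow> G = f F \<or> G = Q)" (is "?A \<longleftrightarrow> ?B")
    proof
      assume A: ?A
      show ?B
      proof (intro allI impI)
        fix G assume "G face_of Q" "f F \<subseteq> G"
        then obtain G' where "G' face_of P" "f G' = G" using surj by blast
        then show "G = f F \<or> G = Q" using A mono[of F G'] F fP \<open>f F \<subseteq> G\<close> by blast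
      qed
    next
      assume B: ?B
      show ?A
      proof (intro allI impI)
        fix G assume G: "G face_of P" "F \<subseteq> G"
        then have "f G = f F \<or> f G = Q" using B ff mono[OF F G(1)] by blast
        then show "G = F \<or> G = P" using eqf[OF G(1) F] eqf[OF G(1) face_of_refl[OF P.cvx]] fP by auto
      qed
    qed
    moreover have "F \<noteq> P \<longleftrightarrow> f F \<noteq> Q" using eqf[OF F face_of_refl[OF P.cvx]] fP by auto
    ultimately show ?thesis using F ff[OF F] unfolding P.facet_maximal Q.facet_maximal by simp
  qed
  have "(`) \<sigma> ` facet_verts P = facet_verts Q"
  proof (intro equalityI subsetI)
    fix S assume "S \<in> (`) \<sigma> ` facet_verts P"
    then obtain F where F: "F \<in> facets P" "S = \<sigma> ` verts F" unfolding facet_verts_def by blast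
    then show "S \<in> facet_verts Q"
      using img[OF facets_face[OF F(1)]] fac[OF facets_face[OF F(1)]] unfolding facet_verts_def by blast
  next
    fix S assume "S \<in> facet_verts Q"
    then obtain G where G: "G \<in> facets Q" "S = verts G" unfolding facet_verts_def by blast
    then obtain F where F: "F face_of P" "f F = G" using surj[OF facets_face[OF G(1)]] by blast
    then have "F \<in> facets P" using fac G by blast
    then show "S \<in> (`) \<sigma> ` facet_verts P" using img[OF F(1)] F G unfolding facet_verts_def by blast
  qed
  with b show thesis by (rule that)
qed

text \<open>By Euler's formula a list of supporting planes with the right total number of incidences already
  contains all facets.\<close>

lemma facet_certificate:
  fixes V :: "pt3 set" and \<S> :: "pt3 set set"
  assumes fin: "finite V" and sub: "\<And>S. S \<in> \<S> \<Longrightarrow> S \<subset> V" and c3: "\<And>S. S \<in> \<S> \<Longrightarrow> card S \<ge> 3"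
    and pl: "\<And>S. S \<in> \<S> \<Longrightarrow> \<exists>a b. \<forall>v\<in>V. a \<bullet> v \<le> b \<and> (a \<bullet> v = b \<longleftrightarrow> v \<in> S)"
    and ne: "\<S> \<noteq> {}" and cov: "\<And>v. v \<in> V \<Longrightarrow> \<exists>S\<in>\<S>. v \<in> S"
    and sep: "\<And>v w. v \<in> V \<Longrightarrow> w \<in> V \<Longrightarrow> v \<noteq> w \<Longrightarrow> \<exists>S\<in>\<S>. v \<in> S \<and> w \<notin> S"
    and eul: "(\<Sum>S\<in>\<S>. card S) + 4 \<ge> 2 * card \<S> + 2 * card V"
  shows "polyhedron3 (convex hull V)" "verts (convex hull V) = V" "facet_verts (convex hull V) = \<S>"
proof -
  let ?P = "convex hull V"
  have pt: "polytope ?P" using fin by (rule polytope_convex_hull)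
  have VV: "verts ?P \<subseteq> V" by (auto simp: verts_def dest: extreme_point_of_convex_hull)
  have exF: "\<exists>F. F face_of ?P \<and> F \<inter> V = S" if hS: "S \<in> \<S>" for S
  proof -
    obtain a b where ab: "\<forall>v\<in>V. a \<bullet> v \<le> b \<and> (a \<bullet> v = b \<longleftrightarrow> v \<in> S)" using pl[OF hS] by blast
    have "?P \<subseteq> {x. a \<bullet> x \<le> b}" by (rule hull_minimal) (use ab in \<open>auto simp: convex_halfspace_le\<close>)
    then have "?P \<inter> {x. a \<bullet> x = b} face_of ?P"
      by (intro face_of_Int_supporting_hyperplane_le) auto
    moreover have "?P \<inter> {x. a \<bullet> x = b} \<inter> V = S" using ab sub[OF hS] hull_subset[of V convex] by blast
    ultimately show ?thesis by blast
  qed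
  then obtain \<Phi> where \<Phi>: "\<And>S. S \<in> \<S> \<Longrightarrow> \<Phi> S face_of ?P \<and> \<Phi> S \<inter> V = S" by metis
  have "V \<subseteq> verts ?P"
  proof
    fix v assume v: "v \<in> V"
    let ?N = "{S \<in> \<S>. v \<in> S}"
    \<comment> \<open>The listed faces through \<open>v\<close> meet in a face that has no vertex
      besides \<open>v\<close> by \<open>sep\<close>; since a face is the hull of its vertices,
      \<open>v\<close> is one.\<close>
    define K where "K = \<Inter>(\<Phi> ` ?N)"
    have K: "K face_of ?P" unfolding K_def using cov[OF v] \<Phi> by (intro face_of_Inter) auto
    have vK: "v \<in> K" unfolding K_def using \<Phi> by auto
    have "verts K \<subseteq> {v}"
    proof
      fix w assume "w \<in> verts K"
      then have w: "w \<in> V" "w \<in> K" using VV verts_face[OF K] by auto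
      show "w \<in> {v}"
      proof (rule ccontr)
        assume "w \<notin> {v}"
        then obtain S where "S \<in> \<S>" "v \<in> S" "w \<notin> S" using sep[OF v w(1)] by blast
        then show False using w \<Phi>[of S] unfolding K_def by blast
      qed
    qed
    moreover have "K = convex hull (verts K)" by (rule face_conv_verts[OF pt K])
    then have "verts K \<noteq> {}" using vK by (metis convex_hull_eq_empty empty_iff)
    ultimately have "v \<in> verts K" by blast
    then show "v \<in> verts ?P" using verts_face[OF K] by blast
  qed
  with VV show V: "verts ?P = V" by blast
  have vF: "verts (\<Phi> S) = S" if "S \<in> \<S>" for S using verts_face \<Phi>[OF that] V by blast
  have dF: "aff_dim (\<Phi> S) \<ge> 2" if "S \<in> \<S>" for S
    using card_verts_le_2[OF face_of_polytope_polytope[OF pt], of "\<Phi> S"] \<Phi>[OF that] vF[OF that] c3[OF that]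
    by fastforce
  have lt: "aff_dim (\<Phi> S) < aff_dim ?P" if "S \<in> \<S>" for S
  proof (rule face_of_aff_dim_lt)
    show "\<Phi> S \<noteq> ?P" using vF[OF that] V sub[OF that] by auto
  qed (use \<Phi>[OF that] in auto)
  \<comment> \<open>A proper face of dimension at least 2 leaves only dimension 3 for the
    hull.\<close>
  have "aff_dim ?P \<le> 3" using aff_dim_le_DIM[of ?P] by simp
  moreover obtain S0 where "S0 \<in> \<S>" using ne by blast
  ultimately have d3: "aff_dim ?P = 3" using dF[of S0] lt[of S0] by simp
  then show P3: "polyhedron3 ?P" using pt by (simp add: polyhedron3_def)
  interpret poly3 ?P using P3 by unfold_locales
  have sub': "\<S> \<subseteq> facet_verts ?P"
  proof
    fix S assume S: "S \<in> \<S>"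
    then have "\<Phi> S \<in> facets ?P" using \<Phi>[OF S] dF[OF S] lt[OF S] d3 by (intro facetI) auto
    then show "S \<in> facet_verts ?P" unfolding facet_verts_def using vF[OF S] by blast
  qed
  have finF: "finite (facet_verts ?P)" by (rule finite_facet_verts_set)
  \<comment> \<open>Euler's relation grants the missing facets at most two incidences each on
    average, while every facet has at least three vertices.\<close>
  let ?X = "facet_verts ?P - \<S>"
  have "(\<Sum>S\<in>facet_verts ?P. card S) = (\<Sum>S\<in>\<S>. card S) + (\<Sum>S\<in>?X. card S)"
    using sum.subset_diff[OF sub' finF, of card] by simp
  moreover have "card (facet_verts ?P) = card \<S> + card ?X"
    using sub' finF by (simp add: card_Diff_subset finite_subset card_mono)
  moreover have "(\<Sum>S\<in>?X. card S) \<ge> card ?X * 3"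
  proof -
    have "card S \<ge> 3" if "S \<in> ?X" for S using that facet_card_ge3 unfolding facet_verts_def by blast
    then show ?thesis using sum_bounded_below[of ?X 3 card] by simp
  qed
  ultimately have "card ?X = 0" using euler_verts eul V by simp
  then have "?X = {}" using finF by simp
  then show "facet_verts ?P = \<S>" using sub' by blast
qed

section \<open>Exhaustive search for facet systems\<close>

definition has_matrix :: "'a set \<Rightarrow> 'a set set \<Rightarrow> bool list list \<Rightarrow> bool" where
  "has_matrix V \<F> R \<longleftrightarrow> (\<exists>vs fs. distinct vs \<and> set vs = V \<and> distinct fs \<and> set fs = \<F> \<and>
     R = map (\<lambda>v. map (\<lambda>F. v \<in> F) fs) vs)"

text \<open>State of a vertex with respect to a chosen facet: \<open>SO\<close> means off the facet;
  \<open>SA\<close>, \<open>SB\<close>, \<open>SC\<close> mean on it, with none, one or both of the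
  two neighbours of the facet at this vertex already chosen.\<close>

datatype slot = SO | SA | SB | SC
text \<open>What the facet under construction shares so far with an earlier one: no vertex, a single
  one, two (an edge), or, for \<open>TX\<close>, a single one that is saturated there and excludes a
  second.\<close>

datatype tally = TN | TS | TD | TX
text \<open>A class of interchangeable vertices: their common slots, newest facet first, and their
  number.\<close>

type_synonym cell = "slot list \<times> nat"

text \<open>\<open>None\<close> rejects the choice of \<open>m\<close> vertices: it would produce
  three common vertices, or two of which one is saturated.\<close>

fun tally1 :: "slot \<Rightarrow> nat \<Rightarrow> tally \<Rightarrow> tally option" where
  "tally1 SO m t = Some t"
| "tally1 SC (Suc 0) TN = Some TX"
| "tally1 SA (Suc 0) TN = Some TS"
| "tally1 SA (Suc (Suc 0)) TN = Some TD"
| "tally1 SA (Suc 0) TS = Some TD"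
| "tally1 SB (Suc 0) TN = Some TS"
| "tally1 SB (Suc (Suc 0)) TN = Some TD"
| "tally1 SB (Suc 0) TS = Some TD"
| "tally1 _ _ _ = None"

fun ocons :: "'a option \<Rightarrow> 'a list option \<Rightarrow> 'a list option" where
  "ocons (Some x) (Some xs) = Some (x # xs)"
| "ocons None xs = None"
| "ocons (Some x) None = None"

fun tallys :: "slot list \<Rightarrow> nat \<Rightarrow> tally list \<Rightarrow> tally list option" where
  "tallys (s # sl) m (t # ts) = ocons (tally1 s m t) (tallys sl m ts)"
| "tallys [] m ts = Some []"
| "tallys (s # sl) m [] = Some []"

text \<open>A shared edge supplies the earlier facet with one more neighbour at each common
  vertex.\<close>

primrec bump1 :: "tally \<Rightarrow> slot \<Rightarrow> slot" where
  "bump1 TD s = (case s of SO \<Rightarrow> SO | SA \<Rightarrow> SB | SB \<Rightarrow> SC | SC \<Rightarrow> SC)"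
| "bump1 TN s = s" | "bump1 TS s = s" | "bump1 TX s = s"

fun bump :: "slot list \<Rightarrow> tally list \<Rightarrow> slot list" where
  "bump (s # sl) (t # ts) = bump1 t s # bump sl ts"
| "bump [] ts = []"
| "bump (s # sl) [] = []"

primrec up :: "slot \<Rightarrow> slot option" where
  "up SA = Some SB" | "up SB = Some SC" | "up SC = None" | "up SO = None"

text \<open>Computes the slot of a vertex in the new facet itself: it advances once for every
  earlier facet through the vertex that shares an edge with the new one, and a third such facet is a
  contradiction.\<close>

fun hcount :: "slot list \<Rightarrow> tally list \<Rightarrow> slot option \<Rightarrow> slot option" where
  "hcount (s # sl) (TN # ts) h = hcount sl ts h"
| "hcount (s # sl) (TS # ts) h = hcount sl ts h"
| "hcount (s # sl) (TX # ts) h = hcount sl ts h"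
| "hcount (s # sl) (TD # ts) h = hcount sl ts (case s of SO \<Rightarrow> h | _ \<Rightarrow> Option.bind h up)"
| "hcount [] ts h = h"
| "hcount (s # sl) [] h = h"

text \<open>Keeps the vertices of a class that the new facet leaves out, and drops the class when
  none is left.\<close>

fun rest :: "slot list \<Rightarrow> nat \<Rightarrow> nat \<Rightarrow> cell list \<Rightarrow> cell list" where
  "rest sl (Suc n) (Suc m) acc = rest sl n m acc"
| "rest sl 0 m acc = acc"
| "rest sl (Suc n) 0 acc = (SO # sl, Suc n) # acc"

fun upd :: "(cell \<times> nat) list \<Rightarrow> tally list \<Rightarrow> cell list \<Rightarrow> cell list option" where
  "upd [] ts acc = Some acc"
| "upd (((sl, n), 0) # vis) ts acc = upd vis ts ((SO # sl, n) # acc)"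
| "upd (((sl, n), Suc m) # vis) ts acc = (case hcount sl ts (Some SA) of None \<Rightarrow> None
     | Some h \<Rightarrow> upd vis ts ((h # bump sl ts, Suc m) # rest sl n (Suc m) acc))"

primrec tdnth :: "nat \<Rightarrow> tally list \<Rightarrow> bool" where
  "tdnth n [] = True"
| "tdnth n (t # ts) = (case n of 0 \<Rightarrow> t = TD | Suc n' \<Rightarrow> tdnth n' ts)"

fun tdj :: "nat option \<Rightarrow> tally list \<Rightarrow> bool" where
  "tdj None ts = True" | "tdj (Some j) ts = tdnth j ts"

fun eres :: "nat \<Rightarrow> nat \<Rightarrow> nat option" where
  "eres 0 0 = Some 0"
| "eres (Suc d) 0 = Some d"
| "eres (Suc d) (Suc 0) = Some (Suc d)"
| "eres _ _ = None"

text \<open>A largest facet is placed first, so every later one has at most four vertices.\<close>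

fun budget :: "nat \<Rightarrow> nat" where
  "budget 0 = Suc (Suc (Suc 0))" | "budget (Suc e) = Suc (Suc (Suc (Suc 0)))"

text \<open>\<open>ND\<close> is a partial system with \<open>k\<close> facets missing.
  \<open>GN\<close> and \<open>GM\<close> are states in the construction of one more facet:
  \<open>vis\<close> records how many vertices were taken from each visited class, \<open>b\<close>
  how many may still be taken, \<open>j\<close> the position of an earlier facet with which an edge
  must be shared. In \<open>GM\<close> at least \<open>m\<close> vertices come from the current
  class, and \<open>r\<close> bounds the alternatives left.\<close>

datatype entry = ND nat nat "cell list"
  | GN nat nat "nat option" "cell list" "tally list" nat "(cell \<times> nat) list"
  | GM nat nat "nat option" "slot list" nat nat nat "cell list" "tally list" nat "(cell \<times> nat) list"

fun find_slot :: "slot \<Rightarrow> slot list \<Rightarrow> nat \<Rightarrow> nat option" where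
  "find_slot t [] n = None"
| "find_slot t (s # sl) n = (if s = t then Some n else find_slot t sl (Suc n))"

fun target :: "slot \<Rightarrow> cell list \<Rightarrow> cell list \<Rightarrow> (nat \<times> slot list \<times> nat \<times> cell list) option" where
  "target t [] acc = None"
| "target t ((sl, n) # cs) acc = (case find_slot t sl 0 of None \<Rightarrow> target t cs ((sl, n) # acc)
     | Some j \<Rightarrow> Some (j, sl, n, acc @ cs))"

definition emit :: "nat \<Rightarrow> nat \<Rightarrow> nat option \<Rightarrow> cell list \<Rightarrow> tally list \<Rightarrow> nat \<Rightarrow> (cell \<times> nat) list \<Rightarrow> entry list" where
  "emit k e j cs ts b vis = (case eres e b of None \<Rightarrow> [] | Some e' \<Rightarrow> if tdj j ts then
     (case upd vis ts (map (\<lambda>(sl, n). (SO # sl, n)) cs) of None \<Rightarrow> [] | Some cs' \<Rightarrow> [ND k e' cs']) else [])"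

fun no_tallies :: "cell list \<Rightarrow> tally list" where
  "no_tallies [] = []" | "no_tallies ((sl, n) # cs) = map (\<lambda>_. TN) sl"

text \<open>An open slot is filled by some missing facet, so only facets through a vertex of that
  class that share an edge with the facet in question are tried; the start of \<open>GM\<close> at
  one vertex enforces the first condition, \<open>Some j\<close> the second. Slots that miss one
  neighbour are preferred to those that miss two, as they determine the facet uniquely.\<close>

fun expand :: "entry \<Rightarrow> entry list" where
  "expand (ND 0 e cs) = []"
| "expand (ND (Suc k) e cs) = (case target SB cs [] of
      Some (j, sl, n, cs') \<Rightarrow> [GM k e (Some j) sl n n (Suc 0) cs' (map (\<lambda>_. TN) sl) (budget e) []]
    | None \<Rightarrow> (case target SA cs [] of
        Some (j, sl, n, cs') \<Rightarrow> [GM k e (Some j) sl n n (Suc 0) cs' (map (\<lambda>_. TN) sl) (budget e) []]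
      | None \<Rightarrow> [GN k e None cs (no_tallies cs) (budget e) []]))"
| "expand (GN k e j [] ts b vis) = emit k e j [] ts b vis"
| "expand (GN k e j (c # cs) ts 0 vis) = emit k e j (c # cs) ts 0 vis"
| "expand (GN k e j ((sl, n) # cs) ts (Suc b) vis) =
     [GN k e j cs ts (Suc b) (((sl, n), 0) # vis), GM k e j sl n n (Suc 0) cs ts (Suc b) vis]"
| "expand (GM k e j sl n 0 m cs ts b vis) = []"
| "expand (GM k e j sl n (Suc r) m cs ts 0 vis) = []"
| "expand (GM k e j sl n (Suc r) m cs ts (Suc b) vis) = (case tallys sl m ts of
      None \<Rightarrow> [GM k e j sl n r (Suc m) cs ts b vis]
    | Some ts' \<Rightarrow> [GN k e j cs ts' b (((sl, n), m) # vis), GM k e j sl n r (Suc m) cs ts b vis])"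

definition pat :: "slot list \<Rightarrow> bool list" where "pat sl = map (\<lambda>s. s \<noteq> SO) sl"

fun take_at :: "nat \<Rightarrow> 'a \<Rightarrow> 'a list \<Rightarrow> 'a \<times> 'a list" where
  "take_at 0 x xs = (x, xs)"
| "take_at (Suc n) x [] = (x, [])"
| "take_at (Suc n) x (y # ys) = (case take_at n y ys of (z, zs) \<Rightarrow> (z, x # zs))"

text \<open>A Lehmer code: each entry is the position of the next element among those not yet used.
  Trailing zeros of a code are omitted.\<close>

fun lehmer :: "nat list \<Rightarrow> 'a list \<Rightarrow> 'a list" where
  "lehmer [] xs = xs"
| "lehmer (i # c) [] = []"
| "lehmer (i # c) (x # xs) = (case take_at i x xs of (y, ys) \<Rightarrow> y # lehmer c ys)"

fun le_row :: "bool list \<Rightarrow> bool list \<Rightarrow> bool" where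
  "le_row (True # r) (True # s) = le_row r s"
| "le_row (False # r) (False # s) = le_row r s"
| "le_row (False # r) (True # s) = True"
| "le_row (True # r) (False # s) = False"
| "le_row [] s = True"
| "le_row (x # r) [] = True"

fun ins_row :: "bool list \<Rightarrow> bool list list \<Rightarrow> bool list list" where
  "ins_row r [] = [r]"
| "ins_row r (s # ss) = (if le_row r s then r # s # ss else s # ins_row r ss)"

fun sort_rows :: "bool list list \<Rightarrow> bool list list" where
  "sort_rows [] = []" | "sort_rows (r # rs) = ins_row r (sort_rows rs)"

text \<open>Sorting the rows disposes of the order of the vertices, so a certificate consists of a
  permutation of the facets only. The vertex labels in the tables are such that the matrices of the
  representatives are sorted already.\<close>

fun normal :: "nat list \<Rightarrow> cell list \<Rightarrow> bool list list" where
  "normal c cs = sort_rows (map (\<lambda>(sl, n). lehmer c (pat sl)) cs)"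

text \<open>The truncated subtraction turns \<open>d\<close> into a lower bound for the number of
  facets through the vertex.\<close>

fun closed_slots :: "slot list \<Rightarrow> nat \<Rightarrow> bool" where
  "closed_slots [] d = (d = 0)"
| "closed_slots (SO # sl) d = closed_slots sl d"
| "closed_slots (SC # sl) d = closed_slots sl (d - 1)"
| "closed_slots (SA # sl) d = False"
| "closed_slots (SB # sl) d = False"

definition leaf_ok :: "cell list \<Rightarrow> bool" where
  "leaf_ok cs = list_all (\<lambda>(sl, n). closed_slots sl 3) cs"

text \<open>The product pays for all counts that \<open>GM\<close> may try in the first class, each
  followed by a pass through the remaining classes.\<close>

fun gweight :: "cell list \<Rightarrow> nat" where
  "gweight [] = 1"
| "gweight ((sl, n) # cs) = 3 + gweight cs + n * (gweight cs + 1)"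

fun weight :: "entry \<Rightarrow> nat" where
  "weight (ND k e cs) = 0"
| "weight (GN k e j cs ts b vis) = gweight cs"
| "weight (GM k e j sl n r m cs ts b vis) = 1 + r * (gweight cs + 1)"

lemma gweight_pos: "gweight cs > 0" by (induction cs rule: gweight.induct) auto

lemma weight_emit: "x \<in> set (emit k e j cs ts b vis) \<Longrightarrow> weight x = 0"
proof (cases "eres e b")
  case (Some e')
  assume "x \<in> set (emit k e j cs ts b vis)"
  then show ?thesis
    using Some by (cases "upd vis ts (map (\<lambda>(sl, n). (SO # sl, n)) cs)"; cases "tdj j ts") (simp_all add: emit_def)
qed (simp add: emit_def)

lemma weight_expand: "weight y > 0 \<Longrightarrow> x \<in> set (expand y) \<Longrightarrow> weight x < weight y"
proof (cases y)
  case (ND k e cs)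
  assume "weight y > 0" then show ?thesis by (simp add: ND)
next
  case (GN k e j cs ts b vis)
  assume y: "weight y > 0" and x: "x \<in> set (expand y)"
  consider "cs = [] \<or> b = 0" | sl n cs' b' where "cs = (sl, n) # cs'" "b = Suc b'"
    by (cases cs; cases b) auto
  then show ?thesis
  proof cases
    case 1
    then have "x \<in> set (emit k e j cs ts b vis)" using x by (cases cs) (auto simp: GN)
    then show ?thesis using y by (simp add: weight_emit)
  next
    case 2
    then show ?thesis using x by (auto simp: GN)
  qed
next
  case (GM k e j sl n r m cs ts b vis)
  assume x: "x \<in> set (expand y)"
  show ?thesis
  proof (cases "r = 0 \<or> b = 0")
    case True then show ?thesis using x by (cases r) (auto simp: GM)
  next
    case False
    then obtain r' b' where "r = Suc r'" "b = Suc b'" by (meson not0_implies_Suc)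
    then show ?thesis using x by (cases "tallys sl m ts") (auto simp: GM)
  qed
qed

text \<open>Runs the construction of one facet to its end, so that \<open>ok\<close> meets complete
  facets only.\<close>

function emits :: "entry \<Rightarrow> entry list" where
  "emits x = (if weight x = 0 then [x] else concat (map emits (expand x)))"
  by auto
termination by (relation "inv_image less_than weight") (auto simp: weight_expand)

declare emits.simps [simp del]

lemma emits_ND: "emits (ND k e cs) = [ND k e cs]" by (subst emits.simps) simp
lemma emits_GN: "emits (GN k e j cs ts b vis) = concat (map emits (expand (GN k e j cs ts b vis)))"
  by (subst emits.simps) (use gweight_pos[of cs] in simp)
lemma emits_GM: "emits (GM k e j sl n r m cs ts b vis) = concat (map emits (expand (GM k e j sl n r m cs ts b vis)))"
  by (subst emits.simps) simp

text \<open>The first list is the stack of a depth-first search; the second holds one column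
  permutation for each accepted leaf, in the order of the search. Discarded branches consume
  nothing.\<close>

inductive ok :: "bool list list list \<Rightarrow> entry list \<Rightarrow> nat list list \<Rightarrow> bool" for reps where
  ok_Nil: "ok reps [] cts"
| ok_drop: "ok reps st cts \<Longrightarrow> \<not> (e = 0 \<and> leaf_ok cs) \<Longrightarrow> ok reps (ND 0 e cs # st) cts"
| ok_leaf: "ok reps st cts \<Longrightarrow> leaf_ok cs \<Longrightarrow> normal c cs \<in> set reps \<Longrightarrow> list_all (\<lambda>(sl, n). n = Suc 0) cs \<Longrightarrow>
    ok reps (ND 0 0 cs # st) (c # cts)"
| ok_step: "ok reps (concat (map emits (expand (ND (Suc k) e cs))) @ st) cts \<Longrightarrow> ok reps (ND (Suc k) e cs # st) cts"

section \<open>Soundness of the search\<close>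

lemma mset_lehmer_take: "take_at i x xs = (y, ys) \<Longrightarrow> add_mset y (mset ys) = add_mset x (mset xs)"
  by (induction i x xs arbitrary: y ys rule: take_at.induct) (auto split: prod.splits simp: add_mset_commute)

lemma mset_lehmer: "mset (lehmer c xs) = mset xs"
  by (induction c xs rule: lehmer.induct) (auto split: prod.splits dest: mset_lehmer_take)

lemma take_at_map: "take_at i (f x) (map f xs) = (case take_at i x xs of (y, ys) \<Rightarrow> (f y, map f ys))"
  by (induction i x xs rule: take_at.induct) (auto split: prod.splits)

lemma lehmer_map: "lehmer c (map f xs) = map f (lehmer c xs)"
  by (induction c xs rule: lehmer.induct) (auto simp: take_at_map split: prod.splits)

lemma mset_ins_row: "mset (ins_row r rs) = add_mset r (mset rs)"
  by (induction rs) (auto simp: add_mset_commute)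

lemma mset_sort_rows: "mset (sort_rows rs) = mset rs"
  by (induction rs) (auto simp: mset_ins_row)

text \<open>Conditions that the facets of every polytope with 8 vertices and 9 facets satisfy;
  \<open>total\<close> is Euler's relation, 2 * 9 + 2 * 8 - 4.\<close>

locale facet_system =
  fixes V :: "'a set" and \<F> :: "'a set set"
  assumes finV: "finite V" and finF: "finite \<F>" and sub: "S \<in> \<F> \<Longrightarrow> S \<subseteq> V"
    and cF: "card \<F> = 9"
    and c3: "S \<in> \<F> \<Longrightarrow> card S \<ge> 3"
    and int2: "S \<in> \<F> \<Longrightarrow> T \<in> \<F> \<Longrightarrow> S \<noteq> T \<Longrightarrow> card (S \<inter> T) \<le> 2"
    and two: "S \<in> \<F> \<Longrightarrow> v \<in> S \<Longrightarrow> card {T \<in> \<F>. T \<noteq> S \<and> v \<in> T \<and> card (S \<inter> T) = 2} = 2"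
    and deg3: "v \<in> V \<Longrightarrow> card {S \<in> \<F>. v \<in> S} \<ge> 3"
    and total: "(\<Sum>S\<in>\<F>. card S) = 30"
begin

definition nbs :: "'a set set \<Rightarrow> 'a set \<Rightarrow> 'a \<Rightarrow> 'a set set" where
  "nbs A S v = {T \<in> A. T \<noteq> S \<and> v \<in> T \<and> card (S \<inter> T) = 2}"

definition sv :: "nat \<Rightarrow> slot" where "sv c = (if c = 0 then SA else if c = 1 then SB else SC)"

definition slot :: "'a set set \<Rightarrow> 'a \<Rightarrow> 'a set \<Rightarrow> slot" where
  "slot A v S = (if v \<in> S then sv (card (nbs A S v)) else SO)"

definition slots :: "'a set list \<Rightarrow> 'a \<Rightarrow> slot list" where "slots Fl v = map (slot (set Fl) v) Fl"

text \<open>Classes are required to differ in their membership patterns and not just in their slots: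
  a new facet may advance slots but only prepends one entry to a pattern, so the condition is easily
  maintained.\<close>

definition inv :: "'a set list \<Rightarrow> nat \<Rightarrow> nat \<Rightarrow> cell list \<Rightarrow> bool" where
  "inv Fl k e cs \<longleftrightarrow> distinct Fl \<and> set Fl \<subseteq> \<F> \<and> length Fl + k = 9 \<and>
     (\<Sum>S\<in>set Fl. card S) + 3 * k + e = 30 \<and> (\<forall>S\<in>\<F> - set Fl. card S \<le> 4) \<and>
     distinct (map (pat \<circ> fst) cs) \<and>
     (\<forall>(sl, n)\<in>set cs. n > 0 \<and> card {v \<in> V. slots Fl v = sl} = n) \<and>
     (\<forall>v\<in>V. slots Fl v \<in> fst ` set cs)"

definition reg :: "'a set list \<Rightarrow> slot list set \<Rightarrow> 'a set" where
  "reg Fl A = {v \<in> V. slots Fl v \<in> A}"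

text \<open>The meaning of a tally: \<open>U\<close> is the set of vertices in the classes visited
  so far, and only the part of \<open>G\<close> inside \<open>U\<close> is known.\<close>

definition tal :: "'a set list \<Rightarrow> 'a set \<Rightarrow> 'a set \<Rightarrow> 'a set \<Rightarrow> tally" where
  "tal Fl U G S = (let c = card (U \<inter> G \<inter> S) in if c = 0 then TN else if c \<ge> 2 then TD
     else if \<exists>v\<in>U \<inter> G \<inter> S. slot (set Fl) v S = SC then TX else TS)"

definition gsem :: "'a set list \<Rightarrow> 'a set \<Rightarrow> nat option \<Rightarrow> tally list \<Rightarrow> (cell \<times> nat) list \<Rightarrow> bool" where
  "gsem Fl G j ts vis \<longleftrightarrow> G \<in> \<F> \<and> G \<notin> set Fl \<and> ts = map (tal Fl (reg Fl (fst ` fst ` set vis)) G) Fl \<and>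
     (\<forall>((sl, n), m)\<in>set vis. m = card (G \<inter> reg Fl {sl})) \<and>
     (\<forall>i. j = Some i \<longrightarrow> i < length Fl \<and> card (G \<inter> Fl ! i) = 2)"

text \<open>An entry is meaningful if some facets of the given system realise it, and soundness says
  that each meaningful entry has a meaningful successor. In \<open>GM\<close> only
  \<open>m - 1\<close> vertices of the current class have been charged to the budget; the charge for
  the next one occurs in the following expansion.\<close>

fun sem :: "entry \<Rightarrow> bool" where
  "sem (ND k e cs) \<longleftrightarrow> (\<exists>Fl. inv Fl k e cs)"
| "sem (GN k e j cs ts b vis) \<longleftrightarrow> (\<exists>Fl G. inv Fl (Suc k) e (map fst vis @ cs) \<and> gsem Fl G j ts vis \<and>
     card (G \<inter> reg Fl (fst ` fst ` set vis)) + b = budget e)"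
| "sem (GM k e j sl n r m cs ts b vis) \<longleftrightarrow> (\<exists>Fl G. inv Fl (Suc k) e (map fst vis @ (sl, n) # cs) \<and>
     gsem Fl G j ts vis \<and> 0 < m \<and> m \<le> card (G \<inter> reg Fl {sl}) \<and> r + m = Suc n \<and>
     card (G \<inter> reg Fl (fst ` fst ` set vis)) + (m - 1) + b = budget e)"

lemma nbs_two: "S \<in> \<F> \<Longrightarrow> v \<in> S \<Longrightarrow> card (nbs \<F> S v) = 2"
  using two by (simp add: nbs_def)

lemma finite_nbs: "A \<subseteq> \<F> \<Longrightarrow> finite (nbs A S v)"
  using finF by (auto simp: nbs_def intro: finite_subset)

lemma card_nbs_le: "A \<subseteq> \<F> \<Longrightarrow> S \<in> \<F> \<Longrightarrow> v \<in> S \<Longrightarrow> card (nbs A S v) \<le> 2"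
  using card_mono[OF finite_nbs[of \<F> S v], of "nbs A S v"] nbs_two[of S v] by (force simp: nbs_def)

lemma finS: "S \<in> \<F> \<Longrightarrow> finite S" using sub finV finite_subset by blast

lemma slot_SO [simp]: "slot A v S = SO \<longleftrightarrow> v \<notin> S"
  by (simp add: slot_def sv_def)

text \<open>A vertex of \<open>S\<close> whose two neighbours in \<open>S\<close> are known cannot lie on a further edge of \<open>S\<close>.\<close>

lemma saturated:
  assumes "set Fl \<subseteq> \<F>" "S \<in> set Fl" "G \<in> \<F>" "G \<notin> set Fl" "v \<in> S" "v \<in> G" "slot (set Fl) v S = SC"
  shows "card (G \<inter> S) \<le> 1"
proof (rule ccontr)
  assume "\<not> ?thesis"
  moreover have ne: "S \<noteq> G" "S \<in> \<F>" using assms by auto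
  ultimately have "card (S \<inter> G) = 2" using int2[of S G] assms by (force simp: Int_commute)
  then have "insert G (nbs (set Fl) S v) \<subseteq> nbs \<F> S v" using assms ne by (auto simp: nbs_def)
  then have "card (insert G (nbs (set Fl) S v)) \<le> 2"
    using card_mono[OF finite_nbs[of \<F> S v]] nbs_two[of S v] assms ne by fastforce
  moreover have "G \<notin> nbs (set Fl) S v" using assms by (simp add: nbs_def)
  ultimately have "card (nbs (set Fl) S v) \<le> 1" using finite_nbs[OF assms(1), of S v] by simp
  then show False using assms(5,7) by (auto simp: slot_def sv_def split: if_splits)
qed

text \<open>In a genuine facet system the rejected cases of \<open>tally1\<close> cannot occur:
  \<open>int2\<close> excludes three common vertices and \<open>saturated\<close> excludes a second
  vertex next to a closed one.\<close>

lemma tally_step: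
  assumes Fl: "set Fl \<subseteq> \<F>" "S \<in> set Fl" "G \<in> \<F>" "G \<notin> set Fl" and U: "U \<subseteq> V" "C \<subseteq> V" "U \<inter> C = {}"
    and C: "\<And>v. v \<in> C \<Longrightarrow> slot (set Fl) v S = s" and m: "card (G \<inter> C) = m" "m > 0"
  shows "tally1 s m (tal Fl U G S) = Some (tal Fl (U \<union> C) G S)"
proof -
  have SG: "S \<in> \<F>" "S \<noteq> G" "finite G" "finite S" using Fl finS by auto
  have le2: "card (G \<inter> S) \<le> 2" using int2[of G S] SG Fl by auto
  obtain v where v: "v \<in> G" "v \<in> C" using m by (metis IntE card_gt_0_iff ex_in_conv)
  show ?thesis
  proof (cases "s = SO")
    case True
    then have "C \<inter> S = {}" using C slot_SO by blast
    then have "(U \<union> C) \<inter> G \<inter> S = U \<inter> G \<inter> S" by blast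
    then have "tal Fl (U \<union> C) G S = tal Fl U G S" unfolding tal_def by (simp only:)
    then show ?thesis using True by simp
  next
    case False
    then have CS: "C \<subseteq> S" using C slot_SO by blast
    have un: "(U \<union> C) \<inter> G \<inter> S = (U \<inter> G \<inter> S) \<union> (G \<inter> C)" using CS by blast
    have c: "card ((U \<union> C) \<inter> G \<inter> S) = card (U \<inter> G \<inter> S) + m"
      unfolding un using U(3) SG m(1) by (subst card_Un_disjoint) auto
    have "(U \<union> C) \<inter> G \<inter> S \<subseteq> G \<inter> S" by blast
    then have le: "card (U \<inter> G \<inter> S) + m \<le> card (G \<inter> S)" using c SG by (metis card_mono finite_Int)
    have sat: "card (G \<inter> S) \<le> 1" if "\<exists>w\<in>(U \<union> C) \<inter> G \<inter> S. slot (set Fl) w S = SC"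
      using saturated[OF Fl] that by blast
    have exU: "(\<exists>w\<in>(U \<union> C) \<inter> G \<inter> S. slot (set Fl) w S = SC) \<longleftrightarrow>
        (\<exists>w\<in>U \<inter> G \<inter> S. slot (set Fl) w S = SC) \<or> s = SC"
      using un v C by blast
    have uc: "(\<exists>w\<in>U \<inter> G \<inter> S. slot (set Fl) w S = SC) \<Longrightarrow> card (U \<inter> G \<inter> S) > 0"
      using SG by (auto simp: card_gt_0_iff)
    consider "m = 1" "card (U \<inter> G \<inter> S) = 0" | "m = 1" "card (U \<inter> G \<inter> S) = 1" | "m = 2" "card (U \<inter> G \<inter> S) = 0"
      using le le2 m(2) by linarith
    then show ?thesis
    proof cases
      case 1
      then show ?thesis using False uc c exU by (cases s) (auto simp: tal_def Let_def)
    next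
      case 2
      then have "s \<noteq> SC" "\<not> (\<exists>w\<in>U \<inter> G \<inter> S. slot (set Fl) w S = SC)" using sat exU le by auto
      then show ?thesis using 2 False c by (cases s) (auto simp: tal_def Let_def)
    next
      case 3
      then have "s \<noteq> SC" using sat exU le by auto
      then show ?thesis using 3 False c by (cases s) (auto simp: tal_def Let_def numeral_2_eq_2)
    qed
  qed
qed

lemma tallys_map: "(\<And>S. S \<in> set Fl \<Longrightarrow> tally1 (h S) m (f S) = Some (g S)) \<Longrightarrow>
    tallys (map h Fl) m (map f Fl) = Some (map g Fl)"
  by (induction Fl) auto


lemma pat_slots: "pat (slots Fl v) = map (\<lambda>S. v \<in> S) Fl"
  by (simp add: slots_def pat_def)

lemma length_slots [simp]: "length (slots Fl v) = length Fl" by (simp add: slots_def)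

lemma inv_perm: "inv Fl k e cs \<Longrightarrow> mset cs = mset cs' \<Longrightarrow> inv Fl k e cs'"
proof -
  assume i: "inv Fl k e cs" and m: "mset cs = mset cs'"
  have "mset (map (pat \<circ> fst) cs) = mset (map (pat \<circ> fst) cs')" using m by simp
  then have "distinct (map (pat \<circ> fst) cs) = distinct (map (pat \<circ> fst) cs')"
    by (rule mset_eq_imp_distinct_iff)
  moreover have "set cs = set cs'" using m by (rule mset_eq_setD)
  ultimately show ?thesis using i unfolding inv_def by simp
qed

lemma inv_cell: "inv Fl k e cs \<Longrightarrow> (sl, n) \<in> set cs \<Longrightarrow> n > 0 \<and> card {v \<in> V. slots Fl v = sl} = n"
  by (auto simp: inv_def)

lemma inv_cov: "inv Fl k e cs \<Longrightarrow> v \<in> V \<Longrightarrow> slots Fl v \<in> fst ` set cs"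
  by (auto simp: inv_def)

lemma inv_dist: "inv Fl k e cs \<Longrightarrow> distinct (map (pat \<circ> fst) cs)"
  by (auto simp: inv_def)

lemma cell_unique:
  assumes "inv Fl k e cs" "c \<in> set cs" "c' \<in> set cs" "pat (fst c) = pat (fst c')" shows "c = c'"
proof -
  have "inj_on (pat \<circ> fst) (set cs)" using inv_dist[OF assms(1)] by (simp add: distinct_map)
  then show ?thesis by (rule inj_onD) (use assms in auto)
qed

text \<open>All other missing facets take at least three incidences each, so what remains of the 30
  bounds the size of \<open>G\<close>.\<close>

lemma card_new:
  assumes i: "inv Fl (Suc k) e cs" and G: "G \<in> \<F>" "G \<notin> set Fl"
  shows "card G \<ge> 3" "card G \<le> budget e" "card G \<le> 3 + e"
proof -
  show "card G \<ge> 3" using c3 G by blast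
  have Fl: "set Fl \<subseteq> \<F>" "distinct Fl" "length Fl + Suc k = 9" using i by (auto simp: inv_def)
  have "card (\<F> - set Fl) = Suc k"
    using Fl cF finF by (simp add: card_Diff_subset distinct_card)
  then have ck: "card (\<F> - set Fl - {G}) = k" using G finF by (simp add: card_Diff_singleton)
  have "(\<Sum>S\<in>\<F>. card S) = (\<Sum>S\<in>set Fl. card S) + (\<Sum>S\<in>\<F> - set Fl. card S)"
    using sum.subset_diff[OF Fl(1) finF, of card] by simp
  also have "(\<Sum>S\<in>\<F> - set Fl. card S) = card G + (\<Sum>S\<in>\<F> - set Fl - {G}. card S)"
    using G finF by (subst sum.remove[of _ G]) auto
  finally have "30 = (\<Sum>S\<in>set Fl. card S) + card G + (\<Sum>S\<in>\<F> - set Fl - {G}. card S)"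
    using total by simp
  moreover have "(\<Sum>S\<in>\<F> - set Fl - {G}. card S) \<ge> k * 3"
    using sum_bounded_below[of "\<F> - set Fl - {G}" 3 card] c3 ck by simp
  moreover have "(\<Sum>S\<in>set Fl. card S) + 3 * Suc k + e = 30" using i by (simp add: inv_def)
  ultimately show le: "card G \<le> 3 + e" by simp
  have "card G \<le> 4" using i G by (simp add: inv_def)
  then show "card G \<le> budget e" using le by (cases e) auto
qed

lemma tal_full:
  assumes "G \<subseteq> U" "G \<in> \<F>" "S \<in> \<F>" "S \<noteq> G"
  shows "tal Fl U G S = TD \<longleftrightarrow> card (G \<inter> S) = 2"
proof -
  have "U \<inter> G \<inter> S = G \<inter> S" using assms(1) by blast
  then show ?thesis using int2[of G S] assms by (auto simp: tal_def Let_def)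
qed

lemma slot_out: "v \<notin> G \<Longrightarrow> slot (insert G A) v S = slot A v S"
proof -
  assume "v \<notin> G"
  then have "nbs (insert G A) S v = nbs A S v" by (auto simp: nbs_def)
  then show ?thesis by (simp add: slot_def)
qed

text \<open>The new facet joins the neighbours of \<open>S\<close> at \<open>v\<close> exactly when
  the two share an edge, and by \<open>card_nbs_le\<close> the number of neighbours then stays
  within the range that \<open>sv\<close> distinguishes.\<close>

lemma slot_in:
  assumes "G \<subseteq> U" "G \<in> \<F>" "G \<notin> set Fl" "set Fl \<subseteq> \<F>" "S \<in> set Fl" "v \<in> G"
  shows "slot (insert G (set Fl)) v S = bump1 (tal Fl U G S) (slot (set Fl) v S)"
proof (cases "v \<in> S")
  case False
  then show ?thesis by (cases "tal Fl U G S") (simp_all add: slot_def)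
next
  case True
  have SF: "S \<in> \<F>" "S \<noteq> G" using assms by auto
  note td = tal_full[OF assms(1,2) SF, of Fl]
  show ?thesis
  proof (cases "card (G \<inter> S) = 2")
    case c2: True
    have "nbs (insert G (set Fl)) S v = insert G (nbs (set Fl) S v)"
      using c2 SF assms by (auto simp: nbs_def Int_commute)
    moreover have "G \<notin> nbs (set Fl) S v" using assms by (simp add: nbs_def)
    ultimately have c: "card (nbs (insert G (set Fl)) S v) = Suc (card (nbs (set Fl) S v))"
      using finite_nbs[OF assms(4)] by simp
    moreover have "card (nbs (insert G (set Fl)) S v) \<le> 2"
      using card_nbs_le[of "insert G (set Fl)" S v] assms SF True by auto
    ultimately show ?thesis using td c2 True by (auto simp: slot_def sv_def)
  next
    case nc: False
    then have "nbs (insert G (set Fl)) S v = nbs (set Fl) S v"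
      by (auto simp: nbs_def Int_commute)
    moreover have "bump1 (tal Fl U G S) x = x" for x using td nc by (cases "tal Fl U G S") auto
    ultimately show ?thesis by (simp add: slot_def)
  qed
qed

lemma bump_map: "bump (map h Fl) (map f Fl) = map (\<lambda>S. bump1 (f S) (h S)) Fl"
  by (induction Fl) auto

lemma pat_bump: "length sl \<le> length ts \<Longrightarrow> pat (bump sl ts) = pat sl"
proof (induction sl ts rule: bump.induct)
  case (1 s sl t ts)
  have "(bump1 t s \<noteq> SO) = (s \<noteq> SO)" by (cases t; cases s) auto
  then show ?case using 1 by (simp add: pat_def)
qed (auto simp: pat_def)

lemma hcount_map:
  "c + length (filter (\<lambda>S. h S \<noteq> SO \<and> f S = TD) Fl) \<le> 2 \<Longrightarrow>
   hcount (map h Fl) (map f Fl) (Some (sv c)) = Some (sv (c + length (filter (\<lambda>S. h S \<noteq> SO \<and> f S = TD) Fl)))"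
proof (induction Fl arbitrary: c)
  case (Cons S Fl)
  show ?case
  proof (cases "h S \<noteq> SO \<and> f S = TD")
    case True
    then have "c < 2" using Cons.prems by simp
    then have "up (sv c) = Some (sv (Suc c))" by (auto simp: sv_def)
    then show ?thesis using Cons True by (cases "h S") auto
  next
    case False
    then show ?thesis using Cons by (cases "f S") (auto split: slot.splits)
  qed
qed simp

lemma slots_step:
  assumes "G \<subseteq> U" "G \<in> \<F>" "G \<notin> set Fl" "set Fl \<subseteq> \<F>" "distinct Fl"
  defines "ts \<equiv> map (tal Fl U G) Fl"
  shows "v \<notin> G \<Longrightarrow> slots (G # Fl) v = SO # slots Fl v"
    and "v \<in> G \<Longrightarrow> \<exists>h. h \<noteq> SO \<and> hcount (slots Fl v) ts (Some SA) = Some h \<and> slots (G # Fl) v = h # bump (slots Fl v) ts"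
proof -
  show "v \<notin> G \<Longrightarrow> slots (G # Fl) v = SO # slots Fl v"
    by (simp add: slots_def slot_out)
  assume v: "v \<in> G"
  have "map (slot (insert G (set Fl)) v) Fl = bump (slots Fl v) ts"
    unfolding slots_def ts_def bump_map by (intro map_cong refl slot_in[OF assms(1-4) _ v])
  moreover have nG: "nbs (insert G (set Fl)) G v = nbs (set Fl) G v" by (auto simp: nbs_def)
  have flt: "{S \<in> set Fl. slot (set Fl) v S \<noteq> SO \<and> tal Fl U G S = TD} = nbs (set Fl) G v"
  proof -
    have "S \<noteq> G \<and> (tal Fl U G S = TD \<longleftrightarrow> card (G \<inter> S) = 2)" if "S \<in> set Fl" for S
      using tal_full[OF assms(1,2), of S Fl] that assms(3,4) by blast
    then show ?thesis by (auto simp: nbs_def)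
  qed
  have len: "length (filter (\<lambda>S. slot (set Fl) v S \<noteq> SO \<and> tal Fl U G S = TD) Fl) = card (nbs (set Fl) G v)"
    unfolding flt[symmetric] using distinct_card[OF distinct_filter[OF assms(5)]] by (simp only: set_filter)
  have "card (nbs (set Fl) G v) \<le> 2" by (rule card_nbs_le[OF assms(4,2) v])
  then have "hcount (slots Fl v) ts (Some (sv 0)) = Some (sv (card (nbs (set Fl) G v)))"
    unfolding slots_def ts_def using hcount_map[of 0 "slot (set Fl) v" "tal Fl U G" Fl] len by simp
  moreover have "sv 0 = SA" by (simp add: sv_def)
  moreover have "slot (insert G (set Fl)) v G = sv (card (nbs (set Fl) G v))" using v nG by (simp add: slot_def)
  moreover have "sv c \<noteq> SO" for c by (simp add: sv_def)
  ultimately show "\<exists>h. h \<noteq> SO \<and> hcount (slots Fl v) ts (Some SA) = Some h \<and> slots (G # Fl) v = h # bump (slots Fl v) ts"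
    by (simp add: slots_def)
qed

text \<open>The contribution of one visited class to the result of \<open>upd\<close>, split into
  the vertices inside and outside the new facet.\<close>

definition nc :: "tally list \<Rightarrow> cell \<times> nat \<Rightarrow> cell list" where
  "nc ts = (\<lambda>((sl, n), m). if m = 0 then [(SO # sl, n)]
     else (the (hcount sl ts (Some SA)) # bump sl ts, m) # (if n \<le> m then [] else [(SO # sl, n - m)]))"

lemma rest_eq: "rest sl n m acc = (if n \<le> m then acc else (SO # sl, n - m) # acc)"
  by (induction sl n m acc rule: rest.induct) auto

lemma upd_eq:
  "(\<And>sl n m. ((sl, n), m) \<in> set vis \<Longrightarrow> m > 0 \<Longrightarrow> hcount sl ts (Some SA) \<noteq> None) \<Longrightarrow>
   upd vis ts acc = Some (concat (map (nc ts) (rev vis)) @ acc)"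
proof (induction vis ts acc rule: upd.induct)
  case (2 sl n vis ts acc)
  then show ?case by (simp add: nc_def)
next
  case (3 sl n m vis ts acc)
  then obtain h where h: "hcount sl ts (Some SA) = Some h" by fastforce
  have "upd vis ts ((h # bump sl ts, Suc m) # rest sl n (Suc m) acc) =
      Some (concat (map (nc ts) (rev vis)) @ (h # bump sl ts, Suc m) # rest sl n (Suc m) acc)"
    by (rule 3(1)[OF h]) (use 3(2) in \<open>meson list.set_intros(2)\<close>)
  then show ?case using h by (simp add: nc_def rest_eq)
qed simp

text \<open>Patterns only receive one new leading entry: the two parts of a class differ in it, and
  different classes differ behind it.\<close>

lemma distinct_nc:
  assumes "distinct (map (pat \<circ> fst \<circ> fst) xs)"
    "\<And>sl n m. ((sl, n), m) \<in> set xs \<Longrightarrow> length sl = length ts \<and> (m > 0 \<longrightarrow> the (hcount sl ts (Some SA)) \<noteq> SO)"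
  shows "distinct (map (pat \<circ> fst) (concat (map (nc ts) xs)))"
  using assms
proof (induction xs)
  case (Cons x xs)
  obtain sl n m where x: "x = ((sl, n), m)" by (metis surj_pair)
  have mem: "\<exists>b. p = b # pat (fst (fst y))" if "((sl', n'), m') = y" "p \<in> (pat \<circ> fst) ` set (nc ts y)" "length sl' = length ts" for y p sl' n' m'
    using that pat_bump[of sl' ts] by (auto simp: nc_def pat_def split: if_splits)
  have "distinct (map (pat \<circ> fst) (nc ts x))"
    using Cons.prems(2)[of sl n m] x by (auto simp: nc_def pat_def)
  moreover have "distinct (map (pat \<circ> fst) (concat (map (nc ts) xs)))"
  proof (rule Cons.IH)
    show "distinct (map (pat \<circ> fst \<circ> fst) xs)" using Cons.prems(1) by (simp only: list.map distinct.simps)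
  qed (use Cons.prems(2) in \<open>meson list.set_intros(2)\<close>)
  moreover have False if p: "p \<in> (pat \<circ> fst) ` set (nc ts x)" "p \<in> (pat \<circ> fst) ` set (concat (map (nc ts) xs))" for p
  proof -
    obtain y where y: "y \<in> set xs" "p \<in> (pat \<circ> fst) ` set (nc ts y)" using p(2) by auto
    obtain sl' n' m' where y': "y = ((sl', n'), m')" by (metis surj_pair)
    obtain b where "p = b # pat (fst (fst x))" using mem[OF x[symmetric] p(1)] Cons.prems(2)[of sl n m] x by auto
    moreover obtain b' where "p = b' # pat (fst (fst y))"
      using mem[OF y'[symmetric] y(2)] Cons.prems(2)[of sl' n' m'] y(1) y' by auto
    ultimately have "pat (fst (fst x)) = pat (fst (fst y))" by simp
    then have "(pat \<circ> fst \<circ> fst) x \<in> set (map (pat \<circ> fst \<circ> fst) xs)" using y(1) by (force simp: image_iff)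
    then show False using Cons.prems(1) by (simp only: list.map distinct.simps) blast
  qed
  ultimately show ?case by (simp only: list.map concat.simps map_append distinct_append set_map) blast
qed simp

lemma reg_insert: "reg Fl (insert sl A) = reg Fl A \<union> reg Fl {sl}"
  by (auto simp: reg_def)

lemma reg_sub: "reg Fl A \<subseteq> V" by (auto simp: reg_def)

text \<open>Once all of \<open>G\<close> has been visited, the tallies are its true intersection
  numbers with the earlier facets, and the emitted classes describe the system enlarged by
  \<open>G\<close>.\<close>

lemma emit_sound:
  assumes i: "inv Fl (Suc k) e (map fst vis @ cs)" and g: "gsem Fl G j ts vis"
    and b: "card (G \<inter> reg Fl (fst ` fst ` set vis)) + b = budget e"
    and full: "G \<subseteq> reg Fl (fst ` fst ` set vis)"
  shows "\<exists>y\<in>set (emit k e j cs ts b vis). sem y"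
proof -
  let ?U = "reg Fl (fst ` fst ` set vis)"
  let ?all = "rev vis @ map (\<lambda>c. (c, 0)) cs"
  let ?cs = "map fst vis @ cs"
  have G: "G \<in> \<F>" "G \<notin> set Fl" and ts: "ts = map (tal Fl ?U G) Fl" using g by (auto simp: gsem_def)
  have Fl: "set Fl \<subseteq> \<F>" "distinct Fl" using i by (auto simp: inv_def)
  have GU: "G \<inter> ?U = G" using full by blast
  note cG = card_new[OF i G]
  obtain e' where e': "eres e b = Some e'" "e' + (card G - 3) = e"
  proof -
    have "card G + b = budget e" using b GU by simp
    then consider "e = 0" "b = 0" "card G = 3" | d where "e = Suc d" "b = 0" "card G = 4"
      | d where "e = Suc d" "b = Suc 0" "card G = 3"
      using cG by (cases e) fastforce+
    then show thesis using that by cases auto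
  qed
  have td: "tdj j ts"
  proof (cases j)
    case (Some q)
    then have q: "q < length Fl" "card (G \<inter> Fl ! q) = 2" using g by (auto simp: gsem_def)
    have "Fl ! q \<in> \<F>" "Fl ! q \<noteq> G" using q Fl G nth_mem by blast+
    then have "ts ! q = TD" using tal_full[OF full G(1), of "Fl ! q" Fl] q by (simp add: ts)
    moreover have "tdnth q ts \<longleftrightarrow> ts ! q = TD" if "q < length ts" for q and ts :: "tally list"
      using that by (induction ts arbitrary: q) (auto split: nat.split)
    ultimately show ?thesis using Some q ts by simp
  qed simp
  note st = slots_step[OF full G Fl, folded ts]
  have setall: "fst ` set ?all = set ?cs" by force
  note ic = inv_cell[OF i] and icov = inv_cov[OF i] and idist = inv_dist[OF i]
  have cov: "\<exists>n. (slots Fl v, n) \<in> set ?cs" if "v \<in> V" for v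
    using icov[OF that] by (simp only: image_iff) (metis prod.collapse)
  \<comment> \<open>Classes that were not visited are disjoint from \<open>G\<close>, which
    justifies the count 0 assigned to them.\<close>
  have mall: "m = card (G \<inter> reg Fl {sl})" if "((sl, n), m) \<in> set ?all" for sl n m
  proof (cases "((sl, n), m) \<in> set vis")
    case True then show ?thesis using g by (auto simp: gsem_def)
  next
    case False
    then have m: "m = 0" "(sl, n) \<in> set cs" using that by auto
    have "sl \<notin> fst ` fst ` set vis"
    proof
      assume "sl \<in> fst ` fst ` set vis"
      then obtain x where "x \<in> set vis" "fst (fst x) = sl" by blast
      then have "pat sl \<in> set (map (pat \<circ> fst) (map fst vis))" by auto
      moreover have "pat sl \<in> set (map (pat \<circ> fst) cs)" using m(2) by (force simp: image_iff)
      moreover have "distinct (map (pat \<circ> fst) (map fst vis) @ map (pat \<circ> fst) cs)"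
        using idist by (simp only: map_append)
      ultimately show False by (metis disjoint_iff distinct_append)
    qed
    then have "G \<inter> reg Fl {sl} = {}" using full by (auto simp: reg_def)
    then show ?thesis using m by simp
  qed
  have cell: "n > 0 \<and> card (reg Fl {sl}) = n" if "(sl, n) \<in> set ?cs" for sl n
    using ic[OF that] by (simp add: reg_def)
  have ex: "\<exists>v\<in>G. slots Fl v = sl" if "((sl, n), m) \<in> set ?all" "m > 0" for sl n m
    using mall[OF that(1)] that(2) by (metis (no_types, lifting) IntE card_gt_0_iff ex_in_conv mem_Collect_eq reg_def singletonD)
  have hc: "\<exists>h. h \<noteq> SO \<and> hcount sl ts (Some SA) = Some h \<and> (\<forall>v\<in>G. slots Fl v = sl \<longrightarrow> slots (G # Fl) v = h # bump sl ts)"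
    if a: "((sl, n), m) \<in> set ?all" "m > 0" for sl n m
  proof -
    obtain v where v: "v \<in> G" "slots Fl v = sl" using ex[OF a] by blast
    then obtain h where "h \<noteq> SO" "hcount sl ts (Some SA) = Some h" using st(2)[OF v(1)] by blast
    moreover from this have "slots (G # Fl) w = h # bump sl ts" if "w \<in> G" "slots Fl w = sl" for w
      using st(2)[OF that(1)] that(2) by auto
    ultimately show ?thesis by blast
  qed
  define cs' where "cs' = concat (map (nc ts) ?all)"
  have upd: "upd vis ts (map (\<lambda>(sl, n). (SO # sl, n)) cs) = Some cs'"
  proof -
    have "concat (map (nc ts) (map (\<lambda>c. (c, 0)) cs)) = map (\<lambda>(sl, n). (SO # sl, n)) cs"
      by (induction cs) (auto simp: nc_def)
    moreover have "hcount sl ts (Some SA) \<noteq> None" if "((sl, n), m) \<in> set vis" "m > 0" for sl n m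
      using hc[of sl n m] that by auto
    ultimately show ?thesis using upd_eq[of vis ts] by (simp add: cs'_def)
  qed
  have len: "length sl = length ts" if "(sl, n) \<in> set ?cs" for sl n
  proof -
    have "reg Fl {sl} \<noteq> {}" using cell[OF that] by force
    then show ?thesis by (auto simp: reg_def ts)
  qed
  \<comment> \<open>Updating keeps patterns and patterns identify classes, so the old class of a
    vertex can be recovered from its new slots.\<close>
  have uniq: "slots Fl v = sl" if "pat (slots Fl v) = pat sl" "(sl, n) \<in> set ?cs" "v \<in> V" for v sl n
  proof -
    obtain n' where "(slots Fl v, n') \<in> set ?cs" using cov[OF \<open>v \<in> V\<close>] by blast
    then show ?thesis using cell_unique[OF i, of "(slots Fl v, n')" "(sl, n)"] that by auto
  qed
  have finR: "finite (reg Fl A)" for A using reg_sub finV finite_subset by blast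
  have GV: "G \<subseteq> V" using sub G by blast
  have "inv (G # Fl) k e' cs'"
    unfolding inv_def
  proof (intro conjI)
    show "distinct (G # Fl)" "set (G # Fl) \<subseteq> \<F>" using Fl G by auto
    show "length (G # Fl) + k = 9" using i by (simp add: inv_def)
    have "(\<Sum>S\<in>set Fl. card S) + 3 * Suc k + e = 30" using i by (simp add: inv_def)
    then show "(\<Sum>S\<in>set (G # Fl). card S) + 3 * k + e' = 30" using G e'(2) cG by simp
    show "\<forall>S\<in>\<F> - set (G # Fl). card S \<le> 4" using i by (simp add: inv_def)
    show "distinct (map (pat \<circ> fst) cs')" unfolding cs'_def
    proof (rule distinct_nc)
      have "mset (map (pat \<circ> fst \<circ> fst) ?all) = mset (map (pat \<circ> fst) ?cs)"
        by (simp add: multiset.map_comp comp_assoc o_def)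
      from mset_eq_imp_distinct_iff[OF this] idist show "distinct (map (pat \<circ> fst \<circ> fst) ?all)" by (simp only:)
      fix sl n m assume a: "((sl, n), m) \<in> set ?all"
      then have "(sl, n) \<in> set ?cs" using setall by force
      then show "length sl = length ts \<and> (m > 0 \<longrightarrow> the (hcount sl ts (Some SA)) \<noteq> SO)"
        using len hc[OF a] by auto
    qed
    show "\<forall>(sl, n)\<in>set cs'. n > 0 \<and> card {v \<in> V. slots (G # Fl) v = sl} = n"
    proof (clarify)
      fix sl' n' assume "(sl', n') \<in> set cs'"
      then obtain sl n m where a: "((sl, n), m) \<in> set ?all" "(sl', n') \<in> set (nc ts ((sl, n), m))"
      proof -
        have "\<exists>x\<in>set ?all. (sl', n') \<in> set (nc ts x)"
          using \<open>(sl', n') \<in> set cs'\<close> unfolding cs'_def by (simp only: set_concat set_map UN_iff bex_simps)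
        then show thesis using that by (metis surj_pair)
      qed
      have c: "(sl, n) \<in> set ?cs" using setall a(1) by force
      note m = mall[OF a(1)]
      have out: "{v \<in> V. slots (G # Fl) v = SO # sl} = reg Fl {sl} - G"
      proof (intro equalityI subsetI)
        fix v assume v: "v \<in> {v \<in> V. slots (G # Fl) v = SO # sl}"
        then have "v \<notin> G" using st(2)[of v] by auto
        then show "v \<in> reg Fl {sl} - G" using st(1)[of v] v by (auto simp: reg_def)
      qed (use st(1) in \<open>auto simp: reg_def\<close>)
      have cout: "card (reg Fl {sl} - G) = n - m"
        using card_Diff_subset_Int[of "reg Fl {sl}" G] finR cell[OF c] m by (simp add: Int_commute)
      have mn: "m \<le> n" using card_mono[OF finR[of "{sl}"], of "G \<inter> reg Fl {sl}"] cell[OF c] m by simp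
      show "n' > 0 \<and> card {v \<in> V. slots (G # Fl) v = sl'} = n'"
      proof (cases "m > 0 \<and> sl' \<noteq> SO # sl")
        case True
        obtain h where h: "h \<noteq> SO" "hcount sl ts (Some SA) = Some h"
          "\<forall>v\<in>G. slots Fl v = sl \<longrightarrow> slots (G # Fl) v = h # bump sl ts" using hc[OF a(1)] True by blast
        have eq: "sl' = h # bump sl ts" "n' = m" using a(2) True h by (auto simp: nc_def split: if_splits)
        have "{v \<in> V. slots (G # Fl) v = h # bump sl ts} = G \<inter> reg Fl {sl}"
        proof (intro equalityI subsetI)
          fix v assume v: "v \<in> {v \<in> V. slots (G # Fl) v = h # bump sl ts}"
          then have vG: "v \<in> G" using st(1)[of v] h(1) by auto
          then have "bump (slots Fl v) ts = bump sl ts" using st(2)[of v] v by auto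
          moreover have "length (slots Fl v) \<le> length ts" "length sl \<le> length ts" using len[OF c] by (simp_all add: ts)
          ultimately have "pat (slots Fl v) = pat sl" using pat_bump[of "slots Fl v" ts] pat_bump[of sl ts] by simp
          then have "slots Fl v = sl" using uniq c v by blast
          then show "v \<in> G \<inter> reg Fl {sl}" using v vG by (simp add: reg_def)
        qed (use h(3) GV in \<open>auto simp: reg_def\<close>)
        then show ?thesis using eq m True by simp
      next
        case False
        then have "sl' = SO # sl" "n' = n - m" "n' > 0"
          using a(2) cell[OF c] hc[OF a(1)] by (auto simp: nc_def split: if_splits)
        then show ?thesis using out cout by simp
      qed
    qed
    show "\<forall>v\<in>V. slots (G # Fl) v \<in> fst ` set cs'"
    proof
      fix v assume v: "v \<in> V"
      obtain n where c: "(slots Fl v, n) \<in> set ?cs" using cov[OF v] by blast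
      then have "(slots Fl v, n) \<in> fst ` set ?all" using setall by simp
      then obtain m where a: "((slots Fl v, n), m) \<in> set ?all" by force
      have ncs: "set (nc ts ((slots Fl v, n), m)) \<subseteq> set cs'" unfolding cs'_def set_concat set_map using a by blast
      have vr: "v \<in> reg Fl {slots Fl v}" using v by (simp add: reg_def)
      show "slots (G # Fl) v \<in> fst ` set cs'"
      proof (cases "v \<in> G")
        case True
        then have "m > 0" using mall[OF a] vr finR by (metis IntI card_gt_0_iff empty_iff finite_Int)
        moreover obtain h where "hcount (slots Fl v) ts (Some SA) = Some h" "slots (G # Fl) v = h # bump (slots Fl v) ts"
          using st(2)[OF True] by blast
        ultimately have "(slots (G # Fl) v, m) \<in> set (nc ts ((slots Fl v, n), m))" by (simp add: nc_def)
        then show ?thesis using ncs by force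
      next
        case False
        have "m < n"
        proof -
          have "G \<inter> reg Fl {slots Fl v} \<subset> reg Fl {slots Fl v}" using False vr by blast
          then show ?thesis using psubset_card_mono[OF finR] mall[OF a] cell[OF c] by metis
        qed
        then have "(slots (G # Fl) v, n - m) \<in> set (nc ts ((slots Fl v, n), m))" using st(1)[OF False] by (simp add: nc_def)
        then show ?thesis using ncs by force
      qed
    qed
  qed
  then have "sem (ND k e' cs')" by auto
  moreover have "ND k e' cs' \<in> set (emit k e j cs ts b vis)" using e' td upd by (simp add: emit_def)
  ultimately show ?thesis by blast
qed


lemma disjoint_cell:
  assumes i: "inv Fl k e (map fst vis @ (sl, n) # cs)"
  shows "reg Fl (fst ` fst ` set vis) \<inter> reg Fl {sl} = {}"
proof -
  have "distinct (map (pat \<circ> fst) (map fst vis) @ map (pat \<circ> fst) ((sl, n) # cs))"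
    using inv_dist[OF i] by (simp only: map_append)
  moreover have "pat sl \<in> set (map (pat \<circ> fst) ((sl, n) # cs))" by simp
  ultimately have "pat sl \<notin> set (map (pat \<circ> fst) (map fst vis))"
    by (metis disjoint_iff distinct_append)
  then have "sl \<notin> fst ` fst ` set vis" by (force simp: image_iff)
  then show ?thesis by (auto simp: reg_def)
qed

lemma finite_reg: "finite (reg Fl A)" using reg_sub finV finite_subset by blast

lemma tallys_step:
  assumes i: "inv Fl (Suc k) e (map fst vis @ (sl, n) # cs)" and g: "gsem Fl G j ts vis"
    and m: "card (G \<inter> reg Fl {sl}) = m" "m > 0"
  shows "\<exists>ts'. tallys sl m ts = Some ts' \<and> gsem Fl G j ts' (((sl, n), m) # vis)"
proof -
  let ?U = "reg Fl (fst ` fst ` set vis)"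
  have G: "G \<in> \<F>" "G \<notin> set Fl" and ts: "ts = map (tal Fl ?U G) Fl" using g by (auto simp: gsem_def)
  have Fl: "set Fl \<subseteq> \<F>" using i by (auto simp: inv_def)
  obtain v where v: "v \<in> reg Fl {sl}" using m by (metis IntE card_gt_0_iff ex_in_conv)
  then have sl: "sl = map (slot (set Fl) v) Fl" by (simp add: reg_def slots_def)
  let ?g = "tal Fl (?U \<union> reg Fl {sl}) G"
  have "tallys sl m ts = Some (map ?g Fl)"
    unfolding ts
  proof (subst (1) sl, rule tallys_map)
    fix S assume S: "S \<in> set Fl"
    show "tally1 (slot (set Fl) v S) m (tal Fl ?U G S) = Some (?g S)"
    proof (rule tally_step[OF Fl S G reg_sub reg_sub disjoint_cell[OF i] _ m])
      fix w assume "w \<in> reg Fl {sl}"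
      then have "map (slot (set Fl) w) Fl = map (slot (set Fl) v) Fl" using sl by (simp add: reg_def slots_def)
      then show "slot (set Fl) w S = slot (set Fl) v S" using S by (metis map_eq_conv)
    qed
  qed
  moreover have "gsem Fl G j (map ?g Fl) (((sl, n), m) # vis)"
  proof -
    have r: "reg Fl (fst ` fst ` set (((sl, n), m) # vis)) = ?U \<union> reg Fl {sl}" using reg_insert[of Fl sl "fst ` fst ` set vis"] by simp
    show ?thesis unfolding gsem_def r using g m by (simp add: gsem_def)
  qed
  ultimately show ?thesis by blast
qed

text \<open>The two successors correspond to exactly \<open>m\<close> and to more than
  \<open>m\<close> vertices of the class in \<open>G\<close>; the size bounds show that neither
  \<open>r\<close> nor \<open>b\<close> is exhausted.\<close>

lemma expand_GM_sound:
  assumes "sem (GM k e j sl n r m cs ts b vis)"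
  shows "\<exists>y\<in>set (expand (GM k e j sl n r m cs ts b vis)). sem y"
proof -
  obtain Fl G where i: "inv Fl (Suc k) e (map fst vis @ (sl, n) # cs)" and g: "gsem Fl G j ts vis"
    and m: "0 < m" "m \<le> card (G \<inter> reg Fl {sl})" and r: "r + m = Suc n"
    and b: "card (G \<inter> reg Fl (fst ` fst ` set vis)) + (m - 1) + b = budget e"
    using assms by auto
  have G: "G \<in> \<F>" "G \<notin> set Fl" using g by (auto simp: gsem_def)
  have n: "card (reg Fl {sl}) = n" using inv_cell[OF i, of sl n] by (simp add: reg_def)
  have "card (G \<inter> reg Fl {sl}) \<le> n" using n card_mono[OF finite_reg, of "G \<inter> reg Fl {sl}"] by (metis Int_lower2)
  then have "r > 0" using r m by linarith
  then obtain r' where r': "r = Suc r'" using gr0_implies_Suc by blast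
  let ?U = "reg Fl (fst ` fst ` set vis)"
  have disj: "(G \<inter> ?U) \<inter> (G \<inter> reg Fl {sl}) = {}" using disjoint_cell[OF i] by blast
  have "card ((G \<inter> ?U) \<union> (G \<inter> reg Fl {sl})) = card (G \<inter> ?U) + card (G \<inter> reg Fl {sl})"
    by (rule card_Un_disjoint[OF _ _ disj]) (simp_all add: finite_reg)
  moreover have "card ((G \<inter> ?U) \<union> (G \<inter> reg Fl {sl})) \<le> card G"
    by (rule card_mono[OF finS[OF G(1)]]) blast
  ultimately have le: "card (G \<inter> ?U) + card (G \<inter> reg Fl {sl}) \<le> budget e"
    using card_new(2)[OF i G] by simp
  then have "b > 0" using b m by linarith
  then obtain b' where b': "b = Suc b'" using gr0_implies_Suc by blast
  show ?thesis
  proof (cases "card (G \<inter> reg Fl {sl}) = m")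
    case True
    then obtain ts' where ts': "tallys sl m ts = Some ts'" "gsem Fl G j ts' (((sl, n), m) # vis)"
      using tallys_step[OF i g] m by blast
    have "inv Fl (Suc k) e (map fst (((sl, n), m) # vis) @ cs)"
      by (rule inv_perm[OF i]) simp
    moreover have "card (G \<inter> reg Fl (fst ` fst ` set (((sl, n), m) # vis))) + b' = budget e"
    proof -
      have "G \<inter> reg Fl (fst ` fst ` set (((sl, n), m) # vis)) = (G \<inter> ?U) \<union> (G \<inter> reg Fl {sl})"
        using reg_insert[of Fl sl "fst ` fst ` set vis"] by (simp add: Int_Un_distrib)
      then show ?thesis
        using \<open>card ((G \<inter> ?U) \<union> (G \<inter> reg Fl {sl})) = card (G \<inter> ?U) + card (G \<inter> reg Fl {sl})\<close> True b b' m by simp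
    qed
    ultimately have "sem (GN k e j cs ts' b' (((sl, n), m) # vis))" using ts'(2) unfolding sem.simps by blast
    then show ?thesis using ts'(1) r' b' by simp
  next
    case False
    then have "Suc m \<le> card (G \<inter> reg Fl {sl})" "r' + Suc m = Suc n" "0 < Suc m"
      "card (G \<inter> ?U) + (Suc m - 1) + b' = budget e"
      using m r b r' b' by linarith+
    then have "sem (GM k e j sl n r' (Suc m) cs ts b' vis)"
      unfolding sem.simps using i g by blast
    then show ?thesis using r' b' by (auto split: option.split)
  qed
qed

lemma expand_GN_sound:
  assumes s: "sem (GN k e j cs ts b vis)"
  shows "\<exists>y\<in>set (expand (GN k e j cs ts b vis)). sem y"
proof -
  obtain Fl G where i: "inv Fl (Suc k) e (map fst vis @ cs)" and g: "gsem Fl G j ts vis"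
    and b: "card (G \<inter> reg Fl (fst ` fst ` set vis)) + b = budget e"
    using s by auto
  let ?U = "reg Fl (fst ` fst ` set vis)"
  have G: "G \<in> \<F>" "G \<notin> set Fl" using g by (auto simp: gsem_def)
  show ?thesis
  proof (cases "cs = [] \<or> b = 0")
    case True
    have "G \<subseteq> ?U"
    proof (cases "cs = []")
      case True
      then have "?U = V" using inv_cov[OF i] by (auto simp: reg_def)
      then show ?thesis using sub G by blast
    next
      case False
      \<comment> \<open>An exhausted budget means that the visited part of \<open>G\<close> is as
        large as \<open>G\<close> can be.\<close>
      then have "card G \<le> card (G \<inter> ?U)" using True b card_new(2)[OF i G] by simp
      then have "G \<inter> ?U = G" using card_seteq[OF finS[OF G(1)], of "G \<inter> ?U"] by blast
      then show ?thesis by blast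
    qed
    from emit_sound[OF i g b this] True show ?thesis by (cases cs) auto
  next
    case False
    then obtain sl n cs' b' where cs: "cs = (sl, n) # cs'" and b': "b = Suc b'"
      by (metis gr0_implies_Suc list.exhaust not_gr_zero surj_pair)
    show ?thesis
    proof (cases "card (G \<inter> reg Fl {sl}) = 0")
      case True
      then have e: "G \<inter> reg Fl {sl} = {}" using finite_reg by (metis card_eq_0_iff finite_Int)
      let ?vis = "((sl, n), 0 :: nat) # vis"
      have r: "reg Fl (fst ` fst ` set ?vis) = ?U \<union> reg Fl {sl}" using reg_insert[of Fl sl "fst ` fst ` set vis"] by simp
      have "tal Fl (?U \<union> reg Fl {sl}) G S = tal Fl ?U G S" for S
      proof -
        have "(?U \<union> reg Fl {sl}) \<inter> G \<inter> S = ?U \<inter> G \<inter> S" using e by blast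
        then show ?thesis unfolding tal_def by (simp only:)
      qed
      then have "map (tal Fl (reg Fl (fst ` fst ` set ?vis)) G) Fl = map (tal Fl ?U G) Fl" unfolding r by simp
      moreover have "ts = map (tal Fl ?U G) Fl" using g by (simp add: gsem_def)
      moreover have "\<forall>((sl, n), m)\<in>set ?vis. m = card (G \<inter> reg Fl {sl})" using g True by (simp add: gsem_def)
      ultimately have "gsem Fl G j ts ?vis" using g unfolding gsem_def by metis
      moreover have "inv Fl (Suc k) e (map fst ?vis @ cs')" by (rule inv_perm[OF i]) (simp add: cs)
      moreover have "G \<inter> (?U \<union> reg Fl {sl}) = G \<inter> ?U" using e by blast
      then have "card (G \<inter> reg Fl (fst ` fst ` set ?vis)) + b = budget e" unfolding r using b by simp
      ultimately have "sem (GN k e j cs' ts b ?vis)" unfolding sem.simps by blast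
      then show ?thesis using cs b' by simp
    next
      case False
      then have "Suc 0 \<le> card (G \<inter> reg Fl {sl})" "n + Suc 0 = Suc n" "card (G \<inter> ?U) + (Suc 0 - 1) + b = budget e"
        using b by simp_all
      then have "sem (GM k e j sl n n (Suc 0) cs' ts b vis)"
        unfolding sem.simps using i g unfolding cs by blast
      then show ?thesis using cs b' by simp
    qed
  qed
qed

lemma emits_sound: "sem x \<Longrightarrow> \<exists>y\<in>set (emits x). sem y"
proof (induction x rule: emits.induct)
  case (1 x)
  show ?case
  proof (cases "weight x = 0")
    case True then show ?thesis using 1 by (subst emits.simps) simp
  next
    case False
    have "\<exists>y\<in>set (expand x). sem y"
      using 1(2) False expand_GN_sound expand_GM_sound by (cases x) (auto simp del: expand.simps sem.simps)
    then obtain y where y: "y \<in> set (expand x)" "sem y" by blast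
    then obtain z where "z \<in> set (emits y)" "sem z" using 1(1)[OF False] by blast
    then show ?thesis using y False by (subst emits.simps) auto
  qed
qed

lemma find_slot_Some: "find_slot t sl i = Some j \<Longrightarrow> i \<le> j \<and> j - i < length sl \<and> sl ! (j - i) = t"
proof (induction t sl i rule: find_slot.induct)
  case (2 t s sl n)
  show ?case
  proof (cases "s = t")
    case True then show ?thesis using 2 by simp
  next
    case False
    then have "Suc n \<le> j \<and> j - Suc n < length sl \<and> sl ! (j - Suc n) = t" using 2 by simp
    moreover from this have "j - n = Suc (j - Suc n)" by linarith
    ultimately show ?thesis by simp
  qed
qed simp

lemma target_Some:
  "target t cs acc = Some (j, sl, n, cs') \<Longrightarrow> add_mset (sl, n) (mset cs') = mset acc + mset cs \<and> j < length sl \<and> sl ! j = t"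
proof (induction t cs acc rule: target.induct)
  case (2 t sl' n' cs acc)
  show ?case
  proof (cases "find_slot t sl' 0")
    case None then show ?thesis using 2 by simp
  next
    case (Some a)
    then show ?thesis using 2(2) find_slot_Some[OF Some] by auto
  qed
qed simp

lemma new_facet:
  assumes i: "inv Fl (Suc k) e cs" shows "\<exists>G. G \<in> \<F> \<and> G \<notin> set Fl"
proof (rule ccontr)
  assume "\<not> ?thesis"
  then have "\<F> \<subseteq> set Fl" by blast
  then have "card \<F> \<le> length Fl" by (metis List.finite_set card_length card_mono order_trans)
  then show False using i cF by (simp add: inv_def)
qed

lemma tal_empty: "tal Fl {} G S = TN" by (simp add: tal_def)

lemma reg_empty: "reg Fl {} = {}" by (simp add: reg_def)

text \<open>The facet \<open>?S\<close> has two neighbours at \<open>v\<close>, but fewer than two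
  of them are chosen, so one is missing. The facets may be listed in any order, hence this one may
  be taken next.\<close>

lemma expand_target_sound:
  assumes i: "inv Fl (Suc k) e cs" and t: "target t cs [] = Some (j, sl, n, cs')" "t = SA \<or> t = SB"
  shows "sem (GM k e (Some j) sl n n (Suc 0) cs' (map (\<lambda>_. TN) sl) (budget e) [])"
proof -
  have tt: "add_mset (sl, n) (mset cs') = mset cs" "j < length sl" "sl ! j = t" using target_Some[OF t(1)] by auto
  then have i': "inv Fl (Suc k) e (map fst [] @ (sl, n) # cs')" by (intro inv_perm[OF i]) simp
  have n: "n > 0" "card (reg Fl {sl}) = n" using inv_cell[OF i', of sl n] by (auto simp: reg_def)
  obtain v where v: "v \<in> V" "slots Fl v = sl" using n by (metis (no_types, lifting) card_gt_0_iff ex_in_conv mem_Collect_eq reg_def singletonD)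
  then have j: "j < length Fl" "slot (set Fl) v (Fl ! j) = t" using tt by (auto simp: slots_def)
  let ?S = "Fl ! j"
  have S: "?S \<in> set Fl" "?S \<in> \<F>" "set Fl \<subseteq> \<F>" using j i nth_mem by (auto simp: inv_def)
  have vS: "v \<in> ?S" using j(2) t(2) slot_SO[of "set Fl" v ?S] by auto
  then have "card (nbs (set Fl) ?S v) < 2" using j(2) t(2) by (auto simp: slot_def sv_def split: if_splits)
  then have "\<not> nbs \<F> ?S v \<subseteq> nbs (set Fl) ?S v"
    using nbs_two[OF S(2) vS] card_mono[OF finite_nbs[OF S(3)], of "nbs \<F> ?S v" ?S v] by linarith
  then obtain G where G: "G \<in> \<F>" "G \<notin> set Fl" "v \<in> G" "card (G \<inter> ?S) = 2" by (auto simp: nbs_def Int_commute)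
  have "length sl = length Fl" using v by auto
  then have "map (\<lambda>_. TN) sl = map (tal Fl {} G) Fl" by (simp add: tal_empty list_eq_iff_nth_eq)
  then have "gsem Fl G (Some j) (map (\<lambda>_. TN) sl) []" using G j by (simp add: gsem_def reg_empty)
  moreover have "v \<in> G \<inter> reg Fl {sl}" using v G by (simp add: reg_def)
  then have "Suc 0 \<le> card (G \<inter> reg Fl {sl})" using finite_reg by (metis One_nat_def Suc_leI card_gt_0_iff empty_iff finite_Int)
  ultimately show ?thesis unfolding sem.simps
    by (intro exI[of _ Fl] exI[of _ G] conjI i') (simp_all add: reg_empty)
qed

lemma expand_ND_sound:
  assumes "sem (ND (Suc k) e cs)" shows "\<exists>y\<in>set (expand (ND (Suc k) e cs)). sem y"
proof -
  obtain Fl where i: "inv Fl (Suc k) e cs" using assms by auto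
  show ?thesis
  proof (cases "target SB cs []")
    case (Some x)
    then obtain j sl n cs' where x: "target SB cs [] = Some (j, sl, n, cs')" by (metis surj_pair)
    show ?thesis using expand_target_sound[OF i x] x by simp
  next
    case n1: None
    show ?thesis
    proof (cases "target SA cs []")
      case (Some x)
      then obtain j sl n cs' where x: "target SA cs [] = Some (j, sl, n, cs')" by (metis surj_pair)
      show ?thesis using expand_target_sound[OF i x] x n1 by simp
    next
      case None
      obtain G where G: "G \<in> \<F>" "G \<notin> set Fl" using new_facet[OF i] by blast
      then obtain v where "v \<in> V" using sub[OF G(1)] c3[OF G(1)] by (metis card.empty ex_in_conv not_numeral_le_zero subset_iff)
      then obtain sl n cs' where cs: "cs = (sl, n) # cs'" using inv_cov[OF i] by (cases cs) auto
      have "card (reg Fl {sl}) > 0" using inv_cell[OF i, of sl n] cs by (simp add: reg_def)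
      then have "length sl = length Fl" by (auto simp: card_gt_0_iff reg_def)
      then have "no_tallies cs = map (tal Fl {} G) Fl" by (simp add: cs tal_empty list_eq_iff_nth_eq)
      then have "gsem Fl G None (no_tallies cs) []" using G by (simp add: gsem_def reg_empty)
      then have "sem (GN k e None cs (no_tallies cs) (budget e) [])" using i by (auto simp: reg_empty)
      then show ?thesis using None n1 by simp
    qed
  qed
qed

lemma closed_slotsI:
  "(\<forall>s\<in>set sl. s = SO \<or> s = SC) \<Longrightarrow> d \<le> length (filter (\<lambda>s. s \<noteq> SO) sl) \<Longrightarrow> closed_slots sl d"
  by (induction sl d rule: closed_slots.induct) auto

text \<open>When all nine facets are chosen, the slots count all neighbours, so every one of them is
  \<open>SO\<close> or \<open>SC\<close>.\<close>

lemma leaf_all: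
  assumes "inv Fl 0 e cs" shows "set Fl = \<F>" "e = 0" "leaf_ok cs"
proof -
  have Fl: "distinct Fl" "set Fl \<subseteq> \<F>" "length Fl = 9" using assms by (auto simp: inv_def)
  then show all: "set Fl = \<F>" using cF finF by (metis card_seteq distinct_card order_refl)
  have "(\<Sum>S\<in>set Fl. card S) + e = 30" using assms by (simp add: inv_def)
  then show "e = 0" using total all by simp
  have "closed_slots sl 3" if c: "(sl, n) \<in> set cs" for sl n
  proof -
    have "card {v \<in> V. slots Fl v = sl} > 0" using inv_cell[OF assms c] by simp
    then obtain v where v: "v \<in> V" "slots Fl v = sl" by (auto simp: card_gt_0_iff)
    show ?thesis
    proof (rule closed_slotsI)
      show "\<forall>s\<in>set sl. s = SO \<or> s = SC"
        unfolding v(2)[symmetric] slots_def using nbs_two all by (auto simp: slot_def sv_def)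
      have "length (filter (\<lambda>s. s \<noteq> SO) sl) = length (filter (\<lambda>S. v \<in> S) Fl)"
        unfolding v(2)[symmetric] slots_def by (simp add: filter_map o_def)
      also have "\<dots> = card (set (filter (\<lambda>S. v \<in> S) Fl))" using distinct_card[OF distinct_filter[OF Fl(1)]] by (simp only:)
      also have "\<dots> = card {S \<in> \<F>. v \<in> S}" using all by simp
      finally show "3 \<le> length (filter (\<lambda>s. s \<noteq> SO) sl)" using deg3[OF v(1)] by simp
    qed
  qed
  then show "leaf_ok cs" by (auto simp: leaf_ok_def list_all_iff)
qed

text \<open>Classes of size one enumerate the vertices; permuting the columns and sorting the rows
  merely changes the enumerations of facets and vertices.\<close>

lemma leaf_matrix:
  assumes i: "inv Fl 0 e cs" and one: "list_all (\<lambda>(sl, n). n = Suc 0) cs"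
  shows "has_matrix V \<F> (normal c cs)"
proof -
  have Fl: "distinct Fl" "set Fl = \<F>" using i leaf_all[OF i] by (auto simp: inv_def)
  define p where "p = (\<lambda>(sl, n :: nat). THE v. v \<in> V \<and> slots Fl v = sl)"
  have p: "p (sl, n) \<in> V \<and> slots Fl (p (sl, n)) = sl \<and> (\<forall>v\<in>V. slots Fl v = sl \<longrightarrow> v = p (sl, n))"
    if "(sl, n) \<in> set cs" for sl n
  proof -
    have "n = 1" using one that by (auto simp: list_all_iff)
    then have "card {v \<in> V. slots Fl v = sl} = 1" using inv_cell[OF i that] by simp
    then obtain v where v: "{v \<in> V. slots Fl v = sl} = {v}" by (meson card_1_singletonE)
    then have v': "\<And>w. w \<in> V \<and> slots Fl w = sl \<longleftrightarrow> w = v" by blast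
    then have "p (sl, n) = v" unfolding p_def by simp
    then show ?thesis using v' by blast
  qed
  let ?vs = "map p cs"
  have pp: "pat (fst x) = map (\<lambda>S. p x \<in> S) Fl" if "x \<in> set cs" for x
    using p[of "fst x" "snd x"] that pat_slots[of Fl "p x"] by simp
  have sV: "set ?vs = V"
  proof (intro equalityI subsetI)
    fix v assume v: "v \<in> V"
    obtain n where x: "(slots Fl v, n) \<in> set cs" using inv_cov[OF i v] by force
    then have "v = p (slots Fl v, n)" using p[OF x] v by blast
    then show "v \<in> set ?vs" using x by (metis imageI list.set_map)
  next
    fix v assume "v \<in> set ?vs"
    then obtain x where "x \<in> set cs" "v = p x" by auto
    then show "v \<in> V" using p[of "fst x" "snd x"] by simp
  qed
  have dv: "distinct ?vs"
  proof -
    have "distinct (map (pat \<circ> fst) cs)" by (rule inv_dist[OF i])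
    then have "inj_on (pat \<circ> fst) (set cs)" "distinct cs" by (simp_all add: distinct_map)
    moreover have "inj_on p (set cs)"
    proof (rule inj_onI)
      fix x y assume xy: "x \<in> set cs" "y \<in> set cs" "p x = p y"
      then have "pat (fst x) = pat (fst y)" using pp by simp
      then show "x = y" using inj_onD[OF \<open>inj_on (pat \<circ> fst) (set cs)\<close>] xy by simp
    qed
    ultimately show ?thesis by (simp add: distinct_map)
  qed
  let ?fs = "lehmer c Fl"
  have fs: "distinct ?fs" "set ?fs = \<F>"
    using mset_eq_imp_distinct_iff[OF mset_lehmer, of c Fl] mset_eq_setD[OF mset_lehmer, of c Fl] Fl by auto
  let ?f = "\<lambda>v. map (\<lambda>F. v \<in> F) ?fs"
  have rows: "map (\<lambda>(sl, n). lehmer c (pat sl)) cs = map ?f ?vs"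
    using pp by (auto simp: lehmer_map)
  have "mset (normal c cs) = mset (map ?f ?vs)" using rows by (simp only: normal.simps mset_sort_rows)
  \<comment> \<open>Lists of rows with equal multisets differ by a permutation, which is then
    applied to the vertices.\<close>
  then obtain \<pi> where \<pi>: "\<pi> permutes {..<length (map ?f ?vs)}" "permute_list \<pi> (map ?f ?vs) = normal c cs"
    using mset_eq_permutation by metis
  then have "\<pi> permutes {..<length ?vs}" by simp
  then have R: "normal c cs = map ?f (permute_list \<pi> ?vs)" using \<pi>(2) permute_list_map by metis
  have "distinct (permute_list \<pi> ?vs)" "set (permute_list \<pi> ?vs) = V"
    using \<open>\<pi> permutes {..<length ?vs}\<close> dv sV by simp_all
  then show ?thesis using R fs unfolding has_matrix_def by blast
qed

lemma ok_sound: "ok reps st cts \<Longrightarrow> \<exists>x\<in>set st. sem x \<Longrightarrow> \<exists>R\<in>set reps. has_matrix V \<F> R"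
proof (induction rule: ok.induct)
  case (ok_drop st cts e cs)
  then show ?case using leaf_all by fastforce
next
  case (ok_leaf st cts cs c)
  then show ?case using leaf_matrix by fastforce
next
  case (ok_step k e cs st cts)
  then consider "sem (ND (Suc k) e cs)" | x where "x \<in> set st" "sem x" by auto
  then show ?case
  proof cases
    case 1
    then obtain y where "y \<in> set (expand (ND (Suc k) e cs))" "sem y" using expand_ND_sound by blast
    moreover from this obtain z where "z \<in> set (emits y)" "sem z" using emits_sound by blast
    ultimately show ?thesis by (intro ok_step.IH) (auto simp del: expand.simps)
  next
    case 2
    then show ?thesis by (intro ok_step.IH) (auto simp del: expand.simps)
  qed
qed simp

text \<open>Nine triangles would give only 27 of the 30 incidences, and eight facets besides
  \<open>S\<close> take at least 24, so \<open>S\<close> has between 4 and 6 vertices. The excess of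
  the other facets is 30 - 24 - \<open>card S\<close>.\<close>

lemma start_sem:
  assumes V8: "card V = 8" and S: "S \<in> \<F>" "\<forall>T\<in>\<F>. card T \<le> card S"
  shows "card S \<in> {4, 5, 6}" "sem (ND 8 (6 - card S) [([SA], card S), ([SO], 8 - card S)])"
proof -
  have tot: "(\<Sum>T\<in>\<F>. card T) = card S + (\<Sum>T\<in>\<F> - {S}. card T)"
    using S finF by (simp add: sum.remove)
  have c8: "card (\<F> - {S}) = 8" using S cF finF by simp
  have lo: "(\<Sum>T\<in>\<F> - {S}. card T) \<ge> 24"
    using sum_bounded_below[of "\<F> - {S}" 3 card] c3 c8 by simp
  have hi: "(\<Sum>T\<in>\<F> - {S}. card T) \<le> 8 * card S"
    using sum_bounded_above[of "\<F> - {S}" card "card S"] S c8 by simp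
  have "card S \<ge> 4" "card S \<le> 6" using tot lo hi total by linarith+
  then show c: "card S \<in> {4, 5, 6}" by auto
  have le4: "card T \<le> 4" if T: "T \<in> \<F> - {S}" for T
  proof (cases "card S = 4")
    case True then show ?thesis using S T by auto
  next
    case False
    have "(\<Sum>T\<in>\<F> - {S}. card T) = card T + (\<Sum>T\<in>\<F> - {S} - {T}. card T)"
      using T finF by (simp add: sum.remove)
    moreover have "(\<Sum>T\<in>\<F> - {S} - {T}. card T) \<ge> 21"
      using sum_bounded_below[of "\<F> - {S} - {T}" 3 card] c3 c8 T finF by simp
    ultimately show ?thesis using tot total False c by auto
  qed
  have n0: "nbs {S} S v = {}" for v by (auto simp: nbs_def)
  have sl: "slots [S] v = [if v \<in> S then SA else SO]" for v
    by (simp add: slots_def slot_def n0 sv_def)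
  have SV: "S \<subseteq> V" using sub S by blast
  have "inv [S] 8 (6 - card S) [([SA], card S), ([SO], 8 - card S)]"
    unfolding inv_def
  proof (intro conjI)
    show "(\<Sum>S\<in>set [S]. card S) + 3 * 8 + (6 - card S) = 30" using c by auto
    show "\<forall>(sl, n)\<in>set [([SA], card S), ([SO], 8 - card S)]. n > 0 \<and> card {v \<in> V. slots [S] v = sl} = n"
    proof -
      have "{v \<in> V. slots [S] v = [SA]} = S" "{v \<in> V. slots [S] v = [SO]} = V - S"
        using SV by (auto simp: sl)
      moreover have "card (V - S) = 8 - card S" using SV V8 finV by (simp add: card_Diff_subset finite_subset)
      ultimately show ?thesis using c by auto
    qed
    show "\<forall>v\<in>V. slots [S] v \<in> fst ` set [([SA], card S), ([SO], 8 - card S)]" by (auto simp: sl)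
  qed (use S le4 in \<open>auto simp: pat_def\<close>)
  then show "sem (ND 8 (6 - card S) [([SA], card S), ([SO], 8 - card S)])" by auto
qed

theorem search_complete:
  assumes "ok reps [ND 8 0 [([SA], 6), ([SO], 2)]] c6" "ok reps [ND 8 1 [([SA], 5), ([SO], 3)]] c5"
    "ok reps [ND 8 2 [([SA], 4), ([SO], 4)]] c4" and "card V = 8"
  shows "\<exists>R\<in>set reps. has_matrix V \<F> R"
proof -
  have "\<F> \<noteq> {}" using cF by auto
  then obtain S where S: "S \<in> \<F>" "\<forall>T\<in>\<F>. card T \<le> card S"
    using Max_in[of "card ` \<F>"] Max_ge[of "card ` \<F>"] finF
    by (metis (no_types, lifting) finite_imageI imageE imageI image_is_empty)
  note s = start_sem[OF assms(4) S]
  consider "card S = 4" | "card S = 5" | "card S = 6" using s(1) by blast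
  then show ?thesis
  proof cases
    case 1 then show ?thesis using ok_sound[OF assms(3)] s(2) by simp
  next
    case 2 then show ?thesis using ok_sound[OF assms(2)] s(2) by simp
  next
    case 3 then show ?thesis using ok_sound[OF assms(1)] s(2) by simp
  qed
qed

end

section \<open>Tables of types and search certificates\<close>

definition facet_matrix :: "nat list list \<Rightarrow> bool list list" where
  "facet_matrix fs = map (\<lambda>v. map (\<lambda>F. v \<in> set F) fs) [0..<8]"

text \<open>In both systems the hexagon \<open>[0,1,2,3,4,5]\<close> meets \<open>[0,1,6]\<close>,
  \<open>[1,2,6]\<close> and \<open>[0,2,6]\<close> in three sides that close up to a
  triangle.\<close>

definition degenerate_types :: "nat list list list" where
  "degenerate_types = [
   [[5,6,7],[4,6,7],[4,5,7],[3,5,6],[3,4,6],[1,2,6],[0,2,6],[0,1,6],[0,1,2,3,4,5]],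
   [[5,6,7],[4,6,7],[3,5,7],[3,4,7],[4,5,6],[1,2,6],[0,2,6],[0,1,6],[0,1,2,3,4,5]]]"

text \<open>The prism has the triangles \<open>0\<close>, \<open>1\<close>, \<open>4\<close> and
  \<open>5\<close>, \<open>6\<close>, \<open>7\<close>; the apex of the first stacking is
  \<open>2\<close>, that of the second is \<open>3\<close>, placed over \<open>1\<close>,
  \<open>2\<close>, \<open>4\<close>.\<close>

definition type_A :: "nat list list" where
  "type_A = [[5,6,7],[2,3,4],[1,3,4],[0,2,4],[1,2,3],[0,1,2],[1,4,6,7],[0,1,5,7],[0,4,5,6]]"

text \<open>The apexes \<open>3\<close> and \<open>7\<close> cap the prism triangles
  \<open>0\<close>, \<open>1\<close>, \<open>2\<close> and \<open>4\<close>, \<open>5\<close>,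
  \<open>6\<close>.\<close>

definition type_B :: "nat list list" where
  "type_B = [[5,6,7],[4,6,7],[4,5,7],[1,2,3],[0,2,3],[0,1,3],[1,2,4,6],[0,2,5,6],[0,1,4,5]]"

definition rigid_types :: "nat list list list" where
  "rigid_types = [
   [[5,6,7],[4,6,7],[4,5,7],[3,5,6],[2,4,6],[0,1,2],[1,2,3,6],[0,1,3,5],[0,2,4,5]],
   [[5,6,7],[3,4,7],[2,4,6],[1,4,6],[1,4,7],[1,6,7],[0,3,5,7],[0,2,5,6],[0,2,3,4]],
   [[5,6,7],[4,6,7],[4,5,7],[2,3,5],[1,3,5],[2,4,5],[0,1,5],[0,5,6],[0,1,2,3,4,6]],
   [[5,6,7],[4,6,7],[2,3,5],[2,3,7],[1,3,7],[0,1,3],[2,5,7],[0,1,4,7],[0,3,4,5,6]],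
   [[5,6,7],[2,3,4],[1,3,4],[0,4,7],[0,1,7],[0,1,4],[2,3,5,6],[2,4,6,7],[1,3,5,7]],
   [[5,6,7],[4,6,7],[4,5,7],[2,3,6],[1,2,3],[0,4,6],[3,5,6],[0,1,2,6],[0,1,3,4,5]],
   [[5,6,7],[4,6,7],[4,5,7],[3,5,6],[2,3,6],[1,2,6],[0,4,5],[0,1,4,6],[0,1,2,3,5]],
   [[5,6,7],[4,6,7],[4,5,7],[3,4,5],[2,5,6],[1,2,5],[0,3,4,6],[0,1,3,5],[0,1,2,6]],
   [[5,6,7],[4,6,7],[1,2,3],[2,3,4],[0,1,3],[1,2,4],[3,4,5,7],[0,3,5,6],[0,1,4,6]],
   [[5,6,7],[4,6,7],[2,3,5],[1,2,3],[0,3,7],[0,5,7],[0,3,5],[1,3,4,7],[1,2,4,5,6]],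
   [[5,6,7],[4,6,7],[1,2,3],[0,2,3],[0,5,7],[1,3,7],[0,3,7],[1,2,4,7],[0,2,4,5,6]],
   [[5,6,7],[4,6,7],[3,5,7],[2,5,6],[2,4,6],[0,1,2],[0,1,3,7],[1,2,4,7],[0,2,3,5]],
   [[5,6,7],[3,4,7],[2,3,4],[1,2,4],[0,2,3],[0,1,2],[0,3,6,7],[1,4,5,7],[0,1,5,6]],
   [[5,6,7],[2,3,4],[3,4,7],[2,4,6],[4,6,7],[1,3,7],[0,1,5,7],[0,2,5,6],[0,1,2,3]],
   [[5,6,7],[4,6,7],[2,3,7],[1,3,7],[1,5,7],[2,4,7],[0,1,3],[0,1,5],[0,2,3,4,5,6]],
   [[5,6,7],[4,6,7],[2,3,4],[3,4,7],[1,2,3],[0,1,2],[1,3,7],[0,1,5,7],[0,2,4,5,6]],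
   [[5,6,7],[4,6,7],[3,4,7],[1,2,3],[2,3,4],[0,1,2],[0,2,5,7],[0,1,3,7],[2,4,5,6]],
   [[5,6,7],[4,6,7],[3,4,7],[0,1,2],[2,3,4],[1,2,3],[1,3,5,7],[0,1,5,6],[0,2,4,6]],
   [[5,6,7],[4,6,7],[3,5,7],[2,4,7],[2,3,7],[0,1,4],[1,4,5,6],[0,1,3,5],[0,2,3,4]],
   [[5,6,7],[4,6,7],[2,3,7],[3,4,7],[2,5,7],[0,1,6],[1,5,6],[0,4,6],[0,1,2,3,4,5]],
   [[5,6,7],[4,6,7],[3,4,7],[0,1,2],[2,3,4],[1,2,4],[1,4,6],[0,1,5,6],[0,2,3,5,7]],
   [[5,6,7],[4,6,7],[3,4,7],[2,5,6],[1,2,5],[0,4,6],[1,3,5,7],[0,1,2,6],[0,1,3,4]],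
   [[5,6,7],[4,6,7],[2,3,4],[3,4,7],[0,1,7],[1,3,7],[2,4,5,6],[0,2,5,7],[0,1,2,3]],
   [[5,6,7],[4,6,7],[2,3,7],[1,3,7],[1,5,7],[0,2,7],[0,4,7],[1,2,3,5],[0,2,4,5,6]],
   [[5,6,7],[4,6,7],[3,4,7],[2,3,7],[1,5,6],[0,1,6],[1,2,5,7],[0,3,4,6],[0,1,2,3]],
   [[5,6,7],[4,6,7],[2,3,4],[1,3,7],[0,1,7],[0,4,7],[2,4,5,6],[2,3,5,7],[0,1,3,4]],
   [[5,6,7],[4,6,7],[3,4,7],[2,3,7],[1,2,7],[0,1,2],[0,1,5,7],[0,2,5,6],[2,3,4,6]],
   [[5,6,7],[2,3,4],[3,4,7],[0,1,4],[1,4,7],[3,6,7],[0,2,4,5],[2,3,5,6],[0,1,5,7]],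
   [[5,6,7],[4,6,7],[3,5,7],[2,4,7],[2,3,7],[0,1,5],[1,3,5],[0,4,5,6],[0,1,2,3,4]],
   [[5,6,7],[4,6,7],[2,3,7],[3,5,7],[1,2,7],[1,4,7],[0,2,3],[0,1,2,4],[0,3,4,5,6]],
   [[5,6,7],[4,6,7],[3,4,7],[2,3,7],[1,2,3],[0,4,6],[0,3,4],[1,2,5,7],[0,1,3,5,6]],
   [[5,6,7],[4,6,7],[3,5,7],[1,2,7],[2,4,7],[0,1,2],[0,1,3,7],[0,3,5,6],[0,2,4,6]],
   [[5,6,7],[4,6,7],[2,3,5],[1,3,5],[0,2,3],[1,3,4],[0,2,5,7],[0,3,4,7],[1,4,5,6]],
   [[5,6,7],[3,4,7],[4,6,7],[2,4,6],[1,3,7],[0,1,2],[0,2,5,6],[0,1,5,7],[1,2,3,4]],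
   [[5,6,7],[4,6,7],[3,4,7],[1,2,4],[0,5,6],[2,3,4],[2,3,5,7],[0,1,2,5],[0,1,4,6]],
   [[5,6,7],[2,3,4],[1,3,4],[0,2,7],[0,1,2],[1,2,4],[1,3,5,6],[0,1,6,7],[2,3,5,7]],
   [[5,6,7],[2,3,4],[3,4,7],[2,4,7],[3,6,7],[1,3,6],[0,2,5,7],[0,1,5,6],[0,1,2,3]],
   [[5,6,7],[3,4,7],[2,4,7],[1,3,4],[2,4,6],[2,6,7],[0,1,3],[0,3,5,7],[0,1,4,5,6]],
   [[5,6,7],[4,6,7],[4,5,7],[2,3,4],[3,4,5],[1,2,4],[0,3,5,6],[0,1,2,3],[0,1,4,6]],
   [[5,6,7],[4,6,7],[3,4,7],[3,4,6],[1,2,5],[0,1,2],[0,2,5,7],[0,1,3,7],[1,3,5,6]],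
   [[5,6,7],[3,4,7],[4,6,7],[2,5,6],[1,2,6],[1,4,6],[0,3,5,7],[0,1,2,5],[0,1,3,4]],
   [[5,6,7],[4,6,7],[2,3,5],[1,3,4],[0,1,2],[1,2,3],[0,2,5,7],[0,1,4,7],[3,4,5,6]],
   [[5,6,7],[4,6,7],[2,3,5],[1,2,3],[0,5,7],[0,4,7],[3,4,5,6],[0,1,3,4],[0,1,2,5]],
   [[5,6,7],[3,4,7],[1,2,6],[0,1,2],[2,3,4],[0,2,4],[0,4,5,7],[0,1,5,6],[2,3,6,7]],
   [[5,6,7],[4,6,7],[1,2,3],[2,3,5],[3,5,7],[0,1,3],[0,1,4],[0,3,4,7],[1,2,4,5,6]],
   [[5,6,7],[4,6,7],[3,4,7],[2,3,7],[0,1,5],[0,1,2],[1,2,3],[0,2,5,7],[1,3,4,5,6]],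
   [[5,6,7],[4,6,7],[1,2,3],[2,3,5],[3,5,7],[3,4,7],[0,4,5,6],[0,1,3,4],[0,1,2,5]],
   [[5,6,7],[4,6,7],[1,2,3],[0,2,3],[1,5,7],[3,4,7],[0,3,7],[0,1,2,7],[1,3,4,5,6]],
   [[5,6,7],[4,6,7],[2,3,4],[1,2,3],[0,3,4],[0,1,3],[0,4,7],[0,1,5,7],[1,2,4,5,6]],
   [[5,6,7],[3,4,7],[2,3,4],[0,1,4],[1,2,4],[0,4,7],[0,6,7],[0,1,5,6],[1,2,3,5,7]],
   [[5,6,7],[4,6,7],[2,3,5],[1,2,3],[0,5,7],[0,1,5],[1,3,5],[2,4,5,6],[0,1,2,4,7]],
   [[5,6,7],[4,6,7],[3,4,7],[2,3,7],[1,3,4],[1,2,3],[0,5,6],[0,2,5,7],[0,1,2,4,6]],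
   [[5,6,7],[4,6,7],[2,3,5],[1,3,5],[2,5,7],[0,1,5],[0,4,5,6],[0,1,2,3],[0,2,4,7]],
   [[5,6,7],[2,3,4],[1,3,4],[2,6,7],[2,4,7],[0,1,4],[2,3,5,6],[0,1,3,5],[0,4,5,7]],
   [[5,6,7],[4,6,7],[3,4,7],[2,5,6],[1,3,4],[0,1,2],[0,2,5,7],[0,1,3,7],[1,2,4,6]],
   [[5,6,7],[4,6,7],[3,4,7],[2,3,4],[1,2,3],[0,1,3],[0,3,5,7],[0,4,5,6],[0,1,2,4]],
   [[5,6,7],[4,6,7],[2,3,5],[3,5,7],[1,2,3],[0,1,2],[0,1,4],[1,3,4,7],[0,2,4,5,6]],
   [[5,6,7],[4,6,7],[3,4,7],[1,2,5],[0,1,2],[2,3,4],[0,1,5,7],[0,2,3,7],[2,4,5,6]],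
   [[5,6,7],[4,6,7],[2,3,5],[3,5,7],[1,2,5],[0,1,2],[1,4,5,6],[0,2,3,7],[0,1,4,7]],
   [[5,6,7],[4,6,7],[2,3,5],[3,5,7],[0,1,4],[1,2,4],[2,4,5,6],[0,3,4,7],[0,1,2,3]],
   [[5,6,7],[4,6,7],[2,3,7],[3,4,7],[0,1,6],[1,5,6],[0,2,3],[0,3,4,6],[0,1,2,5,7]],
   [[5,6,7],[4,6,7],[1,2,3],[2,3,4],[3,4,5],[0,1,2],[4,5,7],[0,2,4,6],[0,1,3,5,6]],
   [[5,6,7],[4,6,7],[2,3,7],[3,4,7],[1,2,6],[0,1,2],[0,2,5,7],[0,1,5,6],[2,3,4,6]],
   [[5,6,7],[4,6,7],[3,5,7],[2,3,5],[1,2,5],[0,1,5],[0,1,4],[0,4,5,6],[1,2,3,4,7]],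
   [[5,6,7],[4,6,7],[1,2,3],[0,2,3],[0,4,7],[0,3,5],[0,4,5,6],[0,1,2,7],[1,3,5,7]],
   [[5,6,7],[4,6,7],[3,5,7],[2,4,7],[1,2,7],[1,3,7],[0,3,5,6],[0,2,4,6],[0,1,2,3]],
   [[5,6,7],[4,6,7],[2,3,5],[1,3,4],[0,1,3],[0,2,3],[0,2,5,7],[0,1,4,7],[3,4,5,6]],
   [[5,6,7],[4,6,7],[3,4,7],[1,2,5],[0,2,3],[0,1,2],[2,3,5,7],[1,4,5,6],[0,1,3,4]],
   [[5,6,7],[4,6,7],[1,2,3],[0,2,3],[4,5,7],[0,3,4],[3,4,5],[1,3,5,6],[0,1,2,4,6]],
   [[5,6,7],[3,4,7],[2,6,7],[1,3,4],[0,1,4],[0,2,6],[1,3,5,7],[0,1,5,6],[0,2,4,7]],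
   [[5,6,7],[4,6,7],[2,3,5],[1,3,5],[1,2,3],[0,4,7],[1,4,5,6],[0,2,5,7],[0,1,2,4]],
   [[5,6,7],[2,3,4],[1,4,7],[0,3,4],[1,6,7],[0,3,6],[2,4,5,7],[2,3,5,6],[0,1,4,6]]]"

text \<open>Lehmer codes for the accepted leaves when the first facet is a hexagon, in the order in
  which the search reaches them; the two tables that follow serve a first facet with five and with
  four vertices.\<close>

definition certs_6 :: "nat list list" where
  "certs_6 = [
   [6,6,4,1,0,1], [4,5,5,3,3], [4,5,3,3,3], [6,5,3], [5,3,1,1,2], [7,4,0,0,3], [0,5,2,3,0,1], [3,5,3,4,3],
   [3,5,4,3,3], [4,1,1,1,1], [5,4,2,0,1], [1,4,1,2,0,1], [7,6,1,0,3,1], [3,4,4,4,3], [3,4,3,3,3], [2,3,5,4,3],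
   [4,3,1,1,1,0,1], [6,6,2,0,2,2], [5,6,4,1,2,2], [3,2,0,1,2,0,1], [0,0,0,3,3,1,1], [1,2,2], [3,0,2], [0,1,1,1],
   [1,2], [0,2,1], [0,1]]"

definition certs_5 :: "nat list list" where
  "certs_5 = [
   [2,4,4,3,3,2,1], [2,0,5,4,3,2,1], [3,6,0,0,3,1,1], [0,0,5,4,0,1,1], [1,5,4,4,3,1,1], [2,3,0,1,1,2,1],
   [0,2,2,2,0,2,1], [2,3,5,2,3,1,1], [4,4,5,4,0,1,1], [7,6,4,4,1,2,1], [4,2,5,2,0,1,1], [3,6,3,2,2,0,1],
   [0,0,4,3,2,1,1], [4,6,3,0,0,2,1], [6,0,4,4,2,0,1], [5,0,4,3,1,0,1], [1,0,2,2,2,2], [7,4,2,1,0,1,1],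
   [1,0,3,3,3,0,1], [6,2,4,3,2,1,1], [5,2,2,2,3,0,1], [1,0,1,1,1,1,1], [3,1,3,3,3,1,1], [0,1,3,3,1,1,1],
   [3,1,5,2,3,2,1], [2,4,5,4,3,2], [4,6,5,0,3,1,1], [1,2,5,2,3,2], [4,1,2,3,2,0,1], [6,6,4,0,2,0,1], [2,1,2,4,2,0,1],
   [5,1,5,3,2,1,1], [5,3,3,2,3,2], [6,4,5,2,1,1,1], [4,5,5,1,0,2,1], [7,4,1,1,2,0,1], [0,0,2,4,0,1,1],
   [3,0,0,0,3,2,1], [6,6,5,2], [1,2,3,1,0,1,1], [3,4,4,1,3,2,1], [7,4,4,4,3,2], [1,3,5,4,1,1,1], [4,6,4,4,3,2],
   [2,0,5,4,3,2,1], [4,1,2,2,3,0,1], [7,4,4,3,2,1,1], [1,0,1,2,1,2,1], [0,1,5,2,0,2,1], [6,5,5,4,1], [5,3,3,4,3,2,1],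
   [0,1,4,2,3,1,1], [7,4,3,3,3], [0,0,4,1,2,1,1], [1,1,2,2,3,2], [5,5,2,1,0,2,1], [4,2,4,4,0,0,1], [6,5,0,0,3,2],
   [1,1,3,1,2,2], [7,2,2,1,2,2], [3,5,4,0,0,2], [3,1,4,3,0,0,1], [2,1,1,4,2,2], [7,6,0,0,0,2], [6,5,3,1,1,0,1],
   [3,0,1,3,3,0,1], [6,6,2,1,3,1], [1,1,4,4,1], [6,6,1,0,2], [7,6,0,0,1], [0,1,4,4], [2,1,4,0,0,2], [0,5,1,4,2,1],
   [3,0,2,4,1,2], [0,0,0,3,1,2], [4,6,1,1,0,2], [3,2,2,3,3,1], [1,0,5,2,2], [4,6,3], [5,2,0,0,3,1], [2,4,2,1,0,0,1],
   [4,0,3,2,3], [4,6,2], [7,4,1,0,2,1], [0,0,2,0,1,0,1], [4,6,1,1], [2,1,1,0,3], [1,1,3,2,1,1,1], [0,2,5,4,3,1,1],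
   [3,3,5,3,1,0,1], [1,2,1,3,1,2,1], [2,5,2,2,0,2,1], [7,5,3,3,2,2,1], [3,6,5,0,1,2,1], [5,0,3,4,3,1,1],
   [3,1,5,4,0,1,1], [0,4,3,4,2,0,1], [6,6,3,1,2,0,1], [3,2,1,1,2,2,1], [2,0,5,4,1,2,1], [4,1,4,4,3,2,1],
   [2,2,4,2,3,2], [5,4,0,1,3,2,1], [0,2,3,3,3,0,1], [4,4,3,2,1,2,1], [1,3,3,2,3,2], [7,6,4,4,1], [7,6,1,3,3],
   [3,5,5,4,1,1,1], [6,3,2,2,3,0,1], [5,4,5,4,3], [6,3,4,4,0,0,1], [6,6,4,4,2,1], [7,6,4,2,1,0,1], [0,0,3,0,1,1,1],
   [1,0,5,3,2,2], [0,4,2,4,3], [0,0,4,4,1,2], [0,1,1,2,2,2], [7,6,2,0,3], [2,2,4,3,3], [6,6,1,2,0,2], [1,1,4,1,1,0,1],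
   [6,6,0,1,1], [6,6,2,2], [6,3,3,2,3], [7,6,3,0,2,1], [3,0,1,0,3,2], [2,5,5,1,3,2,1], [6,4,2,2,2,2], [5,6,2,2,1,2,1],
   [4,0,2,3,3,2,1], [0,1,3,4,1,2,1], [2,1,3,4,3,2,1], [7,5,4,4,0,1,1], [5,6,5,4,1,0,1], [7,5,1,2,3,0,1],
   [7,6,2,4,0,2], [0,4,5,3,3,1], [2,4,3,0,0,1,1], [5,2,0,0,2,2], [6,6,5,2,2], [7,5,3,0,3,1], [6,6,1,1,2,2,1],
   [4,5,3,0,0,1,1], [7,6,2,1,3,2], [3,0,1,2,3,2], [7,6,1,1,3], [0,0,4,4,0,2], [2,1,4,4], [0,1,2,0,0,2,1],
   [7,6,3,3,1,1], [6,6,3], [7,6,2,0,1], [1,3,2,3,1,0,1], [1,1,4,2,1,2], [3,2,5,4,1,1], [6,6,3,2,2], [1,0,0,1,2,2],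
   [4,0,3,2,0,0,1], [1,1,3,2,0,0,1], [3,1,2,1,1,2], [7,1,1,0,1,1], [2,4,3,0,1,2], [3,1,1,4,1,1], [7,5,1,0,1,1],
   [7,3,0,1], [0,1,1,1,1,2], [2,0,2,2,3], [5,4,1,2,0,0,1], [5,6,3,2,2,1], [2,0,0,2,3], [0,3,1,1,0,2], [7,5,0,2,0,1],
   [3,3,3,2,1,2], [5,6,4,3,2], [4,3,5,3,0,1], [1,3,3,4], [7,5,2,2,1,1], [5,6,2,1,0,1], [4,3,2,2,1,0,1], [2,0,0,0,1,2],
   [3,1,4,0,1,1], [1,3,4,3,1], [6,5,4,0,2], [1,3,4,3], [5,5,1,0,0,1], [3,4,2,1,0,1], [4,0,2,3,2], [2,1,0,3,0,1],
   [0,5,0,3,1,1], [4,2,2,2,0,1], [1,3,2,1], [6,1,0,3,2], [3,5,4,3,2], [3,2,0,2], [5,4,4,3,2], [4,4,3,0,0,1],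
   [3,5,4,3,1], [6,3,2,2,1,1], [0,4,0,2,0,1], [3,0,2,1], [5,2,1,3,1,1], [6,4,1,1,2,1], [0,3,2,1,1,1], [5,2,2,1,1,1],
   [6,1], [5,1,2,2,2], [1,4,1,1,1,1], [0,1,0,1,2,1], [2,0,1,0,0,1], [5,0,0,2], [6,4,2,1,1,1], [4,5,1,1,1,1], [4,5,3,3]]"

definition certs_4 :: "nat list list" where
  "certs_4 = [
   [2,6,5,3,3,2,1], [3,3,1,4,3,2,0,1], [3,0,3,3,2,2,2,1], [7,2,4,3,3,2,2,1], [4,4,3,4,3,2,2,1], [3,3,3,3,3,2,2,1],
   [7,6,5,4,3,1,2,1], [5,0,4,4,3,2,1,1], [1,2,2,3,2,2], [7,6,0,2,2,2,1,1], [6,5,5,3,3,1,2,1], [3,3,0,2,3,2,0,1],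
   [5,0,3,2,2,2,0,1], [2,2,5,4,3,2,2], [3,6,5,3,2,2], [2,5,4,2,3,2], [4,1,4,3,3,2,2], [0,2,2,2,2,2,1,1],
   [5,5,0,3,3,1,2], [1,3,3,4,2,2,0,1], [0,6,2,2,2,2,1], [0,6,5,2,3,2,1], [2,3,1,4,3,2], [0,1,2,4,3,2], [2,1,5,4,2,2],
   [4,5,4,0,3,1,0,1], [0,1,3,3,2,2,0,1], [7,0,4,0,2,2], [4,4,5,4,2,1,2], [0,0,2,2,2,2,2], [7,3,4,4,3,2,2],
   [1,2,2,2,3,2], [4,0,4,2,3,2], [7,6,5,4,3,1,2], [6,5,0,4,2,2,0,1], [2,3,3,4,1,2], [0,6,5,3,1,2,1,1], [0,3,3,1,2,2],
   [7,5,5,0,3,0,1,1], [6,5,0,4,3,0,2,1], [7,6,4,4,1,0,2,1], [4,4,4,4,2,1,2], [5,5,0,3,1,2,0,1], [1,3,5,4,3],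
   [4,1,4,0,2,2,2], [1,6,5,3,3,0,2,1], [1,4,4,1,2,2], [0,1,5,4,3,2,0,1], [0,0,4,3,3,2,1,1], [1,3,3,4,3,0,2],
   [1,1,1,3,3,2,1], [1,5,4,4,0,1,1], [7,6,5,0,1,0,2,1], [0,5,5,4,2,1,2], [0,0,4,4,3,1,2,1], [6,3,5,4,2,1],
   [6,6,3,2,3,0,2], [1,2,5,0,2,2,2,1], [5,5,5,3,0,0,1,1], [7,6,5,2,1,0,2,1], [5,5,0,0,3,0,0,1], [7,6,1,0,3],
   [3,6,5,4,0,1,0,1], [2,1,1,4,3,2], [0,4,4,4,2], [5,5,5,1,1,1,1,1], [6,6,5,0,2,1,1,1], [6,5,3,4,1,1,0,1],
   [2,0,3,1,3,2,1,1], [5,5,5,0,2,1,1,1], [7,3,0,3,3,0,2], [6,5,0,0,3,1,1], [5,0,2,4,3,0,1], [6,0,4,4,0,0,0,1],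
   [6,5,5,1,0,0,2,1], [2,1,4,3,3,0,1,1], [1,1,0,2,2,2,0,1], [2,1,0,3,2,2,2], [6,6,0,4], [3,0,1,4,3,1],
   [6,0,3,0,3,1,1], [2,1,0,3,1,2,2,1], [4,1,1,4,3,1,0,1], [0,3,2,4,1,2,2], [1,3,2,3,1,2,1], [4,0,1,3,3,1],
   [4,1,5,4,2,0,1,1], [4,1,4,4,2,0,2,1], [2,1,2,0,3,2,1], [2,0,0,4,3,1], [1,3,1,0,2,2,2,1], [1,1,1,4,1,2,1,1],
   [6,6,0,2,2,1], [6,4,5,2,1,1,1], [7,3,3,2,3,0,2], [4,2,5,4,2,0,2], [0,5,3,0,1,2,1], [6,1,2,1,3,1], [4,2,4,4,0,1,1],
   [0,2,0,3,3,1,0,1], [0,5,0,4,1,1,1], [3,6,3,1,0,2,2], [1,6,3,4,1,0,2], [7,4,5,2,1,0,2], [7,6,1,0,2,0,0,1],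
   [0,0,2,0,2,2,2], [2,3,0,0,3,2,1,1], [0,0,0,3,3,1,0,1], [5,4,3,3,3,2,1], [6,6,4,2,3,2], [5,5,5,4,3,2,2,1],
   [1,4,4,3,3,2,1], [6,0,4,4,3,1], [2,4,4,2,3,2], [4,6,5,3,3,1], [7,4,3,4,3,0,2,1], [1,2,2,2,3,2], [7,6,5,4,3,0,2],
   [4,6,5,1,3,1], [1,4,4,0,3,2,2], [0,3,5,1,2,2,1], [5,2,4,3,3,0,2,1], [1,4,0,2,2,2,2,1], [6,5,4,4,0,0,0,1],
   [7,6,5,1,3,1,2,1], [2,6,3,3,3,0,2,1], [0,4,4,0,2,2], [0,6,5,3,0,2], [6,5,4,0,3], [3,6,5,4,0,1,1,1], [1,2,3,4,0,2],
   [2,5,4,1,3,1,1], [7,6,2,4,2,0,1], [1,4,0,3,3,1], [5,5,5,1,2,0,2], [0,4,4,4,1,1,1], [5,2,5,4,0,1,2],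
   [3,1,5,0,2,2,2], [5,1,4,4,0,1,2], [3,0,3,3,0,2,1], [0,0,5,4,0,2,1], [4,5,5,3,3], [4,6,5,4,3,0,2], [2,1,3,2,3,2],
   [0,1,4,2,2,2,1], [7,4,5,2,3,0,2], [5,5,4,4,1], [6,6,1,4,1,1,1,1], [3,6,2,4,3,0,1], [1,4,4,1,1,2], [5,2,5,2,3,0,2],
   [7,6,2,2,0,2,1,1], [2,4,4,1,3,1], [3,6,0,1,3,2,2], [1,0,1,2,3,2,2], [5,0,4,0,1,2,0,1], [5,2,1,3,3,0,2,1],
   [7,2,1,4,3,0,1], [1,1,0,3,2,2,1], [4,6,5,3,3,2,1], [5,5,5,1,2,2,2,1], [4,4,3,4,3,0,2,1], [7,4,4,4,1,1,2],
   [0,6,5,4,3,1,1], [1,0,3,3,2,2,1], [4,6,5,1,1,2], [1,3,0,3,3,2,1], [1,1,5,2,3,2,0,1], [4,4,4,0,0,2,1,1],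
   [6,5,3,1,3,1], [6,0,5,4,2,0,1], [1,1,1,4,2,2], [5,5,5,3,2,0,2], [1,4,4,2,0,2,1], [1,6,5,0,1,2,1],
   [1,1,0,2,3,2,1,1], [7,0,5,4,0,0,2,1], [3,4,4,4,2,0,2,1], [0,0,4,1,3,2], [1,6,0,4,0,2,1,1], [7,0,5,0,0,2,1,1],
   [5,5,1,1,0,2,0,1], [2,1,3,1,2,2,0,1], [3,6,5,1,0,2,1,1], [0,5,4,0,0,2], [1,5,5,0,0,2,1], [5,2,1,0,2,2,0,1],
   [7,6,5,3,2,1,2,1], [6,6,3,0,3,0,1], [2,1,5,4,0,2], [2,1,2,1,3,2,2], [1,3,2,4,0,2], [4,0,1,0,3,2],
   [7,4,3,2,3,1,2,1], [4,3,4,0,3,1], [1,6,5,2,2,0,2,1], [6,6,4,2,2,1], [4,3,4,4,2,1,0,1], [2,2,2,0,3,2,2],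
   [2,2,0,3,1,2,2,1], [2,5,5,0,1,1,1], [1,2,2,0,2,2], [0,6,3,4,0,1], [3,1,2,3,3,0,2,1], [4,1,5,0,3,0,0,1],
   [2,0,0,3,1,2], [0,3,0,0,2,2,0,1], [0,5,1,1,1,2,1,1], [0,5,1,0,1,2,1,1], [0,5,5,1,1], [2,0,0,3,3,0,1,1], [1,0,5,4],
   [1,6,5,1,1,1,1], [0,6,3,4,2,1,1], [1,5,5,0,1,1,2], [6,6,4,2,2,1,1], [3,3,5,4,1,0,0,1], [2,0,2,4,3,0,2],
   [2,0,5,2,3,0,0,1], [3,3,4,4,1,1], [7,6,4,1,2,0,2], [0,1,2,3,3,0,1], [0,0,4,2,3], [6,4,5,0,1], [7,6,2,2,1,0,2,1],
   [6,6,0,2,0,0,1,1], [6,6,0,2,1,0,1,1], [6,6,1,0,0,0,1,1], [2,0,5,4,1,0,2,1], [6,6,0,2], [3,0,1,0,3,2],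
   [6,6,4,1,1,1], [4,6,1,1,1,2,2], [4,6,2,2,0,2,2,1], [2,1,2,3,1,2,2,1], [3,2,0,1,3,2,1,1], [0,2,1,3,1,2],
   [7,6,4,1,0,1,0,1], [3,5,5,0,0,1,1,1], [6,6,0,0,2], [1,0,5,2,3,0,0,1], [4,1,1,1,3,2,2], [3,3,2,4,3,0,2,1],
   [0,0,4,2,3,1], [3,0,2,4,0,2,1,1], [4,6,0,1,0,2,2,1], [1,0,0,3,3,1], [2,0,0,1,3,2,0,1], [0,1,0,4,3,1,1,1],
   [3,1,0,4,0,2,1,1], [6,1,0,0,3,0,1,1], [7,6,0,2,1,0,0,1], [1,0,4,4], [3,2,0,4,0,2,1,1], [2,2,0,0,2,2,1],
   [0,5,0,1,0,2,1], [3,6,5,2,0,0,2], [0,0,0,0,2,2,0,1], [0,2,4,4,0,0,1,1], [7,6,2,1,1,0,0,1], [1,1,5,1,2,1,2],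
   [2,2,0,1,3,1,1,1], [5,4,1,0,3,1], [7,3,3,3,1,1,1,1], [0,1,1,1,1,2], [5,6,4,3,2,1,1], [2,3,5,3,2,0,2],
   [3,6,0,1,1,1,1,1], [7,3,3,3,1,0,2], [3,6,1,3,0,1,1], [4,1,5,2,2,0,2], [0,4,5,1,0,1,1], [5,0,5,2,2,1,1],
   [3,6,2,2,1,1,2], [7,3,4,3,2,0,2,1], [1,0,5,1,1,1,1], [3,6,1,0,2,1,2,1], [1,2,0,2,3,1,2,1], [5,0,1,1,1,2],
   [7,3,4,3,0,1,1], [4,6,4,3,1,0,2], [1,0,1,2,1,2,0,1], [4,4,1,0,3,1,0,1], [2,3,5,1,0,1,2], [2,0,0,1,1,2],
   [7,0,0,2,2,0,0,1], [7,0,0,3,2], [0,4,0,2,0,2,1], [1,1,0,2,1,2,0,1], [3,3,0,1,3,1,2], [7,4,3,0,2,0,2],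
   [5,1,0,2,0,2,2], [5,2,2,2,1,2,1], [3,0,5,2,1,1,2], [3,3,5,1,2,1,2], [5,2,5,0,1,1,2], [7,4,0,2,2,1,1],
   [0,2,2,4,0,1,1], [1,2,1,1,3,1], [2,4,2,4,0,1], [3,1,2,4,0,1,2], [5,6,4,3,0,0,1,1], [0,3,2,0,3,1,1],
   [1,0,0,1,3,1,0,1], [0,3,5,0,2,0,1], [1,0,5,2,0,1,1], [1,4,2,2,1,2,0,1], [5,0,5,3,1,1], [1,4,1,4,2,1],
   [2,3,2,0,3,1,0,1], [5,2,0,4,2,1], [7,4,3,3,1,0,2], [1,1,3,4,2,1,0,1], [7,4,0,0,1,1,1], [0,1,3,0,1,2,2],
   [5,1,0,4,2,0,1], [1,1,3,1,3,1,2], [3,0,2,1,1,2,0,1], [0,2,2,0,3,1], [5,6,0,0,2,1,2], [7,4,4,0,0,0,2],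
   [4,6,1,1,0,1,0,1], [7,4,4,0,0,0,2], [5,2,0,0,3,1,1], [0,2,5,3], [0,0,0,2,0,2,1], [7,3,4,2], [0,0,0,0,1,2],
   [0,1,0,0,1,2], [7,5,3,0,1,0,1], [5,3,2,0,3,1,2], [7,4,0,2,0,1,2], [0,1,2,1,1,2], [4,6,2,3,0,1], [0,2,3,0,3,1,1],
   [0,0,3,1,1,2,1], [4,6,1,3,2,1], [5,3,2,4,2,0,2], [7,4,0,3,2,0,1], [5,3,5,0,0,1,2], [0,1,3,4,2], [5,6,2,1,2,0,1],
   [0,3,0,0,3,1], [4,6,2,2,0,1], [3,4,1,2,0,2], [4,1,1,4,0,1,2], [5,0,5,3,0,0,0,1], [5,0,1,4,2,0,0,1],
   [2,0,1,2,0,2,2], [1,2,1,0,1,2,0,1], [0,0,5,3,1,0,0,1], [7,5,0,0,1,0,2], [7,1,4,2,0,0,0,1], [3,2,1,2,0,2,2],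
   [2,2,0,0,1,2,2], [7,5,3,2,0,0,1,1], [1,2,1,0,1,2,1], [7,1,0,3,1], [7,0,0,3,1,0,0,1], [0,0,5,2,0,0,1], [7,0,2],
   [1,0,1,1,0,2,2,1], [1,0,0,0,0,2,2], [2,1,0,1,0,2,1], [3,1,1,1,3,0,2,1], [7,0,0,2,1,0,1], [0,2,1,0,0,2,1],
   [7,2,2,2,1,0,2], [1,0,0,1,0,2,1,1], [1,1,0,1,3,0,1,1], [2,1,1,1,0,2,2], [7,3,2,0,0,0,0,1], [3,3,2,4,2,2,2],
   [2,2,2,2,3,2,2,1], [7,6,4,3,3,2,2], [7,5,4,3,3,2,2], [1,5,2,2,3,2,1], [5,4,0,4,3,2,1,1], [7,6,4,4,3,1,2],
   [3,0,3,3,3,2,1], [5,4,4,4,2,1,0,1], [1,0,2,3,3,2,1,1], [5,6,4,2,3,0,1,1], [7,6,0,3,3,1,2], [4,4,5,0,3,0,1,1],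
   [4,4,5,1,0,2,1,1], [1,1,4,4,3,2], [0,3,3,4,3,1], [5,4,0,0,3,2,1], [4,0,4,4,3,0,1], [6,6,5,4,0,0,0,1],
   [0,4,1,4,3,1,1], [3,1,3,4,0,2,1], [2,5,1,3,3,1,0,1], [7,6,3,0,3,1,2], [5,1,4,0,3,1], [5,3,5,0,0,2,1],
   [0,4,2,1,2,2,1], [5,6,2,4,2], [3,1,5,3,3,0,2], [6,6,3,1,0,2,2], [1,0,4,4,1,2,1,1], [3,2,5,4,3,2,0,1],
   [4,4,5,3,1,2,2,1], [3,5,0,3,3,2], [6,6,5,2,1,2,1], [0,6,4,3,3,1], [6,4,4,0,0,2,0,1], [7,6,4,4,2,1,2,1],
   [6,4,1,4,3,0,2], [6,6,5,1,3,1,1], [1,0,2,2,2,2], [6,3,2,1,3,2,2], [0,2,3,3,3], [2,2,4,3,1,2,2,1], [5,6,0,2,3,1],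
   [1,0,1,2,3,2], [3,0,0,3,3,2,0,1], [1,1,0,3,3,2,1,1], [2,0,4,4,0,2,1,1], [6,6,0,1,1,2,2,1], [6,6,1,0,1,2,2,1],
   [1,5,1,4,3,0,2,1], [0,0,0,2,2,2], [6,6,2,1,0,2,2], [5,6,5,3,2,1], [1,0,5,4,3,1,0,1], [7,5,5,1,0,0,0,1],
   [2,4,5,0,0,2,1,1], [0,1,0,4,2,2,1,1], [1,1,4,2,1,2,0,1], [4,2,0,3,1,2], [6,6,1,1,2,1,2,1], [3,6,3,4,2,0,2],
   [7,6,4,3,0,1,2,1], [7,6,4,3,0,0,1], [1,1,5,4,1,1,1], [2,5,0,2,3,1,2,1], [3,3,1,0,3,2,0,1], [4,0,5,4,2,0,1],
   [6,6,0,2,0,1,2], [4,0,1,4,3,1,0,1], [1,3,2,3,0,2], [0,5,2,1,3,1], [7,6,3,3,0,1,1], [4,1,5,0,1,2,2],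
   [4,0,5,4,0,1,0,1], [4,6,1,1,3,1,1], [6,3,2,4,0,1,2], [3,1,4,0,1,2], [0,0,2,1,3,2,1], [6,6,2,1,0,1], [6,6,2,3],
   [6,6,2,3], [0,1,2,4,3,1], [7,6,0,0,1,1,2], [4,1,1,4,3,0,2], [0,0,2,0,2,2,1], [4,1,1,0,3,2,2], [7,2,2,0,0,2,0,1],
   [3,2,0,3,3,0,1,1], [1,1,0,3,0,2,2], [7,2,1,4,1,0,2], [1,0,1,3,0,2,1,1], [0,0,0,0,2,2,1], [1,4,5,4,3,2],
   [0,2,2,3,3,2], [4,5,4,4,2,1], [0,3,1,2,3,2,1], [4,5,5,4,1,1], [1,0,4,4,2,2,0,1], [0,4,4,4,1,1,1],
   [5,6,0,2,3,1,2,1], [6,6,0,1,3,1,2], [0,0,1,3,3,2], [0,1,0,2,3,2,1], [1,0,3,4,0,2,1,1], [1,1,1,1,2,2,2,1],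
   [6,6,3,3,2,1,2], [2,0,2,4,3,1,1], [4,3,1,0,2,2], [3,0,5,4,2], [2,1,4,2,3,0,2,1], [7,6,2,0,0,1,2,1],
   [7,6,4,2,2,1,1], [0,0,1,1,3,2], [6,4,5,0,0,0,1,1], [2,3,4,0,0,2,0,1], [0,0,0,3,1,2,0,1], [2,2,1,0,2,2,1,1],
   [3,2,1,3,3,0,2,1], [0,0,1,0,3,2], [6,6,3,2,2,1,2], [7,6,4,3,0,0,1,1], [0,0,5,4,0,1,0,1], [7,6,1,1,0,0,2,1],
   [3,0,4,4,1], [3,2,1,0,2,2,2,1], [7,5,4,3,2,1,2,1], [3,3,3,4,1,1,2], [2,6,4,2,2,0,2,1], [4,4,0,2,0,2,0,1],
   [1,2,2,4,1,1], [7,4,4,0,2,1,1,1], [7,5,3,3,1,1,2,1], [5,4,0,4,2,1,2,1], [2,6,4,2,0,1,1,1], [0,2,5,3,2],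
   [3,1,3,0,1,2,2], [0,2,2,0,1,2], [5,1,3,4,0,0,1,1], [5,4,5,1,0,0,2], [4,0,3,4,2,1,1,1], [1,1,3,2,3,0,0,1],
   [7,3,4,1,1,0,2,1], [7,2,0,0,2,0,1,1], [7,5,0,0,1,0,1,1], [2,2,2,1,1,2,0,1], [3,2,1,4,1,1], [4,4,2,1,1,2,0,1],
   [3,2,0,1,3,1,1,1], [7,0,4,2,1,1,1,1], [3,2,3,0,3,1], [1,4,3,0,1,2], [1,4,5,0,1,1,1], [4,4,5,1,1,0,2],
   [2,6,4,0,0,1,1,1], [5,4,1,2,3,1], [3,6,0,3,1,1,1,1], [7,1,4,3,0,1,2,1], [5,0,5,3,0,1,1], [0,3,3,1,0,2,1],
   [1,6,4,0,0,1,1], [1,3,3,4,1,0,2,1], [4,1,1,0,1,2,0,1], [1,0,1,0,1,2], [2,2,0,4,0,1,0,1], [2,1,0,0,1,2],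
   [2,0,0,4,0,1,0,1], [5,1,0,1,3,0,0,1], [7,5,0,0,0,0,1,1], [0,4,2,0,0,2], [3,6,4,1,0,0,2,1], [2,2,5,1,0,0,2,1],
   [1,1,1,1,0,2,2,1], [7,4,0,2,0,0,2,1], [7,1,3,1,0,0,1,1], [3,1,1,0,0,2,1,1], [3,0,1,1,0,2,2,1], [3,2,5,2,0,0,1,1],
   [2,2,1,1,3,1,0,1], [5,4,5,2,2,0,2,1], [7,5,1,1,1,1,1,1], [4,0,2,1,1,2,0,1], [0,1,1,2,1,2], [2,1,3,2,3,1,1,1],
   [2,2,2,4,2,0,2], [1,3,3,0,1,2], [0,0,5,3,2,1,0,1], [5,6,0,3,1,0,1], [7,5,4,1,1,0,2], [2,1,0,1,1,2,1,1],
   [2,1,0,2,3,0,1,1], [0,2,1,0,3,1,0,1], [2,1,1,0,1,2,2,1], [1,1,5,3,1,1], [5,6,1,0,2,1,1], [7,5,4,0,0,0,2,1],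
   [7,5,2,2,1,0,1,1], [0,0,3,4,1,0,0,1], [3,2,1,0,1,2,1,1], [0,3,1,1,0,2], [1,0,0,1,0,2,1,1], [7,2,1,2,1,0,1],
   [1,0,0,0,0,2,1], [7,2,1,1,1,0,1,1], [7,0,2,2,0,0,1,1], [7,4,1,0,0,0,2], [7,2,2,2,0,0,1], [2,0,0,0,0,2],
   [2,1,0,0,0,2,2,1], [7,5,3,2,2,1,2,1], [4,3,5,3,2,0,0,1], [7,5,1,2,1,1,1], [2,2,2,2,3,0,2,1], [2,2,2,0,1,2,2,1],
   [5,6,2,1,1,1,2], [2,0,3,4,1,1], [3,3,3,1,3,0,2,1], [0,0,1,1,3,1], [7,5,1,1,0,1,1,1], [5,2,5,0,0,1,1,1],
   [4,2,3,0,0,2,0,1], [5,6,1,1,0,0,2], [3,0,0,4,2,0,1], [0,0,1,0,3,1], [4,3,2,1,1,2,2,1], [4,3,1,0,1,2,1,1],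
   [7,5,4,0,0,0,2,1], [2,2,1,0,1,2], [3,0,5,3,1], [0,0,0,2,0,2,0,1], [3,3,2,1,0,2,2,1], [3,0,2,1,0,2,0,1],
   [2,1,1,0,0,2,0,1], [7,1,0,2], [7,4,3,0,0,0,2], [7,1,1,0,1,0,2,1], [7,3,3,2,1,0,2], [3,2,2,0,0,2,2],
   [3,0,1,1,0,2,1,1], [7,4,3,1,1,0,2,1], [7,3,2,2,1,0,2], [7,3,3,2,0,0,1], [7,2,1,1], [3,2,1,1,1,1],
   [2,2,0,3,2,1,0,1], [1,3,3,3,0,1,0,1], [0,5,4,3], [3,4,3,3,2,1,2], [3,0,3,2,2,1,2,1], [5,2,3,3,1,1],
   [3,2,2,0,2,1,2,1], [6,5,4,2,0,1,1,1], [3,1,1,2,1,1,1], [4,4,4,1,2,0,2,1], [3,4,4,3,0,1,1], [6,5,3,0,2,0,0,1],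
   [4,4,3,0,2], [4,4,4,0,0,1,2,1], [5,4,4,1,1,1,1,1], [5,5,2,3,1,1,0,1], [4,4,4,2,0,1,2,1], [6,5,4,0,2,1,1,1],
   [3,0,4,1,1,1,1,1], [5,4,0,3,0,1], [3,0,0,2,2,1,2], [5,1,4,3,0,1,0,1], [5,5,4,0,0,1,2,1], [3,1,3,3,2,0,1,1],
   [5,5,1,0,2,0,1], [6,1,1,2,2,0,1], [5,4,2,1,2,0,2], [4,2,0,3,2,0,2], [6,5,1,1,1,1], [5,2,1,2,2,1,2,1],
   [0,5,3,2,1,1,1,1], [0,5,4,3,0,1], [1,1,3,3,2,1,0,1], [0,2,1,2,2,1,2], [1,1,4,3,1,1], [0,3,1,3,2,1,1],
   [4,0,2,1,2,1], [6,5,0,0,1,1,1,1], [0,2,3,3,0,1,2,1], [1,0,2,1,1,1], [3,1,1,3,1,1,2,1], [4,3,0,1,1,1,1,1],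
   [2,4,2,2,1,1,2,1], [0,3,2,3,1,1], [2,4,0,1,1,1,2], [6,1,0,1,2,1,1,1], [4,0,0,2,1,1,1,1], [0,5,0,2,1,1,1],
   [0,3,4,3,0,1,1,1], [1,0,1,1,2,1,0,1], [4,5,4,0,0,0,1,1], [5,5,2,0,0,1,0,1], [5,5,0,3,2,1,0,1], [2,1,4,0,2,1],
   [3,4,4,1,1,0,2,1], [6,5], [1,0,3,0,2,0,0,1], [1,3,2,1,1,1,2], [4,3,2,2,0,1], [3,0,0,1,1,1], [4,5,4,1,1,1,1],
   [6,5,3,3,2,1], [4,2,0,3,1,1,2,1], [3,2,4,3,2,0,0,1], [4,2,2,0,1,1,2], [4,0,0,3,1,1], [3,0,3,0,2,1,0,1],
   [0,2,0,1,2,1,0,1], [4,0,0,3,2,0,1,1], [1,0,3,3,2], [4,4,4,1,1,1,1], [4,5,4,0,1,1,2], [1,0,3,1,2,1,0,1],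
   [0,0,4,1,2,1], [5,5,1,1,2,0,2,1], [6,5,0,1,2,0,1,1], [6,5,0,0,2,0,1,1], [6,5,0,1,2], [3,2,1,1,1,1,2],
   [0,1,4,1,2,1], [4,0,2,2,0,1,1,1], [4,3,1,2,2,0,2,1], [4,2,0,2,0,1,1,1], [0,0,4,3,0,1], [1,3,0,0,2,1,1],
   [4,4,4,0,0,0,2], [5,5,1,1,2,0,0,1], [0,4,2,3], [0,1,1,0,2,1], [0,5,0,0,0,1,1,1], [0,4,2,3,1,0,1], [6,5,3,1,1,0,1],
   [5,5,3,1,1,0,2], [2,0,0,0,1,1,0,1], [0,0,0,3,2], [3,4,0,0,0,1,2,1], [2,1,1,3,2,0,2,1], [1,0,0,2,2,0,1,1],
   [3,3,2,1,0,1,0,1], [6,4,3,1,0,0,1,1], [1,1,1,1,0,1,0,1], [1,1,2,0,0,1], [6,3,2,1,0,0,0,1], [2,2,2,1,0,1,1,1],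
   [4,1,1,1,0,1,1,1], [1,3,2,0,0,1,1], [6,4,1,2,1,0,2,1], [4,0,4,0,1,0,1,1], [0,1,2,0,2,0,1], [0,1,1,0,2],
   [6,3,2,2,1,0,2], [0,3,2,1], [4,3,0,1], [5,3,3,2,1,0,2,1], [0,0,1,0,0,0,0,1], [5,0,1,2,0,0,1], [0,3,1,1,0,0,2],
   [4,0,0,0,0,0,2,1], [2,1,2,1,1,0,2], [5,1,0,1], [1,0,3,1,1], [2,1,0,0,1,0,0,1], [0,0,2,1,0,0,2,1],
   [5,4,2,1,0,0,1,1], [4,4,1,2,1,1,0,1], [4,3,0,2,1,1], [3,3,3,1,0,1,2,1], [6,2,1,2,2,1,2], [5,4,3,2,2,0,1,1],
   [3,3,4,2,2,1], [6,2,3,3,2,0,1,1], [5,4,3,0,1,1,1,1], [6,0,4,0,1,1,1,1], [4,3,3,1,0,1,1,1], [4,0,2,2,0,1],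
   [6,2,1,2,1,1,1], [3,3,3,2,2,0,2,1], [5,4,4,2,2,1,0,1], [3,3,3,0,1,1,2,1], [6,2,3,2,2,0,2,1], [4,4,3,1,0,1,2,1],
   [4,0,3,2,0,1,0,1], [6,1,2,0,2,1,2,1], [6,4,4,3,0,0,1], [6,4,3,3,0,0,2], [1,1,1,3,1,1,2], [4,4,3,2,2,0,0,1],
   [6,1,2,2,2,0,2,1], [5,4,1,3,1,1], [5,4,0,1,2,1,1,1], [5,4,3,1,2,1], [6,0,2,3,2,1,1,1], [2,2,2,0,1,1,0,1],
   [1,0,3,2,1,1], [4,4,0,3,0,1,0,1], [0,2,3,0,1,1], [6,2,0,3,0,1,2,1], [6,1,1,2,0,1,1,1], [5,4,3,2,2,1,1,1],
   [3,5,0,1,2,1,1], [0,0,3,2,2,1,0,1], [0,0,1,3,2,1,0,1], [0,1,3,0,1,1], [6,2,1,0,1,1,2], [6,4,4,2,1,0,1],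
   [6,5,4,2,1,0,1], [3,5,1,1,1,1,2], [4,4,3,2,2,0,2,1], [0,0,2,2,2,1], [1,0,1,3,1,1], [2,1,2,0,1,1,0,1],
   [6,1,0,3,0,1], [6,5,4,0,1,0,2], [6,4,4,2,1,0,2], [6,1,1,2,0,1], [1,2,1,0,1,1], [1,2,4,0,2,0,1], [5,5,3,1,1,0,2,1],
   [5,1,1,3,1,0,2], [0,0,3,0,2,0,0,1], [3,5,1,0,0,1,1], [3,2,4,0,0,1,1,1], [5,2,2,0,0,1,0,1], [6,3,2,1,0,1,1,1],
   [2,2,0,0,0,1,0,1], [2,2,4,1,1,0,2], [4,5,3,0,0,0,1,1], [3,2,4,0,0,0,2,1], [4,2,2,0,0,1], [6,3,2,1,0,0,2,1],
   [4,0,1,3,1,0,1], [0,0,2,0,2], [3,5,1,0,0,0,2], [6,4,3,2,1,1,2,1], [5,5,4,2,1,1,1,1], [1,1,1,3,2,1],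
   [6,3,3,0,1,1,1,1], [6,4,2,2,0,1,2,1], [4,3,0,3,1,1,2,1], [4,1,2,3,0,1,1,1], [4,3,4,1,0,1,2], [6,5,0,0,2,0,1,1],
   [6,4,0,0,0,1,1,1], [4,3,2,2,2,1], [4,0,4,2,1,1,1], [6,1,3,2,0,1,2,1], [5,5,0,3,0,1,1,1], [2,0,0,3,2,1,0,1],
   [4,1,0,2,2,0,0,1], [6,4,0,1,0,1,1,1], [5,5,4,1,0,0,2,1], [5,2,4,1,0,0,2,1], [5,2,1,0,0,1,1,1], [5,0,4,2,1,0,1,1],
   [5,0,1,1,0,1,2,1], [6,4,4,1,1,1,1,1], [5,1,0,1,1,1,1,1], [5,0,1,0,1,1,2,1], [6,5,0,1,1,0,1,1], [1,0,3,0,0,1,1],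
   [1,1,0,2,0,1,2,1], [5,1,1,1,1,1,2,1], [6,4,4,0,0,1,2,1], [5,2,1,0,1,1,1,1], [2,2,3,0,0,1,2], [2,0,1,2,0,1,1,1],
   [6,5,3,1,1,0,2,1], [0,1,4,2,1], [2,1,2,0,0,1,2], [3,0,2,3,1,0,1,1], [0,2,2,1,0,1,1], [1,5,3,0,0,0,1],
   [2,2,2,3,1,0,2,1], [0,1,1,0,0,1], [3,1,1,0,0,1,0,1], [3,0,1,0,0,1,0,1], [0,0,4,2,1,0,0,1], [0,0,0,1,0,1],
   [3,2,1,0,0,1], [2,0,4,2,1], [0,0,0,1,0,1,0,1], [5,0,1,1,1,0,1], [4,4,0,0,1,0,1], [1,0,1,2,1], [3,1,0,0,0,0,0,1],
   [1,3,0,1,0,0,2,1], [4,4,1,2,1,0,2], [1,2,1,0,1], [1,3,1,2], [0,3,0,2,0,0,1], [0,4,2,1,0,0,1,1], [5,4,0,1,0,0,1],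
   [3,1,0,2,1,0,2], [4,3,1,1,1,0,2], [2,2,1,2,1,0,2,1], [1,1,0,1,1,0,1,1], [4,1,3,1,1], [3,3], [0,2,1,1], [4,3,2],
   [0,4,1,0,1,0,1], [1,2,1,1,0,0,1], [0,3,3,0,0,0,0,1], [3,2,1,2,1,0,2,1], [2,1,0,0,0,0,0,1], [4,0,1,0,0,0,2],
   [1,3,3,1,1], [2,0,1,1,0,0,0,1], [4,1,0,0,0,0,0,1], [2,0,0,2,0,0,1,1]]"


definition reps :: "bool list list list" where
  "reps = map facet_matrix (degenerate_types @ type_A # type_B # rigid_types)"

text \<open>A source of rewrite rules: with literal matrices substituted, each membership test at a
  leaf becomes a single rewriting step.\<close>

lemma reps_mem: "list_all (\<lambda>R. R \<in> set reps) (map facet_matrix (degenerate_types @ type_A # type_B # rigid_types))"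
  by (simp add: reps_def list_all_iff)

lemma upt_8: "[0..<8] = [0, 1, 2, 3, 4, 5, 6, 7 :: nat]" by (simp add: upt_rec)

lemmas reps_mem_eval = reps_mem[unfolded degenerate_types_def type_A_def type_B_def rigid_types_def
  append.simps list.map facet_matrix_def upt_8 list.pred_inject, simplified]

section \<open>Evaluation of the search by rewriting\<close>

context begin

text \<open>These auxiliary constants act as continuations. Their leading arguments hold the values
  currently being computed, and the congruence rules below permit rewriting only there, which
  imposes a call-by-value order on the simplifier.\<close>

private definition "okL b cs st cts \<longleftrightarrow> (if b then (case cts of [] \<Rightarrow> False | c # cts' \<Rightarrow>
    normal c cs \<in> set reps \<and> list_all (\<lambda>(sl, n). n = Suc 0) cs \<and> ok reps st cts') else ok reps st cts)"
private definition "okR b cs st cts \<longleftrightarrow> b \<and> list_all (\<lambda>(sl, n). n = Suc 0) cs \<and> ok reps st cts"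
private definition "okR2 b st cts \<longleftrightarrow> b \<and> ok reps st cts"
private inductive_simps ok_ND0: "ok R (ND 0 e cs # st) cts"
private inductive_simps ok_NDS: "ok R (ND (Suc k) e cs # st) cts"

text \<open>A work list with an accumulator; results are collected in reverse order, and
  \<open>okC\<close> restores the order while pushing them onto the stack.\<close>

private definition "loop gs acc = rev (concat (map emits gs)) @ acc"
private definition "okC L st cts \<longleftrightarrow> ok reps (rev L @ st) cts"
private definition "okG ts b k e j sl n cs = loop [GM k e (Some j) sl n n (Suc 0) cs ts b []] []"
private definition "okN ts b k e cs = loop [GN k e None cs ts b []] []"
private definition "okT2 x k e cs = (case x of None \<Rightarrow> okN (no_tallies cs) (budget e) k e cs
  | Some (j, sl, n, cs') \<Rightarrow> okG (map (\<lambda>_. TN) sl) (budget e) k e j sl n cs')"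
private definition "okT1 x k e cs = (case x of None \<Rightarrow> okT2 (target SA cs []) k e cs
  | Some (j, sl, n, cs') \<Rightarrow> okG (map (\<lambda>_. TN) sl) (budget e) k e j sl n cs')"
private definition "okE3 x k e gs acc = (case x of None \<Rightarrow> loop gs acc | Some cs \<Rightarrow> loop gs (ND k e cs # acc))"
private definition "updm acc vis ts = upd vis ts acc"
private definition "outs cs = map (\<lambda>(sl, n :: nat). (SO # sl, n)) cs"
private definition "okE2 b k e cs ts vis gs acc = (if b then okE3 (updm (outs cs) vis ts) k e gs acc else loop gs acc)"
private definition "okE1 x k j cs ts vis gs acc = (case x of None \<Rightarrow> loop gs acc | Some e \<Rightarrow> okE2 (tdj j ts) k e cs ts vis gs acc)"
private definition "okM x k e j sl n r m cs ts b vis gs acc = (case x of None \<Rightarrow> loop (GM k e j sl n r (Suc m) cs ts b vis # gs) acc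
  | Some ts' \<Rightarrow> loop (GN k e j cs ts' b (((sl, n), m) # vis) # GM k e j sl n r (Suc m) cs ts b vis # gs) acc)"
private definition "updo h bs r m vis ts = (case h of None \<Rightarrow> None | Some h \<Rightarrow> upd vis ts ((h # bs, Suc m) # r))"
private definition "targeto f t sl n cs acc = (case f of None \<Rightarrow> target t cs ((sl, n) # acc) | Some j \<Rightarrow> Some (j, sl, n, acc @ cs))"
private definition "inso b r s ss = (if b then r # s # ss else s # ins_row r ss)"


private lemma ok_eqs:
  "ok reps [] cts = True"
  "ok reps (ND 0 (Suc e) cs # st) cts = ok reps st cts"
  "ok reps (ND 0 0 cs # st) cts = okL (leaf_ok cs) cs st cts"
  "ok reps (ND (Suc k) e cs # st) cts = okC (okT1 (target SB cs []) k e cs) st cts"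
  "okC [] st cts = ok reps st cts"
  "okC (x # xs) st cts = okC xs (x # st) cts"
proof -
  show "ok reps [] cts = True" by (simp add: ok_Nil)
  show "ok reps (ND 0 (Suc e) cs # st) cts = ok reps st cts" by (subst ok_ND0) auto
  show "ok reps (ND 0 0 cs # st) cts = okL (leaf_ok cs) cs st cts"
    by (subst ok_ND0) (auto simp: okL_def split: list.splits)
  show "ok reps (ND (Suc k) e cs # st) cts = okC (okT1 (target SB cs []) k e cs) st cts"
    by (subst ok_NDS) (auto simp: okC_def okT1_def okT2_def okG_def okN_def loop_def split: option.splits)
qed (simp_all add: okC_def)

private lemma loop_eqs:
  "loop [] acc = acc"
  "loop (ND k e cs # gs) acc = loop gs (ND k e cs # acc)"
  "loop (GN k e j [] ts b vis # gs) acc = okE1 (eres e b) k j [] ts vis gs acc"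
  "loop (GN k e j (c # cs) ts 0 vis # gs) acc = okE1 (eres e 0) k j (c # cs) ts vis gs acc"
  "loop (GN k e j ((sl, n) # cs) ts (Suc b) vis # gs) acc =
     loop (GN k e j cs ts (Suc b) (((sl, n), 0) # vis) # GM k e j sl n n (Suc 0) cs ts (Suc b) vis # gs) acc"
  "loop (GM k e j sl n 0 m cs ts b vis # gs) acc = loop gs acc"
  "loop (GM k e j sl n (Suc r) m cs ts 0 vis # gs) acc = loop gs acc"
  "loop (GM k e j sl n (Suc r) m cs ts (Suc b) vis # gs) acc = okM (tallys sl m ts) k e j sl n r m cs ts b vis gs acc"
proof -
  show "loop (GN k e j [] ts b vis # gs) acc = okE1 (eres e b) k j [] ts vis gs acc"
    by (simp add: loop_def okE1_def okE2_def okE3_def updm_def outs_def emits_GN emits_ND emit_def split: option.splits)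
  show "loop (GN k e j (c # cs) ts 0 vis # gs) acc = okE1 (eres e 0) k j (c # cs) ts vis gs acc"
    by (simp add: loop_def okE1_def okE2_def okE3_def updm_def outs_def emits_GN emits_ND emit_def split: option.splits)
  show "loop (GN k e j ((sl, n) # cs) ts (Suc b) vis # gs) acc =
     loop (GN k e j cs ts (Suc b) (((sl, n), 0) # vis) # GM k e j sl n n (Suc 0) cs ts (Suc b) vis # gs) acc"
    unfolding loop_def by (simp add: emits_GN[of k e j "(sl, n) # cs"])
  show "loop (GM k e j sl n 0 m cs ts b vis # gs) acc = loop gs acc"
    unfolding loop_def by (simp add: emits_GM)
  show "loop (GM k e j sl n (Suc r) m cs ts 0 vis # gs) acc = loop gs acc"
    unfolding loop_def by (simp add: emits_GM)
  show "loop (GM k e j sl n (Suc r) m cs ts (Suc b) vis # gs) acc = okM (tallys sl m ts) k e j sl n r m cs ts b vis gs acc"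
    unfolding loop_def okM_def by (simp add: emits_GM[of k e j sl n "Suc r" m cs ts "Suc b"] split: option.splits)
qed (simp_all add: loop_def emits_ND)

private lemma ok_aux_eqs:
  "okL True cs st [] = False"
  "okL True cs st (c # cts) = okR (normal c cs \<in> set reps) cs st cts"
  "okL False cs st cts = ok reps st cts"
  "okR True cs st cts = okR2 (list_all (\<lambda>(sl, n). n = Suc 0) cs) st cts"
  "okR False cs st cts = False"
  "okR2 True st cts = ok reps st cts"
  "okR2 False st cts = False"
  "okG ts b k e j sl n cs = loop [GM k e (Some j) sl n n (Suc 0) cs ts b []] []"
  "okN ts b k e cs = loop [GN k e None cs ts b []] []"
  "okT2 None k e cs = okN (no_tallies cs) (budget e) k e cs"
  "okT2 (Some (j, sl, n, cs')) k e cs = okG (map (\<lambda>_. TN) sl) (budget e) k e j sl n cs'"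
  "okT1 None k e cs = okT2 (target SA cs []) k e cs"
  "okT1 (Some (j, sl, n, cs')) k e cs = okG (map (\<lambda>_. TN) sl) (budget e) k e j sl n cs'"
  "okE3 None k e gs acc = loop gs acc"
  "okE3 (Some cs) k e gs acc = loop gs (ND k e cs # acc)"
  "updm ac vis ts = upd vis ts ac"
  "outs [] = []"
  "outs ((sl, n) # cs) = (SO # sl, n) # outs cs"
  "okE2 True k e cs ts vis gs acc = okE3 (updm (outs cs) vis ts) k e gs acc"
  "okE2 False k e cs ts vis gs acc = loop gs acc"
  "okE1 None k jj cs ts vis gs acc = loop gs acc"
  "okE1 (Some e) k jj cs ts vis gs acc = okE2 (tdj jj ts) k e cs ts vis gs acc"
  "okM None k e jj sl n r m cs ts b vis gs acc = loop (GM k e jj sl n r (Suc m) cs ts b vis # gs) acc"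
  "okM (Some ts') k e jj sl n r m cs ts b vis gs acc = loop (GN k e jj cs ts' b (((sl, n), m) # vis) # GM k e jj sl n r (Suc m) cs ts b vis # gs) acc"
  by (simp_all add: okL_def okR_def okR2_def okG_def okN_def okT1_def okT2_def okE1_def okE2_def okE3_def okM_def updm_def outs_def)

private lemma fun_eqs:
  "upd (((sl, n), Suc m) # vis) ts acc = updo (hcount sl ts (Some SA)) (bump sl ts) (rest sl n (Suc m) acc) m vis ts"
  "updo None bs r m vis ts = None"
  "updo (Some h) bs r m vis ts = upd vis ts ((h # bs, Suc m) # r)"
  "target t ((sl, n) # cs) acc = targeto (find_slot t sl 0) t sl n cs acc"
  "targeto None t sl n cs acc = target t cs ((sl, n) # acc)"
  "targeto (Some j) t sl n cs acc = Some (j, sl, n, acc @ cs)"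
  "find_slot SB (SB # sl) n = Some n" "find_slot SB (SA # sl) n = find_slot SB sl (Suc n)"
  "find_slot SB (SO # sl) n = find_slot SB sl (Suc n)" "find_slot SB (SC # sl) n = find_slot SB sl (Suc n)"
  "find_slot SA (SA # sl) n = Some n" "find_slot SA (SB # sl) n = find_slot SA sl (Suc n)"
  "find_slot SA (SO # sl) n = find_slot SA sl (Suc n)" "find_slot SA (SC # sl) n = find_slot SA sl (Suc n)"
  "tdnth 0 (TD # ts) = True" "tdnth 0 (TN # ts) = False" "tdnth 0 (TS # ts) = False" "tdnth 0 (TX # ts) = False"
  "tdnth (Suc j) (tt # ts) = tdnth j ts"
  "bump1 TD SO = SO" "bump1 TD SA = SB" "bump1 TD SB = SC" "bump1 TD SC = SC"
  "hcount (SO # sl) (TD # ts) ho = hcount sl ts ho"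
  "hcount (SA # sl) (TD # ts) (Some SA) = hcount sl ts (Some SB)"
  "hcount (SB # sl) (TD # ts) (Some SA) = hcount sl ts (Some SB)"
  "hcount (SC # sl) (TD # ts) (Some SA) = hcount sl ts (Some SB)"
  "hcount (SA # sl) (TD # ts) (Some SB) = hcount sl ts (Some SC)"
  "hcount (SB # sl) (TD # ts) (Some SB) = hcount sl ts (Some SC)"
  "hcount (SC # sl) (TD # ts) (Some SB) = hcount sl ts (Some SC)"
  "hcount (SA # sl) (TD # ts) (Some SC) = hcount sl ts None"
  "hcount (SB # sl) (TD # ts) (Some SC) = hcount sl ts None"
  "hcount (SC # sl) (TD # ts) (Some SC) = hcount sl ts None"
  "hcount (SA # sl) (TD # ts) None = hcount sl ts None"
  "hcount (SB # sl) (TD # ts) None = hcount sl ts None"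
  "hcount (SC # sl) (TD # ts) None = hcount sl ts None"
  "ins_row rw (s # ss) = inso (le_row rw s) rw s ss"
  "inso True rw s ss = rw # s # ss" "inso False rw s ss = s # ins_row rw ss"
  "pat [] = []" "pat (SO # sl) = False # pat sl" "pat (SA # sl) = True # pat sl" "pat (SB # sl) = True # pat sl"
  "pat (SC # sl) = True # pat sl"
  "closed_slots [] 0 = True" "closed_slots [] (Suc d) = False"
  "closed_slots (SC # sl) (Suc d) = closed_slots sl d" "closed_slots (SC # sl) 0 = closed_slots sl 0"
  "leaf_ok [] = True" "leaf_ok ((sl, n) # cs) = (closed_slots sl (Suc (Suc (Suc 0))) \<and> leaf_ok cs)"
  "take_at 1 x xs = take_at (Suc 0) x xs" "take_at (numeral v) x (y # ys) = (case take_at (pred_numeral v) y ys of (z, zs) \<Rightarrow> (z, x # zs))"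
  by (simp_all add: updo_def targeto_def inso_def pat_def leaf_ok_def numeral_3_eq_3 numeral_eq_Suc)

text \<open>A congruence without premises freezes every argument until an equation applies to the
  whole term; the others open exactly the arguments that have to be evaluated first. Thus the long
  stacks and certificate lists are never traversed.\<close>

private lemma congs:
  "ok R st cts = ok R st cts"
  "loop gs acc = loop gs acc"
  "\<And>x y. x = y \<Longrightarrow> okC x st cts = okC y st cts"
  "\<And>x y. x = y \<Longrightarrow> okL x cs st cts = okL y cs st cts"
  "\<And>x y. x = y \<Longrightarrow> okR x cs st cts = okR y cs st cts"
  "\<And>x y. x = y \<Longrightarrow> okR2 x st cts = okR2 y st cts"
  "\<And>x y. ts = ts' \<Longrightarrow> x = y \<Longrightarrow> okG ts x k e j sl n cs = okG ts' y k e j sl n cs"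
  "\<And>x y. ts = ts' \<Longrightarrow> x = y \<Longrightarrow> okN ts x k e cs = okN ts' y k e cs"
  "\<And>x y. x = y \<Longrightarrow> okT1 x k e cs = okT1 y k e cs"
  "\<And>x y. x = y \<Longrightarrow> okT2 x k e cs = okT2 y k e cs"
  "\<And>x y. x = y \<Longrightarrow> okE1 x k jj cs ts vis gs acc = okE1 y k jj cs ts vis gs acc"
  "\<And>x y. x = y \<Longrightarrow> okE2 x k e cs ts vis gs acc = okE2 y k e cs ts vis gs acc"
  "\<And>x y. x = y \<Longrightarrow> okE3 x k e gs acc = okE3 y k e gs acc"
  "\<And>x y. x = y \<Longrightarrow> okM x k e jj sl n r m cs ts b vis gs acc = okM y k e jj sl n r m cs ts b vis gs acc"
  "\<And>x y. x = y \<Longrightarrow> updm x vis ts = updm y vis ts"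
  "upd vis ts ac = upd vis ts ac"
  "\<And>x y a b r s. x = y \<Longrightarrow> a = b \<Longrightarrow> r = s \<Longrightarrow> updo x a r m vis ts = updo y b s m vis ts"
  "target t cs ac = target t cs ac"
  "\<And>x y. x = y \<Longrightarrow> targeto x t sl n cs ac = targeto y t sl n cs ac"
  "find_slot t sl n = find_slot t sl n"
  "hcount sl ts h = hcount sl ts h" "bump sl ts = bump sl ts" "tallys sl m ts = tallys sl m ts"
  "tdnth j ts = tdnth j ts" "leaf_ok cs = leaf_ok cs" "closed_slots sl n = closed_slots sl n" "outs cs = outs cs"
  "rest sl n m ac = rest sl n m ac"
  by simp_all

private lemmas eval_eqs = ok_eqs loop_eqs ok_aux_eqs fun_eqs tally1.simps ocons.simps tallys.simps bump1.simps(2-4) bump.simps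
  hcount.simps(1-3,5,6) rest.simps upd.simps(1,2) tdj.simps eres.simps budget.simps no_tallies.simps find_slot.simps(1)
  target.simps(1) take_at.simps(1-3) lehmer.simps le_row.simps ins_row.simps(1) sort_rows.simps normal.simps
  closed_slots.simps(2,4,5) append.simps list.map case_prod_conv pred_numeral_simps BitM.simps reps_mem_eval list.pred_inject
  numeral_One simp_thms

text \<open>Numbers are written in unary form so that they match the \<open>Suc\<close> patterns of
  the defining equations.\<close>

lemma ok_6: "ok reps [ND (Suc (Suc (Suc (Suc (Suc (Suc (Suc (Suc 0)))))))) 0
    [([SA], Suc (Suc (Suc (Suc (Suc (Suc 0)))))), ([SO], Suc (Suc 0))]] certs_6"
  unfolding certs_6_def by (simp only: eval_eqs cong: congs)

lemma ok_5: "ok reps [ND (Suc (Suc (Suc (Suc (Suc (Suc (Suc (Suc 0)))))))) (Suc 0)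
    [([SA], Suc (Suc (Suc (Suc (Suc 0))))), ([SO], Suc (Suc (Suc 0)))]] certs_5"
  unfolding certs_5_def by (simp only: eval_eqs cong: congs)

lemma ok_4: "ok reps [ND (Suc (Suc (Suc (Suc (Suc (Suc (Suc (Suc 0)))))))) (Suc (Suc 0))
    [([SA], Suc (Suc (Suc (Suc 0)))), ([SO], Suc (Suc (Suc (Suc 0))))]] certs_4"
  unfolding certs_4_def by (simp only: eval_eqs cong: congs)

end

theorem (in facet_system) classification: "card V = 8 \<Longrightarrow> \<exists>R\<in>set reps. has_matrix V \<F> R"
  by (rule search_complete[of reps certs_6 certs_5 certs_4]) (use ok_6 ok_5 ok_4 in \<open>simp_all add: eval_nat_numeral\<close>)

section \<open>Decomposability\<close>

text \<open>Adjacency expressed through facets: different facets share at most two vertices, so two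
  common facets of \<open>v\<close> and \<open>w\<close> meet in the edge between them.\<close>

definition linked :: "'a set set \<Rightarrow> 'a \<Rightarrow> 'a \<Rightarrow> bool" where
  "linked \<F> v w \<longleftrightarrow> v \<noteq> w \<and> (\<exists>S\<in>\<F>. \<exists>T\<in>\<F>. S \<noteq> T \<and> v \<in> S \<and> w \<in> S \<and> v \<in> T \<and> w \<in> T)"

text \<open>Sets of vertices on which a summand must be a homothetic copy. The two vertices to which
  \<open>x\<close> is attached may be nonadjacent: their difference is already known to be scaled by
  the common factor.\<close>

inductive rigid :: "'a set set \<Rightarrow> 'a set \<Rightarrow> bool" for \<F> where
  rigid_edge: "linked \<F> v w \<Longrightarrow> rigid \<F> {v, w}"
| rigid_insert: "rigid \<F> S \<Longrightarrow> linked \<F> x y \<Longrightarrow> linked \<F> x z \<Longrightarrow> y \<in> S \<Longrightarrow> z \<in> S \<Longrightarrow> y \<noteq> z \<Longrightarrow> rigid \<F> (insert x S)"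

text \<open>Of three different collinear points one lies strictly between the others, and the value
  of \<open>k\<close> tells which; that point would not be extreme.\<close>

lemma extreme_not_collinear:
  assumes "x \<in> verts P" "y \<in> verts P" "z \<in> verts P" "x \<noteq> y" "x \<noteq> z" "y \<noteq> z"
  shows "x - z \<noteq> k *\<^sub>R (x - y)"
proof
  assume k: "x - z = k *\<^sub>R (x - y)"
  have P: "x \<in> P" "y \<in> P" "z \<in> P" using assms verts_subset by auto
  have noseg: "\<And>a b c. a \<in> verts P \<Longrightarrow> b \<in> P \<Longrightarrow> c \<in> P \<Longrightarrow> a \<notin> open_segment b c"
    by (auto simp: verts_def extreme_point_of_def)
  have "k \<noteq> 0" using k assms by auto
  have "k \<noteq> 1" using k assms by auto
  consider "0 < k" "k < 1" | "k > 1" | "k < 0" using \<open>k \<noteq> 0\<close> \<open>k \<noteq> 1\<close> by linarith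
  then show False
  proof cases
    case 1
    have "z = (1 - k) *\<^sub>R x + k *\<^sub>R y" using k by (simp add: algebra_simps)
    then have "z \<in> open_segment x y" using 1 assms(4) by (auto simp: in_segment)
    then show False using noseg assms P by blast
  next
    case 2
    define u where "u = 1 / k"
    have u: "0 < u" "u < 1" "u * k = 1" using 2 by (auto simp: u_def)
    have "u *\<^sub>R (x - z) = x - y" using k u by simp
    then have "y = (1 - u) *\<^sub>R x + u *\<^sub>R z" by (simp add: algebra_simps)
    then have "y \<in> open_segment x z" using u assms(5) by (auto simp: in_segment)
    then show False using noseg assms P by blast
  next
    case 3
    define u where "u = 1 / (1 - k)"
    have u: "0 < u" "u < 1" "u * (1 - k) = 1" using 3 by (auto simp: u_def)
    have "z - y = (1 - k) *\<^sub>R (x - y)" using k by (simp add: algebra_simps)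
    then have "u *\<^sub>R (z - y) = x - y" using u by simp
    then have "x = (1 - u) *\<^sub>R y + u *\<^sub>R z" by (simp add: algebra_simps)
    then have "x \<in> open_segment y z" using u assms(6) by (auto simp: in_segment)
    then show False using noseg assms P by blast
  qed
qed

context poly3
begin

lemma normals:
  obtains A \<beta> where "\<And>F x. F \<in> facets P \<Longrightarrow> x \<in> P \<Longrightarrow> A F \<bullet> x \<le> \<beta> F"
    "\<And>F x. F \<in> facets P \<Longrightarrow> x \<in> P \<Longrightarrow> A F \<bullet> x = \<beta> F \<longleftrightarrow> x \<in> F"
proof -
  have "\<exists>a b. \<forall>x\<in>P. a \<bullet> x \<le> b \<and> (a \<bullet> x = b \<longleftrightarrow> x \<in> F)" if F: "F \<in> facets P" for F
  proof -
    obtain a b where "P \<subseteq> {x. a \<bullet> x \<le> b}" "F = P \<inter> {x. a \<bullet> x = b}" using facet_hyperplane[OF F] by metis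
    then show ?thesis by blast
  qed
  then obtain A \<beta> where "\<And>F. F \<in> facets P \<Longrightarrow> \<forall>x\<in>P. A F \<bullet> x \<le> \<beta> F \<and> (A F \<bullet> x = \<beta> F \<longleftrightarrow> x \<in> F)" by metis
  then show thesis using that[of A \<beta>] by blast
qed

lemma in_verts_facet: "F \<in> facets P \<Longrightarrow> v \<in> verts P \<Longrightarrow> v \<in> verts F \<longleftrightarrow> v \<in> F"
  using verts_face[OF facets_face] by blast

lemma linked_edge:
  assumes "linked (facet_verts P) v w"
  obtains F G where "F \<in> facets P" "G \<in> facets P" "F \<inter> G = closed_segment v w"
proof -
  obtain S T where ST: "S \<in> facet_verts P" "T \<in> facet_verts P" "S \<noteq> T" "v \<in> S" "w \<in> S" "v \<in> T" "w \<in> T" "v \<noteq> w"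
    using assms unfolding linked_def by blast
  then obtain F G where FG: "F \<in> facets P" "G \<in> facets P" "S = verts F" "T = verts G" unfolding facet_verts_def by blast
  then have ne: "F \<noteq> G" using ST by blast
  have f: "F \<inter> G face_of P" using face_of_Int[OF facets_face facets_face] FG by blast
  have v: "verts (F \<inter> G) = verts F \<inter> verts G" using verts_Int[OF facets_face facets_face] FG by blast
  have "{v, w} \<subseteq> verts F \<inter> verts G" using ST FG by blast
  moreover have "card (verts F \<inter> verts G) \<le> card {v, w}" using facet_Int_card[OF FG(1,2) ne] ST(8) by simp
  moreover have "finite (verts F \<inter> verts G)" using finite_facet_verts[OF FG(1)] by blast
  ultimately have "{v, w} = verts F \<inter> verts G" by (metis card_seteq)
  then have "F \<inter> G = convex hull {v, w}" using face_conv_verts[OF pt f] v by simp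
  then show thesis using that FG by (simp add: segment_convex_hull)
qed

text \<open>The mixed sums \<open>q v + r w\<close> and \<open>q w + r v\<close> lie in
  \<open>P\<close> and add up to \<open>v + w\<close>. Where a facet contains \<open>v\<close> and
  \<open>w\<close>, both mixed sums must therefore attain the maximum, so they lie on the edge from
  \<open>v\<close> to \<open>w\<close>; the position of \<open>q v + r w\<close> on it gives the
  factor.\<close>

lemma linked_ratio:
  assumes l: "linked (facet_verts P) v w"
    and sum: "\<And>a b. a \<in> Q \<Longrightarrow> b \<in> R \<Longrightarrow> a + b \<in> P"
    and qr: "q v \<in> Q" "q w \<in> Q" "r v \<in> R" "r w \<in> R" "q v + r v = v" "q w + r w = w"
  shows "\<exists>m. 0 \<le> m \<and> m \<le> 1 \<and> q w - q v = m *\<^sub>R (w - v)"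
proof -
  obtain F G where FG: "F \<in> facets P" "G \<in> facets P" "F \<inter> G = closed_segment v w" using linked_edge[OF l] by blast
  obtain A \<beta> where A: "\<And>F x. F \<in> facets P \<Longrightarrow> x \<in> P \<Longrightarrow> A F \<bullet> x \<le> \<beta> F"
    "\<And>F x. F \<in> facets P \<Longrightarrow> x \<in> P \<Longrightarrow> A F \<bullet> x = \<beta> F \<longleftrightarrow> x \<in> F" by (rule normals) blast
  define z where "z = q v + r w"
  have zP: "z \<in> P" "q w + r v \<in> P" using sum qr by (auto simp: z_def)
  have vw: "v \<in> F" "v \<in> G" "w \<in> F" "w \<in> G" using FG(3) ends_in_segment by blast+
  then have vwP: "v \<in> P" "w \<in> P" using FG face_of_imp_subset[OF facets_face] by blast+
  have "z + (q w + r v) = (q v + r v) + (q w + r w)" by (simp add: z_def algebra_simps)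
  then have s: "z + (q w + r v) = v + w" unfolding qr(5,6) .
  have on: "A H \<bullet> z = \<beta> H" if H: "H \<in> facets P" "v \<in> H" "w \<in> H" for H
  proof -
    have "A H \<bullet> v = \<beta> H" "A H \<bullet> w = \<beta> H" using A(2) H vwP by auto
    then have "A H \<bullet> (z + (q w + r v)) = \<beta> H + \<beta> H" unfolding s by (simp add: inner_add_right)
    then have "A H \<bullet> z + A H \<bullet> (q w + r v) = \<beta> H + \<beta> H" by (simp only: inner_add_right)
    then show ?thesis using A(1)[OF H(1) zP(1)] A(1)[OF H(1) zP(2)] by linarith
  qed
  then have "z \<in> F \<inter> G" using A(2) zP(1) FG vw by blast
  then obtain u where u: "0 \<le> u" "u \<le> 1" "z = (1 - u) *\<^sub>R v + u *\<^sub>R w" unfolding FG(3) by (auto simp: in_segment)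
  have "q w - q v = w - z" using qr(6) by (simp add: z_def algebra_simps)
  also have "\<dots> = (1 - u) *\<^sub>R (w - v)" unfolding u(3) by (simp add: algebra_simps)
  finally show ?thesis using u by (intro exI[of _ "1 - u"]) auto
qed

lemma linked_verts: "linked (facet_verts P) v w \<Longrightarrow> v \<in> verts P \<and> w \<in> verts P \<and> v \<noteq> w"
  unfolding linked_def using facet_verts_subset by blast

text \<open>The factor along the difference of \<open>y\<close> and \<open>z\<close> is known; as
  \<open>x\<close>, \<open>y\<close>, \<open>z\<close> are not collinear, the factors along the
  other two differences must agree with it.\<close>

lemma rigid_homothetic:
  assumes sum: "\<And>a b. a \<in> Q \<Longrightarrow> b \<in> R \<Longrightarrow> a + b \<in> P"
    and qr: "\<And>v. v \<in> verts P \<Longrightarrow> q v \<in> Q \<and> r v \<in> R \<and> q v + r v = v"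
    and "rigid (facet_verts P) S"
  shows "S \<subseteq> verts P \<and> (\<exists>m t. 0 \<le> m \<and> m \<le> 1 \<and> (\<forall>x\<in>S. q x = m *\<^sub>R x + t))"
  using assms(3)
proof (induction rule: rigid.induct)
  case (rigid_edge v w)
  note vw = linked_verts[OF rigid_edge]
  obtain m where m: "0 \<le> m" "m \<le> 1" "q w - q v = m *\<^sub>R (w - v)"
    using linked_ratio[OF rigid_edge sum, where q = q and r = r] qr vw by blast
  have "q x = m *\<^sub>R x + (q v - m *\<^sub>R v)" if "x \<in> {v, w}" for x
  proof (cases "x = v")
    case False
    then have "q x = q v + m *\<^sub>R (w - v)" using that m(3) by (auto simp: algebra_simps)
    then show ?thesis using that False by (simp add: algebra_simps)
  qed simp
  then show ?case using vw m(1,2) by blast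
next
  case (rigid_insert S x y z)
  obtain m t where m: "0 \<le> m" "m \<le> 1" "\<forall>x\<in>S. q x = m *\<^sub>R x + t" and SP: "S \<subseteq> verts P" using rigid_insert.IH by blast
  note xy = linked_verts[OF rigid_insert.hyps(2)] and xz = linked_verts[OF rigid_insert.hyps(3)]
  obtain a where a: "q y - q x = a *\<^sub>R (y - x)"
    using linked_ratio[OF rigid_insert.hyps(2) sum, where q = q and r = r] qr xy by blast
  obtain b where b: "q z - q x = b *\<^sub>R (z - x)"
    using linked_ratio[OF rigid_insert.hyps(3) sum, where q = q and r = r] qr xz by blast
  have yz: "q y = m *\<^sub>R y + t" "q z = m *\<^sub>R z + t" using m(3) rigid_insert.hyps by auto
  have qy: "q x = m *\<^sub>R y + t - a *\<^sub>R (y - x)" using a yz by (simp add: algebra_simps)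
  have qz: "q x = m *\<^sub>R z + t - b *\<^sub>R (z - x)" using b yz by (simp add: algebra_simps)
  \<comment> \<open>Comparing the two expressions for \<open>q x\<close> gives a linear relation
    between \<open>x - z\<close> and \<open>x - y\<close>, whose coefficients must vanish.\<close>
  have e: "(b - m) *\<^sub>R (x - z) = (a - m) *\<^sub>R (x - y)" using qy qz by (simp add: algebra_simps)
  have "b = m"
  proof (rule ccontr)
    assume "b \<noteq> m"
    have "(1 / (b - m)) *\<^sub>R ((b - m) *\<^sub>R (x - z)) = (1 / (b - m)) *\<^sub>R ((a - m) *\<^sub>R (x - y))" using e by simp
    then have "x - z = ((a - m) / (b - m)) *\<^sub>R (x - y)" using \<open>b \<noteq> m\<close> by simp
    then show False using extreme_not_collinear[of x P y z] xy xz rigid_insert.hyps(6) by blast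
  qed
  then have "q x = m *\<^sub>R x + t" using qz by (simp add: algebra_simps)
  then show ?case using m SP xy by (intro conjI exI[of _ m] exI[of _ t]) auto
qed

text \<open>All vertices have their \<open>Q\<close>-parts given by one factor \<open>m\<close> and
  one translation. If \<open>m\<close> is positive, \<open>Q\<close> is a homothetic copy of
  \<open>P\<close>; if it is 0, the \<open>R\<close>-parts are translated vertices and
  \<open>R\<close> is a translate of \<open>P\<close>.\<close>

theorem rigid_indecomposable:
  assumes "rigid (facet_verts P) (verts P)" shows "\<not> decomposable P"
proof
  assume "decomposable P"
  then obtain Q R where QR: "convex_body Q" "convex_body R" "P = minkowski_sum Q R"
    "\<not> homothetic_copy Q P" "\<not> homothetic_copy R P" unfolding decomposable_def by blast
  have sum: "\<And>a b. a \<in> Q \<Longrightarrow> b \<in> R \<Longrightarrow> a + b \<in> P" unfolding QR(3) minkowski_sum_def by blast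
  have "\<forall>v\<in>verts P. \<exists>a b. a \<in> Q \<and> b \<in> R \<and> a + b = v"
  proof
    fix v assume "v \<in> verts P"
    then have "v \<in> minkowski_sum Q R" using verts_subset QR(3) by blast
    then show "\<exists>a b. a \<in> Q \<and> b \<in> R \<and> a + b = v" unfolding minkowski_sum_def by blast
  qed
  then obtain q r where qr: "\<And>v. v \<in> verts P \<Longrightarrow> q v \<in> Q \<and> r v \<in> R \<and> q v + r v = v" by metis
  obtain m t where m: "0 \<le> m" "m \<le> 1" "\<forall>x\<in>verts P. q x = m *\<^sub>R x + t"
    using rigid_homothetic[OF sum qr assms] by blast
  \<comment> \<open>Formulated for either summand, because it is applied to \<open>Q\<close> for
    positive \<open>m\<close> and to \<open>R\<close> for \<open>m = 0\<close>.\<close>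
  have part: "K = (\<lambda>x. k *\<^sub>R x + s) ` P"
    if K: "convex_body K" and L: "\<And>a b. a \<in> K \<Longrightarrow> b \<in> L \<Longrightarrow> a + b \<in> P" and f: "\<And>v. v \<in> verts P \<Longrightarrow> k *\<^sub>R v + s \<in> K"
      and g: "\<And>v. v \<in> verts P \<Longrightarrow> (1 - k) *\<^sub>R v - s \<in> L" and k: "0 \<le> k" for K L k s
  proof (intro equalityI subsetI)
    let ?h = "\<lambda>x. k *\<^sub>R x + s"
    have cK: "convex K" using K by (simp add: convex_body_def)
    have aff: "?h ` P = convex hull (?h ` verts P)"
    proof -
      have "?h ` P = (+) s ` (scaleR k ` P)" by (auto simp: image_iff add.commute)
      also have "\<dots> = (+) s ` (scaleR k ` (convex hull (verts P)))" using polytope_conv_verts[OF pt] by simp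
      also have "\<dots> = convex hull ((+) s ` (scaleR k ` verts P))"
        by (simp add: convex_hull_scaling convex_hull_translation)
      also have "(+) s ` (scaleR k ` verts P) = ?h ` verts P" by (auto simp: image_iff add.commute)
      finally show ?thesis .
    qed
    fix z
    {
      assume "z \<in> ?h ` P"
      then show "z \<in> K" unfolding aff using hull_minimal[of "?h ` verts P" K convex] f cK by blast
    }
    assume z: "z \<in> K"
    show "z \<in> ?h ` P"
    proof (rule ccontr)
      assume zn: "z \<notin> ?h ` P"
      have "compact (?h ` P)" using polytope_imp_compact[OF pt] by (intro compact_continuous_image continuous_intros)
      then have "closed (?h ` P)" by (rule compact_imp_closed)
      moreover have "convex (?h ` P)" unfolding aff by simp
      ultimately obtain a b where ab: "a \<bullet> z < b" "\<forall>x\<in>?h ` P. b < a \<bullet> x"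
        using separating_hyperplane_closed_point[of "?h ` P" z] zn by blast
      have ne: "verts P \<noteq> {}" using card_verts_aff_dim[OF pt] dim3 by auto
      \<comment> \<open>If \<open>a\<close> separates \<open>z\<close> from the copy, take a vertex
        \<open>v\<close> at which \<open>a\<close> is minimal on \<open>P\<close>: adding the other
        part of \<open>v\<close> to \<open>z\<close> gives a point of \<open>P\<close>, which the
        separation would place below this minimum.\<close>
      obtain v where v: "v \<in> verts P" "\<forall>w\<in>verts P. a \<bullet> v \<le> a \<bullet> w"
      proof -
        have "Min ((\<bullet>) a ` verts P) \<in> (\<bullet>) a ` verts P" using finite_verts[OF pt] ne by simp
        then obtain v where "v \<in> verts P" "a \<bullet> v = Min ((\<bullet>) a ` verts P)" by auto
        then show thesis using finite_verts[OF pt] by (intro that[of v]) auto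
      qed
      have "P \<subseteq> {x. a \<bullet> v \<le> a \<bullet> x}"
        by (subst polytope_conv_verts[OF pt], rule hull_minimal) (use v convex_halfspace_ge[of "a \<bullet> v" a] in auto)
      moreover have "z + ((1 - k) *\<^sub>R v - s) \<in> P" using L z g v by blast
      ultimately have "a \<bullet> v \<le> a \<bullet> (z + ((1 - k) *\<^sub>R v - s))" by blast
      then have "a \<bullet> (k *\<^sub>R v + s) \<le> a \<bullet> z" by (simp add: inner_add_right inner_diff_right algebra_simps)
      moreover have "v \<in> P" using v verts_subset by blast
      then have "b < a \<bullet> (k *\<^sub>R v + s)" using ab(2) by blast
      ultimately show False using ab(1) by linarith
    qed
  qed
  have rv: "r v = (1 - m) *\<^sub>R v - t" if v: "v \<in> verts P" for v
  proof -
    have "m *\<^sub>R v + t + r v = v" using qr[OF v] m(3) v by simp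
    then have "r v = v - (m *\<^sub>R v + t)" by (metis add_diff_cancel_left')
    then show ?thesis by (simp add: algebra_simps)
  qed
  show False
  proof (cases "m > 0")
    case True
    have "Q = (\<lambda>x. m *\<^sub>R x + t) ` P"
    proof (rule part[OF QR(1) sum])
      show "m *\<^sub>R v + t \<in> Q" if "v \<in> verts P" for v using qr[OF that] m(3) that by simp
      show "(1 - m) *\<^sub>R v - t \<in> R" if "v \<in> verts P" for v using qr[OF that] rv[OF that] by simp
    qed (use m in auto)
    then show False using QR(4) True unfolding homothetic_copy_def by blast
  next
    case False
    then have m0: "m = 0" using m by simp
    have "R = (\<lambda>x. 1 *\<^sub>R x + (- t)) ` P"
    proof (rule part[OF QR(2), of Q])
      show "\<And>a b. a \<in> R \<Longrightarrow> b \<in> Q \<Longrightarrow> a + b \<in> P" using sum by (metis add.commute)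
      show "1 *\<^sub>R v + - t \<in> R" if "v \<in> verts P" for v using qr[OF that] rv[OF that] m0 by simp
      show "(1 - 1) *\<^sub>R v - - t \<in> Q" if "v \<in> verts P" for v using qr[OF that] m(3) m0 that by simp
    qed simp
    then show False using QR(5) unfolding homothetic_copy_def by (metis zero_less_one)
  qed
qed

end

text \<open>The three inner products form a linear map of the space to itself: if it is injective it
  is surjective and a common point exists, otherwise its kernel gives a common direction.\<close>

lemma three_planes:
  fixes n1 n2 n3 :: pt3
  obtains p where "n1 \<bullet> p = b1" "n2 \<bullet> p = b2" "n3 \<bullet> p = b3"
  | d where "d \<noteq> 0" "n1 \<bullet> d = 0" "n2 \<bullet> d = 0" "n3 \<bullet> d = 0"
proof -
  define L :: "pt3 \<Rightarrow> pt3" where "L x = vector [n1 \<bullet> x, n2 \<bullet> x, n3 \<bullet> x]" for x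
  have lin: "linear L"
    by (rule linearI) (simp_all add: L_def vec_eq_iff forall_3 vector_3 inner_add_right)
  show thesis
  proof (cases "inj L")
    case True
    then have "surj L" using linear_injective_imp_surjective[OF lin] by blast
    then obtain p where p: "L p = vector [b1, b2, b3]" by (metis surjD)
    have "n1 \<bullet> p = b1" "n2 \<bullet> p = b2" "n3 \<bullet> p = b3"
      using arg_cong[OF p, of "\<lambda>v. v $ 1"] arg_cong[OF p, of "\<lambda>v. v $ 2"] arg_cong[OF p, of "\<lambda>v. v $ 3"]
      by (simp_all add: L_def vector_3)
    then show ?thesis using that(1) by blast
  next
    case False
    then obtain d where d: "L d = 0" "d \<noteq> 0" using linear_injective_0[OF lin] by blast
    have "n1 \<bullet> d = 0" "n2 \<bullet> d = 0" "n3 \<bullet> d = 0"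
      using arg_cong[OF d(1), of "\<lambda>v. v $ 1"] arg_cong[OF d(1), of "\<lambda>v. v $ 2"] arg_cong[OF d(1), of "\<lambda>v. v $ 3"]
      by (simp_all add: L_def vector_3)
    then show ?thesis using that(2) d(2) by blast
  qed
qed

text \<open>The bound \<open>1/2\<close> serves \<open>split_decomposable\<close>, where a
  coefficient \<open>1/2\<close> is perturbed and must stay nonnegative.\<close>

lemma small_epsilon:
  fixes a c :: "'i \<Rightarrow> real"
  assumes "finite I" "\<And>i. i \<in> I \<Longrightarrow> c i > 0"
  obtains e where "0 < e" "e < 1/2" "\<And>i. i \<in> I \<Longrightarrow> e * \<bar>a i\<bar> \<le> c i"
proof -
  have "\<exists>e>0. e < 1/2 \<and> (\<forall>i\<in>I. e * \<bar>a i\<bar> \<le> c i)"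
    using assms
  proof (induction I rule: finite_induct)
    case empty
    show ?case by (intro exI[of _ "1/4"]) auto
  next
    case (insert i I)
    then obtain e where e: "e > 0" "e < 1/2" "\<forall>i\<in>I. e * \<bar>a i\<bar> \<le> c i" by auto
    \<comment> \<open>The summand 1 keeps the denominator positive when \<open>a i\<close>
      vanishes.\<close>
    define f where "f = min e (c i / (\<bar>a i\<bar> + 1))"
    have ci: "c i > 0" using insert by auto
    have f: "f > 0" "f \<le> e" "f \<le> c i / (\<bar>a i\<bar> + 1)" using e ci by (auto simp: f_def)
    have "f * \<bar>a i\<bar> \<le> f * (\<bar>a i\<bar> + 1)" using f by simp
    also have "\<dots> \<le> c i" using f(3) by (simp add: pos_le_divide_eq)
    finally have "f * \<bar>a i\<bar> \<le> c i" .
    moreover have "f * \<bar>a j\<bar> \<le> c j" if "j \<in> I" for j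
      using mult_right_mono[OF f(2), of "\<bar>a j\<bar>"] e(3) that by fastforce
    ultimately show ?case using f e by (intro exI[of _ f]) auto
  qed
  then show thesis using that by blast
qed

context poly3
begin

text \<open>The segment from an interior point to \<open>x\<close> would leave \<open>P\<close> at a
  point of some facet. The inequality of that facet is strict at the interior point and holds at
  \<open>x\<close>, so it would be strict at that point too.\<close>

lemma halfspace_description:
  assumes A: "\<And>F x. F \<in> facets P \<Longrightarrow> x \<in> P \<Longrightarrow> A F \<bullet> x \<le> \<beta> F"
    "\<And>F x. F \<in> facets P \<Longrightarrow> x \<in> P \<Longrightarrow> A F \<bullet> x = \<beta> F \<longleftrightarrow> x \<in> F"
    and x: "\<And>F. F \<in> facets P \<Longrightarrow> A F \<bullet> x \<le> \<beta> F"
  shows "x \<in> P"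
proof (rule ccontr)
  assume xP: "x \<notin> P"
  obtain z where z: "z \<in> interior P" using interior_nonempty by blast
  have zP: "z \<in> P" using z interior_subset by blast
  have "closed_segment z x \<inter> frontier P \<noteq> {}"
    by (rule connected_Int_frontier) (use zP xP in auto)
  then obtain y where y: "y \<in> closed_segment z x" "y \<in> frontier P" by blast
  have cl: "closed P" using polytope_imp_closed[OF pt] .
  have yP: "y \<in> P" "y \<notin> interior P" using y(2) cl by (auto simp: frontier_def)
  then obtain F where F: "F \<in> facets P" "y \<in> F" using interior_eq by blast
  obtain t where t: "0 \<le> t" "t \<le> 1" "y = (1 - t) *\<^sub>R z + t *\<^sub>R x" using y(1) by (auto simp: in_segment)
  have "t \<noteq> 1" using t yP xP by auto
  have "t \<noteq> 0" using t yP z by auto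
  have az: "A F \<bullet> z < \<beta> F" using A(1)[OF F(1) zP] A(2)[OF F(1) zP] facet_disjoint_interior[OF F(1) z] by linarith
  have "\<beta> F = A F \<bullet> y" using A(2)[OF F(1) yP(1)] F(2) by simp
  also have "\<dots> = (1 - t) * (A F \<bullet> z) + t * (A F \<bullet> x)" unfolding t(3) by (simp add: inner_add_right)
  also have "\<dots> < (1 - t) * \<beta> F + t * \<beta> F"
  proof (rule add_less_le_mono)
    show "(1 - t) * (A F \<bullet> z) < (1 - t) * \<beta> F" using az t \<open>t \<noteq> 1\<close> by simp
    show "t * (A F \<bullet> x) \<le> t * \<beta> F" using x[OF F(1)] t by (simp add: mult_left_mono)
  qed
  also have "\<dots> = \<beta> F" by (simp add: algebra_simps)
  finally show False by simp
qed

text \<open>Otherwise \<open>v\<close> could be moved a little in both directions \<open>y\<close>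
  and \<open>- y\<close> without violating any facet inequality, and would not be extreme.\<close>

lemma vertex_normals_span:
  assumes A: "\<And>F x. F \<in> facets P \<Longrightarrow> x \<in> P \<Longrightarrow> A F \<bullet> x \<le> \<beta> F"
    "\<And>F x. F \<in> facets P \<Longrightarrow> x \<in> P \<Longrightarrow> A F \<bullet> x = \<beta> F \<longleftrightarrow> x \<in> F"
    and v: "v \<in> verts P" and y: "\<And>F. F \<in> facets P \<Longrightarrow> v \<in> F \<Longrightarrow> A F \<bullet> y = 0"
  shows "y = 0"
proof (rule ccontr)
  assume "y \<noteq> 0"
  have vP: "v \<in> P" using v verts_subset by blast
  let ?I = "{F \<in> facets P. v \<notin> F}"
  have fin: "finite ?I" using finite_facets[OF pt] by simp
  have pos: "\<beta> F - A F \<bullet> v > 0" if "F \<in> ?I" for F using A[of F v] that vP by (auto simp: less_le)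
  obtain e where e: "0 < e" "\<And>F. F \<in> ?I \<Longrightarrow> e * \<bar>A F \<bullet> y\<bar> \<le> \<beta> F - A F \<bullet> v"
    using small_epsilon[OF fin, of "\<lambda>F. \<beta> F - A F \<bullet> v" "\<lambda>F. A F \<bullet> y", OF pos] by blast
  have inP: "v + s *\<^sub>R y \<in> P" if s: "\<bar>s\<bar> = e" for s
  proof (rule halfspace_description[OF A])
    fix F assume F: "F \<in> facets P"
    show "A F \<bullet> (v + s *\<^sub>R y) \<le> \<beta> F"
    proof (cases "v \<in> F")
      case True
      then show ?thesis using y[OF F True] A(1)[OF F vP] by (simp add: inner_add_right)
    next
      case False
      have "s * (A F \<bullet> y) \<le> \<bar>s\<bar> * \<bar>A F \<bullet> y\<bar>" by (metis abs_ge_self abs_mult)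
      also have "\<dots> \<le> \<beta> F - A F \<bullet> v" using e(2)[of F] F False s by simp
      finally show ?thesis by (simp add: inner_add_right)
    qed
  qed
  have "v + e *\<^sub>R y \<in> P" "v + (- e) *\<^sub>R y \<in> P" using inP[of e] inP[of "- e"] e(1) by simp_all
  moreover have "v \<in> open_segment (v + e *\<^sub>R y) (v + (- e) *\<^sub>R y)"
  proof -
    have "v + e *\<^sub>R y \<noteq> v + (- e) *\<^sub>R y"
    proof
      assume "v + e *\<^sub>R y = v + (- e) *\<^sub>R y"
      then have "\<forall>i. e * y $ i = 0" by (simp add: vec_eq_iff)
      then show False using e(1) \<open>y \<noteq> 0\<close> by (simp add: vec_eq_iff)
    qed
    moreover have "v = (1 - 1/2) *\<^sub>R (v + e *\<^sub>R y) + (1/2) *\<^sub>R (v + (- e) *\<^sub>R y)" by (simp add: vec_eq_iff field_simps)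
    ultimately show ?thesis unfolding in_segment by (intro conjI exI[of _ "1/2"]) auto
  qed
  ultimately show False using v by (auto simp: verts_def extreme_point_of_def)
qed

text \<open>If all facets but three lie on one side of a partition of the vertices, then the part \<open>T\<close> can be
  scaled towards a common point (or translated in a common direction) of the three remaining planes.\<close>

theorem split_decomposable:
  assumes V: "verts P = T \<union> B" "T \<inter> B = {}" and t: "t1 \<in> T" "t2 \<in> T" "t1 \<noteq> t2" and b: "b1 \<in> B" "b2 \<in> B" "b1 \<noteq> b2"
    and M: "M1 \<in> facets P" "M2 \<in> facets P" "M3 \<in> facets P"
    and F: "\<And>F. F \<in> facets P \<Longrightarrow> verts F \<subseteq> T \<or> verts F \<subseteq> B \<or> F = M1 \<or> F = M2 \<or> F = M3"
  shows "decomposable P"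
proof -
  obtain A \<beta> where A: "\<And>F x. F \<in> facets P \<Longrightarrow> x \<in> P \<Longrightarrow> A F \<bullet> x \<le> \<beta> F"
    "\<And>F x. F \<in> facets P \<Longrightarrow> x \<in> P \<Longrightarrow> A F \<bullet> x = \<beta> F \<longleftrightarrow> x \<in> F"
  proof -
    have "\<exists>a b. \<forall>x\<in>P. a \<bullet> x \<le> b \<and> (a \<bullet> x = b \<longleftrightarrow> x \<in> F)" if F: "F \<in> facets P" for F
    proof -
      obtain a b where "P \<subseteq> {x. a \<bullet> x \<le> b}" "F = P \<inter> {x. a \<bullet> x = b}" using facet_hyperplane[OF F] by metis
      then show ?thesis by blast
    qed
    then obtain A \<beta> where "\<And>F. F \<in> facets P \<Longrightarrow> \<forall>x\<in>P. A F \<bullet> x \<le> \<beta> F \<and> (A F \<bullet> x = \<beta> F \<longleftrightarrow> x \<in> F)" by metis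
    then show thesis using that[of A \<beta>] by blast
  qed
  \<comment> \<open>\<open>g\<close> is the velocity with which \<open>T\<close> is moved:
    \<open>x - p\<close> for a common point \<open>p\<close> of the three planes, a constant
    \<open>d\<close> for a common direction. Both cases have one factor \<open>\<kappa>\<close>, and
    in both the motion maps the three planes to themselves.\<close>
  have "\<exists>g \<kappa>. (\<forall>x y. g x - g y = \<kappa> *\<^sub>R (x - y)) \<and> (\<forall>F\<in>{M1, M2, M3}. \<forall>x. A F \<bullet> g x = \<kappa> * (A F \<bullet> x - \<beta> F))
      \<and> (\<kappa> = 1 \<or> \<kappa> = 0 \<and> (\<exists>d. d \<noteq> 0 \<and> (\<forall>x. g x = d)))"
  proof (rule three_planes[of "A M1" "\<beta> M1" "A M2" "\<beta> M2" "A M3" "\<beta> M3"])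
    fix p assume p: "A M1 \<bullet> p = \<beta> M1" "A M2 \<bullet> p = \<beta> M2" "A M3 \<bullet> p = \<beta> M3"
    show ?thesis by (intro exI[of _ "\<lambda>x. x - p"] exI[of _ 1]) (auto simp: p inner_diff_right)
  next
    fix d assume d: "d \<noteq> 0" "A M1 \<bullet> d = 0" "A M2 \<bullet> d = 0" "A M3 \<bullet> d = 0"
    show ?thesis by (intro exI[of _ "\<lambda>x. d"] exI[of _ 0]) (auto simp: d)
  qed
  then obtain g \<kappa> where gd: "\<And>x y. g x - g y = \<kappa> *\<^sub>R (x - y)"
    and gM: "\<And>F x. F \<in> {M1, M2, M3} \<Longrightarrow> A F \<bullet> g x = \<kappa> * (A F \<bullet> x - \<beta> F)"
    and \<kappa>: "\<kappa> = 1 \<or> \<kappa> = 0 \<and> (\<exists>d. d \<noteq> 0 \<and> (\<forall>x. g x = d))" by blast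
  have \<kappa>01: "0 \<le> \<kappa>" "\<kappa> \<le> 1" using \<kappa> by auto
  have finV: "finite (verts P)" by (rule finite_verts[OF pt])
  have VP: "v \<in> P" if "v \<in> verts P" for v using that verts_subset by blast
  \<comment> \<open>The motion has to be small compared with the slack of every vertex at every
    facet that does not contain it; it may use up at most one half of it.\<close>
  let ?I = "{(F, v, w). F \<in> facets P \<and> v \<in> verts P \<and> w \<in> verts P \<and> v \<notin> F}"
  have "finite ?I"
    by (rule finite_subset[of _ "facets P \<times> verts P \<times> verts P"]) (use finite_facets[OF pt] finV in auto)
  moreover have "(\<lambda>(F, v, w). (\<beta> F - A F \<bullet> v) / 2) i > 0" if "i \<in> ?I" for i
    using A[OF _ VP] that by (fastforce simp: less_le)
  ultimately obtain \<epsilon> where \<epsilon>: "0 < \<epsilon>" "\<epsilon> < 1/2"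
    "\<And>i. i \<in> ?I \<Longrightarrow> \<epsilon> * \<bar>(\<lambda>(F, v, w). A F \<bullet> g w) i\<bar> \<le> (\<lambda>(F, v, w). (\<beta> F - A F \<bullet> v) / 2) i"
    using small_epsilon[of ?I "\<lambda>(F, v, w). (\<beta> F - A F \<bullet> v) / 2" "\<lambda>(F, v, w). A F \<bullet> g w"] by blast
  have eps: "s * (A F \<bullet> g w) \<le> (\<beta> F - A F \<bullet> v) / 2" "- (s * (A F \<bullet> g w)) \<le> (\<beta> F - A F \<bullet> v) / 2"
    if "\<bar>s\<bar> = \<epsilon>" "F \<in> facets P" "v \<in> verts P" "w \<in> verts P" "v \<notin> F" for s F v w
  proof -
    have "\<bar>s * (A F \<bullet> g w)\<bar> \<le> (\<beta> F - A F \<bullet> v) / 2" using \<epsilon>(3)[of "(F, v, w)"] that by (simp add: abs_mult)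
    then show "s * (A F \<bullet> g w) \<le> (\<beta> F - A F \<bullet> v) / 2" "- (s * (A F \<bullet> g w)) \<le> (\<beta> F - A F \<bullet> v) / 2" by linarith+
  qed
  \<comment> \<open>Opposite motions of \<open>T\<close> at half size: the maps for \<open>s\<close>
    and \<open>- s\<close> add up to the identity, so the hulls of the two images are the candidate
    summands.\<close>
  define \<phi> where "\<phi> s x = (1/2) *\<^sub>R x + (if x \<in> T then s *\<^sub>R g x else 0)" for s x
  have \<phi>T: "\<phi> s x = (1/2) *\<^sub>R x + s *\<^sub>R g x" if "x \<in> T" for s x using that by (simp add: \<phi>_def)
  have \<phi>B: "\<phi> s x = (1/2) *\<^sub>R x" if "x \<in> B" for s x using that V(2) by (auto simp: \<phi>_def)
  have sum\<phi>: "\<phi> s x + \<phi> (- s) x = x" for s x by (simp add: \<phi>_def flip: scaleR_add_left)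
  have coef: "1/2 + s * \<kappa> \<ge> 0" if "\<bar>s\<bar> = \<epsilon>" for s
  proof -
    have "\<bar>s * \<kappa>\<bar> \<le> \<epsilon> * 1" unfolding abs_mult using that \<kappa>01 \<epsilon>(1) by (intro mult_mono) auto
    then show ?thesis using \<epsilon>(2) by linarith
  qed
  \<comment> \<open>Each facet normal still attains its maximum at the images of the vertices of its
    facet. This is where the hypothesis on the facets enters: away from the three exceptional ones,
    the vertices of a facet move together.\<close>
  have maxF: "A F \<bullet> \<phi> s v \<le> A F \<bullet> \<phi> s u" if s: "\<bar>s\<bar> = \<epsilon>" and FF: "F \<in> facets P" and u: "u \<in> verts F" and v: "v \<in> verts P" for F s u v
  proof -
    have uP: "u \<in> verts P" "u \<in> F" using u verts_face[OF facets_face[OF FF]] by blast+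
    have au: "A F \<bullet> u = \<beta> F" using A(2)[OF FF VP[OF uP(1)]] uP(2) by simp
    have av: "A F \<bullet> v \<le> \<beta> F" by (rule A(1)[OF FF VP[OF v]])
    have pt: "(1/2 + s * \<kappa>) * (A F \<bullet> v - \<beta> F) \<le> 0" using coef[OF s] av by (simp add: mult_nonneg_nonpos)
    have gdA: "A F \<bullet> g x - A F \<bullet> g y = \<kappa> * (A F \<bullet> x - A F \<bullet> y)" for x y
      using arg_cong[OF gd[of x y], of "(\<bullet>) (A F)"] by (simp add: inner_diff_right)
    have vF: "v \<notin> F" if "verts F \<subseteq> X" "v \<notin> X" for X
      using that verts_face[OF facets_face[OF FF]] v by blast
    consider "verts F \<subseteq> T" | "verts F \<subseteq> B" | "F \<in> {M1, M2, M3}" using F[OF FF] by blast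
    then show ?thesis
    proof cases
      case 1
      then have uT: "u \<in> T" using u by blast
      show ?thesis
      proof (cases "v \<in> T")
        case True
        have "A F \<bullet> \<phi> s v - A F \<bullet> \<phi> s u = (1/2) * (A F \<bullet> v - \<beta> F) + s * (A F \<bullet> g v - A F \<bullet> g u)"
          using au by (simp add: \<phi>T[OF True] \<phi>T[OF uT] inner_add_right algebra_simps)
        also have "\<dots> = (1/2 + s * \<kappa>) * (A F \<bullet> v - \<beta> F)" unfolding gdA au by (simp add: algebra_simps)
        finally show ?thesis using pt by linarith
      next
        case False
        then have vB: "v \<in> B" using v V by blast
        show ?thesis using eps(2)[OF s FF v uP(1) vF[OF 1 False]] au
          by (simp add: \<phi>B[OF vB] \<phi>T[OF uT] inner_add_right)
      qed
    next
      case 2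
      then have uB: "u \<in> B" using u by blast
      show ?thesis
      proof (cases "v \<in> T")
        case True
        then have "v \<notin> B" using V(2) by blast
        then show ?thesis using eps(1)[OF s FF v v vF[OF 2]] au
          by (simp add: \<phi>T[OF True] \<phi>B[OF uB] inner_add_right)
      next
        case False
        then have vB: "v \<in> B" using v V by blast
        show ?thesis using au av by (simp add: \<phi>B[OF vB] \<phi>B[OF uB])
      qed
    next
      case 3
      \<comment> \<open>For an exceptional facet the plane is kept at the value
        \<open>\<beta> F / 2\<close> on both parts, and slacks are only multiplied by nonnegative
        factors.\<close>
      have val: "A F \<bullet> \<phi> s x = \<beta> F / 2 + (1/2 + (if x \<in> T then s * \<kappa> else 0)) * (A F \<bullet> x - \<beta> F)" for x
        by (simp add: \<phi>_def inner_add_right gM[OF 3] algebra_simps)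
      have "A F \<bullet> \<phi> s u = \<beta> F / 2" unfolding val au by simp
      moreover have "(1/2 + (if v \<in> T then s * \<kappa> else 0)) * (A F \<bullet> v - \<beta> F) \<le> 0" using pt av by simp
      ultimately show ?thesis unfolding val[of v] by linarith
    qed
  qed
  define Q where "Q s = convex hull (\<phi> s ` verts P)" for s
  have maxQ: "A F \<bullet> z \<le> A F \<bullet> \<phi> s u" if "\<bar>s\<bar> = \<epsilon>" "F \<in> facets P" "u \<in> verts F" "z \<in> Q s" for F s u z
  proof -
    have "Q s \<subseteq> {z. A F \<bullet> z \<le> A F \<bullet> \<phi> s u}" unfolding Q_def
      by (rule hull_minimal) (use maxF[OF that(1-3)] in \<open>auto simp: convex_halfspace_le\<close>)
    then show ?thesis using that(4) by blast
  qed
  have vQ: "\<phi> s v \<in> Q s" if "v \<in> verts P" for s v unfolding Q_def using that by (intro hull_inc) blast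
  have ne: "verts P \<noteq> {}" using V t by blast
  have body: "convex_body (Q s)" for s
    unfolding convex_body_def Q_def using finV ne by (simp add: finite_imp_compact_convex_hull)
  have eq: "P = minkowski_sum (Q \<epsilon>) (Q (- \<epsilon>))"
  proof (intro equalityI subsetI)
    fix x assume "x \<in> P"
    then have "x \<in> convex hull (verts P)" using polytope_conv_verts[OF pt] by simp
    moreover have "convex (minkowski_sum (Q \<epsilon>) (Q (- \<epsilon>)))"
    proof -
      have "minkowski_sum (Q \<epsilon>) (Q (- \<epsilon>)) = (\<Union>x\<in>Q \<epsilon>. \<Union>y\<in>Q (- \<epsilon>). {x + y})"
        unfolding minkowski_sum_def by blast
      then show ?thesis using convex_sums[of "Q \<epsilon>" "Q (- \<epsilon>)"] by (simp add: Q_def)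
    qed
    moreover have "verts P \<subseteq> minkowski_sum (Q \<epsilon>) (Q (- \<epsilon>))"
    proof
      fix v assume v: "v \<in> verts P"
      show "v \<in> minkowski_sum (Q \<epsilon>) (Q (- \<epsilon>))"
        unfolding minkowski_sum_def using vQ[OF v] sum\<phi>[of \<epsilon> v] by (metis (mono_tags, lifting) mem_Collect_eq)
    qed
    ultimately show "x \<in> minkowski_sum (Q \<epsilon>) (Q (- \<epsilon>))" using hull_minimal[of "verts P" _ convex] by blast
  next
    fix x assume "x \<in> minkowski_sum (Q \<epsilon>) (Q (- \<epsilon>))"
    then obtain q r where qr: "q \<in> Q \<epsilon>" "r \<in> Q (- \<epsilon>)" "x = q + r" unfolding minkowski_sum_def by blast
    show "x \<in> P"
    proof (rule halfspace_description[OF A])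
      fix F assume FF: "F \<in> facets P"
      have "verts F \<noteq> {}" using facet_card_ge3[OF FF] by auto
      then obtain u where u: "u \<in> verts F" by blast
      then have uP: "u \<in> verts P" "u \<in> F" using verts_face[OF facets_face[OF FF]] by blast+
      have "A F \<bullet> x \<le> A F \<bullet> \<phi> \<epsilon> u + A F \<bullet> \<phi> (- \<epsilon>) u"
        using maxQ[OF _ FF u qr(1)] maxQ[OF _ FF u qr(2)] \<epsilon>(1) unfolding qr(3) inner_add_right by fastforce
      also have "\<dots> = A F \<bullet> (\<phi> \<epsilon> u + \<phi> (- \<epsilon>) u)" by (simp only: inner_add_right)
      also have "\<dots> = \<beta> F" unfolding sum\<phi> using A(2)[OF FF VP[OF uP(1)]] uP(2) by simp
      finally show "A F \<bullet> x \<le> \<beta> F" .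
    qed
  qed
  have nh: "\<not> homothetic_copy (Q s) P" if s: "\<bar>s\<bar> = \<epsilon>" for s
  proof
    assume "homothetic_copy (Q s) P"
    then obtain c w where c: "c > 0" "Q s = (\<lambda>x. c *\<^sub>R x + w) ` P" unfolding homothetic_copy_def by blast
    \<comment> \<open>Both points maximise the normals of all facets through \<open>v\<close> on
      \<open>Q s\<close>; these normals determine a point, so a homothety would have to send each
      vertex to its own image.\<close>
    have hfix: "\<phi> s v = c *\<^sub>R v + w" if v: "v \<in> verts P" for v
    proof -
      have "A F \<bullet> (\<phi> s v - (c *\<^sub>R v + w)) = 0" if FF: "F \<in> facets P" "v \<in> F" for F
      proof -
        have vF: "v \<in> verts F" using verts_face[OF facets_face[OF FF(1)]] v FF(2) by blast
        have "c *\<^sub>R v + w \<in> Q s" unfolding c(2) using VP[OF v] by blast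
        then have 1: "A F \<bullet> (c *\<^sub>R v + w) \<le> A F \<bullet> \<phi> s v" by (rule maxQ[OF s FF(1) vF])
        have "\<phi> s v \<in> (\<lambda>x. c *\<^sub>R x + w) ` P" using vQ[OF v] c(2) by blast
        then obtain x where x: "x \<in> P" "\<phi> s v = c *\<^sub>R x + w" by blast
        have "A F \<bullet> x \<le> A F \<bullet> v" using A(1)[OF FF(1) x(1)] A(2)[OF FF(1) VP[OF v]] FF(2) by simp
        then have "A F \<bullet> \<phi> s v \<le> A F \<bullet> (c *\<^sub>R v + w)" unfolding x(2) using c(1) by (simp add: inner_add_right)
        then show ?thesis using 1 by (simp add: inner_diff_right)
      qed
      from vertex_normals_span[OF A v this] have "\<phi> s v - (c *\<^sub>R v + w) = 0" by blast
      then show ?thesis by simp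
    qed
    have "t1 \<in> verts P" "t2 \<in> verts P" "b1 \<in> verts P" "b2 \<in> verts P" using V t b by auto
    note fx = this[THEN hfix]
    have T1: "(1/2) *\<^sub>R t1 + s *\<^sub>R g t1 = c *\<^sub>R t1 + w" "(1/2) *\<^sub>R t2 + s *\<^sub>R g t2 = c *\<^sub>R t2 + w"
      using fx(1,2) \<phi>T t by auto
    have B1: "(1/2) *\<^sub>R b1 = c *\<^sub>R b1 + w" "(1/2) *\<^sub>R b2 = c *\<^sub>R b2 + w"
      using fx(3,4) \<phi>B b by auto
    \<comment> \<open>The two points of \<open>B\<close> force the homothety to be
      \<open>x \<mapsto> x/2\<close>, so \<open>T\<close> could not have moved.\<close>
    have "(1/2 - c) *\<^sub>R (b1 - b2) = ((1/2) *\<^sub>R b1 - c *\<^sub>R b1) - ((1/2) *\<^sub>R b2 - c *\<^sub>R b2)"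
      by (simp add: algebra_simps)
    also have "\<dots> = 0" unfolding B1 by simp
    finally have c2: "c = 1/2" using b(3) by simp
    then have w0: "w = 0" using B1(1) unfolding c2 by simp
    have sg: "s *\<^sub>R g t1 = 0" "s *\<^sub>R g t2 = 0" using T1 unfolding c2 w0 by simp_all
    have "s \<noteq> 0" using s \<epsilon>(1) by auto
    then have g0: "g t1 = 0" "g t2 = 0" using sg by auto
    then have "\<kappa> *\<^sub>R (t1 - t2) = 0" using gd[of t1 t2] by simp
    then have "\<kappa> = 0" using t(3) by simp
    then show False using \<kappa> g0 by auto
  qed
  show ?thesis unfolding decomposable_def
    using body eq nh[of \<epsilon>] nh[of "- \<epsilon>"] \<epsilon>(1) by (metis abs_minus_cancel abs_of_pos)
qed

end

section \<open>Stacking\<close>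

lemma facet_certificate_all:
  fixes V :: "pt3 set" and \<S> :: "pt3 set set"
  assumes "finite V" "\<And>S. S \<in> \<S> \<Longrightarrow> S \<subset> V" "\<And>S. S \<in> \<S> \<Longrightarrow> card S \<ge> 3"
    "\<And>S. S \<in> \<S> \<Longrightarrow> \<exists>a b. \<forall>v\<in>V. a \<bullet> v \<le> b \<and> (a \<bullet> v = b \<longleftrightarrow> v \<in> S)"
    "\<S> \<noteq> {}" "\<And>v. v \<in> V \<Longrightarrow> \<exists>S\<in>\<S>. v \<in> S"
    "\<And>v w. v \<in> V \<Longrightarrow> w \<in> V \<Longrightarrow> v \<noteq> w \<Longrightarrow> \<exists>S\<in>\<S>. v \<in> S \<and> w \<notin> S"
    "(\<Sum>S\<in>\<S>. card S) + 4 \<ge> 2 * card \<S> + 2 * card V"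
  shows "polyhedron3 (convex hull V) \<and> verts (convex hull V) = V \<and> facet_verts (convex hull V) = \<S>"
  using facet_certificate[OF assms] by blast

context poly3
begin

lemma neighbour_unique:
  assumes F: "F \<in> facets P" "G \<in> facets P" "H \<in> facets P" "G \<noteq> F" "H \<noteq> F"
    and e: "verts F \<inter> verts G = verts F \<inter> verts H" "card (verts F \<inter> verts G) = 2"
  shows "G = H"
proof (rule ccontr)
  assume ne: "G \<noteq> H"
  have I: "F \<inter> G face_of P" "F \<inter> H face_of P"
    using F by (simp_all add: face_of_Int facets_face)
  have "verts (F \<inter> G) = verts (F \<inter> H)" using verts_Int[OF facets_face facets_face] F e(1) by metis
  then have eq: "F \<inter> G = F \<inter> H" using face_conv_verts[OF pt I(1)] face_conv_verts[OF pt I(2)] by simp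
  have d: "aff_dim (F \<inter> G) = 1" using facet_Int_edge[OF F(1,2)] F(4) e(2) by blast
  have "{F, G, H} \<subseteq> {K \<in> facets P. F \<inter> G \<subseteq> K}" using F eq by blast
  from card_mono[OF _ this] have "card {F, G, H} \<le> 2"
    using finite_facets[OF pt] edge_two_facets[OF I(1) d] by simp
  then show False using F ne by simp
qed

text \<open>The two neighbours at \<open>x\<close> meet the triangle in \<open>{x, y}\<close> or
  \<open>{x, z}\<close>, and they cannot both use the same side.\<close>

lemma triangle_neighbour:
  assumes F: "F \<in> facets P" and v: "verts F = {x, y, z}" "x \<noteq> y" "y \<noteq> z" "x \<noteq> z"
  shows "\<exists>G. G \<in> facets P \<and> G \<noteq> F \<and> verts F \<inter> verts G = {x, y}"
proof -
  let ?N = "{G \<in> facets P. G \<noteq> F \<and> x \<in> verts G \<and> card (verts F \<inter> verts G) = 2}"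
  have xF: "x \<in> verts F" using v by simp
  have "card ?N = 2" by (rule facet_two_neighbours[OF F xF])
  then obtain G H where GH: "?N = {G, H}" "G \<noteq> H" by (meson card_2_iff)
  have opt: "verts F \<inter> verts K = {x, y} \<or> verts F \<inter> verts K = {x, z}" if "K \<in> ?N" for K
  proof -
    have K: "x \<in> verts F \<inter> verts K" "card (verts F \<inter> verts K) = 2" "verts F \<inter> verts K \<subseteq> {x, y, z}"
      using that v xF by blast+
    then obtain w where w: "verts F \<inter> verts K = {x, w}" "w \<noteq> x"
      by (metis card_2_iff doubleton_eq_iff insertE singletonD)
    then show ?thesis using K(3) by blast
  qed
  have "G \<in> ?N" "H \<in> ?N" using GH by blast+
  moreover have "\<not> (verts F \<inter> verts G = {x, z} \<and> verts F \<inter> verts H = {x, z})"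
    using neighbour_unique[OF F, of G H] \<open>G \<in> ?N\<close> \<open>H \<in> ?N\<close> GH(2) by auto
  ultimately show ?thesis using opt by blast
qed

lemma separate_verts:
  assumes v: "v \<in> verts P" "w \<in> verts P" "v \<noteq> w"
  shows "\<exists>F\<in>facets P. v \<in> verts F \<and> w \<notin> verts F"
proof -
  have "{v} face_of P" "{v} \<noteq> {}" "{v} \<noteq> P" using v dim3 by (auto simp: singleton_face)
  note eq = face_of_polyhedron[OF ph this]
  have "w \<notin> \<Inter>{F. F facet_of P \<and> {v} \<subseteq> F}" unfolding eq[symmetric] using v(3) by simp
  then obtain F where F: "F facet_of P" "v \<in> F" "w \<notin> F" by blast
  then have "F \<in> facets P" by (simp add: facets_def)
  then show ?thesis using F in_verts_facet[of F] v by blast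
qed

text \<open>\<open>beyond_only\<close> quantifies over all inequalities that describe a facet. They
  differ by positive factors, so the position of a point can be tested on one of them.\<close>

lemma supporting_sign:
  assumes G: "G \<in> facets P" and 1: "P \<subseteq> {x. a \<bullet> x \<le> b}" "G = P \<inter> {x. a \<bullet> x = b}"
    and 2: "P \<subseteq> {x. a' \<bullet> x \<le> b'}" "G = P \<inter> {x. a' \<bullet> x = b'}"
  obtains l where "l > 0" "\<And>x. a \<bullet> x - b = l * (a' \<bullet> x - b')"
proof -
  obtain y where y: "y \<in> interior P" using interior_nonempty by blast
  have yP: "y \<in> P" "y \<notin> G" using y interior_subset facet_disjoint_interior[OF G y] by blast+
  have s: "a \<bullet> y < b" "a' \<bullet> y < b'" using yP 1 2 by (force simp: less_le)+
  define l where "l = (b - a \<bullet> y) / (b' - a' \<bullet> y)"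
  have l: "l > 0" "l * (b' - a' \<bullet> y) = b - a \<bullet> y" using s by (auto simp: l_def)
  have "y \<notin> affine hull G" using face_of_imp_eq_affine_Int[OF cvx facets_face[OF G]] yP by blast
  then have "aff_dim (insert y G) = 3" using facet_dim[OF G] by (simp add: aff_dim_insert)
  then have hull: "affine hull (insert y G) = UNIV" using aff_dim_eq_full[of "insert y G"] by simp
  have "a \<bullet> x + (- b) = (l *\<^sub>R a') \<bullet> x + (- (l * b'))" for x
  proof (rule affine_eq_on_hull[where S = "insert y G"])
    fix z assume "z \<in> insert y G"
    then show "a \<bullet> z + (- b) = (l *\<^sub>R a') \<bullet> z + (- (l * b'))"
    proof
      assume "z = y" then show ?thesis using l(2) by (simp add: algebra_simps)
    next
      assume "z \<in> G"
      then have "a \<bullet> z = b" "a' \<bullet> z = b'" using 1(2) 2(2) by blast+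
      then show ?thesis by simp
    qed
  qed (simp add: hull)
  then have "a \<bullet> x - b = l * (a' \<bullet> x - b')" for x by (simp add: algebra_simps)
  then show thesis using that l(1) by blast
qed

text \<open>The point is obtained by prolonging the segment from an interior point of
  \<open>P\<close> to a relative interior point of \<open>F\<close> slightly beyond
  \<open>F\<close>; all other facet inequalities are strict at the latter point and survive a small
  step.\<close>

lemma beyond_only_exists:
  assumes F: "F \<in> facets P" shows "\<exists>u. beyond_only P F u"
proof -
  obtain A \<beta> where A: "\<And>F x. F \<in> facets P \<Longrightarrow> x \<in> P \<Longrightarrow> A F \<bullet> x \<le> \<beta> F"
    "\<And>F x. F \<in> facets P \<Longrightarrow> x \<in> P \<Longrightarrow> A F \<bullet> x = \<beta> F \<longleftrightarrow> x \<in> F" by (rule normals) blast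
  obtain y where y: "y \<in> interior P" using interior_nonempty by blast
  have "F \<noteq> {}" using facet_dim[OF F] by auto
  then have "rel_interior F \<noteq> {}" using rel_interior_eq_empty face_of_imp_convex[OF facets_face[OF F]] by blast
  then obtain z where z: "z \<in> rel_interior F" by blast
  have zF: "z \<in> F" using z rel_interior_subset by blast
  have FP: "F \<subseteq> P" using face_of_imp_subset[OF facets_face[OF F]] .
  have zP: "z \<in> P" and yP: "y \<in> P" using zF FP y interior_subset by blast+
  have zG: "z \<notin> G" if G: "G \<in> facets P" "G \<noteq> F" for G
  proof
    assume "z \<in> G"
    then have "F \<subseteq> G" using subset_of_face_of[OF facets_face[OF G(1)] FP] z by blast
    then have "F = G" using face_of_aff_dim_eq[OF cvx facets_face[OF F] facets_face[OF G(1)]] facet_dim F G(1) by simp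
    then show False using G(2) by simp
  qed
  let ?I = "facets P - {F}"
  have fin: "finite ?I" using finite_facets[OF pt] by simp
  have pos: "(\<beta> G - A G \<bullet> z) / 2 > 0" if "G \<in> ?I" for G using A[of G z] zG[of G] that zP by (auto simp: less_le)
  obtain e where e0: "0 < e" "e < 1/2" and e1: "\<And>G. G \<in> ?I \<Longrightarrow> e * \<bar>A G \<bullet> (z - y)\<bar> \<le> (\<beta> G - A G \<bullet> z) / 2"
    by (rule small_epsilon[where c = "\<lambda>G. (\<beta> G - A G \<bullet> z) / 2" and a = "\<lambda>G. A G \<bullet> (z - y)", OF fin pos]) (assumption, rule that)
  note e = e0(1) e1
  define u where "u = z + e *\<^sub>R (z - y)"
  have AF: "P \<subseteq> {x. A G \<bullet> x \<le> \<beta> G}" "G = P \<inter> {x. A G \<bullet> x = \<beta> G}" if G: "G \<in> facets P" for G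
  proof -
    show "P \<subseteq> {x. A G \<bullet> x \<le> \<beta> G}" using A(1)[OF G] by blast
    have "x \<in> G \<longleftrightarrow> x \<in> P \<inter> {x. A G \<bullet> x = \<beta> G}" for x
      using A(2)[OF G, of x] face_of_imp_subset[OF facets_face[OF G]] by blast
    then show "G = P \<inter> {x. A G \<bullet> x = \<beta> G}" by (rule set_eqI)
  qed
  have uF: "A F \<bullet> u > \<beta> F"
  proof -
    have "A F \<bullet> z = \<beta> F" "A F \<bullet> y < \<beta> F"
      using A[OF F zP] zF A[OF F yP] facet_disjoint_interior[OF F y] by (auto simp: less_le)
    then have "e * (A F \<bullet> z - A F \<bullet> y) > 0" using e(1) by simp
    then show ?thesis using \<open>A F \<bullet> z = \<beta> F\<close> by (simp add: u_def inner_add_right inner_diff_right)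
  qed
  have uG: "A G \<bullet> u < \<beta> G" if G: "G \<in> facets P" "G \<noteq> F" for G
  proof -
    have "e * (A G \<bullet> (z - y)) \<le> e * \<bar>A G \<bullet> (z - y)\<bar>" using e(1) by simp
    also have "\<dots> \<le> (\<beta> G - A G \<bullet> z) / 2" using e(2) G by simp
    also have "\<dots> < \<beta> G - A G \<bullet> z" using pos[of G] G by simp
    finally show ?thesis by (simp add: u_def inner_add_right)
  qed
  have key: "if G = F then a \<bullet> u > b else a \<bullet> u < b"
    if h: "G facet_of P" "P \<subseteq> {x. a \<bullet> x \<le> b}" "G = P \<inter> {x. a \<bullet> x = b}" for G a b
  proof -
    have G: "G \<in> facets P" using h(1) by (simp add: facets_def)
    obtain l where l: "l > 0" "\<And>x. a \<bullet> x - b = l * (A G \<bullet> x - \<beta> G)"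
      using supporting_sign[OF G h(2,3) AF[OF G]] by blast
    show ?thesis
    proof (cases "G = F")
      case True
      then have "l * (A G \<bullet> u - \<beta> G) > 0" using uF l(1) by simp
      then show ?thesis using l(2)[of u] True by simp
    next
      case False
      then have "l * (A G \<bullet> u - \<beta> G) < 0" using uG[OF G False] l(1) by (simp add: mult_pos_neg)
      then show ?thesis using l(2)[of u] False by simp
    qed
  qed
  have "beyond_only P F u"
    unfolding beyond_only_def
  proof (intro conjI allI impI)
    show "F facet_of P" using F by (simp add: facets_def)
    fix G a b assume "G facet_of P" "P \<subseteq> {x. a \<bullet> x \<le> b}" "G = P \<inter> {x. a \<bullet> x = b}"
    then show "if G = F then a \<bullet> u > b else a \<bullet> u < b" by (rule key)
  qed
  then show ?thesis by blast
qed

text \<open>The facets are certified by counting: the stacking adds one vertex and two facets, and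
  nine incidences replace three, which balances in Euler's relation.\<close>

lemma stack_triangle:
  assumes F: "F \<in> facets P" and v: "verts F = {x, y, z}" "x \<noteq> y" "y \<noteq> z" "x \<noteq> z" and bo: "beyond_only P F u"
  shows "polyhedron3 (convex hull (insert u P))" "verts (convex hull (insert u P)) = insert u (verts P)" "u \<notin> verts P"
    "facet_verts (convex hull (insert u P)) = (facet_verts P - {{x, y, z}}) \<union> {{u, x, y}, {u, y, z}, {u, x, z}}"
proof -
  let ?V = "insert u (verts P)" and ?N = "{{u, x, y}, {u, y, z}, {u, x, z}}"
  let ?S = "(facet_verts P - {{x, y, z}}) \<union> ?N"
  obtain A \<beta> where A: "\<And>F x. F \<in> facets P \<Longrightarrow> x \<in> P \<Longrightarrow> A F \<bullet> x \<le> \<beta> F"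
    "\<And>F x. F \<in> facets P \<Longrightarrow> x \<in> P \<Longrightarrow> A F \<bullet> x = \<beta> F \<longleftrightarrow> x \<in> F" by (rule normals) blast
  have sgn: "if G = F then A G \<bullet> u > \<beta> G else A G \<bullet> u < \<beta> G" if G: "G \<in> facets P" for G
  proof -
    have r: "P \<subseteq> {x. A G \<bullet> x \<le> \<beta> G}" "G = P \<inter> {x. A G \<bullet> x = \<beta> G}"
      using A(1)[OF G] A(2)[OF G] face_of_imp_subset[OF facets_face[OF G]] by blast+
    have "A G \<noteq> 0"
    proof
      assume 0: "A G = 0"
      obtain y where "y \<in> interior P" using interior_nonempty by blast
      then have y: "y \<in> P" "y \<notin> G" using interior_subset facet_disjoint_interior[OF G] by blast+
      obtain w where w: "w \<in> G" using facet_dim[OF G] by fastforce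
      then have "w \<in> P" using face_of_imp_subset[OF facets_face[OF G]] by blast
      then have "A G \<bullet> w = \<beta> G" using A(2)[OF G] w by blast
      then have "A G \<bullet> y = \<beta> G" by (simp add: 0)
      then show False using A(2)[OF G y(1)] y(2) by simp
    qed
    moreover have "G facet_of P" using G by (simp add: facets_def)
    ultimately show ?thesis using bo[unfolded beyond_only_def, THEN conjunct2, rule_format, OF _ _ r] by blast
  qed
  have xyz: "x \<in> verts P" "y \<in> verts P" "z \<in> verts P" using v verts_face_subset[OF facets_face[OF F]] by blast+
  have VP: "w \<in> P" if "w \<in> verts P" for w using that verts_subset by blast
  show un: "u \<notin> verts P" using sgn[OF F] A(1)[OF F VP[of u]] by force
  have uxyz: "u \<noteq> x" "u \<noteq> y" "u \<noteq> z" using un xyz by blast+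
  have old: "S \<subseteq> verts P" if "S \<in> facet_verts P" for S using facet_verts_subset[OF that] .
  have finV: "finite (verts P)" by (rule finite_verts[OF pt])
  have c4: "card (verts P) \<ge> 4" using card_verts_aff_dim[OF pt] dim3 by simp
  have "\<not> verts P \<subseteq> {x, y, z}"
  proof
    assume "verts P \<subseteq> {x, y, z}"
    then have "card (verts P) \<le> card {x, y, z}" by (intro card_mono) auto
    then show False using c4 v by simp
  qed
  then obtain w0 where w0: "w0 \<in> verts P" "w0 \<notin> {x, y, z}" by blast
  have ou: "w0 \<noteq> u" using w0 un by blast
  have new: "\<exists>a b. \<forall>w\<in>?V. a \<bullet> w \<le> b \<and> (a \<bullet> w = b \<longleftrightarrow> w \<in> {u, p, q})"
    if pq: "G \<in> facets P" "G \<noteq> F" "verts F \<inter> verts G = {p, q}" for p q G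
  proof -
    \<comment> \<open>The new facet through \<open>u\<close> and the edge of \<open>F\<close> and
      \<open>G\<close> lies in the plane of a positive combination of their slacks, with weights
      chosen to make it vanish at \<open>u\<close>, which is beyond \<open>F\<close> and beneath
      \<open>G\<close>.\<close>
    define s where "s = A F \<bullet> u - \<beta> F"
    define r where "r = \<beta> G - A G \<bullet> u"
    have rs: "r > 0" "s > 0" using sgn[OF F] sgn[OF pq(1)] pq(2) by (auto simp: r_def s_def)
    let ?a = "r *\<^sub>R A F + s *\<^sub>R A G" and ?b = "r * \<beta> F + s * \<beta> G"
    have d: "?a \<bullet> w - ?b = r * (A F \<bullet> w - \<beta> F) + s * (A G \<bullet> w - \<beta> G)" for w
      by (simp add: inner_add_left algebra_simps)
    have u0: "?a \<bullet> u - ?b = 0" unfolding d by (simp add: r_def s_def algebra_simps)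
    have "?a \<bullet> w \<le> ?b \<and> (?a \<bullet> w = ?b \<longleftrightarrow> w \<in> {u, p, q})" if w: "w \<in> ?V" for w
    proof (cases "w = u")
      case True then show ?thesis using u0 by simp
    next
      case False
      then have wP: "w \<in> verts P" using w by blast
      have m: "r * (A F \<bullet> w - \<beta> F) \<le> 0" "s * (A G \<bullet> w - \<beta> G) \<le> 0"
        using A(1)[OF F VP[OF wP]] A(1)[OF pq(1) VP[OF wP]] rs by (simp_all add: mult_nonneg_nonpos)
      then have "?a \<bullet> w - ?b = 0 \<longleftrightarrow> r * (A F \<bullet> w - \<beta> F) = 0 \<and> s * (A G \<bullet> w - \<beta> G) = 0" unfolding d by linarith
      also have "\<dots> \<longleftrightarrow> w \<in> F \<and> w \<in> G" using rs A(2)[OF F VP[OF wP]] A(2)[OF pq(1) VP[OF wP]] by simp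
      also have "\<dots> \<longleftrightarrow> w \<in> {p, q}" using in_verts_facet[OF F wP] in_verts_facet[OF pq(1) wP] pq(3) by blast
      finally have "?a \<bullet> w - ?b = 0 \<longleftrightarrow> w \<in> {p, q}" .
      moreover have "?a \<bullet> w - ?b \<le> 0" unfolding d using m by linarith
      ultimately show ?thesis using False by auto
    qed
    then show ?thesis by blast
  qed
  obtain G1 where G1: "G1 \<in> facets P" "G1 \<noteq> F" "verts F \<inter> verts G1 = {x, y}"
    using triangle_neighbour[OF F v] by blast
  have v2: "verts F = {y, z, x}" "verts F = {x, z, y}" using v(1) by blast+
  obtain G2 where G2: "G2 \<in> facets P" "G2 \<noteq> F" "verts F \<inter> verts G2 = {y, z}"
    using triangle_neighbour[OF F v2(1)] v by blast
  obtain G3 where G3: "G3 \<in> facets P" "G3 \<noteq> F" "verts F \<inter> verts G3 = {x, z}"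
    using triangle_neighbour[OF F v2(2)] v by blast
  have conv: "convex hull (insert u P) = convex hull ?V"
    using polytope_conv_verts[OF pt] hull_insert[of convex u "verts P"] by simp
  have fS: "finite (facet_verts P)" by (rule finite_facet_verts_set)
  have FS: "{x, y, z} \<in> facet_verts P" using F v(1) unfolding facet_verts_def by blast
  have cN: "card ?N = 3" "\<forall>S\<in>?N. card S = 3"
  proof -
    have mem_ne: "X \<noteq> Y" if "e \<in> X" "e \<notin> Y" for e and X Y :: "pt3 set" using that by blast
    have "{u, x, y} \<noteq> {u, y, z}" by (rule mem_ne[of x]) (use uxyz v in simp_all)
    moreover have "{u, x, y} \<noteq> {u, x, z}" by (rule mem_ne[of y]) (use uxyz v in simp_all)
    moreover have "{u, y, z} \<noteq> {u, x, z}" by (rule mem_ne[of y]) (use uxyz v in simp_all)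
    ultimately show "card ?N = 3" by simp
    show "\<forall>S\<in>?N. card S = 3" using uxyz v by simp
  qed
  have disj: "(facet_verts P - {{x, y, z}}) \<inter> ?N = {}" using old un by blast
  have facet_other: "S \<in> facet_verts P - {{x, y, z}} \<Longrightarrow> \<exists>G. G \<in> facets P \<and> G \<noteq> F \<and> S = verts G" for S
    unfolding facet_verts_def using v(1) by blast
  have R: "polyhedron3 (convex hull ?V) \<and> verts (convex hull ?V) = ?V \<and> facet_verts (convex hull ?V) = ?S"
  proof (rule facet_certificate_all)
    show "finite ?V" using finV by simp
    show "S \<subset> ?V" if "S \<in> ?S" for S
      using that
    proof
      assume "S \<in> facet_verts P - {{x, y, z}}"
      then have "S \<subseteq> verts P" using old by blast
      then show ?thesis using un by blast
    next
      assume "S \<in> ?N"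
      then have "S \<subseteq> ?V" "w0 \<notin> S" using xyz w0 ou by blast+
      then show ?thesis using w0 by blast
    qed
    show "card S \<ge> 3" if "S \<in> ?S" for S
      using that cN(2) facet_card_ge3 unfolding facet_verts_def by fastforce
    show "\<exists>a b. \<forall>w\<in>?V. a \<bullet> w \<le> b \<and> (a \<bullet> w = b \<longleftrightarrow> w \<in> S)" if "S \<in> ?S" for S
      using that
    proof
      assume "S \<in> facet_verts P - {{x, y, z}}"
      then obtain G where G: "G \<in> facets P" "G \<noteq> F" "S = verts G" using facet_other by blast
      have "A G \<bullet> w \<le> \<beta> G \<and> (A G \<bullet> w = \<beta> G \<longleftrightarrow> w \<in> S)" if "w \<in> ?V" for w
      proof (cases "w = u")
        case True
        then show ?thesis using sgn[OF G(1)] G old[of S] un unfolding facet_verts_def by auto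
      next
        case False
        then have w: "w \<in> verts P" using that by blast
        then show ?thesis using A(1)[OF G(1) VP[OF w]] A(2)[OF G(1) VP[OF w]] in_verts_facet[OF G(1) w] G(3) by simp
      qed
      then show ?thesis by blast
    next
      assume "S \<in> ?N"
      then consider "S = {u, x, y}" | "S = {u, y, z}" | "S = {u, x, z}" by blast
      then show ?thesis
      proof cases
        case 1 then show ?thesis using new[OF G1] by blast
      next
        case 2 then show ?thesis using new[OF G2] by blast
      next
        case 3 then show ?thesis using new[OF G3] by blast
      qed
    qed
    have N: "{u, x, y} \<in> ?N" "{u, y, z} \<in> ?N" "{u, x, z} \<in> ?N" by (simp_all only: insert_iff simp_thms)
    note inS = N[THEN UnI2, of "facet_verts P - {{x, y, z}}"]
    from inS(1) show "?S \<noteq> {}" by (metis empty_iff)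
    \<comment> \<open>A vertex has degree at least three, so the loss of \<open>F\<close> leaves it
      on an old facet.\<close>
    have oldG: "\<exists>S\<in>facet_verts P - {{x, y, z}}. w \<in> S" if w: "w \<in> verts P" for w
    proof -
      have "\<not> {G \<in> facets P. w \<in> verts G} \<subseteq> {F}"
      proof
        assume "{G \<in> facets P. w \<in> verts G} \<subseteq> {F}"
        then have "card {G \<in> facets P. w \<in> verts G} \<le> card {F}" by (intro card_mono) auto
        then show False using vertex_degree_ge3[OF w] by simp
      qed
      then obtain G where G: "G \<in> facets P" "w \<in> verts G" "G \<noteq> F" by blast
      then have "verts G \<noteq> verts F" using inj_onD[OF inj_on_verts_facets[OF pt], of G F] F by blast
      then show ?thesis using G v(1) unfolding facet_verts_def by blast
    qed
    show "\<exists>S\<in>?S. w \<in> S" if "w \<in> ?V" for w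
    proof (cases "w = u")
      case False
      then have "w \<in> verts P" using that by blast
      from oldG[OF this] show ?thesis by blast
    qed blast
    show "\<exists>S\<in>?S. w \<in> S \<and> w' \<notin> S" if h: "w \<in> ?V" "w' \<in> ?V" "w \<noteq> w'" for w w'
    proof -
      consider "w = u" | "w \<noteq> u" "w' = u" | "w \<noteq> u" "w' \<noteq> u" by blast
      then show ?thesis
      proof cases
        case 1
        have "w' \<notin> {u, x, y} \<or> w' \<notin> {u, y, z} \<or> w' \<notin> {u, x, z}" using h(3) 1 v(2-4) by auto
        then show ?thesis using 1 inS by (metis insertI1)
      next
        case 2
        then have "w \<in> verts P" using h by blast
        from oldG[OF this] obtain S where S: "S \<in> facet_verts P - {{x, y, z}}" "w \<in> S" by blast
        then have "w' \<notin> S" using old un 2 by blast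
        then show ?thesis using S by blast
      next
        case 3
        then have wP: "w \<in> verts P" "w' \<in> verts P" using h by blast+
        obtain G where G: "G \<in> facets P" "w \<in> verts G" "w' \<notin> verts G" using separate_verts[OF wP h(3)] by blast
        show ?thesis
        proof (cases "G = F")
          case True
          then have "w \<in> {x, y, z}" "w' \<notin> {x, y, z}" using G v by simp_all
          then have "w \<in> {u, x, y} \<and> w' \<notin> {u, x, y} \<or> w \<in> {u, x, z} \<and> w' \<notin> {u, x, z}" using 3 by auto
          then show ?thesis using inS by metis
        next
          case False
          then have "verts G \<noteq> verts F" using inj_onD[OF inj_on_verts_facets[OF pt], of G F] F G(1) by blast
          then have "verts G \<in> facet_verts P - {{x, y, z}}" using G(1) v(1) unfolding facet_verts_def by blast
          then show ?thesis using G by blast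
        qed
      qed
    qed
    have s1: "(\<Sum>S\<in>?S. card S) = (\<Sum>S\<in>facet_verts P - {{x, y, z}}. card S) + (\<Sum>S\<in>?N. card S)"
      using fS disj by (intro sum.union_disjoint) auto
    have "(\<Sum>S\<in>?N. card S) = (\<Sum>S\<in>?N. 3)" by (rule sum.cong[OF refl]) (use cN(2) in blast)
    then have s2: "(\<Sum>S\<in>?N. card S) = 9" by (simp only: sum_constant cN(1)) simp
    have s3: "(\<Sum>S\<in>facet_verts P. card S) = card {x, y, z} + (\<Sum>S\<in>facet_verts P - {{x, y, z}}. card S)"
      by (rule sum.remove[OF fS FS])
    have s4: "card {x, y, z} = 3" using v by simp
    have c1: "card ?S = card (facet_verts P - {{x, y, z}}) + 3"
      using card_Un_disjoint[OF _ _ disj] fS cN(1) by simp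
    have c2: "card (facet_verts P) = Suc (card (facet_verts P - {{x, y, z}}))" using card.remove[OF fS FS] .
    have c3: "card ?V = Suc (card (verts P))" using un finV by simp
    show "2 * card ?S + 2 * card ?V \<le> (\<Sum>S\<in>?S. card S) + 4"
      using euler_verts s1 s2 s3 s4 c1 c2 c3 by linarith
  qed
  show "polyhedron3 (convex hull (insert u P))" "verts (convex hull (insert u P)) = ?V" "facet_verts (convex hull (insert u P)) = ?S"
    unfolding conv using R by blast+
qed

end

section \<open>The triangular prism\<close>

definition prism_facets :: "'a \<Rightarrow> 'a \<Rightarrow> 'a \<Rightarrow> 'a \<Rightarrow> 'a \<Rightarrow> 'a \<Rightarrow> 'a set set" where
  "prism_facets a b c a' b' c' = {{a, b, c}, {a', b', c'}, {a, b, a', b'}, {b, c, b', c'}, {a, c, a', c'}}"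

text \<open>In the affine coordinates dual to \<open>e1\<close>, \<open>e2\<close>, \<open>v\<close>
  the prism becomes the standard one, and its facets are given by simple coordinate
  inequalities.\<close>

lemma prism_structure:
  assumes P: "P = convex hull {a, b, c, a + v, b + v, c + v}" "aff_dim P = 3"
  shows "polyhedron3 P" "verts P = {a, b, c, a + v, b + v, c + v}" "facet_verts P = prism_facets a b c (a + v) (b + v) (c + v)"
    "distinct [a, b, c, a + v, b + v, c + v]"
proof -
  let ?V = "{a, b, c, a + v, b + v, c + v}"
  define e1 e2 where "e1 = b - a" and "e2 = c - a"
  have bc: "b = a + e1" "c = a + e2" by (simp_all add: e1_def e2_def)
  \<comment> \<open>A direction orthogonal to all three vectors would confine the prism to a plane;
    this excludes the second alternative of \<open>three_planes\<close> and yields the dual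
    basis.\<close>
  have nod: False if d: "d \<noteq> 0" "e1 \<bullet> d = 0" "e2 \<bullet> d = 0" "v \<bullet> d = 0" for d
  proof -
    have "?V \<subseteq> {x. d \<bullet> x = d \<bullet> a}" unfolding bc using d by (auto simp: inner_add_right inner_commute)
    then have "P \<subseteq> {x. d \<bullet> x = d \<bullet> a}" unfolding P by (intro hull_minimal) (auto simp: convex_hyperplane)
    then have "aff_dim P \<le> aff_dim {x. d \<bullet> x = d \<bullet> a}" by (rule aff_dim_subset)
    then show False using P(2) d(1) by simp
  qed
  have dual: "\<exists>l. l \<bullet> e1 = k1 \<and> l \<bullet> e2 = k2 \<and> l \<bullet> v = k3" for k1 k2 k3
    by (rule three_planes[of e1 k1 e2 k2 v k3]) (use nod in \<open>auto simp: inner_commute\<close>)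
  obtain l1 where l1: "l1 \<bullet> e1 = 1" "l1 \<bullet> e2 = 0" "l1 \<bullet> v = 0" using dual by blast
  obtain l2 where l2: "l2 \<bullet> e1 = 0" "l2 \<bullet> e2 = 1" "l2 \<bullet> v = 0" using dual by blast
  obtain l3 where l3: "l3 \<bullet> e1 = 0" "l3 \<bullet> e2 = 0" "l3 \<bullet> v = 1" using dual by blast
  have val: "l1 \<bullet> b = l1 \<bullet> a + 1" "l1 \<bullet> c = l1 \<bullet> a" "l2 \<bullet> b = l2 \<bullet> a" "l2 \<bullet> c = l2 \<bullet> a + 1" "l3 \<bullet> b = l3 \<bullet> a" "l3 \<bullet> c = l3 \<bullet> a"
    unfolding bc using l1 l2 l3 by (simp_all add: inner_add_right)
  have valv: "l1 \<bullet> (x + v) = l1 \<bullet> x" "l2 \<bullet> (x + v) = l2 \<bullet> x" "l3 \<bullet> (x + v) = l3 \<bullet> x + 1" for x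
    using l1 l2 l3 by (simp_all add: inner_add_right)
  have ne: "x \<noteq> y" if "l1 \<bullet> x \<noteq> l1 \<bullet> y \<or> l2 \<bullet> x \<noteq> l2 \<bullet> y \<or> l3 \<bullet> x \<noteq> l3 \<bullet> y" for x y using that by auto
  show dist: "distinct [a, b, c, a + v, b + v, c + v]"
    by (simp only: distinct.simps list.set insert_iff empty_iff simp_thms de_Morgan_disj)
       (intro conjI ne; simp add: val valv)
  then have neq: "a \<noteq> b" "a \<noteq> c" "b \<noteq> c" "a \<noteq> a + v" "a \<noteq> b + v" "a \<noteq> c + v" "b \<noteq> a + v" "b \<noteq> b + v" "b \<noteq> c + v"
    "c \<noteq> a + v" "c \<noteq> b + v" "c \<noteq> c + v" "a + v \<noteq> b + v" "a + v \<noteq> c + v" "b + v \<noteq> c + v"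
    by (simp_all only: distinct.simps list.set insert_iff empty_iff simp_thms de_Morgan_disj)
  define a' b' c' where "a' = a + v" and "b' = b + v" and "c' = c + v"
  note neq' = neq[folded a'_def b'_def c'_def]
  have val': "l1 \<bullet> a' = l1 \<bullet> a" "l2 \<bullet> a' = l2 \<bullet> a" "l3 \<bullet> a' = l3 \<bullet> a + 1"
    "l1 \<bullet> b' = l1 \<bullet> b" "l2 \<bullet> b' = l2 \<bullet> b" "l3 \<bullet> b' = l3 \<bullet> b + 1"
    "l1 \<bullet> c' = l1 \<bullet> c" "l2 \<bullet> c' = l2 \<bullet> c" "l3 \<bullet> c' = l3 \<bullet> c + 1"
    by (simp_all add: a'_def b'_def c'_def valv)
  let ?W = "{a, b, c, a', b', c'}"
  have W: "?V = ?W" by (simp add: a'_def b'_def c'_def)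
  have pf: "S \<in> prism_facets a b c a' b' c' \<Longrightarrow> S = {a, b, c} \<or> S = {a', b', c'} \<or> S = {a, b, a', b'} \<or> S = {b, c, b', c'} \<or> S = {a, c, a', c'}" for S
    by (simp only: prism_facets_def insert_iff empty_iff simp_thms)
  note ns = neq' neq'[symmetric]
  have five: "card (prism_facets a b c a' b' c') = 5" "(\<Sum>S\<in>prism_facets a b c a' b' c'. card S) = 18"
  proof -
    have mem_ne: "X \<noteq> Y" if "e \<in> X" "e \<notin> Y" for e and X Y :: "pt3 set" using that by blast
    have d0: "{a, b, c} \<noteq> {a', b', c'}" by (rule mem_ne[of "a"]) (use ns in simp_all)
    have d1: "{a, b, c} \<noteq> {a, b, a', b'}" by (rule mem_ne[of "c"]) (use ns in simp_all)
    have d2: "{a, b, c} \<noteq> {b, c, b', c'}" by (rule mem_ne[of "a"]) (use ns in simp_all)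
    have d3: "{a, b, c} \<noteq> {a, c, a', c'}" by (rule mem_ne[of "b"]) (use ns in simp_all)
    have d4: "{a', b', c'} \<noteq> {a, b, a', b'}" by (rule mem_ne[of "c'"]) (use ns in simp_all)
    have d5: "{a', b', c'} \<noteq> {b, c, b', c'}" by (rule mem_ne[of "a'"]) (use ns in simp_all)
    have d6: "{a', b', c'} \<noteq> {a, c, a', c'}" by (rule mem_ne[of "b'"]) (use ns in simp_all)
    have d7: "{a, b, a', b'} \<noteq> {b, c, b', c'}" by (rule mem_ne[of "a"]) (use ns in simp_all)
    have d8: "{a, b, a', b'} \<noteq> {a, c, a', c'}" by (rule mem_ne[of "b"]) (use ns in simp_all)
    have d9: "{b, c, b', c'} \<noteq> {a, c, a', c'}" by (rule mem_ne[of "b"]) (use ns in simp_all)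
    note d = d0 d1 d2 d3 d4 d5 d6 d7 d8 d9
    show "card (prism_facets a b c a' b' c') = 5" unfolding prism_facets_def using d by simp
    show "(\<Sum>S\<in>prism_facets a b c a' b' c'. card S) = 18" unfolding prism_facets_def using d ns by simp
  qed
  have R: "polyhedron3 (convex hull ?W) \<and> verts (convex hull ?W) = ?W \<and> facet_verts (convex hull ?W) = prism_facets a b c a' b' c'"
  proof (rule facet_certificate_all)
    show "finite ?W" by simp
    show "S \<subset> ?W" if "S \<in> prism_facets a b c a' b' c'" for S
    proof -
      have ps: "X \<subset> ?W" if "X \<subseteq> ?W" "e \<in> ?W" "e \<notin> X" for e X using that by blast
      show ?thesis using pf[OF that]
      proof (elim disjE)
        assume S: "S = {a, b, c}" show ?thesis unfolding S by (rule ps[of _ a']) (use ns in simp_all)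
      next
        assume S: "S = {a', b', c'}" show ?thesis unfolding S by (rule ps[of _ a]) (use ns in simp_all)
      next
        assume S: "S = {a, b, a', b'}" show ?thesis unfolding S by (rule ps[of _ c]) (use ns in simp_all)
      next
        assume S: "S = {b, c, b', c'}" show ?thesis unfolding S by (rule ps[of _ a]) (use ns in simp_all)
      next
        assume S: "S = {a, c, a', c'}" show ?thesis unfolding S by (rule ps[of _ b]) (use ns in simp_all)
      qed
    qed
    show "card S \<ge> 3" if "S \<in> prism_facets a b c a' b' c'" for S
      using pf[OF that] ns by (elim disjE) simp_all
    show "\<exists>n \<beta>. \<forall>w\<in>?W. n \<bullet> w \<le> \<beta> \<and> (n \<bullet> w = \<beta> \<longleftrightarrow> w \<in> S)" if "S \<in> prism_facets a b c a' b' c'" for S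
      using pf[OF that]
    proof (elim disjE)
      assume S: "S = {a, b, c}"
      show ?thesis by (rule exI[of _ "- l3"], rule exI[of _ "- (l3 \<bullet> a)"]) (use ns in \<open>simp add: S val val'\<close>)
    next
      assume S: "S = {a', b', c'}"
      show ?thesis by (rule exI[of _ l3], rule exI[of _ "l3 \<bullet> a + 1"]) (use ns in \<open>simp add: S val val'\<close>)
    next
      assume S: "S = {a, b, a', b'}"
      show ?thesis by (rule exI[of _ "- l2"], rule exI[of _ "- (l2 \<bullet> a)"]) (use ns in \<open>simp add: S val val'\<close>)
    next
      assume S: "S = {b, c, b', c'}"
      show ?thesis by (rule exI[of _ "l1 + l2"], rule exI[of _ "l1 \<bullet> a + l2 \<bullet> a + 1"]) (use ns in \<open>simp add: S val val' inner_add_left\<close>)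
    next
      assume S: "S = {a, c, a', c'}"
      show ?thesis by (rule exI[of _ "- l1"], rule exI[of _ "- (l1 \<bullet> a)"]) (use ns in \<open>simp add: S val val'\<close>)
    qed
    show "prism_facets a b c a' b' c' \<noteq> {}" by (simp add: prism_facets_def)
    show "\<exists>S\<in>prism_facets a b c a' b' c'. w \<in> S" if "w \<in> ?W" for w
      using that by (auto simp: prism_facets_def)
    show "\<exists>S\<in>prism_facets a b c a' b' c'. w \<in> S \<and> w' \<notin> S" if hw: "w \<in> ?W" "w' \<in> ?W" "w \<noteq> w'" for w w'
    proof -
      have mem: "{a, b, c} \<in> prism_facets a b c a' b' c'" "{a', b', c'} \<in> prism_facets a b c a' b' c'"
        "{a, b, a', b'} \<in> prism_facets a b c a' b' c'" "{b, c, b', c'} \<in> prism_facets a b c a' b' c'"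
        "{a, c, a', c'} \<in> prism_facets a b c a' b' c'" by (simp_all add: prism_facets_def)
      consider "w = a" | "w = b" | "w = c" | "w = a'" | "w = b'" | "w = c'" using hw(1) by blast
      then show ?thesis
      proof cases
        case 1
        then have "w' \<notin> {a, b, c} \<or> w' \<notin> {a, b, a', b'} \<or> w' \<notin> {a, c, a', c'}" using hw(3) ns by auto
        moreover have "w \<in> {a, b, c}" "w \<in> {a, b, a', b'}" "w \<in> {a, c, a', c'}" using 1 by simp_all
        ultimately show ?thesis using mem by metis
      next
        case 2
        then have "w' \<notin> {a, b, c} \<or> w' \<notin> {a, b, a', b'} \<or> w' \<notin> {b, c, b', c'}" using hw(3) ns by auto
        moreover have "w \<in> {a, b, c}" "w \<in> {a, b, a', b'}" "w \<in> {b, c, b', c'}" using 2 by simp_all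
        ultimately show ?thesis using mem by metis
      next
        case 3
        then have "w' \<notin> {a, b, c} \<or> w' \<notin> {b, c, b', c'} \<or> w' \<notin> {a, c, a', c'}" using hw(3) ns by auto
        moreover have "w \<in> {a, b, c}" "w \<in> {b, c, b', c'}" "w \<in> {a, c, a', c'}" using 3 by simp_all
        ultimately show ?thesis using mem by metis
      next
        case 4
        then have "w' \<notin> {a', b', c'} \<or> w' \<notin> {a, b, a', b'} \<or> w' \<notin> {a, c, a', c'}" using hw(3) ns by auto
        moreover have "w \<in> {a', b', c'}" "w \<in> {a, b, a', b'}" "w \<in> {a, c, a', c'}" using 4 by simp_all
        ultimately show ?thesis using mem by metis
      next
        case 5
        then have "w' \<notin> {a', b', c'} \<or> w' \<notin> {a, b, a', b'} \<or> w' \<notin> {b, c, b', c'}" using hw(3) ns by auto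
        moreover have "w \<in> {a', b', c'}" "w \<in> {a, b, a', b'}" "w \<in> {b, c, b', c'}" using 5 by simp_all
        ultimately show ?thesis using mem by metis
      next
        case 6
        then have "w' \<notin> {a', b', c'} \<or> w' \<notin> {b, c, b', c'} \<or> w' \<notin> {a, c, a', c'}" using hw(3) ns by auto
        moreover have "w \<in> {a', b', c'}" "w \<in> {b, c, b', c'}" "w \<in> {a, c, a', c'}" using 6 by simp_all
        ultimately show ?thesis using mem by metis
      qed
    qed
    show "2 * card (prism_facets a b c a' b' c') + 2 * card ?W \<le> (\<Sum>S\<in>prism_facets a b c a' b' c'. card S) + 4"
      using five ns by simp
  qed
  have PW: "convex hull ?W = P" using P(1) W by simp
  show "polyhedron3 P" using R PW by simp
  show "verts P = ?V" using R PW W by simp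
  show "facet_verts P = prism_facets a b c (a + v) (b + v) (c + v)"
    using R unfolding PW unfolding a'_def b'_def c'_def by blast
qed

section \<open>Combinatorial types\<close>

definition has_type :: "pt3 set \<Rightarrow> nat list list \<Rightarrow> bool" where
  "has_type P fs \<longleftrightarrow> (\<exists>p. bij_betw p {..<8} (verts P) \<and> facet_verts P = (\<lambda>F. p ` set F) ` set fs)"

text \<open>Strictly increasing facet lists make \<open>set\<close> injective on them, so that lists
  can be counted in place of sets.\<close>

definition wf_type :: "nat list list \<Rightarrow> bool" where
  "wf_type fs \<longleftrightarrow> length fs = 9 \<and> distinct fs \<and> list_all (\<lambda>F. sorted_wrt (<) F \<and> list_all (\<lambda>x. x < 8) F \<and> 3 \<le> length F) fs
     \<and> sum_list (map length fs) = 30"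

definition types :: "nat list list list" where "types = type_A # type_B # rigid_types"

section \<open>Executable invariants and certificates of a type\<close>

fun degree_of :: "nat \<Rightarrow> nat list list \<Rightarrow> nat" where
  "degree_of v [] = 0"
| "degree_of v (F # fs) = (if v \<in> set F then degree_of v fs + 1 else degree_of v fs)"

fun degrees :: "nat list \<Rightarrow> nat list list \<Rightarrow> nat list" where
  "degrees [] fs = []"
| "degrees (v # vs) fs = (degree_of v fs)\<^sup>2 # degrees vs fs"

fun facet_weight :: "nat list \<Rightarrow> nat list \<Rightarrow> nat" where
  "facet_weight ds [] = 0"
| "facet_weight ds (v # F) = ds ! v + facet_weight ds F"

fun facet_weights :: "nat list \<Rightarrow> nat list list \<Rightarrow> nat list" where
  "facet_weights ds [] = []"
| "facet_weights ds (F # fs) = (facet_weight ds F)\<^sup>2 # facet_weights ds fs"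

fun vertex_weight :: "nat \<Rightarrow> nat list list \<Rightarrow> nat list \<Rightarrow> nat" where
  "vertex_weight v [] ws = 0"
| "vertex_weight v (F # fs) [] = 0"
| "vertex_weight v (F # fs) (w # ws) = (if v \<in> set F then w + vertex_weight v fs ws else vertex_weight v fs ws)"

fun total_weight :: "nat list \<Rightarrow> nat list list \<Rightarrow> nat list \<Rightarrow> nat" where
  "total_weight [] fs ws = 0"
| "total_weight (v # vs) fs ws = (vertex_weight v fs ws)\<^sup>2 + total_weight vs fs ws"

text \<open>Vertex degrees are propagated to the facets, back to the vertices, and added up.
  Squaring at each stage makes the result sensitive to how the values are distributed and not only
  to their sums.\<close>

definition list_inv :: "nat list list \<Rightarrow> nat" where
  "list_inv fs = total_weight [0..<8] fs (facet_weights (degrees [0..<8] fs) fs)"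

definition linkedb :: "nat list list \<Rightarrow> nat \<Rightarrow> nat \<Rightarrow> bool" where
  "linkedb fs x y \<longleftrightarrow> x \<noteq> y \<and> 2 \<le> length (filter (\<lambda>F. x \<in> set F \<and> y \<in> set F) fs)"

text \<open>A replay of \<open>rigid\<close> along a prescribed order of attachments;
  \<open>S\<close> lists the vertices reached so far.\<close>

fun rigidb :: "nat list list \<Rightarrow> nat list \<Rightarrow> (nat \<times> nat \<times> nat) list \<Rightarrow> bool" where
  "rigidb fs S [] \<longleftrightarrow> list_all (\<lambda>i. i \<in> set S) [0..<8]"
| "rigidb fs S ((x, y, z) # r) \<longleftrightarrow> linkedb fs x y \<and> linkedb fs x z \<and> y \<in> set S \<and> z \<in> set S \<and> y \<noteq> z \<and> rigidb fs (x # S) r"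

definition dot_int :: "int \<times> int \<times> int \<Rightarrow> int \<times> int \<times> int \<Rightarrow> int" where
  "dot_int = (\<lambda>(a, b, c) (x, y, z). a * x + b * y + c * z)"

fun supports :: "nat list \<Rightarrow> int \<times> int \<times> int \<times> int \<Rightarrow> nat list \<Rightarrow> (int \<times> int \<times> int) list \<Rightarrow> bool" where
  "supports F q [] xs \<longleftrightarrow> True"
| "supports F q (i # is) [] \<longleftrightarrow> False"
| "supports F (a, b, c, d) (i # is) (x # xs) \<longleftrightarrow>
     (if i \<in> set F then dot_int (a, b, c) x = d else dot_int (a, b, c) x < d) \<and> supports F (a, b, c, d) is xs"

fun separates :: "nat \<Rightarrow> nat \<Rightarrow> nat list list \<Rightarrow> bool" where
  "separates i j [] \<longleftrightarrow> False"
| "separates i j (F # fs) \<longleftrightarrow> (if i \<in> set F then (if j \<in> set F then separates i j fs else True) else separates i j fs)"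

fun separates_from :: "nat list list \<Rightarrow> nat \<Rightarrow> nat list \<Rightarrow> bool" where
  "separates_from fs i [] \<longleftrightarrow> True"
| "separates_from fs i (j # js) \<longleftrightarrow> (i = j \<or> separates i j fs) \<and> separates_from fs i js"

fun separates_all :: "nat list list \<Rightarrow> nat list \<Rightarrow> bool" where
  "separates_all fs [] \<longleftrightarrow> True"
| "separates_all fs (i # is) \<longleftrightarrow> separates_from fs i [0..<8] \<and> separates_all fs is"

definition realizes :: "nat list list \<Rightarrow> (int \<times> int \<times> int) list \<times> (int \<times> int \<times> int \<times> int) list \<Rightarrow> bool" where
  "realizes fs = (\<lambda>(xs, qs). list_all2 (\<lambda>F q. supports F q [0..<8] xs) fs qs
     \<and> list_all (\<lambda>F. length F < 8) fs \<and> separates_all fs [0..<8])"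

text \<open>Aligned with \<open>rigid_types\<close>: a starting edge, then six steps
  \<open>(x, y, z)\<close> that attach \<open>x\<close> through its edges to \<open>y\<close> and
  \<open>z\<close>.\<close>

definition rigid_orders :: "((nat \<times> nat) \<times> (nat \<times> nat \<times> nat) list) list" where
  "rigid_orders = [
   ((2,4), [(6,2,4),(7,4,6),(5,4,6),(0,2,5),(1,2,0),(3,6,5)]),
   ((1,4), [(6,1,4),(7,1,4),(2,4,6),(3,4,7),(5,6,7),(0,2,3)]),
   ((0,1), [(5,0,1),(6,0,5),(7,5,6),(3,1,5),(4,5,6),(2,5,3)]),
   ((0,1), [(3,0,1),(7,1,3),(2,3,7),(4,0,7),(5,3,7),(6,7,4)]),
   ((0,1), [(4,0,1),(7,0,1),(3,1,4),(5,7,3),(6,7,5),(2,4,3)]),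
   ((0,4), [(6,0,4),(7,4,6),(5,4,6),(3,6,5),(1,0,3),(2,6,3)]),
   ((0,4), [(5,0,4),(6,4,5),(7,4,5),(1,0,6),(2,6,1),(3,5,6)]),
   ((1,2), [(5,1,2),(6,2,5),(7,5,6),(0,1,6),(3,5,0),(4,5,6)]),
   ((0,1), [(3,0,1),(4,1,3),(6,0,4),(7,4,6),(2,1,3),(5,3,6)]),
   ((0,3), [(5,0,3),(7,0,3),(2,3,5),(6,5,7),(1,3,2),(4,7,6)]),
   ((0,2), [(3,0,2),(7,0,3),(1,2,3),(4,2,7),(5,0,7),(6,7,4)]),
   ((2,4), [(6,2,4),(7,4,6),(1,2,7),(5,2,6),(0,2,1),(3,7,5)]),
   ((0,1), [(2,0,1),(3,0,2),(4,1,2),(7,3,4),(5,1,7),(6,0,7)]),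
   ((1,3), [(7,1,3),(4,3,7),(6,7,4),(2,3,4),(5,7,6),(0,1,2)]),
   ((0,1), [(3,0,1),(5,0,1),(7,1,3),(2,3,7),(4,7,2),(6,5,7)]),
   ((0,1), [(2,0,1),(3,1,2),(4,2,3),(7,1,3),(5,0,7),(6,4,7)]),
   ((0,1), [(2,0,1),(3,1,2),(4,2,3),(7,0,3),(5,2,7),(6,4,7)]),
   ((0,1), [(2,0,1),(3,1,2),(4,2,3),(6,0,4),(7,3,4),(5,1,6)]),
   ((2,3), [(7,2,3),(4,2,7),(5,3,7),(6,7,4),(0,3,4),(1,4,5)]),
   ((0,1), [(6,0,1),(4,0,6),(5,1,6),(7,6,4),(2,5,7),(3,4,7)]),
   ((0,1), [(2,0,1),(4,1,2),(6,1,4),(7,4,6),(3,2,4),(5,0,6)]),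
   ((0,4), [(6,0,4),(7,4,6),(3,4,7),(5,6,7),(1,0,3),(2,6,5)]),
   ((0,1), [(7,0,1),(3,1,7),(4,7,3),(6,7,4),(2,0,3),(5,7,6)]),
   ((0,2), [(7,0,2),(3,2,7),(4,0,7),(5,2,7),(6,7,4),(1,7,3)]),
   ((0,1), [(6,0,1),(5,1,6),(7,6,5),(2,1,7),(3,0,7),(4,6,7)]),
   ((0,1), [(7,0,1),(3,1,7),(4,0,7),(6,7,4),(2,3,4),(5,7,6)]),
   ((0,1), [(2,0,1),(7,1,2),(3,2,7),(4,7,3),(5,0,7),(6,2,7)]),
   ((0,1), [(4,0,1),(7,1,4),(3,4,7),(5,0,7),(6,7,3),(2,4,3)]),
   ((0,1), [(5,0,1),(3,1,5),(7,5,3),(2,3,7),(4,0,7),(6,5,7)]),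
   ((0,2), [(3,0,2),(7,2,3),(1,2,7),(4,0,7),(5,3,7),(6,7,4)]),
   ((0,3), [(4,0,3),(6,0,4),(7,3,4),(2,3,7),(5,6,7),(1,3,2)]),
   ((0,1), [(2,0,1),(7,1,2),(3,0,7),(4,2,7),(5,7,3),(6,0,7)]),
   ((0,2), [(3,0,2),(5,2,3),(7,0,5),(1,3,5),(4,3,7),(6,5,7)]),
   ((1,3), [(7,1,3),(4,3,7),(6,7,4),(2,1,4),(5,7,6),(0,1,2)]),
   ((0,5), [(6,0,5),(7,5,6),(4,6,7),(1,0,4),(2,5,4),(3,7,4)]),
   ((0,1), [(2,0,1),(3,1,2),(4,1,2),(7,0,2),(5,3,7),(6,1,7)]),
   ((1,3), [(6,1,3),(7,3,6),(2,3,7),(4,3,7),(5,6,7),(0,1,2)]),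
   ((0,1), [(3,0,1),(4,1,3),(7,3,4),(2,4,7),(5,0,7),(6,4,7)]),
   ((1,2), [(4,1,2),(3,2,4),(5,4,3),(6,4,5),(7,4,5),(0,1,3)]),
   ((0,1), [(2,0,1),(5,1,2),(7,0,5),(3,1,7),(4,7,3),(6,5,7)]),
   ((1,2), [(6,1,2),(4,1,6),(5,2,6),(7,6,4),(0,1,5),(3,4,7)]),
   ((0,1), [(2,0,1),(3,1,2),(4,1,3),(5,2,3),(6,4,5),(7,0,4)]),
   ((0,4), [(7,0,4),(5,0,7),(6,4,7),(3,4,5),(1,0,3),(2,5,3)]),
   ((0,1), [(2,0,1),(4,0,2),(6,1,2),(7,4,6),(3,2,4),(5,0,6)]),
   ((0,1), [(3,0,1),(4,0,1),(7,3,4),(2,1,3),(5,3,7),(6,4,7)]),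
   ((0,1), [(2,0,1),(3,1,2),(5,0,1),(7,2,3),(4,3,7),(6,5,7)]),
   ((1,2), [(3,1,2),(5,2,3),(7,3,5),(0,1,5),(4,3,7),(6,5,7)]),
   ((0,2), [(3,0,2),(7,0,3),(1,2,3),(4,3,7),(5,7,1),(6,7,4)]),
   ((0,1), [(3,0,1),(4,0,3),(7,0,4),(2,1,3),(5,1,7),(6,4,7)]),
   ((0,1), [(4,0,1),(7,0,4),(2,1,4),(3,4,7),(5,1,7),(6,0,7)]),
   ((0,1), [(5,0,1),(7,0,5),(2,1,5),(3,1,5),(4,7,2),(6,5,7)]),
   ((0,5), [(6,0,5),(7,5,6),(2,0,7),(3,7,2),(4,6,7),(1,2,3)]),
   ((0,1), [(5,0,1),(2,0,5),(3,1,5),(7,5,2),(4,0,7),(6,5,7)]),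
   ((0,1), [(4,0,1),(3,1,4),(5,0,3),(7,4,5),(2,4,3),(6,5,7)]),
   ((1,3), [(4,1,3),(7,3,4),(0,1,7),(2,1,0),(5,7,2),(6,4,7)]),
   ((0,1), [(3,0,1),(4,0,3),(7,3,4),(2,1,3),(5,0,7),(6,4,7)]),
   ((0,1), [(2,0,1),(3,1,2),(4,0,1),(5,2,3),(6,4,5),(7,3,4)]),
   ((0,1), [(2,0,1),(5,1,2),(7,0,5),(3,2,7),(4,2,7),(6,5,7)]),
   ((0,1), [(2,0,1),(5,1,2),(7,0,5),(3,2,5),(4,1,7),(6,5,7)]),
   ((0,1), [(4,0,1),(2,1,4),(3,0,2),(5,2,3),(6,4,5),(7,4,3)]),
   ((0,1), [(6,0,1),(5,1,6),(7,6,5),(2,0,7),(3,0,7),(4,6,7)]),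
   ((0,1), [(2,0,1),(3,1,2),(4,2,3),(5,3,4),(6,0,4),(7,4,5)]),
   ((0,1), [(2,0,1),(6,1,2),(7,2,6),(3,2,7),(4,6,7),(5,0,6)]),
   ((0,1), [(4,0,1),(5,0,1),(6,4,5),(7,4,5),(2,1,5),(3,5,7)]),
   ((0,2), [(3,0,2),(5,0,3),(7,0,5),(1,2,3),(4,0,7),(6,5,7)]),
   ((1,2), [(7,1,2),(3,1,7),(4,2,7),(5,7,3),(6,7,4),(0,2,3)]),
   ((0,1), [(3,0,1),(4,1,3),(7,0,4),(2,0,3),(5,3,7),(6,4,7)]),
   ((0,1), [(2,0,1),(3,0,2),(4,1,3),(5,1,2),(6,4,5),(7,3,4)]),
   ((0,2), [(3,0,2),(4,0,3),(5,3,4),(6,4,5),(7,4,5),(1,2,3)]),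
   ((0,1), [(4,0,1),(3,1,4),(7,4,3),(2,0,7),(5,1,7),(6,0,7)]),
   ((0,4), [(7,0,4),(6,4,7),(5,7,6),(1,4,5),(2,0,5),(3,5,1)]),
   ((0,3), [(4,0,3),(6,0,3),(7,4,6),(1,4,6),(2,3,4),(5,6,7)])]"

text \<open>Aligned with \<open>types\<close>: the coordinates of the vertices \<open>0\<close> to
  \<open>7\<close>, then for each facet the coefficients \<open>(a, b, c, d)\<close> of its plane,
  with inner product \<open>d\<close> on the facet and less than \<open>d\<close> at the other
  vertices.\<close>

definition realizations :: "((int \<times> int \<times> int) list \<times> (int \<times> int \<times> int \<times> int) list) list" where
  "realizations = [
   ([(2,0,0),(0,0,2),(2,2,2),(1,2,2),(0,2,0),(1,0,0),(0,1,0),(0,0,1)], [(-1,-1,-1,-1),(0,1,0,2),(-2,1,1,2),(1,1,-1,2),(0,0,1,2),(1,-1,1,2),(-1,0,0,0),(0,-1,0,0),(0,0,-1,0)]),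
   ([(2,1,0),(0,0,0),(1,2,1),(1,1,0),(0,0,1),(2,1,2),(1,2,2),(1,1,2)], [(0,0,1,2),(-1,0,1,1),(0,-1,1,1),(-1,1,-1,0),(0,1,-1,1),(0,0,-1,0),(-2,1,0,0),(1,1,0,3),(1,-2,0,0)]),
   ([(0,2,1),(0,2,2),(1,3,1),(0,0,3),(2,2,0),(0,0,0),(2,0,2),(2,1,0)], [(1,-2,-1,0),(1,0,0,2),(0,0,-1,0),(0,-1,0,0),(2,1,1,6),(-1,1,0,2),(1,1,2,6),(-1,0,0,0),(-1,1,-2,0)]),
   ([(0,0,0),(2,2,2),(0,0,1),(0,1,0),(0,2,2),(1,0,0),(2,0,2),(2,2,0)], [(2,-1,-1,2),(-1,2,-1,2),(-1,-1,2,2),(0,0,1,2),(0,1,0,2),(1,0,0,2),(0,0,-1,0),(0,-1,0,0),(-1,0,0,0)]),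
   ([(1,2,0),(2,1,0),(3,0,3),(3,0,1),(2,1,3),(0,0,0),(0,3,1),(0,2,1)], [(-1,0,0,0),(-1,0,1,1),(-5,-2,4,0),(0,-1,0,0),(1,-2,-3,0),(-1,-1,1,0),(0,0,-1,0),(-2,1,-3,0),(1,1,0,3)]),
   ([(3,1,2),(2,1,2),(1,2,2),(2,2,3),(3,1,1),(1,3,1),(1,3,0),(0,1,1)], [(-2,1,0,1),(0,-1,-2,-3),(-1,1,1,3),(-1,0,1,1),(-1,-2,2,0),(0,-1,1,1),(-2,1,1,2),(0,-1,0,-1),(1,1,0,4)]),
   ([(0,0,1),(0,0,0),(2,1,2),(2,1,0),(1,0,2),(2,2,1),(2,2,2),(0,2,2)], [(0,1,0,2),(1,-1,0,1),(2,-4,-1,0),(-2,-1,2,2),(-1,0,0,0),(0,-1,0,0),(1,0,0,2),(0,0,1,2),(-1,2,-2,0)]),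
   ([(0,3,3),(0,2,3),(0,0,2),(2,0,1),(1,3,2),(3,1,0),(0,0,0),(2,1,0)], [(0,0,-1,0),(-2,4,-5,0),(0,1,-1,1),(0,-1,0,0),(1,-1,2,4),(-1,1,-1,0),(1,-3,-2,0),(-1,0,0,0),(1,0,1,3)]),
   ([(3,3,3),(3,3,1),(2,3,0),(1,3,0),(1,1,3),(0,3,3),(0,0,0),(0,1,2)], [(-1,0,0,0),(-1,-2,1,0),(-2,-1,2,3),(-3,1,-1,0),(0,0,-1,0),(3,-2,-3,0),(0,0,1,3),(1,-1,0,0),(0,1,0,3)]),
   ([(0,0,1),(0,0,0),(1,0,0),(1,3,3),(2,3,3),(1,3,1),(2,0,1),(2,2,2)], [(3,1,-2,4),(1,0,0,2),(2,1,-1,4),(0,1,0,3),(3,1,-3,3),(0,1,-3,0),(0,-2,3,3),(-3,1,0,0),(0,-1,0,0)]),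
   ([(1,0,2),(0,0,0),(0,1,0),(0,2,2),(2,2,0),(1,2,2),(2,1,2),(2,2,1)], [(1,1,1,5),(1,0,0,2),(-1,0,0,0),(-1,2,-1,2),(-2,-1,1,0),(0,0,-1,0),(0,1,0,2),(0,0,1,2),(2,-2,-1,0)]),
   ([(1,1,2),(2,2,2),(2,2,3),(1,3,3),(2,1,1),(2,0,3),(2,0,1),(1,0,0)], [(0,-1,0,0),(1,0,-1,1),(0,0,1,3),(1,1,0,4),(-1,0,0,-1),(-3,-2,1,-3),(-3,-1,2,0),(0,1,-1,0),(1,0,0,2)]),
   ([(0,3,2),(1,1,1),(0,1,0),(1,2,1),(0,0,2),(0,1,3),(0,0,3),(1,0,3)], [(0,0,1,3),(0,-1,0,0),(1,0,-1,0),(0,1,-1,1),(1,1,2,7),(1,0,0,1),(2,1,1,5),(1,-2,-1,-2),(-1,0,0,0)]),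
   ([(0,2,0),(0,2,1),(0,0,0),(1,2,0),(1,0,1),(2,1,0),(2,0,1),(1,2,2)], [(3,1,1,7),(0,-1,2,2),(1,1,0,3),(1,-2,-2,0),(0,-1,0,0),(-1,0,0,0),(0,1,0,2),(-2,-1,2,0),(0,0,-1,0)]),
   ([(2,1,0),(0,1,0),(1,0,0),(1,0,1),(0,0,1),(0,2,1),(1,2,1),(0,1,2)], [(0,1,1,3),(0,-1,1,1),(0,-1,0,0),(-1,-1,-1,-1),(1,-1,0,1),(0,0,-1,0),(1,0,1,2),(-1,0,0,0),(0,1,-1,1)]),
   ([(0,0,1),(1,0,0),(0,0,2),(2,0,0),(2,2,2),(0,1,1),(0,2,2),(1,1,0)], [(-1,1,-1,0),(1,-1,1,2),(1,1,-1,2),(0,0,1,2),(0,2,-1,2),(0,0,-1,0),(-1,0,-1,-1),(-1,0,0,0),(0,-1,0,0)]),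
   ([(0,1,0),(0,1,1),(1,0,0),(0,0,0),(2,1,0),(1,2,0),(2,2,0),(2,1,2)], [(0,2,1,4),(1,0,0,2),(0,-2,1,0),(-1,-2,2,0),(-1,3,2,5),(1,-1,0,1),(-1,0,0,0),(-1,1,0,1),(0,0,-1,0)]),
   ([(2,2,0),(2,1,1),(2,0,0),(1,0,1),(0,0,0),(1,2,0),(0,1,0),(0,1,1)], [(-1,1,0,1),(-1,0,0,0),(0,-1,0,0),(-1,-1,1,0),(1,-1,1,2),(1,0,0,2),(0,0,1,1),(0,1,1,2),(0,0,-1,0)]),
   ([(1,0,0),(0,1,0),(0,0,1),(0,2,0),(2,2,1),(1,0,1),(2,1,1),(2,0,0)], [(1,-1,1,2),(1,0,0,2),(1,1,-2,2),(-1,0,0,0),(-1,1,2,2),(-1,-1,-1,-1),(0,-1,0,0),(0,0,-1,0),(0,0,1,1)]),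
   ([(0,1,0),(1,2,0),(0,1,1),(1,1,2),(0,0,1),(1,1,0),(0,0,0),(1,0,1)], [(1,-1,-1,0),(0,-1,0,0),(0,-1,1,1),(-1,1,0,1),(-1,0,1,1),(-1,2,1,3),(1,0,0,1),(0,0,-1,0),(-1,0,0,0)]),
   ([(0,0,1),(0,1,0),(1,0,2),(0,0,2),(1,0,0),(0,2,0),(1,1,0),(2,2,2)], [(1,1,-1,2),(2,0,-1,2),(-1,1,1,2),(2,-1,0,2),(0,0,1,2),(-1,-1,-1,-1),(0,0,-1,0),(-1,0,0,0),(0,-1,0,0)]),
   ([(0,0,1),(1,0,2),(2,0,1),(1,0,0),(0,0,0),(2,0,2),(0,1,1),(1,1,0)], [(1,3,1,4),(-1,1,-1,0),(1,0,-1,1),(0,0,-1,0),(1,1,0,2),(-1,0,1,1),(0,1,1,2),(-1,0,0,0),(0,-1,0,0)]),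
   ([(0,1,2),(1,1,2),(0,2,1),(0,1,0),(1,1,0),(0,0,1),(1,0,1),(0,0,0)], [(0,-1,0,0),(1,-1,-1,0),(0,0,-1,0),(0,1,1,3),(0,1,-1,1),(1,1,0,2),(1,0,0,1),(0,-1,1,1),(-1,0,0,0)]),
   ([(0,1,0),(0,0,0),(0,1,1),(1,0,0),(1,1,0),(1,0,2),(0,2,1),(2,0,1)], [(1,1,1,3),(1,1,0,2),(1,0,-1,1),(-1,0,1,1),(-2,-1,1,0),(0,1,-1,1),(0,-1,0,0),(-1,0,0,0),(0,0,-1,0)]),
   ([(0,1,0),(0,0,1),(0,2,0),(0,0,2),(2,2,2),(1,2,0),(2,2,1),(1,0,0)], [(1,0,-1,1),(2,-1,0,2),(-1,1,1,2),(2,-2,1,2),(-1,-1,-1,-1),(0,-1,0,0),(0,1,0,2),(0,0,-1,0),(-1,0,0,0)]),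
   ([(0,3,2),(1,0,1),(0,0,3),(1,0,2),(0,3,1),(0,0,0),(0,1,0),(2,1,1)], [(1,0,-2,0),(1,1,-2,1),(1,0,1,3),(1,-1,0,1),(1,-1,-1,0),(5,2,6,18),(1,1,0,3),(0,-1,0,0),(-1,0,0,0)]),
   ([(1,1,2),(0,2,1),(0,1,1),(1,0,2),(1,0,1),(0,1,0),(1,1,0),(0,0,0)], [(0,0,-1,0),(1,-1,-1,0),(0,-1,0,0),(-2,-1,1,0),(0,1,-1,1),(1,1,0,2),(-1,0,0,0),(1,0,0,1),(-1,0,1,1)]),
   ([(2,1,3),(3,2,3),(0,3,2),(3,3,3),(0,0,3),(0,2,1),(0,0,2),(3,1,1)], [(-1,-3,-6,-12),(1,-3,0,0),(-1,1,3,9),(1,0,0,3),(2,-2,1,5),(2,-4,1,3),(-1,0,0,0),(1,3,-3,3),(0,0,1,3)]),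
   ([(2,0,2),(2,0,1),(3,1,0),(1,2,0),(0,2,1),(1,0,3),(0,1,3),(0,0,0)], [(-3,-3,1,0),(-1,0,0,0),(-2,1,-2,0),(0,0,-1,0),(1,-3,-2,0),(1,-1,0,2),(0,-1,0,0),(1,1,1,4),(1,2,1,5)]),
   ([(1,2,0),(0,1,0),(2,2,2),(2,0,2),(0,2,2),(2,2,0),(2,0,1),(0,0,0)], [(1,-1,-2,0),(0,0,1,2),(-1,-1,1,0),(-2,2,-1,2),(-1,0,0,0),(0,-1,0,0),(0,1,0,2),(1,0,0,2),(0,0,-1,0)]),
   ([(0,2,1),(0,1,0),(0,0,1),(0,0,0),(0,2,2),(1,1,0),(1,1,1),(1,0,1)], [(1,0,0,1),(1,0,1,2),(1,-1,-1,0),(0,-1,2,2),(0,-1,0,0),(0,1,-1,1),(0,0,-1,0),(1,1,0,2),(-1,0,0,0)]),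
   ([(1,2,2),(0,1,1),(0,2,1),(1,2,0),(1,0,2),(1,1,0),(1,0,1),(0,0,0)], [(1,-1,-1,0),(0,-1,0,0),(-2,1,-2,0),(0,0,-1,0),(-1,0,0,0),(-2,-1,1,0),(0,1,0,2),(-1,0,1,1),(1,0,0,1)]),
   ([(0,0,2),(2,0,0),(2,1,0),(0,0,0),(0,1,2),(2,0,1),(1,0,2),(2,2,1)], [(1,0,1,3),(1,1,3,7),(-3,4,-2,0),(-1,2,-2,0),(0,0,-1,0),(0,0,1,2),(-1,0,0,0),(1,0,0,2),(0,-1,0,0)]),
   ([(2,0,1),(2,1,1),(2,1,2),(1,0,0),(1,1,2),(0,0,0),(0,0,1),(1,2,0)], [(-2,1,0,0),(-3,2,1,1),(0,0,-1,0),(1,1,0,3),(0,2,1,4),(1,0,0,2),(1,0,-1,1),(0,-1,0,0),(0,-1,1,1)]),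
   ([(0,1,2),(2,1,0),(0,2,2),(2,2,2),(2,0,0),(0,2,0),(1,0,0),(0,0,1)], [(-2,-1,-2,-2),(0,-1,0,0),(0,1,0,2),(1,2,-1,4),(0,0,1,2),(1,0,0,2),(-1,0,0,0),(1,-2,2,2),(0,0,-1,0)]),
   ([(2,2,0),(2,2,2),(0,2,0),(1,1,2),(0,1,1),(1,0,0),(0,0,0),(1,0,2)], [(0,-1,0,0),(-1,0,1,1),(-2,-1,1,0),(-1,0,0,0),(0,0,1,2),(0,1,0,2),(0,0,-1,0),(2,-1,0,2),(-1,1,1,2)]),
   ([(1,1,2),(1,2,2),(0,2,1),(0,1,0),(1,1,0),(0,0,1),(1,0,1),(0,0,0)], [(0,-1,0,0),(1,-1,-1,0),(0,0,-1,0),(1,2,-1,3),(0,-1,1,1),(0,1,-1,1),(-1,0,0,0),(-1,0,1,1),(1,0,0,1)]),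
   ([(1,1,0),(0,0,0),(2,0,1),(0,1,2),(1,0,1),(0,2,1),(0,1,0),(1,2,0)], [(-1,1,-1,1),(0,-1,1,1),(-1,-2,1,0),(1,0,-1,1),(1,-1,-2,0),(0,-1,0,0),(-1,0,0,0),(0,0,-1,0),(1,1,1,3)]),
   ([(2,0,2),(1,0,0),(2,2,2),(1,2,0),(1,2,1),(0,0,1),(0,0,0),(0,1,1)], [(-1,0,0,0),(0,1,0,2),(-1,1,0,1),(-1,1,1,2),(-2,1,-1,0),(0,0,-1,0),(-1,0,2,2),(0,-1,0,0),(2,0,-1,2)]),
   ([(0,1,2),(0,0,1),(1,1,0),(1,0,1),(0,0,0),(0,2,2),(0,2,1),(2,1,0)], [(1,2,0,4),(1,-2,-1,0),(0,0,-1,0),(0,-1,0,0),(-1,1,-2,0),(0,1,-1,1),(0,-1,1,1),(1,0,1,2),(-1,0,0,0)]),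
   ([(1,2,0),(0,2,0),(0,2,1),(1,2,2),(0,0,0),(2,1,2),(2,1,0),(2,0,1)], [(1,0,0,2),(1,-2,-2,0),(-1,-2,2,0),(-2,-1,2,0),(-2,-2,3,0),(-1,0,0,0),(1,1,0,3),(0,1,0,2),(0,0,-1,0)]),
   ([(0,0,1),(1,0,2),(0,1,2),(2,0,1),(2,1,0),(0,2,2),(2,2,0),(0,0,0)], [(-1,1,-1,0),(0,0,-1,0),(1,-2,-2,0),(1,0,0,2),(0,0,1,2),(-1,-1,1,1),(-1,0,0,0),(0,-1,0,0),(2,1,2,6)]),
   ([(0,2,0),(0,0,0),(1,1,0),(0,2,1),(0,0,1),(1,2,0),(2,0,1),(1,2,2)], [(2,1,0,4),(-1,0,1,1),(0,-1,2,2),(1,0,-1,1),(1,-1,-2,0),(0,-1,0,0),(0,1,0,2),(0,0,-1,0),(-1,0,0,0)]),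
   ([(0,2,0),(0,0,0),(0,1,2),(1,0,1),(1,0,0),(2,1,2),(2,1,1),(1,2,0)], [(1,1,0,3),(1,0,-1,1),(0,-1,1,1),(0,-1,0,0),(-1,0,0,0),(-1,-2,1,0),(0,2,1,4),(0,0,-1,0),(1,-1,0,1)]),
   ([(0,0,1),(0,1,2),(0,2,2),(2,2,2),(2,1,1),(0,2,0),(1,1,0),(1,0,0)], [(0,0,-1,0),(1,0,-1,1),(0,1,0,2),(0,0,1,2),(-2,-1,-2,-2),(1,-2,1,1),(1,1,-1,2),(1,-2,2,2),(-1,0,0,0)]),
   ([(0,2,1),(0,1,1),(0,0,0),(1,0,0),(1,1,0),(1,1,2),(1,0,2),(2,0,1)], [(1,0,1,3),(1,0,-1,1),(-2,-1,1,0),(-1,0,0,0),(0,0,-1,0),(-1,1,-2,0),(1,1,0,2),(-1,0,1,1),(0,-1,0,0)]),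
   ([(0,1,0),(0,1,1),(1,0,2),(0,0,0),(1,2,0),(2,0,2),(2,1,1),(2,1,0)], [(1,0,0,2),(1,1,0,3),(-2,-1,1,0),(0,-1,0,0),(1,-2,-1,0),(-1,0,0,0),(-1,1,0,1),(0,0,-1,0),(0,1,1,2)]),
   ([(1,2,1),(2,2,2),(0,1,1),(2,0,2),(2,0,1),(2,2,0),(2,1,0),(0,0,0)], [(0,0,-1,0),(1,-2,-2,0),(0,-1,0,0),(-1,-1,1,0),(0,1,0,2),(-1,1,1,2),(-1,0,2,2),(-1,1,-1,0),(1,0,0,2)]),
   ([(2,1,0),(2,0,0),(2,0,1),(0,0,0),(1,2,0),(2,1,2),(1,2,1),(0,2,1)], [(0,1,1,3),(0,1,0,2),(0,-1,0,0),(-1,-2,2,0),(-3,-2,4,0),(-2,1,-2,0),(1,1,0,3),(0,0,-1,0),(1,0,0,2)]),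
   ([(1,2,2),(0,0,0),(0,1,1),(0,2,0),(2,3,0),(3,1,0),(3,3,0),(3,3,3)], [(1,0,0,3),(0,1,0,3),(-1,0,0,0),(-2,1,1,2),(1,-3,2,0),(-3,6,1,12),(-2,3,1,6),(0,-1,1,0),(0,0,-1,0)]),
   ([(2,1,0),(0,2,0),(0,2,1),(1,2,1),(0,0,2),(0,1,0),(0,0,1),(1,0,0)], [(-1,-1,-1,-1),(0,-1,0,0),(0,1,2,4),(0,1,0,2),(1,0,1,2),(1,2,-1,4),(2,-2,1,2),(0,0,-1,0),(-1,0,0,0)]),
   ([(2,2,0),(0,0,0),(0,0,1),(0,1,2),(2,0,2),(0,1,0),(1,2,0),(0,2,2)], [(-2,2,-1,2),(0,0,1,2),(-1,-2,2,2),(1,-1,-1,0),(0,-1,0,0),(1,1,1,4),(0,1,0,2),(0,0,-1,0),(-1,0,0,0)]),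
   ([(1,0,0),(0,0,0),(0,0,2),(0,1,1),(1,0,2),(2,3,2),(2,1,2),(2,0,1)], [(1,0,0,2),(1,-1,1,3),(-3,2,2,4),(-1,0,0,0),(3,1,-3,3),(0,2,-3,0),(-1,2,-2,0),(0,0,1,2),(0,-1,0,0)]),
   ([(1,2,0),(2,1,1),(2,2,0),(2,0,1),(1,0,2),(0,1,0),(0,1,1),(0,0,0)], [(-1,0,0,0),(-2,-1,1,0),(0,-1,0,0),(1,-1,-2,0),(1,0,1,3),(1,0,0,2),(-1,1,0,1),(0,0,-1,0),(0,1,1,2)]),
   ([(2,3,0),(2,2,1),(0,1,2),(1,1,2),(1,2,0),(2,0,0),(1,1,0),(0,1,1)], [(-1,-1,-1,-2),(-1,0,-1,-1),(0,-2,1,0),(3,-1,2,6),(-1,-2,0,-2),(1,0,0,2),(0,0,-1,0),(0,1,1,3),(-1,1,0,1)]),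
   ([(2,1,0),(1,0,0),(0,1,1),(0,0,0),(1,0,2),(2,2,0),(1,2,1),(1,2,2)], [(0,1,0,2),(-2,-1,1,0),(0,-1,0,0),(-1,1,0,1),(-1,0,1,1),(1,-1,0,1),(-1,1,-1,0),(0,0,-1,0),(2,0,1,4)]),
   ([(0,1,1),(1,2,1),(0,1,2),(1,1,0),(2,1,0),(0,0,1),(1,0,1),(0,0,0)], [(0,-1,0,0),(1,-2,-1,0),(0,0,-1,0),(0,-1,1,1),(0,1,-1,1),(-1,1,0,1),(-1,0,0,0),(-1,1,-1,0),(1,0,1,2)]),
   ([(2,1,0),(1,0,0),(1,0,1),(0,0,0),(2,1,3),(3,3,1),(3,3,2),(1,2,1)], [(-1,2,0,3),(-1,1,1,2),(-5,1,3,0),(-1,-1,1,0),(0,-1,0,0),(0,0,-1,0),(-1,2,-3,0),(2,-1,0,3),(1,-1,0,1)]),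
   ([(0,1,0),(0,1,1),(1,0,0),(1,1,2),(0,2,0),(2,0,0),(2,2,0),(2,2,2)], [(1,0,0,2),(0,1,0,2),(0,-2,1,0),(1,-1,1,2),(-1,-2,1,-1),(-1,-1,0,-1),(-1,0,0,0),(-1,1,1,2),(0,0,-1,0)]),
   ([(1,2,0),(0,2,1),(0,0,0),(1,0,0),(1,0,1),(0,2,2),(1,1,2),(2,2,0)], [(1,1,1,4),(3,-1,1,4),(2,-1,0,2),(-1,0,0,0),(-2,1,-2,0),(0,-1,0,0),(0,1,0,2),(0,0,-1,0),(-1,-1,1,0)]),
   ([(0,2,0),(0,2,1),(1,2,0),(1,1,0),(0,1,1),(2,0,1),(1,0,1),(0,0,0)], [(0,-1,0,0),(-1,-1,1,0),(1,0,-1,1),(1,-1,-2,0),(1,1,1,3),(0,1,0,2),(0,0,1,1),(0,0,-1,0),(-1,0,0,0)]),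
   ([(1,2,0),(0,2,1),(0,2,2),(2,2,0),(0,0,0),(1,1,2),(1,0,1),(2,0,0)], [(1,-1,1,2),(0,-1,0,0),(1,1,1,4),(2,0,1,4),(-2,1,-2,0),(-1,0,0,0),(-1,-1,1,0),(0,0,-1,0),(0,1,0,2)]),
   ([(2,2,0),(1,2,0),(2,1,0),(2,1,1),(1,1,2),(0,1,0),(0,2,2),(0,0,0)], [(-1,0,0,0),(-1,-1,1,0),(1,-2,0,0),(1,-3,1,0),(0,1,0,2),(-2,2,-1,2),(1,0,0,2),(1,1,1,4),(0,0,-1,0)]),
   ([(1,1,0),(2,0,1),(3,0,1),(2,0,2),(3,2,3),(1,1,3),(0,2,0),(1,2,3)], [(-3,0,1,0),(0,1,0,2),(0,-1,0,0),(1,-1,1,4),(1,-2,3,8),(0,-1,-1,-1),(0,0,1,3),(1,1,-1,2),(-1,-1,0,-2)]),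
   ([(0,3,3),(1,1,1),(0,0,3),(2,0,2),(3,0,1),(1,3,3),(3,0,0),(3,2,3)], [(3,6,-4,9),(1,0,0,3),(2,-3,4,12),(1,-1,1,4),(-1,-1,-1,-3),(-2,0,-1,-3),(0,0,1,3),(0,1,-1,0),(0,-1,0,0)]),
   ([(1,1,0),(2,2,0),(2,2,1),(2,1,2),(2,0,0),(0,1,1),(1,0,1),(2,0,2)], [(-1,-1,1,0),(0,-1,0,0),(-1,0,2,2),(-1,2,2,4),(-1,2,0,2),(-1,1,-1,0),(0,0,-1,0),(-1,-1,-1,-2),(1,0,0,2)]),
   ([(3,3,0),(0,2,0),(1,3,0),(0,2,2),(2,1,1),(0,0,3),(1,0,2),(0,0,0)], [(0,-1,0,0),(2,-3,-1,0),(-1,1,0,2),(0,2,1,6),(1,-1,-1,0),(1,1,2,6),(1,0,1,3),(0,0,-1,0),(-1,0,0,0)]),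
   ([(0,0,0),(1,0,2),(1,0,0),(0,0,2),(1,1,0),(0,1,1),(0,1,0),(2,2,2)], [(-1,2,0,2),(0,2,-1,2),(-1,1,1,2),(2,0,-1,2),(2,-1,0,2),(0,0,1,2),(-1,0,0,0),(0,0,-1,0),(0,-1,0,0)]),
   ([(2,0,1),(0,1,2),(1,0,0),(0,0,0),(0,2,2),(1,1,0),(1,2,1),(2,2,1)], [(0,1,-1,1),(0,1,0,2),(0,0,-1,0),(-1,0,0,0),(-1,-4,2,0),(0,-1,0,0),(1,0,-1,1),(1,0,2,4),(-1,1,-1,0)]),
   ([(2,0,1),(2,0,0),(2,1,1),(1,0,2),(0,0,0),(1,2,0),(0,1,0),(0,1,1)], [(-1,1,0,1),(-1,0,0,0),(-2,-1,1,0),(2,1,-1,4),(1,0,1,3),(1,0,0,2),(0,1,1,2),(0,0,-1,0),(0,-1,0,0)]),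
   ([(0,2,0),(0,3,1),(0,3,0),(2,2,0),(0,0,1),(2,0,2),(0,1,3),(1,0,2)], [(0,-1,1,2),(-1,-2,1,1),(1,2,0,6),(0,0,-1,0),(0,-1,0,0),(0,-1,-2,-2),(1,-2,-2,-2),(1,1,1,4),(-1,0,0,0)]),
   ([(1,2,0),(0,0,0),(2,1,1),(0,0,1),(0,1,1),(1,0,0),(2,1,0),(2,0,2)], [(2,-2,-1,2),(-1,0,2,2),(1,0,0,2),(-1,0,0,0),(-2,1,-1,0),(1,1,0,3),(0,-1,0,0),(0,0,-1,0),(0,1,1,2)]),
   ([(2,1,0),(0,2,2),(1,2,0),(0,2,1),(1,1,2),(0,0,0),(1,0,1),(2,0,0)], [(0,-1,0,0),(1,-1,1,2),(-2,1,-2,0),(-1,0,0,0),(0,1,0,2),(2,0,1,4),(-1,-1,1,0),(0,0,-1,0),(2,2,1,6)]),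
   ([(0,1,1),(0,0,1),(2,2,0),(1,2,0),(0,0,0),(2,1,2),(0,1,2),(1,0,2)], [(0,0,1,2),(0,0,-1,0),(0,-1,0,0),(-2,1,-1,0),(-1,-1,1,1),(-1,1,0,1),(2,-2,-1,0),(0,2,1,4),(-1,0,0,0)])]"

lemma wf_types: "list_all wf_type (degenerate_types @ types)"
  unfolding types_def degenerate_types_def type_A_def type_B_def rigid_types_def append.simps list.pred_inject
  by (intro conjI TrueI; simp add: wf_type_def)

text \<open>The values are tabulated so that distinctness of the types is decided on plain
  numbers.\<close>

definition type_invs :: "nat list" where
  "type_invs = [
   1201538008, 851833194, 1130661791, 1241374908, 2802015078, 1753560745, 1138378247, 1528187665,
   1721584920, 1658175202, 1185741153, 1364380860, 1447211866, 1093969669, 700481210, 818140170,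
   1522221958, 885576171, 1125401332, 688350042, 1057024538, 1197229158, 872995782, 872503992,
   1394288072, 2652129582, 1041050830, 1696549387, 1692090965, 1078830996, 1088955897, 1384649886,
   1155029006, 1404721075, 1123755318, 854074196, 854010692, 1141135296, 1073374599, 1188961977,
   1446284638, 1000494265, 833773854, 712800349, 951526596, 900831797, 974925384, 975021004,
   1104019112, 1800673422, 971221387, 1152435854, 1543252952, 982900561, 1473944137, 919510429,
   928509252, 1187551152, 797107046, 1139973699, 1090936313, 935933118, 1179556014, 1016402584,
   1391848176, 1491825312, 1204707359, 1315640460, 908997458, 754528308, 1227092574, 917274588,
   969077075, 1092498412]"

lemma list_inv_types: "list_all2 (\<lambda>fs n. list_inv fs = n) types type_invs"
  unfolding types_def type_A_def type_B_def rigid_types_def type_invs_def list.rel_inject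
  by (intro conjI list.rel_intros; simp add: list_inv_def upt_8 numeral_2_eq_2[symmetric])

lemma distinct_list_inv: "distinct (map list_inv types)"
proof -
  have "map list_inv types = type_invs"
    using list_inv_types by (simp add: list_all2_conv_all_nth list_eq_iff_nth_eq)
  moreover have "distinct type_invs" by (simp add: type_invs_def)
  ultimately show ?thesis by simp
qed

lemma rigid_orders_valid:
  "list_all2 (\<lambda>fs ((v, w), us). linkedb fs v w \<and> rigidb fs [v, w] us) rigid_types rigid_orders"
  unfolding rigid_types_def rigid_orders_def list.rel_inject prod.case
  by (intro conjI list.rel_intros; simp add: linkedb_def upt_8)

lemma realizations_valid: "list_all2 realizes types realizations"
  unfolding types_def type_A_def type_B_def rigid_types_def realizations_def list.rel_inject
  by (intro conjI list.rel_intros; simp add: realizes_def dot_int_def upt_8)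

lemma wf_typeD:
  assumes "wf_type fs"
  shows "F \<in> set fs \<Longrightarrow> set F \<subseteq> {..<8}" "F \<in> set fs \<Longrightarrow> distinct F" "F \<in> set fs \<Longrightarrow> card (set F) \<ge> 3"
    "inj_on set (set fs)" "distinct fs" "length fs = 9" "sum_list (map length fs) = 30"
proof -
  have F: "sorted_wrt (<) F \<and> (\<forall>x\<in>set F. x < 8) \<and> 3 \<le> length F" if "F \<in> set fs" for F
    using assms that by (auto simp: wf_type_def list_all_iff)
  show "F \<in> set fs \<Longrightarrow> set F \<subseteq> {..<8}" using F by blast
  show d: "F \<in> set fs \<Longrightarrow> distinct F" for F using F strict_sorted_iff by blast
  show "F \<in> set fs \<Longrightarrow> card (set F) \<ge> 3" using F d distinct_card by metis
  show "inj_on set (set fs)"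
    by (rule inj_onI) (use F strict_sorted_equal in blast)
  show "distinct fs" "length fs = 9" "sum_list (map length fs) = 30" using assms by (auto simp: wf_type_def)
qed

lemma has_type_of_matrix:
  assumes m: "has_matrix (verts P) (facet_verts P) (facet_matrix fs)" and sub: "\<And>S. S \<in> facet_verts P \<Longrightarrow> S \<subseteq> verts P"
    and wf: "wf_type fs"
  shows "has_type P fs"
proof -
  obtain vs gs where vs: "distinct vs" "set vs = verts P" and gs: "set gs = facet_verts P"
    and eq: "facet_matrix fs = map (\<lambda>v. map (\<lambda>F. v \<in> F) gs) vs" using m unfolding has_matrix_def by blast
  have len: "length vs = 8" using arg_cong[OF eq, of length] by (simp add: facet_matrix_def)
  have row: "map (\<lambda>F. i \<in> set F) fs = map (\<lambda>F. vs ! i \<in> F) gs" if "i < 8" for i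
    using arg_cong[OF eq, of "\<lambda>R. R ! i"] that len by (simp add: facet_matrix_def)
  have lg: "length gs = length fs" using arg_cong[OF row[of 0], of length] by simp
  have ent: "i \<in> set (fs ! j) \<longleftrightarrow> vs ! i \<in> gs ! j" if "i < 8" "j < length fs" for i j
    using arg_cong[OF row[OF that(1)], of "\<lambda>r. r ! j"] that(2) lg by simp
  have col: "gs ! j = (!) vs ` set (fs ! j)" if j: "j < length fs" for j
  proof (intro equalityI subsetI)
    fix x assume x: "x \<in> gs ! j"
    then have "x \<in> set vs" using sub[of "gs ! j"] gs vs nth_mem[of j gs] j lg by auto
    then obtain i where i: "i < 8" "x = vs ! i" using len by (metis in_set_conv_nth)
    then show "x \<in> (!) vs ` set (fs ! j)" using ent[OF i(1) j] x by blast
  next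
    fix x assume "x \<in> (!) vs ` set (fs ! j)"
    then obtain i where i: "i \<in> set (fs ! j)" "x = vs ! i" by blast
    then have "i < 8" using wf_typeD(1)[OF wf nth_mem[OF j]] by blast
    then show "x \<in> gs ! j" using ent[OF _ j] i by blast
  qed
  have "bij_betw ((!) vs) {..<8} (verts P)" using bij_betw_nth[OF vs(1), of "{..<8}" "verts P"] len vs(2) by simp
  moreover have "facet_verts P = (\<lambda>F. (!) vs ` set F) ` set fs"
  proof (intro equalityI subsetI)
    fix S assume "S \<in> facet_verts P"
    then obtain j where "j < length fs" "S = gs ! j" using gs lg by (metis in_set_conv_nth)
    then show "S \<in> (\<lambda>F. (!) vs ` set F) ` set fs" using col nth_mem by blast
  next
    fix S assume "S \<in> (\<lambda>F. (!) vs ` set F) ` set fs"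
    then obtain j where "j < length fs" "S = (!) vs ` set (fs ! j)" by (metis (no_types, lifting) imageE in_set_conv_nth)
    then show "S \<in> facet_verts P" using col gs lg nth_mem by metis
  qed
  ultimately show ?thesis unfolding has_type_def by blast
qed

lemma has_type_comb_equiv:
  assumes "polyhedron3 P" "polyhedron3 Q" "has_type P fs" "has_type Q fs" "wf_type fs"
  shows "comb_equiv P Q"
proof -
  obtain p where p: "bij_betw p {..<8} (verts P)" "facet_verts P = (\<lambda>F. p ` set F) ` set fs" using assms(3) unfolding has_type_def by blast
  obtain q where q: "bij_betw q {..<8} (verts Q)" "facet_verts Q = (\<lambda>F. q ` set F) ` set fs" using assms(4) unfolding has_type_def by blast
  define \<sigma> where "\<sigma> = q \<circ> inv_into {..<8} p"
  have b: "bij_betw \<sigma> (verts P) (verts Q)" unfolding \<sigma>_def using bij_betw_trans[OF bij_betw_inv_into[OF p(1)] q(1)] .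
  have "\<sigma> (p i) = q i" if "i < 8" for i using p(1) that by (simp add: \<sigma>_def bij_betw_inv_into_left)
  then have im: "\<sigma> ` (p ` set F) = q ` set F" if "F \<in> set fs" for F
    using wf_typeD(1)[OF assms(5) that] by (force simp: image_iff)
  have "(`) \<sigma> ` facet_verts P = (\<lambda>F. \<sigma> ` (p ` set F)) ` set fs" unfolding p(2) by (simp only: image_image)
  also have "\<dots> = facet_verts Q" unfolding q(2) using im by (intro image_cong) auto
  finally show ?thesis using comb_equiv_of_bij[OF assms(1,2) b] by blast
qed

lemma comb_equiv_has_type:
  assumes "polyhedron3 P" "polyhedron3 Q" "comb_equiv P Q" "has_type P fs"
  shows "has_type Q fs"
proof -
  obtain \<sigma> where \<sigma>: "bij_betw \<sigma> (verts P) (verts Q)" "(`) \<sigma> ` facet_verts P = facet_verts Q"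
    using bij_of_comb_equiv[OF assms(1-3)] by blast
  obtain p where p: "bij_betw p {..<8} (verts P)" "facet_verts P = (\<lambda>F. p ` set F) ` set fs" using assms(4) unfolding has_type_def by blast
  have "facet_verts Q = (\<lambda>F. (\<sigma> \<circ> p) ` set F) ` set fs" unfolding \<sigma>(2)[symmetric] p(2) by (simp add: image_image image_comp)
  then show ?thesis unfolding has_type_def using bij_betw_trans[OF p(1) \<sigma>(1)] by blast
qed

text \<open>\<open>facet_triangle\<close> read in the labels of a type: three neighbours whose sides
  on \<open>F\<close> form a triangle force \<open>F\<close> to be that triangle.\<close>

lemma not_degenerate:
  assumes P: "polyhedron3 P" and t: "has_type P fs" and wf: "wf_type fs"
    and F: "F \<in> set fs" "G1 \<in> set fs" "G2 \<in> set fs" "G3 \<in> set fs"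
    and abc: "a \<noteq> b" "b \<noteq> c" "a \<noteq> c"
    and I: "set F \<inter> set G1 = {a, b}" "set F \<inter> set G2 = {b, c}" "set F \<inter> set G3 = {a, c}" and ne: "length F \<noteq> 3"
  shows False
proof -
  interpret poly3 P using P by unfold_locales
  obtain p where p: "bij_betw p {..<8} (verts P)" "facet_verts P = (\<lambda>F. p ` set F) ` set fs" using t unfolding has_type_def by blast
  have inj: "inj_on p {..<8}" using p(1) by (simp add: bij_betw_def)
  note s8 = wf_typeD(1)[OF wf]
  have ex: "\<exists>K. K \<in> facets P \<and> verts K = p ` set X" if "X \<in> set fs" for X
  proof -
    have "p ` set X \<in> facet_verts P" using p(2) that by blast
    then show ?thesis unfolding facet_verts_def by (metis imageE)
  qed
  obtain K where K: "K \<in> facets P" "verts K = p ` set F" using ex[OF F(1)] by blast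
  obtain K1 where K1: "K1 \<in> facets P" "verts K1 = p ` set G1" using ex[OF F(2)] by blast
  obtain K2 where K2: "K2 \<in> facets P" "verts K2 = p ` set G2" using ex[OF F(3)] by blast
  obtain K3 where K3: "K3 \<in> facets P" "verts K3 = p ` set G3" using ex[OF F(4)] by blast
  have int: "p ` set F \<inter> p ` set X = p ` (set F \<inter> set X)" if "X \<in> set fs" for X
    using inj_on_image_Int[OF inj s8[OF F(1)] s8[OF that]] by simp
  have "{a, b} \<subseteq> set F" unfolding I(1)[symmetric] by (rule Int_lower1)
  moreover have "{b, c} \<subseteq> set F" unfolding I(2)[symmetric] by (rule Int_lower1)
  ultimately have abc8: "a \<in> {..<8}" "b \<in> {..<8}" "c \<in> {..<8}" using s8[OF F(1)] by (simp_all add: subset_iff)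
  then have pn: "p a \<noteq> p b" "p b \<noteq> p c" "p a \<noteq> p c" using abc by (simp_all only: inj_on_eq_iff[OF inj] not_False_eq_True simp_thms)
  have "verts K = {p a, p b, p c}"
    by (rule facet_triangle[OF K(1) pn K1(1) K2(1) K3(1)]) (simp_all add: K(2) K1(2) K2(2) K3(2) int F I)
  then have "card (p ` set F) = 3" using K(2) pn by simp
  then have "card (set F) = 3" using card_image[OF inj_on_subset[OF inj s8[OF F(1)]]] by simp
  then show False using ne distinct_card[OF wf_typeD(2)[OF wf F(1)]] by simp
qed

lemma facet_system_of_polyhedron:
  assumes "P \<in> polys_8_9" shows "facet_system (verts P) (facet_verts P)"
proof -
  have P: "polyhedron3 P" "card (verts P) = 8" "card (facets P) = 9" using assms by (auto simp: polys_8_9_def)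
  interpret poly3 P using P(1) by unfold_locales
  have inj: "inj_on verts (facets P)" by (rule inj_on_verts_facets[OF pt])
  have eqF: "verts F = verts G \<longleftrightarrow> F = G" if "F \<in> facets P" "G \<in> facets P" for F G
    using inj_onD[OF inj] that by blast
  show ?thesis
  proof
    show "finite (verts P)" by (rule finite_verts[OF pt])
    show "finite (facet_verts P)" by (rule finite_facet_verts_set)
    show "S \<subseteq> verts P" if "S \<in> facet_verts P" for S using facet_verts_subset[OF that] .
    show c9: "card (facet_verts P) = 9" using card_facet_verts P(3) by simp
    show "3 \<le> card S" if "S \<in> facet_verts P" for S using that facet_card_ge3 unfolding facet_verts_def by blast
    show "card (S \<inter> T) \<le> 2" if "S \<in> facet_verts P" "T \<in> facet_verts P" "S \<noteq> T" for S T
      using that facet_Int_card unfolding facet_verts_def by blast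
    show "card {T \<in> facet_verts P. T \<noteq> S \<and> v \<in> T \<and> card (S \<inter> T) = 2} = 2" if h: "S \<in> facet_verts P" "v \<in> S" for S v
    proof -
      obtain F where F: "F \<in> facets P" "S = verts F" using h unfolding facet_verts_def by blast
      let ?A = "{G \<in> facets P. G \<noteq> F \<and> v \<in> verts G \<and> card (verts F \<inter> verts G) = 2}"
      have "{T \<in> facet_verts P. T \<noteq> S \<and> v \<in> T \<and> card (S \<inter> T) = 2} = verts ` ?A"
        unfolding facet_verts_def F(2) using eqF F(1) by blast
      moreover have "card (verts ` ?A) = card ?A" by (rule card_image, rule inj_on_subset[OF inj]) blast
      ultimately show ?thesis using facet_two_neighbours[OF F(1)] h(2) F(2) by simp
    qed
    show "3 \<le> card {S \<in> facet_verts P. v \<in> S}" if v: "v \<in> verts P" for v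
    proof -
      have "{S \<in> facet_verts P. v \<in> S} = verts ` {F \<in> facets P. v \<in> verts F}" unfolding facet_verts_def by blast
      moreover have "card (verts ` {F \<in> facets P. v \<in> verts F}) = card {F \<in> facets P. v \<in> verts F}"
        by (rule card_image, rule inj_on_subset[OF inj]) blast
      ultimately show ?thesis using vertex_degree_ge3[OF v] by simp
    qed
    show "(\<Sum>S\<in>facet_verts P. card S) = 30" using euler_verts c9 P(2) by simp
  qed
qed

lemma types_complete:
  assumes P: "P \<in> polys_8_9" obtains fs where "fs \<in> set types" "has_type P fs"
proof -
  have Q: "polyhedron3 P" "card (verts P) = 8" using P by (auto simp: polys_8_9_def)
  interpret poly3 P using Q(1) by unfold_locales
  interpret facet_system "verts P" "facet_verts P" by (rule facet_system_of_polyhedron[OF P])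
  obtain R where R: "R \<in> set reps" "has_matrix (verts P) (facet_verts P) R" using classification[OF Q(2)] by blast
  have "R \<in> facet_matrix ` set (degenerate_types @ types)" using R(1) unfolding reps_def types_def by (simp only: set_map)
  then obtain fs where fs: "fs \<in> set (degenerate_types @ types)" "R = facet_matrix fs" by blast
  then have wf: "wf_type fs" using wf_types by (metis list_all_iff)
  have t: "has_type P fs" by (rule has_type_of_matrix[OF R(2)[unfolded fs(2)] facet_verts_subset wf])
  have "fs \<notin> set degenerate_types"
  proof
    assume "fs \<in> set degenerate_types"
    \<comment> \<open>These four facets occur in both spurious systems and contradict
      \<open>not_degenerate\<close>.\<close>
    then have "[0, 1, 2, 3, 4, 5] \<in> set fs" "[0, 1, 6] \<in> set fs" "[1, 2, 6] \<in> set fs" "[0, 2, 6] \<in> set fs"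
      by (auto simp: degenerate_types_def)
    from not_degenerate[OF Q(1) t wf this, of 0 1 2] show False by (auto)
  qed
  then show thesis using that fs t by auto
qed

text \<open>The form of \<open>list_inv\<close> without labels; it is invariant under bijections of
  vertices by construction.\<close>

definition set_inv :: "'a set \<Rightarrow> 'a set set \<Rightarrow> nat" where
  "set_inv V \<F> = (\<Sum>v\<in>V. (\<Sum>S\<in>{S \<in> \<F>. v \<in> S}. (\<Sum>w\<in>S. (card {S \<in> \<F>. w \<in> S})\<^sup>2)\<^sup>2)\<^sup>2)"

lemma set_inv_image:
  assumes inj: "inj_on p V" and sub: "\<And>S. S \<in> \<F> \<Longrightarrow> S \<subseteq> V"
  shows "set_inv (p ` V) ((`) p ` \<F>) = set_inv V \<F>"
proof -
  have injF: "inj_on ((`) p) \<F>" using inj_on_image_eq_iff[OF inj] sub by (intro inj_onI) blast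
  have st: "{S \<in> (`) p ` \<F>. p v \<in> S} = (`) p ` {S \<in> \<F>. v \<in> S}" if "v \<in> V" for v
  proof -
    have "p v \<in> p ` S \<longleftrightarrow> v \<in> S" if "S \<in> \<F>" for S using inj_on_image_mem_iff[OF inj \<open>v \<in> V\<close> sub[OF that]] .
    then show ?thesis by blast
  qed
  have dg: "card {S \<in> (`) p ` \<F>. p v \<in> S} = card {S \<in> \<F>. v \<in> S}" if "v \<in> V" for v
    unfolding st[OF that] by (rule card_image, rule inj_on_subset[OF injF]) blast
  have sm: "(\<Sum>w\<in>p ` S. (card {S \<in> (`) p ` \<F>. w \<in> S})\<^sup>2) = (\<Sum>w\<in>S. (card {S \<in> \<F>. w \<in> S})\<^sup>2)" if S: "S \<in> \<F>" for S
  proof -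
    have "(\<Sum>w\<in>p ` S. (card {S \<in> (`) p ` \<F>. w \<in> S})\<^sup>2) = (\<Sum>w\<in>S. (card {S \<in> (`) p ` \<F>. p w \<in> S})\<^sup>2)"
      using sum.reindex[OF inj_on_subset[OF inj sub[OF S]]] by simp
    also have "\<dots> = (\<Sum>w\<in>S. (card {S \<in> \<F>. w \<in> S})\<^sup>2)" by (rule sum.cong[OF refl]) (use dg sub[OF S] in auto)
    finally show ?thesis .
  qed
  let ?f = "\<lambda>S. (\<Sum>w\<in>S. (card {S \<in> (`) p ` \<F>. w \<in> S})\<^sup>2)\<^sup>2"
  have vs: "(\<Sum>S\<in>{S \<in> (`) p ` \<F>. p v \<in> S}. ?f S) = (\<Sum>S\<in>{S \<in> \<F>. v \<in> S}. (\<Sum>w\<in>S. (card {S \<in> \<F>. w \<in> S})\<^sup>2)\<^sup>2)" if v: "v \<in> V" for v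
  proof -
    have "inj_on ((`) p) {S \<in> \<F>. v \<in> S}" by (rule inj_on_subset[OF injF]) blast
    then have "(\<Sum>S\<in>{S \<in> (`) p ` \<F>. p v \<in> S}. ?f S) = (\<Sum>S\<in>{S \<in> \<F>. v \<in> S}. ?f (p ` S))"
      unfolding st[OF v] by (simp only: sum.reindex comp_def)
    also have "\<dots> = (\<Sum>S\<in>{S \<in> \<F>. v \<in> S}. (\<Sum>w\<in>S. (card {S \<in> \<F>. w \<in> S})\<^sup>2)\<^sup>2)"
      by (rule sum.cong[OF refl]) (use sm in simp)
    finally show ?thesis .
  qed
  have "set_inv (p ` V) ((`) p ` \<F>) = (\<Sum>v\<in>V. (\<Sum>S\<in>{S \<in> (`) p ` \<F>. p v \<in> S}. ?f S)\<^sup>2)"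
    unfolding set_inv_def by (simp only: sum.reindex[OF inj] comp_def)
  also have "\<dots> = set_inv V \<F>" unfolding set_inv_def by (rule sum.cong[OF refl]) (simp only: vs)
  finally show ?thesis .
qed

lemma list_inv_eq:
  assumes wf: "wf_type fs" shows "list_inv fs = set_inv {..<8} (set ` set fs)"
proof -
  note inj = wf_typeD(4)[OF wf] and dist = wf_typeD(5)[OF wf] and s8 = wf_typeD(1)[OF wf] and dF = wf_typeD(2)[OF wf]
  let ?d = "\<lambda>v. (card {S \<in> set ` set fs. v \<in> S})\<^sup>2"
  let ?w = "\<lambda>S. (\<Sum>w\<in>S. ?d w)\<^sup>2"
  have dg: "degree_of v fs = card {S \<in> set ` set fs. v \<in> S}" for v
  proof -
    have "degree_of v gs = length (filter (\<lambda>F. v \<in> set F) gs)" for gs by (induction gs) auto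
    moreover have "{S \<in> set ` set fs. v \<in> S} = set ` set (filter (\<lambda>F. v \<in> set F) fs)" by auto
    moreover have "card (set ` set (filter (\<lambda>F. v \<in> set F) fs)) = card (set (filter (\<lambda>F. v \<in> set F) fs))"
      by (rule card_image, rule inj_on_subset[OF inj]) auto
    ultimately show ?thesis using distinct_card[OF distinct_filter[OF dist]] by metis
  qed
  have d1: "degrees vs fs = map ?d vs" for vs by (induction vs) (simp_all add: dg)
  have w1: "facet_weight ds F = sum_list (map ((!) ds) F)" for ds F by (induction F) auto
  have w2: "facet_weight (map ?d [0..<8]) F = (\<Sum>w\<in>set F. ?d w)" if F: "F \<in> set fs" for F
  proof -
    have "map ((!) (map ?d [0..<8])) F = map ?d F"
      by (rule map_cong[OF refl]) (use s8[OF F] in \<open>auto simp: nth_map_upt\<close>)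
    then show ?thesis unfolding w1 using sum_list_distinct_conv_sum_set[OF dF[OF F], of ?d] by (simp only:)
  qed
  have w3: "facet_weights ds gs = map (\<lambda>F. (facet_weight ds F)\<^sup>2) gs" for ds gs by (induction gs) auto
  have d2: "facet_weights (degrees [0..<8] fs) fs = map (\<lambda>F. ?w (set F)) fs"
    unfolding w3 d1 by (rule map_cong[OF refl]) (simp only: w2)
  have v1: "vertex_weight v gs (map g gs) = sum_list (map (\<lambda>F. if v \<in> set F then g F else 0) gs)" for v g gs
    by (induction gs) auto
  have v2: "vertex_weight v fs (map (\<lambda>F. ?w (set F)) fs) = (\<Sum>S\<in>{S \<in> set ` set fs. v \<in> S}. ?w S)" for v
  proof -
    have e: "{S \<in> set ` set fs. v \<in> S} = set ` {F \<in> set fs. v \<in> set F}" by blast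
    have i: "inj_on set {F \<in> set fs. v \<in> set F}" by (rule inj_on_subset[OF inj]) blast
    have "vertex_weight v fs (map (\<lambda>F. ?w (set F)) fs) = (\<Sum>F\<in>set fs. if v \<in> set F then ?w (set F) else 0)"
      unfolding v1 by (rule sum_list_distinct_conv_sum_set[OF dist])
    also have "\<dots> = (\<Sum>F\<in>{F \<in> set fs. v \<in> set F}. ?w (set F))" by (rule sum.inter_filter[symmetric]) simp
    also have "\<dots> = (\<Sum>S\<in>{S \<in> set ` set fs. v \<in> S}. ?w S)" unfolding e by (simp only: sum.reindex[OF i] comp_def)
    finally show ?thesis .
  qed
  have t: "total_weight vs gs ws = sum_list (map (\<lambda>v. (vertex_weight v gs ws)\<^sup>2) vs)" for vs gs ws by (induction vs) auto
  have "list_inv fs = sum_list (map (\<lambda>v. (\<Sum>S\<in>{S \<in> set ` set fs. v \<in> S}. ?w S)\<^sup>2) [0..<8])"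
    unfolding list_inv_def d2 t v2 ..
  also have "\<dots> = (\<Sum>v\<in>set [0..<8]. (\<Sum>S\<in>{S \<in> set ` set fs. v \<in> S}. ?w S)\<^sup>2)" by (rule sum_list_distinct_conv_sum_set) simp
  also have "\<dots> = set_inv {..<8} (set ` set fs)" unfolding set_inv_def atLeast_upt ..
  finally show ?thesis .
qed

lemma has_type_inv:
  assumes t: "has_type P fs" and wf: "wf_type fs" shows "set_inv (verts P) (facet_verts P) = list_inv fs"
proof -
  obtain p where p: "bij_betw p {..<8} (verts P)" "facet_verts P = (\<lambda>F. p ` set F) ` set fs" using t unfolding has_type_def by blast
  have "facet_verts P = (`) p ` (set ` set fs)" unfolding p(2) by (simp only: image_image)
  moreover have "verts P = p ` {..<8}" "inj_on p {..<8}" using p(1) by (auto simp: bij_betw_def)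
  moreover have sub: "\<And>S. S \<in> set ` set fs \<Longrightarrow> S \<subseteq> {..<8}" using wf_typeD(1)[OF wf] by blast
  ultimately show ?thesis
    using set_inv_image[OF _ sub, of p] list_inv_eq[OF wf] by simp
qed

lemma types_wf: "fs \<in> set types \<Longrightarrow> wf_type fs"
  using wf_types unfolding list_all_iff by simp

lemma has_type_unique:
  assumes "fs \<in> set types" "gs \<in> set types" "has_type P fs" "has_type P gs" shows "fs = gs"
proof -
  have wf: "wf_type fs" "wf_type gs" using types_wf assms(1,2) by blast+
  then have "list_inv fs = list_inv gs" using has_type_inv assms(3,4) by metis
  then show ?thesis using distinct_list_inv assms(1,2) by (auto simp: distinct_map inj_on_def)
qed

lemma inj_on_type_image:
  assumes wf: "wf_type fs" and inj: "inj_on p {..<8}" shows "inj_on (\<lambda>F. p ` set F) (set fs)"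
proof (rule inj_onI)
  fix F G assume h: "F \<in> set fs" "G \<in> set fs" "p ` set F = p ` set G"
  have "set F = set G" using h(3) inj_on_image_eq_iff[OF inj wf_typeD(1)[OF wf h(1)] wf_typeD(1)[OF wf h(2)]] by simp
  then show "F = G" by (rule inj_onD[OF wf_typeD(4)[OF wf]]) (rule h)+
qed

lemma has_type_polys_8_9:
  assumes P: "polyhedron3 P" and t: "has_type P fs" and wf: "wf_type fs"
  shows "P \<in> polys_8_9"
proof -
  interpret poly3 P using P by unfold_locales
  obtain p where p: "bij_betw p {..<8} (verts P)" "facet_verts P = (\<lambda>F. p ` set F) ` set fs" using t unfolding has_type_def by blast
  have "card (facet_verts P) = card (set fs)"
    unfolding p(2) by (rule card_image, rule inj_on_type_image[OF wf bij_betw_imp_inj_on[OF p(1)]])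
  also have "\<dots> = 9" using distinct_card[OF wf_typeD(5)[OF wf]] wf_typeD(6)[OF wf] by simp
  finally show ?thesis using card_facet_verts P bij_betw_same_card[OF p(1)] by (simp add: polys_8_9_def)
qed

lemma comb_equiv_sym:
  assumes P: "polyhedron3 P" and Q: "polyhedron3 Q" and "comb_equiv P Q" shows "comb_equiv Q P"
proof -
  interpret poly3 P using P by unfold_locales
  obtain \<sigma> where \<sigma>: "bij_betw \<sigma> (verts P) (verts Q)" "(`) \<sigma> ` facet_verts P = facet_verts Q"
    using bij_of_comb_equiv[OF assms] by blast
  define \<tau> where "\<tau> = inv_into (verts P) \<sigma>"
  have canc: "\<tau> ` \<sigma> ` S = S" if "S \<in> facet_verts P" for S
    unfolding \<tau>_def by (rule inv_into_image_cancel[OF bij_betw_imp_inj_on[OF \<sigma>(1)] facet_verts_subset[OF that]])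
  have "(`) \<tau> ` facet_verts Q = (\<lambda>S. \<tau> ` \<sigma> ` S) ` facet_verts P" unfolding \<sigma>(2)[symmetric] by (simp only: image_image)
  also have "\<dots> = (\<lambda>S. S) ` facet_verts P" by (rule image_cong[OF refl]) (rule canc)
  finally have "(`) \<tau> ` facet_verts Q = facet_verts P" by simp
  then show ?thesis by (rule comb_equiv_of_bij[OF Q P bij_betw_inv_into[OF \<sigma>(1), folded \<tau>_def]])
qed

section \<open>Decomposability of the individual types\<close>

lemma has_type_facet:
  assumes "facet_verts P = (\<lambda>F. p ` set F) ` set fs" "X \<in> set fs"
  obtains K where "K \<in> facets P" "verts K = p ` set X"
proof -
  have "p ` set X \<in> facet_verts P" unfolding assms(1) by (rule imageI[OF assms(2)])
  then obtain K where "K \<in> facets P" "p ` set X = verts K" unfolding facet_verts_def by (rule imageE)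
  then show thesis using that by simp
qed

lemma split_type:
  assumes P: "polyhedron3 P" and t: "has_type P fs"
    and V: "{..<8} = T \<union> B" "T \<inter> B = {}" and tt: "t1 \<in> T" "t2 \<in> T" "t1 \<noteq> t2" and b: "b1 \<in> B" "b2 \<in> B" "b1 \<noteq> b2"
    and M: "M1 \<in> set fs" "M2 \<in> set fs" "M3 \<in> set fs"
    and F: "\<And>F. F \<in> set fs \<Longrightarrow> set F \<subseteq> T \<or> set F \<subseteq> B \<or> F = M1 \<or> F = M2 \<or> F = M3"
  shows "decomposable P"
proof -
  interpret poly3 P using P by unfold_locales
  obtain p where p: "bij_betw p {..<8} (verts P)" "facet_verts P = (\<lambda>F. p ` set F) ` set fs" using t unfolding has_type_def by blast
  have inj: "inj_on p {..<8}" and im: "p ` {..<8} = verts P" using p(1) by (simp_all add: bij_betw_def)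
  have m: "T \<subseteq> {..<8}" "B \<subseteq> {..<8}" using V(1) by blast+
  obtain K1 where K1: "K1 \<in> facets P" "verts K1 = p ` set M1" by (rule has_type_facet[OF p(2) M(1)])
  obtain K2 where K2: "K2 \<in> facets P" "verts K2 = p ` set M2" by (rule has_type_facet[OF p(2) M(2)])
  obtain K3 where K3: "K3 \<in> facets P" "verts K3 = p ` set M3" by (rule has_type_facet[OF p(2) M(3)])
  show ?thesis
  proof (rule split_decomposable[of "p ` T" "p ` B" "p t1" "p t2" "p b1" "p b2" K1 K2 K3])
    show "verts P = p ` T \<union> p ` B" using im V(1) by (simp add: image_Un)
    show "p ` T \<inter> p ` B = {}" using inj_on_image_Int[OF inj m] V(2) by simp
    show "p t1 \<in> p ` T" "p t2 \<in> p ` T" "p b1 \<in> p ` B" "p b2 \<in> p ` B" using tt b by simp_all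
    show "p t1 \<noteq> p t2" using inj_on_eq_iff[OF inj, of t1 t2] m tt by blast
    show "p b1 \<noteq> p b2" using inj_on_eq_iff[OF inj, of b1 b2] m b by blast
    show "K1 \<in> facets P" "K2 \<in> facets P" "K3 \<in> facets P" by fact+
    show "verts F \<subseteq> p ` T \<or> verts F \<subseteq> p ` B \<or> F = K1 \<or> F = K2 \<or> F = K3" if F': "F \<in> facets P" for F
    proof -
      have "verts F \<in> facet_verts P" unfolding facet_verts_def by (rule imageI[OF F'])
      then obtain X where X: "verts F = p ` set X" "X \<in> set fs" unfolding p(2) by (rule imageE)
      have e: "F = K" if "K \<in> facets P" "verts F = verts K" for K
        by (rule inj_onD[OF inj_on_verts_facets[OF pt] that(2) F' that(1)])
      consider "set X \<subseteq> T" | "set X \<subseteq> B" | "X = M1" | "X = M2" | "X = M3" using F[OF X(2)] by blast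
      then show ?thesis
      proof cases
        case 1 then show ?thesis using image_mono[OF 1, of p] X(1) by simp
      next
        case 2 then show ?thesis using image_mono[OF 2, of p] X(1) by simp
      next
        case 3 then have "F = K1" by (intro e) (simp_all add: K1 X)
        then show ?thesis by simp
      next
        case 4 then have "F = K2" by (intro e) (simp_all add: K2 X)
        then show ?thesis by simp
      next
        case 5 then have "F = K3" by (intro e) (simp_all add: K3 X)
        then show ?thesis by simp
      qed
    qed
  qed
qed

lemma lessThan_8: "{..<8::nat} = {0, 1, 2, 3, 4, 5, 6, 7}"
  by (rule set_eqI, unfold lessThan_iff insert_iff empty_iff, arith)

text \<open>The second group is the free triangle of the prism; the first is the opposite triangle
  with both apexes. The three listed facets are the quadrilaterals of the prism.\<close>

lemma type_A_decomposable:
  assumes "polyhedron3 P" "has_type P type_A" shows "decomposable P"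
proof (rule split_type[OF assms, of "{0, 1, 2, 3, 4}" "{5, 6, 7}" 0 1 5 6 "[1, 4, 6, 7]" "[0, 1, 5, 7]" "[0, 4, 5, 6]"])
  show "{..<8::nat} = {0, 1, 2, 3, 4} \<union> {5, 6, 7}" by (simp add: lessThan_8 insert_commute)
qed (auto simp: type_A_def)

text \<open>Each group is a triangle of the prism together with its apex.\<close>

lemma type_B_decomposable:
  assumes "polyhedron3 P" "has_type P type_B" shows "decomposable P"
proof (rule split_type[OF assms, of "{0, 1, 2, 3}" "{4, 5, 6, 7}" 0 1 5 6 "[1, 2, 4, 6]" "[0, 2, 5, 6]" "[0, 1, 4, 5]"])
  show "{..<8::nat} = {0, 1, 2, 3} \<union> {4, 5, 6, 7}" by (simp add: lessThan_8 insert_commute)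
qed (auto simp: type_B_def)

lemma linked_image:
  assumes inj: "inj_on p V" and sub: "\<And>S. S \<in> \<F> \<Longrightarrow> S \<subseteq> V" and l: "linked \<F> v w"
  shows "linked ((`) p ` \<F>) (p v) (p w)"
proof -
  obtain S T where h: "S \<in> \<F>" "T \<in> \<F>" "S \<noteq> T" "v \<in> S" "w \<in> S" "v \<in> T" "w \<in> T" and vw: "v \<noteq> w"
    using l unfolding linked_def by blast
  have "p v \<noteq> p w" using inj_on_eq_iff[OF inj, of v w] sub[OF h(1)] h(4,5) vw by blast
  moreover have "p ` S \<noteq> p ` T" using inj_on_image_eq_iff[OF inj sub[OF h(1)] sub[OF h(2)]] h(3) by simp
  ultimately show ?thesis unfolding linked_def
    by (intro conjI bexI[of _ "p ` S"] bexI[of _ "p ` T"]) (simp_all add: h)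
qed

lemma linked_in: "linked \<F> v w \<Longrightarrow> v \<in> \<Union>\<F> \<and> w \<in> \<Union>\<F>"
  unfolding linked_def by blast

lemma rigid_subset: "rigid \<F> S \<Longrightarrow> S \<subseteq> \<Union>\<F>"
proof (induction rule: rigid.induct)
  case (rigid_edge v w) then show ?case using linked_in[of \<F> v w] by simp
next
  case (rigid_insert S x y z) then show ?case using linked_in[of \<F> x y] by simp
qed

lemma rigid_image:
  assumes "rigid \<F> S" and inj: "inj_on p V" and sub: "\<And>S. S \<in> \<F> \<Longrightarrow> S \<subseteq> V"
  shows "rigid ((`) p ` \<F>) (p ` S)"
  using assms(1)
proof (induction rule: rigid.induct)
  case (rigid_edge v w)
  from rigid.rigid_edge[OF linked_image[OF inj sub this]] show ?case by simp
next
  case (rigid_insert S x y z)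
  have "S \<subseteq> V" using rigid_subset[OF rigid_insert.hyps(1)] sub by blast
  then have "p y \<noteq> p z" using inj_on_eq_iff[OF inj, of y z] rigid_insert.hyps by blast
  from rigid.rigid_insert[OF rigid_insert.IH linked_image[OF inj sub rigid_insert.hyps(2)] linked_image[OF inj sub rigid_insert.hyps(3)] _ _ this]
  show ?case using rigid_insert.hyps by simp
qed

lemma linkedb_linked:
  assumes wf: "wf_type fs" and l: "linkedb fs x y" shows "linked (set ` set fs) x y"
proof -
  let ?xs = "filter (\<lambda>F. x \<in> set F \<and> y \<in> set F) fs"
  have "\<exists>F\<in>set xs. \<exists>G\<in>set xs. F \<noteq> G" if "2 \<le> length xs" "distinct xs" for xs :: "nat list list"
    using that by (cases xs; cases "tl xs") auto
  moreover have "2 \<le> length ?xs" using l by (simp add: linkedb_def)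
  ultimately obtain F G where FG: "F \<in> set ?xs" "G \<in> set ?xs" "F \<noteq> G"
    using distinct_filter[OF wf_typeD(5)[OF wf]] by meson
  then have m: "F \<in> set fs" "G \<in> set fs" "x \<in> set F" "y \<in> set F" "x \<in> set G" "y \<in> set G" by simp_all
  then have "set F \<noteq> set G" using inj_on_eq_iff[OF wf_typeD(4)[OF wf]] FG(3) by blast
  then show ?thesis unfolding linked_def using l unfolding linkedb_def
    by (intro conjI bexI[of _ "set F"] bexI[of _ "set G"]) (simp_all add: m)
qed

lemma rigidb_rigid:
  assumes wf: "wf_type fs"
  shows "rigid (set ` set fs) (set S) \<Longrightarrow> rigidb fs S us \<Longrightarrow> \<exists>U. rigid (set ` set fs) U \<and> {..<8} \<subseteq> U"
proof (induction us arbitrary: S)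
  case Nil then show ?case by (auto simp: list_all_iff)
next
  case (Cons t us)
  obtain x y z where t: "t = (x, y, z)" by (cases t)
  have "rigid (set ` set fs) (insert x (set S))"
    using Cons.prems(2) unfolding t by (intro rigid_insert[OF Cons.prems(1), of x y z] linkedb_linked[OF wf]) simp_all
  then show ?case using Cons.IH[of "x # S"] Cons.prems(2) unfolding t by simp
qed

lemma list_all2_mem: "list_all2 R xs ys \<Longrightarrow> x \<in> set xs \<Longrightarrow> \<exists>y. R x y"
  by (induction rule: list_all2_induct) auto

lemma rigid_type_indecomposable:
  assumes P: "polyhedron3 P" and t: "has_type P fs" and fs: "fs \<in> set rigid_types"
  shows "\<not> decomposable P"
proof -
  interpret poly3 P using P by unfold_locales
  have wf: "wf_type fs" by (rule types_wf) (simp add: types_def fs)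
  obtain v w us where r: "linkedb fs v w" "rigidb fs [v, w] us" using list_all2_mem[OF rigid_orders_valid fs] by auto
  have "rigid (set ` set fs) (set [v, w])" using rigid_edge[OF linkedb_linked[OF wf r(1)]] by simp
  then obtain U where U: "rigid (set ` set fs) U" "{..<8} \<subseteq> U" using rigidb_rigid[OF wf _ r(2)] by blast
  have sub: "S \<subseteq> {..<8}" if "S \<in> set ` set fs" for S using that wf_typeD(1)[OF wf] by blast
  then have "U = {..<8}" using U(2) rigid_subset[OF U(1)] by blast
  then have "rigid (set ` set fs) {..<8}" using U(1) by simp
  obtain p where p: "bij_betw p {..<8} (verts P)" "facet_verts P = (\<lambda>F. p ` set F) ` set fs" using t unfolding has_type_def by blast
  have "rigid ((`) p ` (set ` set fs)) (p ` {..<8})"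
    by (rule rigid_image[OF \<open>rigid _ {..<8}\<close> bij_betw_imp_inj_on[OF p(1)] sub])
  moreover have "(`) p ` (set ` set fs) = facet_verts P" unfolding p(2) by (simp only: image_image)
  moreover have "p ` {..<8} = verts P" using p(1) by (simp add: bij_betw_def)
  ultimately show ?thesis by (intro rigid_indecomposable) simp
qed

section \<open>Realisation by integer coordinates\<close>

definition pt_of :: "int \<times> int \<times> int \<Rightarrow> pt3" where
  "pt_of = (\<lambda>(x, y, z). vector [of_int x, of_int y, of_int z])"

lemma pt_of_inner: "pt_of a \<bullet> pt_of x = of_int (dot_int a x)"
  by (cases a; cases x) (simp add: pt_of_def dot_int_def inner_vec_def sum_3)

lemma supports_nth:
  "supports F (a, b, c, d) is xs \<Longrightarrow> k < length is \<Longrightarrow>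
    (if is ! k \<in> set F then dot_int (a, b, c) (xs ! k) = d else dot_int (a, b, c) (xs ! k) < d)"
proof (induction "is" arbitrary: xs k)
  case (Cons i "is")
  then show ?case by (cases xs; cases k) (auto split: if_splits)
qed simp

lemma separates_ex: "separates i j fs \<Longrightarrow> \<exists>F\<in>set fs. i \<in> set F \<and> j \<notin> set F"
  by (induction fs) (auto split: if_splits)

lemma separates_all_ex:
  assumes "separates_all fs [0..<8]" "i < 8" "j < 8" "i \<noteq> j" shows "\<exists>F\<in>set fs. i \<in> set F \<and> j \<notin> set F"
proof -
  have 1: "separates_from fs i js \<Longrightarrow> j \<in> set js \<Longrightarrow> i = j \<or> separates i j fs" for js by (induction js) auto
  have 2: "separates_all fs is \<Longrightarrow> i \<in> set is \<Longrightarrow> separates_from fs i [0..<8]" for "is" by (induction "is") auto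
  have "separates_from fs i [0..<8]" using 2[OF assms(1)] assms(2) by simp
  then have "separates i j fs" using 1[of "[0..<8]"] assms(3,4) by simp
  then show ?thesis by (rule separates_ex)
qed

lemma realizes_has_type:
  assumes r: "realizes fs (xs, qs)" and wf: "wf_type fs"
  obtains P where "polyhedron3 P" "has_type P fs"
proof -
  define p where "p = (\<lambda>i. pt_of (xs ! i))"
  define V where "V = p ` {..<8::nat}"
  define \<S> where "\<S> = (\<lambda>F. p ` set F) ` set fs"
  have sup: "list_all2 (\<lambda>F q. supports F q [0..<8] xs) fs qs" and l8: "\<And>F. F \<in> set fs \<Longrightarrow> length F < 8"
    and sa: "separates_all fs [0..<8]"
    using r by (auto simp: realizes_def list_all_iff)
  note sp = separates_all_ex[OF sa]
  have pl: "\<exists>a b. \<forall>i<8. a \<bullet> p i \<le> b \<and> (a \<bullet> p i = b \<longleftrightarrow> i \<in> set F)" if F: "F \<in> set fs" for F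
  proof -
    obtain a b c d where q: "supports F (a, b, c, d) [0..<8] xs" using list_all2_mem[OF sup F] by auto
    have "pt_of (a, b, c) \<bullet> p i \<le> of_int d \<and> (pt_of (a, b, c) \<bullet> p i = of_int d \<longleftrightarrow> i \<in> set F)" if "i < 8" for i
      using supports_nth[OF q, of i] nth_upt[of 0 i 8] that unfolding p_def pt_of_inner by (auto split: if_splits)
    then show ?thesis by blast
  qed
  \<comment> \<open>The points are different because some facet plane contains one of them and not
    the other.\<close>
  have inj: "inj_on p {..<8}"
  proof (rule inj_onI, rule ccontr)
    fix i j assume h: "i \<in> {..<8}" "j \<in> {..<8}" "p i = p j" "i \<noteq> j"
    obtain F where F: "F \<in> set fs" "i \<in> set F" "j \<notin> set F" using sp[of i j] h by auto
    obtain a b where ab: "\<forall>i<8. a \<bullet> p i \<le> b \<and> (a \<bullet> p i = b \<longleftrightarrow> i \<in> set F)" using pl[OF F(1)] by blast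
    have "a \<bullet> p i = b" "a \<bullet> p j \<noteq> b" using ab F(2,3) h(1,2) by simp_all
    then show False using h(3) by simp
  qed
  note s8 = wf_typeD(1)[OF wf] and injS = inj_on_type_image[OF wf inj]
  have cV: "card V = 8" unfolding V_def by (simp add: card_image[OF inj])
  have cS: "card (p ` set F) = length F" if "F \<in> set fs" for F
    using card_image[OF inj_on_subset[OF inj s8[OF that]]] distinct_card[OF wf_typeD(2)[OF wf that]] by simp
  have sum: "(\<Sum>S\<in>\<S>. card S) = 30"
  proof -
    have "(\<Sum>S\<in>\<S>. card S) = (\<Sum>F\<in>set fs. card (p ` set F))" unfolding \<S>_def by (simp only: sum.reindex[OF injS] comp_def)
    also have "\<dots> = (\<Sum>F\<in>set fs. length F)" by (rule sum.cong[OF refl]) (rule cS)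
    also have "\<dots> = sum_list (map length fs)" by (rule sum_list_distinct_conv_sum_set[OF wf_typeD(5)[OF wf], symmetric])
    finally show ?thesis using wf_typeD(7)[OF wf] by simp
  qed
  have c9: "card \<S> = 9"
    unfolding \<S>_def using card_image[OF injS] distinct_card[OF wf_typeD(5)[OF wf]] wf_typeD(6)[OF wf] by simp
  have mem: "p i \<in> p ` set F \<longleftrightarrow> i \<in> set F" if "F \<in> set fs" "i < 8" for i F
    using inj_on_image_mem_iff[OF inj _ s8[OF that(1)]] that(2) by simp
  have sep: "\<exists>S\<in>\<S>. v \<in> S \<and> w \<notin> S" if h: "v \<in> V" "w \<in> V" "v \<noteq> w" for v w
  proof -
    obtain i where i: "i < 8" "v = p i" using h(1) unfolding V_def by auto
    obtain j where j: "j < 8" "w = p j" using h(2) unfolding V_def by auto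
    obtain F where F: "F \<in> set fs" "i \<in> set F" "j \<notin> set F" using sp[OF i(1) j(1)] h(3) i j by blast
    then have "v \<in> p ` set F \<and> w \<notin> p ` set F" using mem[OF F(1)] i j by simp
    then show ?thesis unfolding \<S>_def using F(1) by blast
  qed
  have "polyhedron3 (convex hull V) \<and> verts (convex hull V) = V \<and> facet_verts (convex hull V) = \<S>"
  proof (rule facet_certificate_all)
    show "finite V" unfolding V_def by simp
    show "(\<Sum>S\<in>\<S>. card S) + 4 \<ge> 2 * card \<S> + 2 * card V" using sum c9 cV by simp
    show "\<S> \<noteq> {}" using c9 by auto
    show "\<exists>S\<in>\<S>. v \<in> S \<and> w \<notin> S" if "v \<in> V" "w \<in> V" "v \<noteq> w" for v w using sep[OF that] .
    show "\<exists>S\<in>\<S>. v \<in> S" if v: "v \<in> V" for v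
    proof -
      have "V \<noteq> {v}" using cV by auto
      then obtain w where "w \<in> V" "v \<noteq> w" using v by blast
      then show ?thesis using sep[OF v] by blast
    qed
    fix S assume "S \<in> \<S>"
    then obtain F where F: "F \<in> set fs" "S = p ` set F" unfolding \<S>_def by blast
    show "card S \<ge> 3" using cS[OF F(1)] F(2) wf_typeD(3)[OF wf F(1)] distinct_card[OF wf_typeD(2)[OF wf F(1)]] by simp
    have "S \<subseteq> V" unfolding F(2) V_def using s8[OF F(1)] by (rule image_mono)
    moreover have "card S < card V" using cS[OF F(1)] F(2) l8[OF F(1)] cV by simp
    ultimately show "S \<subset> V" by auto
    obtain a b where ab: "\<forall>i<8. a \<bullet> p i \<le> b \<and> (a \<bullet> p i = b \<longleftrightarrow> i \<in> set F)" using pl[OF F(1)] by blast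
    have "a \<bullet> v \<le> b \<and> (a \<bullet> v = b \<longleftrightarrow> v \<in> S)" if "v \<in> V" for v
    proof -
      obtain i where i: "i < 8" "v = p i" using \<open>v \<in> V\<close> unfolding V_def by auto
      then show ?thesis using ab mem[OF F(1) i(1)] F(2) by simp
    qed
    then show "\<exists>a b. \<forall>v\<in>V. a \<bullet> v \<le> b \<and> (a \<bullet> v = b \<longleftrightarrow> v \<in> S)" by blast
  qed
  then have "polyhedron3 (convex hull V)" "has_type (convex hull V) fs"
    unfolding has_type_def using inj by (auto simp: V_def \<S>_def bij_betw_def)
  then show thesis by (rule that)
qed

lemma types_realizable:
  assumes "fs \<in> set types" obtains P where "P \<in> polys_8_9" "has_type P fs"
proof -
  obtain xs qs where "realizes fs (xs, qs)" using list_all2_mem[OF realizations_valid assms] by auto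
  then obtain P where "polyhedron3 P" "has_type P fs" using realizes_has_type types_wf[OF assms] by metis
  then show thesis using that has_type_polys_8_9 types_wf[OF assms] by metis
qed

section \<open>Stacked prisms\<close>

definition is_prism :: "pt3 set \<Rightarrow> pt3 \<Rightarrow> pt3 \<Rightarrow> pt3 \<Rightarrow> pt3 \<Rightarrow> pt3 \<Rightarrow> pt3 \<Rightarrow> bool" where
  "is_prism P a b c a' b' c' \<longleftrightarrow> polyhedron3 P \<and> verts P = {a, b, c, a', b', c'} \<and>
     facet_verts P = prism_facets a b c a' b' c' \<and> distinct [a, b, c, a', b', c']"

text \<open>\<open>is_prism\<close> keeps only the combinatorics of the prism, so the two triangles
  are on an equal footing; together with rotations this reduces every stacking to a standard
  one.\<close>

lemma is_prism_swap: "is_prism P a b c a' b' c' \<Longrightarrow> is_prism P a' b' c' a b c"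
  unfolding is_prism_def prism_facets_def by (auto simp: insert_commute)

lemma is_prism_rotate: "is_prism P a b c a' b' c' \<Longrightarrow> is_prism P b c a b' c' a'"
  unfolding is_prism_def prism_facets_def by (auto simp: insert_commute)

lemma tri_prism_is_prism: assumes "tri_prism P" obtains a b c a' b' c' where "is_prism P a b c a' b' c'"
proof -
  obtain a b c v where P: "P = convex hull {a, b, c, a + v, b + v, c + v}" "aff_dim P = 3"
    using assms unfolding tri_prism_def by blast
  have "is_prism P a b c (a + v) (b + v) (c + v)" unfolding is_prism_def using prism_structure[OF P] by blast
  then show thesis by (rule that)
qed

lemma prism_triangle:
  assumes p: "is_prism P a b c a' b' c'" and F: "F facet_of P" "triangle_face F"
  shows "verts F = {a, b, c} \<or> verts F = {a', b', c'}"
proof -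
  have "verts F \<in> prism_facets a b c a' b' c'" using p F(1) unfolding is_prism_def facet_verts_def facets_def by blast
  then consider "verts F = {a, b, c}" | "verts F = {a', b', c'}" | "verts F = {a, b, a', b'}" | "verts F = {b, c, b', c'}"
    | "verts F = {a, c, a', c'}" unfolding prism_facets_def by blast
  then show ?thesis
    by cases (use p F(2) in \<open>simp_all add: triangle_face_def is_prism_def\<close>)
qed

lemma stacked_prism:
  assumes p: "is_prism P a b c a' b' c'" and F: "F facet_of P" "verts F = {a, b, c}" and u: "beyond_only P F u"
    and P1: "P1 = convex hull (insert u P)"
  shows "polyhedron3 P1" "verts P1 = {u, a, b, c, a', b', c'}" "distinct [u, a, b, c, a', b', c']"
    "facet_verts P1 = {{a', b', c'}, {a, b, a', b'}, {b, c, b', c'}, {a, c, a', c'}, {u, a, b}, {u, b, c}, {u, a, c}}"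
proof -
  have P: "polyhedron3 P" and d: "distinct [a, b, c, a', b', c']" and vP: "verts P = {a, b, c, a', b', c'}"
    and fP: "facet_verts P = prism_facets a b c a' b' c'" using p unfolding is_prism_def by blast+
  interpret poly3 P using P by unfold_locales
  have F': "F \<in> facets P" using F(1) by (simp add: facets_def)
  have abc: "a \<noteq> b" "b \<noteq> c" "a \<noteq> c" using d by auto
  note s = stack_triangle[OF F' F(2) abc u, folded P1]
  show "polyhedron3 P1" by (rule s(1))
  show "verts P1 = {u, a, b, c, a', b', c'}" unfolding s(2) vP ..
  show "distinct [u, a, b, c, a', b', c']" using d s(3) unfolding vP by simp
  have "a' \<notin> {a, b, c}" "b' \<notin> {a, b, c}" "c' \<notin> {a, b, c}" using d by auto
  then have n: "{a', b', c'} \<noteq> {a, b, c}" "{a, b, a', b'} \<noteq> {a, b, c}" "{b, c, b', c'} \<noteq> {a, b, c}" "{a, c, a', c'} \<noteq> {a, b, c}"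
    by blast+
  have "prism_facets a b c a' b' c' - {{a, b, c}} = {{a', b', c'}, {a, b, a', b'}, {b, c, b', c'}, {a, c, a', c'}}"
    unfolding prism_facets_def by (simp only: insert_Diff_if singleton_iff n if_True if_False empty_Diff refl)
  then show "facet_verts P1 = {{a', b', c'}, {a, b, a', b'}, {b, c, b', c'}, {a, c, a', c'}, {u, a, b}, {u, b, c}, {u, a, c}}"
    unfolding s(4) fP by (simp only: Un_insert_left Un_empty_left)
qed

lemma stacked_prism_type_A:
  assumes p: "is_prism P a b c a' b' c'" and F: "F facet_of P" "verts F = {a, b, c}" and u: "beyond_only P F u"
    and P1: "P1 = convex hull (insert u P)"
    and G: "G facet_of P1" "verts G = {u, a, b}" and w: "beyond_only P1 G w" and P2: "P2 = convex hull (insert w P1)"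
  shows "polyhedron3 P2" "has_type P2 type_A"
proof -
  note s1 = stacked_prism[OF p F u P1]
  interpret poly3 P1 using s1(1) by unfold_locales
  have G': "G \<in> facets P1" using G(1) by (simp add: facets_def)
  have uab: "u \<noteq> a" "a \<noteq> b" "u \<noteq> b" using s1(3) by auto
  note s = stack_triangle[OF G' G(2) uab w, folded P2]
  show "polyhedron3 P2" by (rule s(1))
  have d: "distinct [w, u, a, b, c, a', b', c']" using s1(3) s(3) unfolding s1(2) by simp
  then have "u \<notin> {a', b', c'}" "u \<notin> {a, b, a', b'}" "u \<notin> {b, c, b', c'}" "u \<notin> {a, c, a', c'}" "c \<notin> {u, a, b}" by auto
  then have n: "{a', b', c'} \<noteq> {u, a, b}" "{a, b, a', b'} \<noteq> {u, a, b}" "{b, c, b', c'} \<noteq> {u, a, b}" "{a, c, a', c'} \<noteq> {u, a, b}"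
    "{u, b, c} \<noteq> {u, a, b}" "{u, a, c} \<noteq> {u, a, b}" by blast+
  have "facet_verts P1 - {{u, a, b}} = {{a', b', c'}, {a, b, a', b'}, {b, c, b', c'}, {a, c, a', c'}, {u, b, c}, {u, a, c}}"
    unfolding s1(4) by (simp only: insert_Diff_if singleton_iff n if_True if_False empty_Diff refl)
  then have fv: "facet_verts P2 = {{a', b', c'}, {a, b, a', b'}, {b, c, b', c'}, {a, c, a', c'}, {u, b, c}, {u, a, c}, {w, u, a}, {w, a, b}, {w, u, b}}"
    unfolding s(4) by (simp only: Un_insert_left Un_empty_left)
  \<comment> \<open>The position in the list is the label used in \<open>type_A\<close>.\<close>
  let ?p = "(!) [c, a, u, w, b, c', b', a']"
  have "bij_betw ?p {..<8} (verts P2)"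
    by (rule bij_betw_nth) (use d in \<open>auto simp: s(2) s1(2)\<close>)
  moreover have "facet_verts P2 = (\<lambda>F. ?p ` set F) ` set type_A"
    unfolding fv by (simp add: type_A_def insert_commute)
  ultimately show "has_type P2 type_A" unfolding has_type_def by blast
qed

lemma stacked_prism_type_B:
  assumes p: "is_prism P a b c a' b' c'" and F: "F facet_of P" "verts F = {a, b, c}" and u: "beyond_only P F u"
    and P1: "P1 = convex hull (insert u P)"
    and G: "G facet_of P1" "verts G = {a', b', c'}" and w: "beyond_only P1 G w" and P2: "P2 = convex hull (insert w P1)"
  shows "polyhedron3 P2" "has_type P2 type_B"
proof -
  note s1 = stacked_prism[OF p F u P1]
  interpret poly3 P1 using s1(1) by unfold_locales
  have G': "G \<in> facets P1" using G(1) by (simp add: facets_def)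
  have abc: "a' \<noteq> b'" "b' \<noteq> c'" "a' \<noteq> c'" using s1(3) by auto
  note s = stack_triangle[OF G' G(2) abc w, folded P2]
  show "polyhedron3 P2" by (rule s(1))
  have d: "distinct [w, u, a, b, c, a', b', c']" using s1(3) s(3) unfolding s1(2) by simp
  then have "u \<notin> {a', b', c'}" "a \<notin> {a', b', c'}" "b \<notin> {a', b', c'}" by auto
  then have n: "{a, b, a', b'} \<noteq> {a', b', c'}" "{b, c, b', c'} \<noteq> {a', b', c'}" "{a, c, a', c'} \<noteq> {a', b', c'}"
    "{u, a, b} \<noteq> {a', b', c'}" "{u, b, c} \<noteq> {a', b', c'}" "{u, a, c} \<noteq> {a', b', c'}" by blast+
  have "facet_verts P1 - {{a', b', c'}} = {{a, b, a', b'}, {b, c, b', c'}, {a, c, a', c'}, {u, a, b}, {u, b, c}, {u, a, c}}"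
    unfolding s1(4) by (simp only: insert_Diff_if singleton_iff n if_True if_False empty_Diff refl)
  then have fv: "facet_verts P2 = {{a, b, a', b'}, {b, c, b', c'}, {a, c, a', c'}, {u, a, b}, {u, b, c}, {u, a, c}, {w, a', b'}, {w, b', c'}, {w, a', c'}}"
    unfolding s(4) by (simp only: Un_insert_left Un_empty_left)
  let ?p = "(!) [a, b, c, u, b', a', c', w]"
  have "bij_betw ?p {..<8} (verts P2)"
    by (rule bij_betw_nth) (use d in \<open>auto simp: s(2) s1(2)\<close>)
  moreover have "facet_verts P2 = (\<lambda>F. ?p ` set F) ` set type_B"
    unfolding fv by (simp add: type_B_def insert_commute)
  ultimately show "has_type P2 type_B" unfolding has_type_def by blast
qed

text \<open>\<open>typeA\<close> and \<open>typeB\<close> ask for an actual stacked prism, so a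
  concrete one is needed to show that every polytope with the corresponding facet list has the
  type.\<close>

lemma tri_prism_exists: "\<exists>P. tri_prism P"
proof -
  define S :: "pt3 set" where "S = {0, axis 1 1, axis 2 1, 0 + axis 3 1, axis 1 1 + axis 3 1, axis 2 1 + axis 3 1}"
  have "x \<in> S" if x: "x \<in> Basis" for x :: pt3
  proof -
    obtain i :: 3 where "x = axis i 1" using x by (auto simp: Basis_vec_def)
    then show ?thesis using exhaust_3[of i] by (auto simp: S_def)
  qed
  then have "span (Basis :: pt3 set) \<subseteq> span S" by (intro span_mono) blast
  then have "span S = UNIV" by (simp add: span_Basis top.extremum_unique)
  then have "dim S = 3" using dim_span[of S] by simp
  moreover have "0 \<in> affine hull S" by (rule hull_inc) (simp add: S_def)
  ultimately have "aff_dim (convex hull S) = 3" by (simp add: aff_dim_zero aff_dim_convex_hull)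
  then show ?thesis unfolding tri_prism_def S_def by blast
qed

lemma stackingI:
  assumes "polyhedron3 P" "F \<in> facets P" "verts F = {x, y, z}" "distinct [x, y, z]"
  obtains u where "stacking P F u (convex hull (insert u P))" "beyond_only P F u"
proof -
  interpret poly3 P using assms(1) by unfold_locales
  obtain u where "beyond_only P F u" using beyond_only_exists[OF assms(2)] by blast
  then show thesis using that assms by (simp add: stacking_def triangle_face_def)
qed

lemma facet_vertsE:
  assumes "S \<in> facet_verts P" obtains F where "F \<in> facets P" "verts F = S"
  using assms unfolding facet_verts_def by blast

lemma typeA_has_type:
  assumes "typeA X" shows "polyhedron3 X" "has_type X type_A"
proof -
  obtain P F u P1 G w P2 where X: "polyhedron3 X" and pr: "tri_prism P" and st: "stacking P F u P1"
    and G: "G facet_of P1" "u \<in> G" and st2: "stacking P1 G w P2" and eq: "comb_equiv X P2"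
    using assms unfolding typeA_def by blast
  show "polyhedron3 X" by (rule X)
  have F: "F facet_of P" "triangle_face F" "beyond_only P F u" "P1 = convex hull (insert u P)"
    using st unfolding stacking_def beyond_only_def by blast+
  have w: "beyond_only P1 G w" "P2 = convex hull (insert w P1)" using st2 unfolding stacking_def by blast+
  obtain a b c a' b' c' where "is_prism P a b c a' b' c'" by (rule tri_prism_is_prism[OF pr])
  then have "\<exists>a b c a' b' c'. is_prism P a b c a' b' c' \<and> verts F = {a, b, c}"
    using prism_triangle[OF _ F(1,2)] is_prism_swap by metis
  then obtain a b c a' b' c' where p: "is_prism P a b c a' b' c'" and vF: "verts F = {a, b, c}" by blast
  note s = stacked_prism[OF p F(1) vF F(3,4)]
  interpret poly3 P1 using s(1) by unfold_locales
  have G': "G \<in> facets P1" using G(1) by (simp add: facets_def)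
  have uG: "u \<in> verts G" using in_verts_facet[OF G'] G(2) s(2) by simp
  \<comment> \<open>Only the three stacked triangles contain the apex; rotating the prism turns any
    of them into the one over \<open>a\<close>, \<open>b\<close>.\<close>
  have "verts G \<in> facet_verts P1" unfolding facet_verts_def by (rule imageI[OF G'])
  then consider "verts G = {u, a, b}" | "verts G = {u, b, c}" | "verts G = {u, a, c}"
    unfolding s(4) insert_iff empty_iff by (elim disjE) (use s(3) uG in auto)
  then have "\<exists>a b c a' b' c'. is_prism P a b c a' b' c' \<and> verts F = {a, b, c} \<and> verts G = {u, a, b}"
  proof cases
    case 1 then show ?thesis using p vF by blast
  next
    case 2
    have "verts F = {b, c, a}" using vF by (simp add: insert_commute)
    then show ?thesis using is_prism_rotate[OF p] 2 by blast
  next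
    case 3
    have "verts F = {c, a, b}" "verts G = {u, c, a}" using 3 vF by (simp_all add: insert_commute)
    then show ?thesis using is_prism_rotate[OF is_prism_rotate[OF p]] by blast
  qed
  then obtain a b c a' b' c' where p: "is_prism P a b c a' b' c'" and vF: "verts F = {a, b, c}" and vG: "verts G = {u, a, b}" by blast
  note t = stacked_prism_type_A[OF p F(1) vF F(3,4) G(1) vG w]
  show "has_type X type_A" by (rule comb_equiv_has_type[OF t(1) X comb_equiv_sym[OF X t(1) eq] t(2)])
qed

lemma typeB_has_type:
  assumes "typeB X" shows "polyhedron3 X" "has_type X type_B"
proof -
  obtain P F u P1 G w P2 where X: "polyhedron3 X" and pr: "tri_prism P" and st: "stacking P F u P1"
    and G: "G facet_of P" "G \<noteq> F" and st2: "stacking P1 G w P2" and eq: "comb_equiv X P2"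
    using assms unfolding typeB_def by blast
  show "polyhedron3 X" by (rule X)
  have F: "F facet_of P" "triangle_face F" "beyond_only P F u" "P1 = convex hull (insert u P)"
    using st unfolding stacking_def beyond_only_def by blast+
  have w: "beyond_only P1 G w" "P2 = convex hull (insert w P1)" "triangle_face G" "G facet_of P1"
    using st2 unfolding stacking_def beyond_only_def by blast+
  obtain a b c a' b' c' where "is_prism P a b c a' b' c'" by (rule tri_prism_is_prism[OF pr])
  then have "\<exists>a b c a' b' c'. is_prism P a b c a' b' c' \<and> verts F = {a, b, c}"
    using prism_triangle[OF _ F(1,2)] is_prism_swap by metis
  then obtain a b c a' b' c' where p: "is_prism P a b c a' b' c'" and vF: "verts F = {a, b, c}" by blast
  have "polytope P" using p unfolding is_prism_def polyhedron3_def by blast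
  \<comment> \<open>The second stacking triangle is also a facet of the prism and different from the
    first, hence it is the opposite triangle.\<close>
  then have "verts G \<noteq> verts F" using inj_onD[OF inj_on_verts_facets[of P], of G F] G F(1) unfolding facets_def by blast
  then have vG: "verts G = {a', b', c'}" using prism_triangle[OF p G(1) w(3)] vF by simp
  note t = stacked_prism_type_B[OF p F(1) vF F(3,4) w(4) vG w(1,2)]
  show "has_type X type_B" by (rule comb_equiv_has_type[OF t(1) X comb_equiv_sym[OF X t(1) eq] t(2)])
qed

text \<open>One stacked prism suffices, since \<open>typeA\<close> is closed under combinatorial
  equivalence and polytopes with the same facet list are equivalent.\<close>

lemma has_type_typeA:
  assumes X: "polyhedron3 X" "has_type X type_A" shows "typeA X"
proof -
  obtain P where pr: "tri_prism P" using tri_prism_exists by blast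
  obtain a b c a' b' c' where p: "is_prism P a b c a' b' c'" by (rule tri_prism_is_prism[OF pr])
  have P: "polyhedron3 P" and d: "distinct [a, b, c]" using p unfolding is_prism_def by simp_all
  have "{a, b, c} \<in> facet_verts P" using p unfolding is_prism_def prism_facets_def by simp
  then obtain F where F: "F \<in> facets P" "verts F = {a, b, c}" by (rule facet_vertsE)
  obtain u where u: "stacking P F u (convex hull (insert u P))" "beyond_only P F u" by (rule stackingI[OF P F d])
  have F': "F facet_of P" using F(1) by (simp add: facets_def)
  note s = stacked_prism[OF p F' F(2) u(2) refl]
  let ?P1 = "convex hull (insert u P)"
  have "{u, a, b} \<in> facet_verts ?P1" unfolding s(4) by simp
  then obtain G where G: "G \<in> facets ?P1" "verts G = {u, a, b}" by (rule facet_vertsE)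
  have "distinct [u, a, b]" using s(3) by simp
  then obtain w where w: "stacking ?P1 G w (convex hull (insert w ?P1))" "beyond_only ?P1 G w" by (rule stackingI[OF s(1) G])
  have G': "G facet_of ?P1" "u \<in> G" using G verts_subset[of G] by (auto simp: facets_def)
  note t = stacked_prism_type_A[OF p F' F(2) u(2) refl G'(1) G(2) w(2) refl]
  have "comb_equiv X (convex hull (insert w ?P1))"
    by (rule has_type_comb_equiv[OF X(1) t(1) X(2) t(2)]) (rule types_wf, simp add: types_def)
  then show ?thesis unfolding typeA_def using X(1) pr u(1) G' w(1) by blast
qed

lemma has_type_typeB:
  assumes X: "polyhedron3 X" "has_type X type_B" shows "typeB X"
proof -
  obtain P where pr: "tri_prism P" using tri_prism_exists by blast
  obtain a b c a' b' c' where p: "is_prism P a b c a' b' c'" by (rule tri_prism_is_prism[OF pr])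
  have P: "polyhedron3 P" and d: "distinct [a, b, c, a', b', c']" using p unfolding is_prism_def by simp_all
  have "{a, b, c} \<in> facet_verts P" "{a', b', c'} \<in> facet_verts P" using p unfolding is_prism_def prism_facets_def by simp_all
  then obtain F G0 where F: "F \<in> facets P" "verts F = {a, b, c}" and G0: "G0 \<in> facets P" "verts G0 = {a', b', c'}"
    by (metis facet_vertsE)
  have "distinct [a, b, c]" using d by simp
  then obtain u where u: "stacking P F u (convex hull (insert u P))" "beyond_only P F u" by (rule stackingI[OF P F])
  have F': "F facet_of P" using F(1) by (simp add: facets_def)
  note s = stacked_prism[OF p F' F(2) u(2) refl]
  let ?P1 = "convex hull (insert u P)"
  have "{a', b', c'} \<in> facet_verts ?P1" unfolding s(4) by simp
  then obtain G where G: "G \<in> facets ?P1" "verts G = {a', b', c'}" by (rule facet_vertsE)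
  have pt: "polytope P" "polytope ?P1" using P s(1) unfolding polyhedron3_def by blast+
  \<comment> \<open>\<open>typeB\<close> wants the second triangle to be a facet of the original
    prism. A face is the hull of its vertices, so the facets of both polytopes with these vertices
    coincide.\<close>
  have "G = G0"
    using face_conv_verts[OF pt(1) facets_face[OF G0(1)]] face_conv_verts[OF pt(2) facets_face[OF G(1)]] G(2) G0(2) by simp
  have "distinct [a', b', c']" using d by simp
  then obtain w where w: "stacking ?P1 G w (convex hull (insert w ?P1))" "beyond_only ?P1 G w" by (rule stackingI[OF s(1) G])
  have G': "G facet_of ?P1" "G facet_of P" using G G0 \<open>G = G0\<close> by (auto simp: facets_def)
  have "a \<notin> verts G" "a \<in> verts F" using G(2) F(2) d by auto
  then have "G \<noteq> F" by blast
  note t = stacked_prism_type_B[OF p F' F(2) u(2) refl G'(1) G(2) w(2) refl]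
  have "comb_equiv X (convex hull (insert w ?P1))"
    by (rule has_type_comb_equiv[OF X(1) t(1) X(2) t(2)]) (rule types_wf, simp add: types_def)
  then show ?thesis unfolding typeB_def using X(1) pr u(1) G'(2) \<open>G \<noteq> F\<close> w(1) by blast
qed

section \<open>Counting the types\<close>

lemma comb_rel_class:
  assumes fs: "fs \<in> set types" and P: "P \<in> polys_8_9" "has_type P fs"
  shows "comb_rel polys_8_9 `` {P} = {Q \<in> polys_8_9. has_type Q fs}"
proof -
  have "comb_equiv P Q \<longleftrightarrow> has_type Q fs" if "Q \<in> polys_8_9" for Q
  proof -
    have h: "polyhedron3 P" "polyhedron3 Q" using P(1) that by (simp_all add: polys_8_9_def)
    show ?thesis using has_type_comb_equiv[OF h P(2) _ types_wf[OF fs]] comb_equiv_has_type[OF h _ P(2)] by (rule iffI[rotated])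
  qed
  then show ?thesis using P(1) unfolding comb_rel_def by blast
qed

lemma comb_rel_quotient: "polys_8_9 // comb_rel polys_8_9 = (\<lambda>fs. {Q \<in> polys_8_9. has_type Q fs}) ` set types"
proof (intro equalityI subsetI)
  fix C assume "C \<in> polys_8_9 // comb_rel polys_8_9"
  then obtain P where P: "P \<in> polys_8_9" "C = comb_rel polys_8_9 `` {P}" by (rule quotientE)
  obtain fs where fs: "fs \<in> set types" "has_type P fs" by (rule types_complete[OF P(1)])
  show "C \<in> (\<lambda>fs. {Q \<in> polys_8_9. has_type Q fs}) ` set types"
    unfolding P(2) comb_rel_class[OF fs(1) P(1) fs(2)] by (rule imageI[OF fs(1)])
next
  fix C assume "C \<in> (\<lambda>fs. {Q \<in> polys_8_9. has_type Q fs}) ` set types"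
  then obtain fs where fs: "C = {Q \<in> polys_8_9. has_type Q fs}" "fs \<in> set types" by (rule imageE)
  obtain P where P: "P \<in> polys_8_9" "has_type P fs" by (rule types_realizable[OF fs(2)])
  show "C \<in> polys_8_9 // comb_rel polys_8_9"
    unfolding fs(1) comb_rel_class[OF fs(2) P, symmetric] by (rule quotientI[OF P(1)])
qed

text \<open>Each class contains a realisation, and a realisation has only one type.\<close>

lemma inj_on_class: "inj_on (\<lambda>fs. {Q \<in> polys_8_9. has_type Q fs}) (set types)"
proof (rule inj_onI)
  fix fs gs assume h: "fs \<in> set types" "gs \<in> set types"
    "{Q \<in> polys_8_9. has_type Q fs} = {Q \<in> polys_8_9. has_type Q gs}"
  obtain P where P: "P \<in> polys_8_9" "has_type P fs" by (rule types_realizable[OF h(1)])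
  then have "has_type P gs" using h(3) by blast
  then show "fs = gs" by (rule has_type_unique[OF h(1,2) P(2)])
qed

lemma distinct_types: "distinct types"
  using distinct_list_inv by (simp add: distinct_map)

lemma type_decomposable_iff:
  assumes "fs \<in> set types" "P \<in> polys_8_9" "has_type P fs"
  shows "decomposable P \<longleftrightarrow> fs = type_A \<or> fs = type_B"
proof -
  have P: "polyhedron3 P" using assms(2) by (simp add: polys_8_9_def)
  have "fs = type_A \<or> fs = type_B \<or> fs \<in> set rigid_types" using assms(1) by (simp add: types_def)
  moreover have "type_A \<notin> set rigid_types" "type_B \<notin> set rigid_types" using distinct_types by (auto simp: types_def)
  ultimately show ?thesis
    using type_A_decomposable[OF P] type_B_decomposable[OF P] rigid_type_indecomposable[OF P assms(3)] assms(3) by blast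
qed

theorem theorem7:
  shows "card (polys_8_9 // comb_rel polys_8_9) = 74
    \<and> card {C \<in> polys_8_9 // comb_rel polys_8_9. \<forall>P\<in>C. decomposable P} = 2
    \<and> (\<forall>P. typeA P \<longrightarrow> P \<in> polys_8_9 \<and> decomposable P)
    \<and> (\<forall>P. typeB P \<longrightarrow> P \<in> polys_8_9 \<and> decomposable P)
    \<and> (\<forall>P\<in>polys_8_9. \<not> typeA P \<and> \<not> typeB P \<longrightarrow> \<not> decomposable P)"
proof (intro conjI allI impI ballI)
  let ?c = "\<lambda>fs. {Q \<in> polys_8_9. has_type Q fs}"
  have AB: "type_A \<in> set types" "type_B \<in> set types" by (simp_all add: types_def)
  have "length types = 74" by (simp add: types_def rigid_types_def)
  then have "card (set types) = 74" using distinct_card[OF distinct_types] by simp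
  then show "card (polys_8_9 // comb_rel polys_8_9) = 74"
    unfolding comb_rel_quotient using card_image[OF inj_on_class] by simp
  \<comment> \<open>The classes are nonempty, so the condition on all members is not vacuous and one
    representative decides it.\<close>
  have "(\<forall>P\<in>?c fs. decomposable P) \<longleftrightarrow> fs \<in> {type_A, type_B}" if fs: "fs \<in> set types" for fs
  proof -
    obtain P where "P \<in> polys_8_9" "has_type P fs" by (rule types_realizable[OF fs])
    then show ?thesis using type_decomposable_iff[OF fs] by blast
  qed
  then have "{C \<in> ?c ` set types. \<forall>P\<in>C. decomposable P} = ?c ` {type_A, type_B}" using AB by blast
  moreover have "inj_on ?c {type_A, type_B}" by (rule inj_on_subset[OF inj_on_class]) (simp add: AB)
  moreover have "type_A \<noteq> type_B" using distinct_types by (auto simp: types_def)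
  ultimately show "card {C \<in> polys_8_9 // comb_rel polys_8_9. \<forall>P\<in>C. decomposable P} = 2"
    unfolding comb_rel_quotient using card_image by fastforce
  show "P \<in> polys_8_9" "decomposable P" if "typeA P" for P
    using has_type_polys_8_9[OF typeA_has_type[OF that] types_wf[OF AB(1)]] type_A_decomposable[OF typeA_has_type[OF that]] by blast+
  show "P \<in> polys_8_9" "decomposable P" if "typeB P" for P
    using has_type_polys_8_9[OF typeB_has_type[OF that] types_wf[OF AB(2)]] type_B_decomposable[OF typeB_has_type[OF that]] by blast+
  fix P assume P: "P \<in> polys_8_9" and n: "\<not> typeA P \<and> \<not> typeB P"
  obtain fs where fs: "fs \<in> set types" "has_type P fs" by (rule types_complete[OF P])
  have "polyhedron3 P" using P by (simp add: polys_8_9_def)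
  then show "\<not> decomposable P"
    using type_decomposable_iff[OF fs(1) P fs(2)] fs(2) n has_type_typeA has_type_typeB by blast
qed

end
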